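(* Let $X$ be a locally compact Polish space and $\sigma$ a non-atomic Radon measure on $X$. Let $dm(x,s)=\frac{l(x,s)}{s}\,d\sigma(x)\,ds$ on $X\times\mathbb R_+$, where for each $x\in X$ either $l(x,s)>0$ for all $s\in\mathbb R_+$ or $l(x,s)=0$ for all $s\in\mathbb R_+$. Let $Y:=\{x\in X\mid l(x,\cdot)>0\}$ and assume $\int_{A\times\mathbb R_+}l(x,s)\min\{s^{-1},1\}\,d\sigma(x)\,ds<\infty$ for all $A\in\mathcal B_0(Y)$. Assume that, for some $\epsilon>0$, $$l(x,s)=l_1(x,s)+l_2(x,s)\quad\text{for }x\in Y,\ s\in(0,\epsilon),$$ where, for each fixed $x\in Y$, the function $l_1(x,s)$ is differentiable in $s$ on $(0,\epsilon)$, and for each $n\in\mathbb N$ and $A\in\mathcal B_0(Y)$, $$\int_A\int_{(0,\frac\epsilon n)}\sup_{u\in[\frac sn,sn]}\left|\frac{\partial}{\partial u}l_1(x,u)\right|ds\,d\sigma(x)<\infty$$ and $$\int_A\int_{(0,\epsilon)}\frac{|l_2(x,s)|}{s}\,ds\,d\sigma(x)<\infty.$$ Then: (a) for each $n\in\mathbb N$ there exists $\epsilon'>0$ such that, for each $A\in\mathcal B_0(Y)$, $$\int_A\left[\sup_{r\in[\frac1n,n]}\int_{(0,\epsilon')}\frac{|l(x,rs)-l(x,s)|}{s}\,ds\right]d\sigma(x)<\infty;$$ (b) consequently, $\mu_m$ is quasi-invariant with respect to the group $C_0(X\to\mathbb R_+)$, i.e., each $\theta\in C_0(X\to\mathbb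 R_+)$ maps $\mathbb K(X)$ into itself and $\mu_m^\theta$ is equivalent to $\mu_m$, with density $$\frac{d\mu_m^\theta}{d\mu_m}(\eta)=\exp\bigg[\int_Y\log\left(\frac{l(x,\theta^{-1}(x)s_x)}{l(x,s_x)}\right)s_x^{-1}\,d\eta(x)+\int_Y\int_{\mathbb R_+}\frac{l(x,s)-l(x,\theta^{-1}(x)s)}{s}\,ds\,d\sigma(x)\bigg],$$ where the function integrated with respect to $\eta$ belongs to $L^1(Y,\eta)$ for $\mu_m$-a.a. $\eta\in\mathbb K(X)$.
   Context: $\mathbb R_+=(0,\infty)$. $l:X\times\mathbb R_+\to[0,\infty)$ and the functions $l_1,l_2:Y\times(0,\epsilon)\to\mathbb R$ are measurable. $\mathcal B(X)$ is the Borel $\sigma$-algebra of $X$, $\mathcal B_0(X)$ is the collection of sets in $\mathcal B(X)$ with compact closure, and for $Y\in\mathcal B(X)$, $\mathcal B_0(Y)$ is the collection of all $A\in\mathcal B_0(X)$ with $A\subset Y$. $\mathbb M(X)$ is the set of Radon measures on $X$ (finite on compact sets) with the vague topology and its Borel $\sigma$-algebra. $\mathbb K(X)\subset\mathbb M(X)$ is the set of discrete Radon measures $\eta=\sum_i s_i\delta_{x_i}$ with $s_i>0$, the $x_i\in X$ distinct and at most countably many (the zero measure included), with the trace $\sigma$-algebra. For $\eta\in\mathbb K(X)$, $\tau(\eta)=\{x_i\}$ is its set of atoms and $s_x:=\eta(\{x\})$ for $x\in\tau(\eta)$. For a measure $m$ on $X\times\mathbb R_+$ with $m(\{x\}\times\mathbb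 R_+)=0$ for all $x\in X$ and $\int_{A\times\mathbb R_+}\min\{s,1\}\,dm(x,s)<\infty$ for all $A\in\mathcal B_0(X)$, $\mu_m$ denotes the unique probability measure on $\mathbb K(X)$ (the completely random measure with Lévy measure $m$) with Fourier transform $\int_{\mathbb K(X)}e^{i\int f\,d\eta}\,d\mu_m(\eta)=\exp\left[\int_X\int_{\mathbb R_+}(e^{isf(x)}-1)\,dm(x,s)\right]$ for all continuous compactly supported $f:X\to\mathbb R$. Under the assumptions of the claim $m$ satisfies these two conditions. $C_0(X\to\mathbb R_+)$ is the group (under pointwise multiplication) of continuous functions $\theta:X\to\mathbb R_+$ equal to $1$ outside a compact set; $\theta^{-1}(x)=1/\theta(x)$. It acts on $\mathbb M(X)$ by $\eta\mapsto\theta\eta$, where $\theta\eta$ has density $\theta$ with respect to $\eta$. $\mu_m^\theta$ is the pushforward of $\mu_m$ under $\eta\mapsto\theta\eta$. *)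

theory Defs
  imports "HOL-Probability.Probability"
begin

definition relatively_compact_borel :: "'a::topological_space set \<Rightarrow> 'a set set" where
  "relatively_compact_borel Y = {A \<in> sets borel. compact (closure A) \<and> A \<subseteq> Y}"

definition radon_measures :: "'a::topological_space measure set" where
  "radon_measures = {\<eta>. sets \<eta> = sets borel \<and> (\<forall>K. compact K \<longrightarrow> emeasure \<eta> K < \<infinity>)}"

definition atoms :: "'a measure \<Rightarrow> 'a set" where
  "atoms \<eta> = {x. emeasure \<eta> {x} > 0}"

definition test_functions :: "('a::topological_space \<Rightarrow> real) set" where
  "test_functions = {f. continuous_on UNIV f \<and> compact (closure {x. f x \<noteq> 0})}"

definition vague_topology :: "'a::topological_space measure topology" where
  "vague_topology = topology_generated_by
     {{\<eta> \<in> radon_measures. (LINT x|\<eta>. f x) \<in> U} | f U. f \<in> test_functions \<and> open U}"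

definition borel_of_topology :: "'b topology \<Rightarrow> 'b measure" where
  "borel_of_topology T = sigma (topspace T) {U. openin T U}"

(* A countable family of distinct points x_i is indexed by the set T of its members. *)
definition discrete_radon_measures :: "'a::topological_space measure set" where
  "discrete_radon_measures = {\<eta> \<in> radon_measures. \<exists>T s. countable T \<and> (\<forall>x\<in>T. s x > 0) \<and>
     (\<forall>A\<in>sets borel. emeasure \<eta> A = (\<integral>\<^sup>+x. ennreal (s x) * emeasure (return borel x) A \<partial>count_space T))}"

definition discrete_radon_space :: "'a::topological_space measure measure" where
  "discrete_radon_space = restrict_space (borel_of_topology vague_topology) discrete_radon_measures"

definition levy_measure :: "'a measure \<Rightarrow> ('a \<Rightarrow> real \<Rightarrow> real) \<Rightarrow> ('a \<times> real) measure" where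
  "levy_measure \<sigma> l =
     density (\<sigma> \<Otimes>\<^sub>M restrict_space lborel {0<..}) (\<lambda>(x, s). ennreal (l x s / s))"

(* \<mu> is the law of the completely random measure with Levy measure m. *)
definition completely_random_law ::
    "('a::topological_space \<times> real) measure \<Rightarrow> 'a measure measure \<Rightarrow> bool" where
  "completely_random_law m \<mu> \<longleftrightarrow> prob_space \<mu> \<and> sets \<mu> = sets discrete_radon_space \<and>
     (\<forall>f\<in>test_functions.
        (LINT \<eta>|\<mu>. iexp (LINT x|\<eta>. f x)) = exp (LINT (x, s)|m. iexp (s * f x) - 1))"

definition multiplier_group :: "('a::topological_space \<Rightarrow> real) set" where
  "multiplier_group = {\<theta>. continuous_on UNIV \<theta> \<and> (\<forall>x. \<theta> x > 0) \<and>
     (\<exists>K. compact K \<and> (\<forall>x. x \<notin> K \<longrightarrow> \<theta> x = 1))}"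

abbreviation multiply :: "('a \<Rightarrow> real) \<Rightarrow> 'a measure \<Rightarrow> 'a measure" where
  "multiply \<theta> \<eta> \<equiv> density \<eta> (\<lambda>x. ennreal (\<theta> x))"

definition equivalent_measures :: "'b measure \<Rightarrow> 'b measure \<Rightarrow> bool" where
  "equivalent_measures M N \<longleftrightarrow>
     sets M = sets N \<and> absolutely_continuous M N \<and> absolutely_continuous N M"

(* If \<eta> is discrete and x is not an atom of \<eta>, then s_x = measure \<eta> {x} = 0 and the value is 0
   by the convention z / 0 = 0. Such x form an \<eta>-null set, and atoms \<eta> is countable. *)
definition log_ratio :: "('a \<Rightarrow> real \<Rightarrow> real) \<Rightarrow> ('a \<Rightarrow> real) \<Rightarrow> 'a measure \<Rightarrow> 'a \<Rightarrow> real" where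
  "log_ratio l \<theta> \<eta> x =
     (let s = measure \<eta> {x} in ln (l x (inverse (\<theta> x) * s) / l x s) / s)"

end

theory Submission
  imports Defs
begin

text \<open>Write \<open>m\<close> for the Levy measure, \<open>\<langle>f, \<eta>\<rangle>\<close> for the integral of \<open>f\<close> against \<open>\<eta>\<close>, and \<open>s\<^sub>x\<close> for
the mass of the atom \<open>x\<close> of \<open>\<eta>\<close>.

Part (a) is the mean value theorem. For \<open>r\<close> between \<open>1/n\<close> and \<open>n\<close>, both \<open>r s\<close> and \<open>s\<close> lie between \<open>s/n\<close>
and \<open>s n\<close>, so \<open>\<bar>l\<^sub>1 x (r s) - l\<^sub>1 x s\<bar> / s\<close> is at most \<open>n\<close> times the supremum of the derivative over that
interval; the part \<open>l\<^sub>2\<close> is integrable against \<open>ds/s\<close>, which dilations preserve. One can take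
\<open>\<epsilon>' = \<epsilon>/n\<close>.

For part (b), let \<open>\<phi>(x, s) = l(x, s/\<theta>(x)) / l(x, s)\<close> (\<open>tilt\<close>). The image of \<open>m\<close> under
\<open>(x, s) \<mapsto> (x, \<theta>(x) s)\<close> is \<open>\<phi> m\<close>, and \<open>\<bar>\<phi> - 1\<bar>\<close> is \<open>m\<close>-integrable: near \<open>s = 0\<close> by part (a), for large
\<open>s\<close> because \<open>l(x, s) min {1/s, 1}\<close> is integrable, and off a compact set because \<open>\<theta> = 1\<close> there
(\<open>dilation_total_variation_finite\<close>). Both \<open>\<mu>\<^sup>\<theta>\<close> and the measure with the claimed density with
respect to \<open>\<mu>\<close> are then identified through their Laplace functionals. For \<open>\<mu>\<^sup>\<theta>\<close> it is that of \<open>\<mu>\<close> at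
\<open>\<theta> f\<close>. For the density it comes from the exponential formula
\<open>E exp (\<Sum>\<^sub>x g(x, s\<^sub>x)) = exp (\<integral> (e\<^sup>g - 1) dm)\<close>
(\<open>exponential_formula\<close>) with \<open>g(x, s) = log \<phi>(x, s) - s f(x)\<close>. The two agree by the substitution
\<open>s \<mapsto> \<theta>(x) s\<close>.

Only the Fourier functional of \<open>\<mu>\<close> on continuous functions of compact support is given, so the
exponential formula, where \<open>g\<close> is not linear in \<open>s\<close>, has to be derived from it. This is done on \<open>\<mu>\<close>
itself, without a construction of a Poisson process.

\<^item> An integrable kernel \<open>k\<close> with \<open>\<integral> k(t) exp (- i t z) dt = c exp (- z)\<close> for all \<open>z \<ge> 0\<close> turns the Fourier functional into
  the Laplace functional \<open>E exp (- \<langle>f, \<eta>\<rangle>)\<close> for \<open>f \<ge> 0\<close> (\<open>Laplace_from_Fourier\<close>).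
\<^item> The vague Borel \<open>\<sigma>\<close>-algebra on discrete Radon measures is generated by countably many integrals
  \<open>\<eta> \<mapsto> \<langle>g, \<eta>\<rangle>\<close>, and finite measures on it are determined by their Laplace functionals
  (\<open>Laplace_functional_determines_measure\<close>).
\<^item> Differentiating the Laplace functional gives the Mecke formula
  \<open>E \<integral> H(\<eta>, x) \<eta>(dx) = \<integral> s E H(\<eta> + s \<delta>\<^sub>x, x) m(dx, ds)\<close> (\<open>Mecke\<close>).
\<^item> Apply it to functionals of the marks, with \<open>N\<close> the number of marks in a set \<open>D\<close> of finite measure. If
  \<open>W\<close> picks up a factor \<open>w(x, s)\<close> whenever an atom is added, then
  \<open>(k + 1) E [W; N = k + 1] = \<integral>\<^sub>D w dm E [W; N = k]\<close>, and summing over \<open>k\<close> gives the exponential formula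
  for \<open>g\<close> supported in \<open>D\<close>; dominated convergence gives the general case.\<close>

section \<open>Countable approximation of continuous functions of compact support\<close>

lemma compact_closure_of_subset:
  fixes A :: "'a::t2_space set"
  assumes "compact K" "A \<subseteq> K"
  shows "compact (closure A)"
  using assms by (metis closed_closure closure_minimal compact_Int_closed compact_imp_closed inf.absorb_iff2)

lemma locally_compact_countable_basis:
  assumes "locally_compact_space (euclidean :: 'a::polish_space topology)"
  obtains \<B> :: "'a::polish_space set set" where "countable \<B>" "topological_basis \<B>" "\<And>U. U \<in> \<B> \<Longrightarrow> compact (closure U)"
proof -
  obtain \<A> :: "'a set set" where A: "countable \<A>" "topological_basis \<A>"
    using ex_countable_basis by auto
  define \<B> where "\<B> = {U \<in> \<A>. compact (closure U)}"
  have "topological_basis \<B>"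
  proof (rule topological_basisI)
    fix U assume "U \<in> \<B>" then show "open U"
      using A(2) unfolding \<B>_def by (auto intro: topological_basis_open)
  next
    fix O' :: "'a set" and x assume O': "open O'" "x \<in> O'"
    obtain U K where UK: "open U" "compact K" "x \<in> U" "U \<subseteq> K"
      using assms unfolding locally_compact_space_def
      by (simp add: compactin_euclidean_iff) blast
    obtain V where V: "V \<in> \<A>" "x \<in> V" "V \<subseteq> U \<inter> O'"
      using topological_basisE[OF A(2), of "U \<inter> O'" x] O' UK by (metis IntI open_Int)
    have "compact (closure V)" using V(3) UK(2,4) by (intro compact_closure_of_subset[of K]) auto
    then show "\<exists>B'\<in>\<B>. x \<in> B' \<and> B' \<subseteq> O'" using V unfolding \<B>_def by auto
  qed
  with A(1) show ?thesis by (intro that[of \<B>]) (auto simp: \<B>_def)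
qed

lemma compact_exhaustion:
  assumes "locally_compact_space (euclidean :: 'a::polish_space topology)"
  obtains U :: "nat \<Rightarrow> 'a::polish_space set" where "\<And>n. open (U n)" "\<And>n. compact (closure (U n))" "incseq U" "(\<Union>n. U n) = UNIV"
proof -
  obtain \<B> :: "'a set set" where B: "countable \<B>" "topological_basis \<B>" "\<And>U. U \<in> \<B> \<Longrightarrow> compact (closure U)"
    using locally_compact_countable_basis[OF assms] by blast
  have cover: "\<Union>\<B> = UNIV"
    using B(2) by (auto intro: topological_basisE[OF B(2) open_UNIV])
  then have ne: "\<B> \<noteq> {}" by auto
  define b where "b = from_nat_into \<B>"
  have b: "b n \<in> \<B>" for n unfolding b_def using ne by (rule from_nat_into)
  have rb: "range b = \<B>" unfolding b_def using ne B(1) by (rule range_from_nat_into)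
  define U where "U n = (\<Union>i\<le>n. b i)" for n
  show ?thesis
  proof (rule that[of U])
    show "open (U n)" for n
      unfolding U_def using b topological_basis_open[OF B(2)] by auto
    have "closure (U n) = (\<Union>i\<le>n. closure (b i))" for n
      unfolding U_def by (induction n) (simp_all add: atMost_Suc)
    then show "compact (closure (U n))" for n using b B(3) by auto
    show "incseq U" unfolding U_def incseq_def by fastforce
    have "b n \<subseteq> U n" for n unfolding U_def by auto
    then show "(\<Union>n. U n) = UNIV" using cover rb by blast
  qed
qed

definition nonneg_test_functions :: "('a::topological_space \<Rightarrow> real) set" where
  "nonneg_test_functions = {f \<in> test_functions. \<forall>x. 0 \<le> f x}"

lemma test_functionsI:
  fixes f :: "'a::t2_space \<Rightarrow> real"
  assumes "continuous_on UNIV f" "compact K" "\<And>x. x \<notin> K \<Longrightarrow> f x = 0"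
  shows "f \<in> test_functions"
proof -
  have "compact (closure {x. f x \<noteq> 0})"
    using assms(2,3) by (intro compact_closure_of_subset[of K]) auto
  with assms(1) show ?thesis unfolding test_functions_def by blast
qed

lemma test_functions_bounded:
  assumes "f \<in> test_functions"
  obtains C where "C > 0" "\<And>x. \<bar>f x\<bar> \<le> C"
proof -
  have "compact (f ` closure {x. f x \<noteq> 0})"
    using assms unfolding test_functions_def
    by (auto intro!: compact_continuous_image intro: continuous_on_subset)
  then obtain C where C: "\<And>y. y \<in> f ` closure {x. f x \<noteq> 0} \<Longrightarrow> \<bar>y\<bar> \<le> C"
    by (metis bounded_iff compact_imp_bounded real_norm_def)
  have "\<bar>f x\<bar> \<le> max C 1" for x
  proof (cases "f x = 0")
    case False
    then have "x \<in> {x. f x \<noteq> 0}" by simp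
    then have "x \<in> closure {x. f x \<noteq> 0}" by (rule rev_subsetD[OF _ closure_subset])
    then have "\<bar>f x\<bar> \<le> C" by (intro C imageI)
    then show ?thesis by simp
  qed auto
  then show ?thesis by (intro that[of "max C 1"]) auto
qed

lemma test_functions_support:
  assumes "f \<in> test_functions"
  shows "compact (closure {x. f x \<noteq> 0})" "x \<notin> closure {x. f x \<noteq> 0} \<Longrightarrow> f x = 0"
  using assms closure_subset[of "{x. f x \<noteq> 0}"] unfolding test_functions_def by auto

lemma test_functions_mult:
  fixes f :: "'a::t2_space \<Rightarrow> real"
  assumes "f \<in> test_functions" "continuous_on UNIV g" shows "(\<lambda>x. g x * f x) \<in> test_functions"
proof (rule test_functionsI)
  show "continuous_on UNIV (\<lambda>x. g x * f x)"
    using assms by (auto simp: test_functions_def intro!: continuous_on_mult)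
  show "compact (closure {x. f x \<noteq> 0})" using assms(1) by (rule test_functions_support)
  show "g x * f x = 0" if "x \<notin> closure {x. f x \<noteq> 0}" for x
    using test_functions_support(2)[OF assms(1) that] by simp
qed

lemma test_functions_cmult:
  fixes f :: "'a::t2_space \<Rightarrow> real"
  assumes "f \<in> test_functions" shows "(\<lambda>x. c * f x) \<in> test_functions"
  using test_functions_mult[OF assms continuous_on_const] .

lemma test_functions_combine:
  fixes f g :: "'a::t2_space \<Rightarrow> real"
  assumes "f \<in> test_functions" "g \<in> test_functions"
    "continuous_on UNIV (\<lambda>x. h (f x) (g x))" "h 0 0 = 0"
  shows "(\<lambda>x. h (f x) (g x)) \<in> test_functions"
  using assms(3)
proof (rule test_functionsI)
  show "compact (closure {x. f x \<noteq> 0} \<union> closure {x. g x \<noteq> 0})"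
    using assms test_functions_support by (intro compact_Un) blast+
  show "h (f x) (g x) = 0" if "x \<notin> closure {x. f x \<noteq> 0} \<union> closure {x. g x \<noteq> 0}" for x
    using that test_functions_support(2)[OF assms(1), of x] test_functions_support(2)[OF assms(2), of x] assms(4)
    by auto
qed

lemma test_functions_add:
  fixes f g :: "'a::t2_space \<Rightarrow> real"
  assumes "f \<in> test_functions" "g \<in> test_functions" shows "(\<lambda>x. f x + g x) \<in> test_functions"
  using assms by (intro test_functions_combine[where h="(+)"])
    (auto simp: test_functions_def intro!: continuous_intros)

lemma nonneg_test_functions_simps:
  fixes f g :: "'a::t2_space \<Rightarrow> real"
  assumes "f \<in> nonneg_test_functions" 
  shows "f \<in> test_functions" "0 \<le> f x"
    "g \<in> nonneg_test_functions \<Longrightarrow> (\<lambda>x. f x + g x) \<in> nonneg_test_functions"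
    "c \<ge> 0 \<Longrightarrow> (\<lambda>x. c * f x) \<in> nonneg_test_functions"
  using assms test_functions_add test_functions_cmult unfolding nonneg_test_functions_def
  by (auto)

lemma zero_nonneg_test: "(\<lambda>x. 0) \<in> nonneg_test_functions"
  by (simp add: nonneg_test_functions_def test_functions_def)

text \<open>These increase to the indicator of an open \<open>U\<close> as \<open>k \<rightarrow> \<infinity>\<close>. The case \<open>U = UNIV\<close> is separate because the
distance to the empty set is \<open>0\<close> by convention.\<close>
definition bump :: "'a::metric_space set \<Rightarrow> nat \<Rightarrow> 'a \<Rightarrow> real" where
  "bump U k x = min 1 (real k * (if U = UNIV then 1 else infdist x (- U)))"

lemma bump_nonneg: "0 \<le> bump U k x"
  by (simp add: bump_def infdist_nonneg)

lemma bump_le_1: "bump U k x \<le> 1"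
  by (simp add: bump_def)

lemma bump_continuous: "continuous_on A (bump U k)"
  unfolding bump_def by (cases "U = UNIV") (auto intro!: continuous_intros)

lemma bump_outside: "x \<notin> U \<Longrightarrow> bump U k x = 0"
  by (auto simp: bump_def)

lemma bump_mono: "k \<le> k' \<Longrightarrow> bump U k x \<le> bump U k' x"
  unfolding bump_def by (intro min.mono mult_right_mono) (auto simp: infdist_nonneg)

lemma bump_eventually_1:
  assumes "open U" "x \<in> U"
  shows "\<exists>k0. \<forall>k\<ge>k0. bump U k x = 1"
proof -
  define d where "d = (if U = UNIV then 1 else infdist x (- U))"
  have "d > 0"
  proof (cases "U = UNIV")
    case False
    have "closure (- U) = - U" using assms(1) by (simp add: closure_closed closed_Compl)
    then have "x \<notin> closure (- U)" "- U \<noteq> {}" using assms(2) False by auto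
    then show ?thesis using False
      by (simp add: d_def) (metis infdist_nonneg in_closure_iff_infdist_zero order_le_less)
  qed (simp add: d_def)
  obtain k0 where k0: "real k0 * d > 1" using reals_Archimedean3[OF \<open>d > 0\<close>] by blast
  have "bump U k x = 1" if "k \<ge> k0" for k
  proof -
    have "real k0 * d \<le> real k * d" using that \<open>d > 0\<close> by simp
    then show ?thesis using k0 by (simp add: bump_def d_def)
  qed
  then show ?thesis by blast
qed

lemma bump_tendsto:
  assumes "open U"
  shows "(\<lambda>k. bump U k x) \<longlonglongrightarrow> indicator U x"
proof (cases "x \<in> U")
  case True
  then obtain k0 where "\<forall>k\<ge>k0. bump U k x = 1" using bump_eventually_1[OF assms] by blast
  then have "eventually (\<lambda>k. bump U k x = 1) sequentially" by (auto simp: eventually_sequentially)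
  then show ?thesis using True by (simp add: tendsto_eventually)
qed (simp add: bump_outside)

lemma bump_test:
  assumes "compact (closure U)" shows "bump U k \<in> nonneg_test_functions"
proof -
  have "bump U k \<in> test_functions"
    using closure_subset[of U]
    by (intro test_functionsI[OF bump_continuous assms]) (auto intro: bump_outside)
  then show ?thesis by (simp add: nonneg_test_functions_def bump_nonneg)
qed

text \<open>Maxima rather than sums of bumps: a maximum of bumps that all lie below \<open>F\<close> still lies below \<open>F\<close>, so
approximation from below is a matter of covering.\<close>
fun max_bumps :: "('a::metric_space set \<times> nat \<times> rat) list \<Rightarrow> 'a \<Rightarrow> real" where
  "max_bumps [] x = 0"
| "max_bumps ((U, k, q) # L) x = max (of_rat q * bump U k x) (max_bumps L x)"

lemma max_bumps_nonneg: "0 \<le> max_bumps L x"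
  by (induction L x rule: max_bumps.induct) auto

lemma max_bumps_test:
  assumes "\<And>U k q. (U, k, q) \<in> set L \<Longrightarrow> compact (closure U)"
  shows "max_bumps L \<in> nonneg_test_functions"
proof -
  have "max_bumps L \<in> test_functions" using assms
  proof (induction L)
    case Nil
    then show ?case by (simp add: test_functions_def)
  next
    case (Cons a L)
    obtain U k q where a: "a = (U, k, q)" by (cases a)
    have 1: "bump U k \<in> test_functions"
      using bump_test Cons.prems[of U k q] a by (auto simp: nonneg_test_functions_def)
    have 2: "max_bumps L \<in> test_functions" using Cons by auto
    have "max_bumps (a # L) = (\<lambda>x. max (of_rat q * bump U k x) (max_bumps L x))"
      by (auto simp: a)
    also have "\<dots> \<in> test_functions"
      using 1 2 by (intro test_functions_combine[where h="\<lambda>u v. max (of_rat q * u) v"])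
        (auto simp: test_functions_def intro!: continuous_intros)
    finally show ?case .
  qed
  then show ?thesis by (simp add: nonneg_test_functions_def max_bumps_nonneg)
qed

lemma max_bumps_ge:
  "(U, k, q) \<in> set L \<Longrightarrow> of_rat q * bump U k x \<le> max_bumps L x"
  by (induction L x rule: max_bumps.induct) auto

lemma max_bumps_le:
  "(\<And>U k q. (U, k, q) \<in> set L \<Longrightarrow> of_rat q * bump U k x \<le> c) \<Longrightarrow> 0 \<le> c \<Longrightarrow> max_bumps L x \<le> c"
  by (induction L x rule: max_bumps.induct) auto

definition bump_family :: "'a::metric_space set set \<Rightarrow> ('a \<Rightarrow> real) set" where
  "bump_family \<B> = max_bumps ` lists (\<B> \<times> UNIV \<times> UNIV)"

lemma countable_bump_family: "countable \<B> \<Longrightarrow> countable (bump_family \<B>)"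
  unfolding bump_family_def by (intro countable_image countable_lists countable_SIGMA) auto

lemma bump_family_test:
  "(\<And>U. U \<in> \<B> \<Longrightarrow> compact (closure U)) \<Longrightarrow> g \<in> bump_family \<B> \<Longrightarrow> g \<in> nonneg_test_functions"
  unfolding bump_family_def by (auto intro!: max_bumps_test)

text \<open>Where \<open>bump U k > 1/2\<close>, the bump with parameter \<open>2 k\<close> has already reached \<open>1\<close>.\<close>
lemma bump_eq_1_neighbourhood:
  assumes "open U" "x \<in> U"
  obtains k W where "open W" "x \<in> W" "\<And>y. y \<in> W \<Longrightarrow> bump U k y = 1"
proof -
  obtain k where k: "bump U k x = 1" using bump_eventually_1[OF assms] by blast
  define W where "W = {y. 1/2 < bump U k y}"
  have "open W" unfolding W_def by (intro open_Collect_less continuous_on_const bump_continuous)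
  moreover have "x \<in> W" using k by (simp add: W_def)
  moreover have "bump U (2 * k) y = 1" if "y \<in> W" for y
    using that by (auto simp: W_def bump_def min_def split: if_splits)
  ultimately show ?thesis by (rule that)
qed

text \<open>Near each point of \<open>K\<close> the function \<open>F\<close> is almost equal to a rational \<open>q\<close>, and \<open>q\<close> times a bump supported
near that point stays below \<open>F\<close>. By compactness finitely many such bumps are within \<open>\<delta>\<close> of \<open>F\<close> on \<open>K\<close>.\<close>
lemma bump_family_cover:
  fixes K :: "'a::metric_space set" and F :: "'a \<Rightarrow> real"
  assumes K: "compact K" and loc: "\<And>x. x \<in> K \<Longrightarrow>
      \<exists>U\<in>\<B>. \<exists>q\<ge>0. open U \<and> x \<in> U \<and> (\<forall>y\<in>U. of_rat q < F y \<and> F y < of_rat q + \<delta>)"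
    and F: "\<And>x. 0 \<le> F x"
  shows "\<exists>g\<in>bump_family \<B>. \<forall>x. g x \<le> F x \<and> (x \<in> K \<longrightarrow> F x < g x + \<delta>)"
proof -
  have "\<exists>U k q W. U \<in> \<B> \<and> 0 \<le> q \<and> open W \<and> x \<in> W \<and> (\<forall>y\<in>U. of_rat q < F y \<and> F y < of_rat q + \<delta>) \<and>
     (\<forall>y\<in>W. bump U k y = 1)" if "x \<in> K" for x
  proof -
    obtain U q where U: "U \<in> \<B>" "q \<ge> 0" "open U" "x \<in> U" "\<forall>y\<in>U. of_rat q < F y \<and> F y < of_rat q + \<delta>"
      using loc[OF \<open>x \<in> K\<close>] by blast
    obtain k W where "open W" "x \<in> W" "\<And>y. y \<in> W \<Longrightarrow> bump U k y = 1"
      using bump_eq_1_neighbourhood[OF U(3,4)] by metis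
    with U show ?thesis by blast
  qed
  then obtain U k q W where UW: "\<And>x. x \<in> K \<Longrightarrow> U x \<in> \<B> \<and> (0::rat) \<le> q x \<and> open (W x) \<and> x \<in> W x \<and>
     (\<forall>y\<in>U x. of_rat (q x) < F y \<and> F y < of_rat (q x) + \<delta>) \<and> (\<forall>y\<in>W x. bump (U x) (k x) y = 1)"
    by metis
  obtain C where C: "C \<subseteq> K" "finite C" "K \<subseteq> (\<Union>c\<in>C. W c)"
    using compactE_image[OF K, of K W] UW by blast
  obtain L where L: "set L = (\<lambda>c. (U c, k c, q c)) ` C"
    using finite_list[OF finite_imageI[OF C(2)]] by metis
  have "max_bumps L \<in> bump_family \<B>"
    unfolding bump_family_def using L C UW by (intro imageI) (auto simp: lists_eq_set)
  moreover have "max_bumps L x \<le> F x" for x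
  proof (rule max_bumps_le[OF _ F])
    fix V j p assume "(V, j, p) \<in> set L"
    then obtain c where c: "c \<in> K" "V = U c" "j = k c" "p = q c" using L C by auto
    show "of_rat p * bump V j x \<le> F x"
    proof (cases "x \<in> V")
      case True
      have "of_rat p * bump V j x \<le> of_rat p"
        using UW[OF c(1)] c by (intro mult_left_le bump_le_1) auto
      also have "\<dots> \<le> F x" using UW[OF c(1)] c True by auto
      finally show ?thesis .
    qed (simp add: bump_outside F)
  qed
  moreover have "F x < max_bumps L x + \<delta>" if "x \<in> K" for x
  proof -
    obtain c where c: "c \<in> C" "x \<in> W c" using C(3) \<open>x \<in> K\<close> by blast
    then have b: "bump (U c) (k c) x = 1" using UW C by blast
    then have "x \<in> U c" using bump_outside[of x "U c" "k c"] by fastforce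
    then have "F x < of_rat (q c) + \<delta>" using UW C c by blast
    also have "of_rat (q c) \<le> max_bumps L x"
      using max_bumps_ge[of "U c" "k c" "q c" L x] b L c by auto
    finally show ?thesis by simp
  qed
  ultimately show ?thesis by blast
qed

lemma bump_family_cutoff:
  fixes \<B> :: "'a::metric_space set set"
  assumes "topological_basis \<B>" "compact K"
  shows "\<exists>g\<in>bump_family \<B>. \<forall>x\<in>K. 1 \<le> g x"
proof -
  have "\<exists>g\<in>bump_family \<B>. \<forall>x. g x \<le> 2 \<and> (x \<in> K \<longrightarrow> 2 < g x + 1)"
  proof (rule bump_family_cover[OF assms(2)])
    fix x assume "x \<in> K"
    obtain U where "U \<in> \<B>" "x \<in> U" using topological_basisE[OF assms(1) open_UNIV] by blast
    then show "\<exists>U\<in>\<B>. \<exists>q\<ge>0. open U \<and> x \<in> U \<and> (\<forall>y\<in>U. real_of_rat q < 2 \<and> 2 < real_of_rat q + 1)"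
      using topological_basis_open[OF assms(1)]
      by (intro bexI[of _ U] exI[of _ "3/2"]) (auto simp: of_rat_divide)
  qed simp
  then obtain g where "g \<in> bump_family \<B>" "\<forall>x. x \<in> K \<longrightarrow> 2 < g x + 1" by blast
  then show ?thesis by (intro bexI[of _ g]) (auto intro: less_imp_le)
qed

text \<open>On the compact set where \<open>f \<ge> \<delta>\<close> this is \<open>bump_family_cover\<close>; elsewhere any nonnegative function below
\<open>f\<close> is within \<open>\<delta>\<close>.\<close>
lemma bump_family_approx:
  fixes f :: "'a::metric_space \<Rightarrow> real"
  assumes B: "topological_basis \<B>" and f: "f \<in> nonneg_test_functions" and "\<delta> > 0"
  shows "\<exists>g\<in>bump_family \<B>. \<forall>x. g x \<le> f x \<and> f x \<le> g x + \<delta>"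
proof -
  have cf: "continuous_on UNIV f" and f0: "\<And>x. 0 \<le> f x"
    using f by (auto simp: nonneg_test_functions_def test_functions_def)
  have "closed {x. \<delta> \<le> f x}"
    using cf by (intro closed_Collect_le continuous_on_const)
  moreover have "{x. \<delta> \<le> f x} \<subseteq> closure {x. f x \<noteq> 0}"
    using \<open>\<delta> > 0\<close> closure_subset[of "{x. f x \<noteq> 0}"] by auto
  moreover have "compact (closure {x. f x \<noteq> 0})"
    using f by (auto simp: nonneg_test_functions_def test_functions_def)
  ultimately have cpt: "compact {x. \<delta> \<le> f x}"
    by (metis compact_Int_closed inf.absorb_iff2)
  have "\<exists>g\<in>bump_family \<B>. \<forall>x. g x \<le> f x \<and> (x \<in> {x. \<delta> \<le> f x} \<longrightarrow> f x < g x + \<delta>)"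
  proof (rule bump_family_cover[OF cpt _ f0])
    fix x assume "x \<in> {x. \<delta> \<le> f x}"
    then have x: "\<delta> \<le> f x" by simp
    obtain q where q: "f x - \<delta> / 2 < of_rat q" "of_rat q < f x"
      using of_rat_dense[of "f x - \<delta>/2" "f x"] \<open>\<delta> > 0\<close> by auto
    have "open {y. of_rat q < f y}" "open {y. f y < of_rat q + \<delta>}"
      using cf by (intro open_Collect_less continuous_on_const; simp)+
    then have "open ({y. of_rat q < f y} \<inter> {y. f y < of_rat q + \<delta>})" by (rule open_Int)
    moreover have "x \<in> {y. of_rat q < f y} \<inter> {y. f y < of_rat q + \<delta>}"
      using q x \<open>\<delta> > 0\<close> by auto
    ultimately obtain U where "U \<in> \<B>" "x \<in> U" "U \<subseteq> {y. of_rat q < f y} \<inter> {y. f y < of_rat q + \<delta>}"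
      using topological_basisE[OF B] by metis
    moreover have "q \<ge> 0"
    proof -
      have "0 \<le> real_of_rat q" using q x \<open>\<delta> > 0\<close> by linarith
      then show ?thesis by (simp add: zero_le_of_rat_iff)
    qed
    ultimately show "\<exists>U\<in>\<B>. \<exists>q\<ge>0. open U \<and> x \<in> U \<and> (\<forall>y\<in>U. of_rat q < f y \<and> f y < of_rat q + \<delta>)"
      using topological_basis_open[OF B] by (intro bexI[of _ U] exI[of _ q]) auto
  qed
  then obtain g where g: "g \<in> bump_family \<B>" "\<forall>x. g x \<le> f x \<and> (\<delta> \<le> f x \<longrightarrow> f x < g x + \<delta>)"
    by blast
  have "0 \<le> g x" for x
    using g(1) by (auto simp: bump_family_def max_bumps_nonneg)
  then have "f x \<le> g x + \<delta>" for x
    using g(2)[rule_format, of x] by (cases "\<delta> \<le> f x") (auto intro: add_increasing)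
  with g show ?thesis by (intro bexI[of _ g]) auto
qed

section \<open>The vague Borel space of discrete Radon measures\<close>

lemma radon_test_integrable:
  assumes "\<eta> \<in> radon_measures" "f \<in> test_functions"
  shows "integrable \<eta> f"
proof -
  obtain C where C: "\<And>x. \<bar>f x\<bar> \<le> C" using test_functions_bounded[OF assms(2)] by metis
  have sets: "sets \<eta> = sets borel" using assms(1) by (simp add: radon_measures_def)
  have "f \<in> borel_measurable borel"
    using assms(2) unfolding test_functions_def by (simp add: borel_measurable_continuous_onI)
  then have m: "f \<in> borel_measurable \<eta>" using sets measurable_cong_sets by blast
  show ?thesis
  proof (rule integrableI_bounded_set[OF _ m])
    show "closure {x. f x \<noteq> 0} \<in> sets \<eta>" using sets by simp
    show "emeasure \<eta> (closure {x. f x \<noteq> 0}) < \<infinity>"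
      using assms(1) test_functions_support(1)[OF assms(2)] by (simp add: radon_measures_def)
    show "AE x in \<eta>. x \<in> closure {x. f x \<noteq> 0} \<longrightarrow> norm (f x) \<le> C" using C by simp
    show "AE x in \<eta>. x \<notin> closure {x. f x \<noteq> 0} \<longrightarrow> f x = 0"
      using test_functions_support(2)[OF assms(2)] by (intro AE_I2 impI)
  qed
qed

lemma topspace_vague: "topspace vague_topology = radon_measures"
proof -
  have "(radon_measures :: 'a measure set) \<in> {{\<eta> \<in> radon_measures. (LINT x|\<eta>. f x) \<in> U} | f U. f \<in> test_functions \<and> open U}"
    using zero_nonneg_test
    by (intro CollectI exI[of _ "\<lambda>_. 0"] exI[of _ UNIV]) (auto simp: nonneg_test_functions_def)
  then show ?thesis
    unfolding vague_topology_def topology_generated_by_topspace by blast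
qed

lemma space_discrete_radon_space: "space discrete_radon_space = discrete_radon_measures"
proof -
  have "discrete_radon_measures \<subseteq> (radon_measures :: 'a measure set)"
    by (auto simp: discrete_radon_measures_def)
  then show ?thesis
    by (auto simp: discrete_radon_space_def space_restrict_space borel_of_topology_def
        topspace_vague space_measure_of_conv)
qed

lemma space_discrete_radon_spaceD:
  "\<eta> \<in> space discrete_radon_space \<Longrightarrow> \<eta> \<in> radon_measures"
  "\<eta> \<in> space discrete_radon_space \<Longrightarrow> sets \<eta> = sets borel"
  "\<eta> \<in> space discrete_radon_space \<Longrightarrow> space \<eta> = UNIV"
  "\<eta> \<in> space discrete_radon_space \<Longrightarrow> \<eta> \<in> discrete_radon_measures"
  using sets_eq_imp_space_eq[of \<eta> borel]
  by (auto simp: space_discrete_radon_space discrete_radon_measures_def radon_measures_def)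

lemma test_integral_measurable [measurable (raw)]:
  assumes "f \<in> test_functions"
  shows "(\<lambda>\<eta>. LINT x|\<eta>. f x) \<in> borel_measurable discrete_radon_space"
  unfolding discrete_radon_space_def
proof (rule measurable_restrict_space1, rule borel_measurableI)
  fix U :: "real set" assume U: "open U"
  have "openin vague_topology {\<eta> \<in> radon_measures. (LINT x|\<eta>. f x) \<in> U}"
    unfolding vague_topology_def using assms U by (intro topology_generated_by_Basis) blast
  then have "{\<eta> \<in> radon_measures. (LINT x|\<eta>. f x) \<in> U} \<in> sets (borel_of_topology vague_topology)"
    unfolding borel_of_topology_def using openin_subset
    by (subst sets_measure_of) (blast intro!: sigma_sets.Basic)+
  also have "{\<eta> \<in> radon_measures. (LINT x|\<eta>. f x) \<in> U} =
      (\<lambda>\<eta>. LINT x|\<eta>. f x) -` U \<inter> space (borel_of_topology vague_topology)"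
    by (auto simp: borel_of_topology_def space_measure_of_conv topspace_vague)
  finally show "(\<lambda>\<eta>. LINT x|\<eta>. f x) -` U \<inter> space (borel_of_topology vague_topology) \<in> sets (borel_of_topology vague_topology)" .
qed

text \<open>A single test function \<open>f\<close> can be replaced by three members of the countable family: two approximate
the positive and the negative part of \<open>f\<close> uniformly, and a cutoff \<open>\<kappa>\<close> that is at least \<open>1\<close> on the support of
\<open>f\<close> controls the error, which is at most \<open>\<delta> \<kappa>\<close> pointwise.\<close>
lemma vague_neighbourhood:
  fixes \<B> :: "'a::metric_space set set" and \<V> :: "real set set"
  assumes B: "topological_basis \<B>" "\<And>U. U \<in> \<B> \<Longrightarrow> compact (closure U)"
    and V: "topological_basis \<V>"
    and f: "f \<in> test_functions" and U: "open U"
    and \<eta>0: "\<eta>0 \<in> radon_measures" "(LINT x|\<eta>0. f x) \<in> U"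
  defines "\<D> \<equiv> {{\<eta> \<in> radon_measures. (LINT x|\<eta>. g x) \<in> V} | g V. g \<in> bump_family \<B> \<and> V \<in> \<V>}"
  shows "\<exists>F. finite F \<and> F \<subseteq> \<D> \<and> \<eta>0 \<in> \<Inter>F \<and> \<Inter>F \<inter> radon_measures \<subseteq> {\<eta> \<in> radon_measures. (LINT x|\<eta>. f x) \<in> U}"
proof -
  define K where "K = closure {x. f x \<noteq> 0}"
  obtain \<kappa> where \<kappa>: "\<kappa> \<in> bump_family \<B>" "\<And>x. x \<in> K \<Longrightarrow> 1 \<le> \<kappa> x"
    using bump_family_cutoff[OF B(1) test_functions_support(1)[OF f]] unfolding K_def by blast
  have tst: "g \<in> bump_family \<B> \<Longrightarrow> g \<in> nonneg_test_functions" for g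
    using bump_family_test[OF B(2)] by blast
  have int: "integrable \<eta> g" if "\<eta> \<in> radon_measures" "g \<in> bump_family \<B>" for \<eta> g
    using that tst[OF that(2)] by (intro radon_test_integrable) (auto simp: nonneg_test_functions_def)
  define c where "c = (LINT x|\<eta>0. \<kappa> x)"
  have c0: "c \<ge> 0" unfolding c_def using tst[OF \<kappa>(1)] by (auto simp: nonneg_test_functions_def)
  obtain e where e: "e > 0" "ball (LINT x|\<eta>0. f x) e \<subseteq> U"
    using U \<eta>0(2) openE by blast
  \<comment> \<open>makes \<open>\<delta> (c + 1) = e / 8\<close>, and \<open>c + 1\<close> bounds the mass of \<open>\<kappa>\<close> on the whole neighbourhood\<close>
  define \<delta> where "\<delta> = e / (8 * (c + 1))"
  have \<delta>: "\<delta> > 0" using e c0 by (simp add: \<delta>_def)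
  have parts: "(\<lambda>x. max (f x) 0) \<in> nonneg_test_functions" "(\<lambda>x. max (- f x) 0) \<in> nonneg_test_functions"
  proof -
    have cf: "continuous_on UNIV f" using f by (simp add: test_functions_def)
    have "(\<lambda>x. max (f x) 0) \<in> test_functions" "(\<lambda>x. max (- f x) 0) \<in> test_functions"
      by (rule test_functions_combine[OF f f, of "\<lambda>u v. max u 0"]
            test_functions_combine[OF f f, of "\<lambda>u v. max (- u) 0"],
          intro continuous_intros cf, simp)+
    then show "(\<lambda>x. max (f x) 0) \<in> nonneg_test_functions" "(\<lambda>x. max (- f x) 0) \<in> nonneg_test_functions"
      by (simp_all add: nonneg_test_functions_def)
  qed
  obtain g1 where g1: "g1 \<in> bump_family \<B>" "\<And>x. g1 x \<le> max (f x) 0 \<and> max (f x) 0 \<le> g1 x + \<delta>"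
    using bump_family_approx[OF B(1) parts(1) \<delta>] by metis
  obtain g2 where g2: "g2 \<in> bump_family \<B>" "\<And>x. g2 x \<le> max (- f x) 0 \<and> max (- f x) 0 \<le> g2 x + \<delta>"
    using bump_family_approx[OF B(1) parts(2) \<delta>] by metis
  have nn: "0 \<le> g1 x" "0 \<le> g2 x" "0 \<le> \<kappa> x" for x
    using tst g1(1) g2(1) \<kappa>(1) by (auto simp: nonneg_test_functions_def)
  have dom: "\<bar>f x - (g1 x - g2 x)\<bar> \<le> \<delta> * \<kappa> x" for x
  proof (cases "x \<in> K")
    case True
    have "\<delta> * 1 \<le> \<delta> * \<kappa> x" using \<kappa>(2)[OF True] \<delta> by (intro mult_left_mono) auto
    then show ?thesis using g1(2)[of x] g2(2)[of x] nn[of x] by (auto simp: max_def abs_if split: if_splits)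
  next
    case False
    then have "f x = 0" using test_functions_support(2)[OF f] unfolding K_def by blast
    then show ?thesis using g1(2)[of x] g2(2)[of x] nn[of x] \<delta> by auto
  qed
  have close: "\<bar>(LINT x|\<eta>. f x) - ((LINT x|\<eta>. g1 x) - (LINT x|\<eta>. g2 x))\<bar> \<le> \<delta> * (LINT x|\<eta>. \<kappa> x)"
    if "\<eta> \<in> radon_measures" for \<eta>
  proof -
    have i: "integrable \<eta> f" "integrable \<eta> g1" "integrable \<eta> g2" "integrable \<eta> \<kappa>"
      using radon_test_integrable[OF that f] int[OF that] g1 g2 \<kappa> by auto
    have "\<bar>(LINT x|\<eta>. f x) - ((LINT x|\<eta>. g1 x) - (LINT x|\<eta>. g2 x))\<bar> = \<bar>LINT x|\<eta>. f x - (g1 x - g2 x)\<bar>"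
      using i by simp
    also have "\<dots> \<le> (LINT x|\<eta>. \<bar>f x - (g1 x - g2 x)\<bar>)"
      by (rule integral_abs_bound)
    also have "\<dots> \<le> (LINT x|\<eta>. \<delta> * \<kappa> x)"
      using i dom by (intro integral_mono) auto
    finally show ?thesis by simp
  qed
  have nb: "\<exists>V\<in>\<V>. (LINT x|\<eta>0. g x) \<in> V \<and> V \<subseteq> ball (LINT x|\<eta>0. g x) r" if "r > 0" for r g
    using topological_basisE[OF V, of "ball (LINT x|\<eta>0. g x) r" "LINT x|\<eta>0. g x"] that
    by (metis centre_in_ball open_ball)
  obtain V1 where V1: "V1 \<in> \<V>" "(LINT x|\<eta>0. g1 x) \<in> V1" "V1 \<subseteq> ball (LINT x|\<eta>0. g1 x) (e/8)"
    using nb[of "e/8" g1] e by auto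
  obtain V2 where V2: "V2 \<in> \<V>" "(LINT x|\<eta>0. g2 x) \<in> V2" "V2 \<subseteq> ball (LINT x|\<eta>0. g2 x) (e/8)"
    using nb[of "e/8" g2] e by auto
  obtain V3 where V3: "V3 \<in> \<V>" "(LINT x|\<eta>0. \<kappa> x) \<in> V3" "V3 \<subseteq> ball (LINT x|\<eta>0. \<kappa> x) 1"
    using nb[of 1 \<kappa>] by auto
  define F where "F = {{\<eta> \<in> radon_measures. (LINT x|\<eta>. g1 x) \<in> V1}, {\<eta> \<in> radon_measures. (LINT x|\<eta>. g2 x) \<in> V2},
    {\<eta> \<in> radon_measures. (LINT x|\<eta>. \<kappa> x) \<in> V3}}"
  have "F \<subseteq> \<D>" unfolding F_def \<D>_def using g1(1) g2(1) \<kappa>(1) V1(1) V2(1) V3(1) by blast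
  moreover have "\<eta>0 \<in> \<Inter>F" using \<eta>0(1) V1 V2 V3 by (auto simp: F_def)
  moreover have "(LINT x|\<eta>. f x) \<in> U" if \<eta>: "\<eta> \<in> \<Inter>F" "\<eta> \<in> radon_measures" for \<eta>
  proof -
    have d: "\<bar>(LINT x|\<eta>0. g1 x) - (LINT x|\<eta>. g1 x)\<bar> < e/8" "\<bar>(LINT x|\<eta>0. g2 x) - (LINT x|\<eta>. g2 x)\<bar> < e/8"
      "\<bar>(LINT x|\<eta>0. \<kappa> x) - (LINT x|\<eta>. \<kappa> x)\<bar> < 1"
      using \<eta> V1(3) V2(3) V3(3) by (auto simp: F_def dist_real_def)
    have "\<delta> * (LINT x|\<eta>. \<kappa> x) \<le> \<delta> * (c + 1)" "\<delta> * (LINT x|\<eta>0. \<kappa> x) \<le> \<delta> * (c + 1)"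
      using d(3) \<delta> c0 by (auto intro!: mult_left_mono simp: c_def)
    moreover have "\<delta> * (c + 1) = e / 8" using c0 by (simp add: \<delta>_def field_simps)
    ultimately have "\<bar>(LINT x|\<eta>0. f x) - (LINT x|\<eta>. f x)\<bar> < e"
      using d close[OF \<eta>(2)] close[OF \<eta>0(1)] e(1) by linarith
    then show ?thesis using e(2) by (auto simp: dist_real_def)
  qed
  ultimately show ?thesis by (intro exI[of _ F]) (auto simp: F_def)
qed

text \<open>The sets in \<open>\<D>\<close> form a countable subbase of the vague topology, so an open set is a countable union of
finite intersections of them.\<close>
lemma vague_open_in_countably_generated:
  fixes \<B> :: "'a::metric_space set set" and \<V> :: "real set set"
  assumes B: "countable \<B>" "topological_basis \<B>" "\<And>U. U \<in> \<B> \<Longrightarrow> compact (closure U)"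
    and V: "countable \<V>" "topological_basis \<V>"
    and W: "openin vague_topology W"
  defines "\<D> \<equiv> {{\<eta> \<in> radon_measures. (LINT x|\<eta>. g x) \<in> V} | g V. g \<in> bump_family \<B> \<and> V \<in> \<V>}"
  shows "W \<in> sigma_sets radon_measures \<D>"
proof -
  have loc: "\<exists>F. finite F \<and> F \<subseteq> \<D> \<and> \<eta>0 \<in> \<Inter>F \<and> \<Inter>F \<inter> radon_measures \<subseteq> W" if "\<eta>0 \<in> W" for \<eta>0
    using W[unfolded vague_topology_def openin_topology_generated_by_iff] that
  proof (induction arbitrary: \<eta>0)
    case (Int a b)
    obtain F1 F2 where "finite F1 \<and> F1 \<subseteq> \<D> \<and> \<eta>0 \<in> \<Inter>F1 \<and> \<Inter>F1 \<inter> radon_measures \<subseteq> a"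
      "finite F2 \<and> F2 \<subseteq> \<D> \<and> \<eta>0 \<in> \<Inter>F2 \<and> \<Inter>F2 \<inter> radon_measures \<subseteq> b"
      using Int.IH(1)[of \<eta>0] Int.IH(2)[of \<eta>0] Int.prems by blast
    then show ?case by (intro exI[of _ "F1 \<union> F2"]) auto
  next
    case (UN K)
    obtain k where k: "k \<in> K" "\<eta>0 \<in> k" using UN.prems by blast
    obtain F where "finite F \<and> F \<subseteq> \<D> \<and> \<eta>0 \<in> \<Inter>F \<and> \<Inter>F \<inter> radon_measures \<subseteq> k"
      using UN.IH[OF k] by blast
    with k(1) show ?case by (intro exI[of _ F]) auto
  next
    case (Basis s)
    then obtain f U where "f \<in> test_functions" "open U" "s = {\<eta> \<in> radon_measures. (LINT x|\<eta>. f x) \<in> U}"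
      by blast
    then show ?case
      using vague_neighbourhood[OF B(2,3) V(2), of f U \<eta>0] Basis.prems unfolding \<D>_def by blast
  qed simp
  have Wsub: "W \<subseteq> radon_measures" using openin_subset[OF W] by (simp add: topspace_vague)
  have "countable \<D>"
  proof -
    have "\<D> = (\<lambda>(g, V). {\<eta> \<in> radon_measures. (LINT x|\<eta>. g x) \<in> V}) ` (bump_family \<B> \<times> \<V>)"
      by (auto simp: \<D>_def)
    then show ?thesis using countable_bump_family[OF B(1)] V(1) by auto
  qed
  define \<F> where "\<F> = {F. F \<subseteq> \<D> \<and> finite F \<and> \<Inter>F \<inter> radon_measures \<subseteq> W}"
  have cF: "countable \<F>"
    by (rule countable_subset[OF _ countable_Collect_finite_subset[OF \<open>countable \<D>\<close>]]) (auto simp: \<F>_def)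
  have eq: "W = (\<Union>F\<in>\<F>. \<Inter>F \<inter> radon_measures)"
  proof (intro antisym subsetI)
    fix \<eta> assume "\<eta> \<in> W"
    then show "\<eta> \<in> (\<Union>F\<in>\<F>. \<Inter>F \<inter> radon_measures)"
      using loc[of \<eta>] Wsub unfolding \<F>_def by blast
  qed (auto simp: \<F>_def)
  interpret sigma_algebra radon_measures "sigma_sets radon_measures \<D>"
    by (rule sigma_algebra_sigma_sets) (auto simp: \<D>_def)
  have "\<Inter>F \<inter> radon_measures \<in> sigma_sets radon_measures \<D>" if "finite F" "F \<subseteq> \<D>" for F
    using that
  proof (induction F)
    case empty
    then show ?case using top by auto
  next
    case (insert a F)
    have "\<Inter>(insert a F) \<inter> radon_measures = a \<inter> (\<Inter>F \<inter> radon_measures)" by auto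
    then show ?case using insert by auto
  qed
  then show ?thesis
    unfolding eq by (intro countable_UN'[OF cF]) (auto simp: \<F>_def)
qed

lemma measurable_into_discrete_radon_space:
  fixes g :: "'b \<Rightarrow> 'a::polish_space measure"
  assumes lc: "locally_compact_space (euclidean :: 'a topology)"
    and sp: "\<And>\<omega>. \<omega> \<in> space M \<Longrightarrow> g \<omega> \<in> discrete_radon_measures"
    and m: "\<And>f. f \<in> nonneg_test_functions \<Longrightarrow> (\<lambda>\<omega>. LINT x|g \<omega>. f x) \<in> borel_measurable M"
  shows "g \<in> measurable M discrete_radon_space"
  unfolding discrete_radon_space_def
proof (rule measurable_restrict_space2)
  show "g \<in> space M \<rightarrow> discrete_radon_measures" using sp by auto
  obtain \<B> :: "'a set set" where B: "countable \<B>" "topological_basis \<B>" "\<And>U. U \<in> \<B> \<Longrightarrow> compact (closure U)"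
    using locally_compact_countable_basis[OF lc] by blast
  obtain \<V> :: "real set set" where V: "countable \<V>" "topological_basis \<V>"
    using ex_countable_basis by auto
  define \<D> where "\<D> = {{\<eta> \<in> radon_measures. (LINT x|\<eta>. g x) \<in> V} | g V. g \<in> bump_family \<B> \<and> V \<in> \<V>}"
  have rad: "g \<omega> \<in> radon_measures" if "\<omega> \<in> space M" for \<omega>
    using sp[OF that] by (auto simp: discrete_radon_measures_def)
  have "g \<in> measurable M (sigma radon_measures \<D>)"
  proof (rule measurable_measure_of)
    show "\<D> \<subseteq> Pow radon_measures" by (auto simp: \<D>_def)
    show "g \<in> space M \<rightarrow> radon_measures" using rad by auto
    fix y assume "y \<in> \<D>"
    then obtain h V where h: "h \<in> bump_family \<B>" "V \<in> \<V>" "y = {\<eta> \<in> radon_measures. (LINT x|\<eta>. h x) \<in> V}"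
      unfolding \<D>_def by blast
    have [measurable]: "(\<lambda>\<omega>. LINT x|g \<omega>. h x) \<in> borel_measurable M"
      using m bump_family_test[OF B(3) h(1)] by blast
    have [measurable]: "V \<in> sets borel" using topological_basis_open[OF V(2) h(2)] by simp
    have "g -` y \<inter> space M = (\<lambda>\<omega>. LINT x|g \<omega>. h x) -` V \<inter> space M" using rad by (auto simp: h)
    also have "\<dots> \<in> sets M" by measurable
    finally show "g -` y \<inter> space M \<in> sets M" .
  qed
  then have gm: "g -` A \<inter> space M \<in> sets M" if "A \<in> sigma_sets radon_measures \<D>" for A
    using that by (intro measurable_sets[of g M "sigma radon_measures \<D>"]) (auto simp: \<D>_def sets_measure_of_conv)
  show "g \<in> measurable M (borel_of_topology (vague_topology :: 'a measure topology))"
    unfolding borel_of_topology_def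
  proof (rule measurable_measure_of)
    show "{U. openin vague_topology U} \<subseteq> Pow (topspace (vague_topology :: 'a measure topology))" using openin_subset by blast
    show "g \<in> space M \<rightarrow> topspace (vague_topology :: 'a measure topology)" using rad by (auto simp: topspace_vague)
    fix W :: "'a measure set" assume "W \<in> {U. openin vague_topology U}"
    then show "g -` W \<inter> space M \<in> sets M"
      using gm vague_open_in_countably_generated[OF B V, of W] unfolding \<D>_def by blast
  qed
qed

text \<open>Polynomials are uniformly dense in the continuous functions on the unit interval.\<close>
lemma equal_moments_imp_equal_integral: 
  assumes "finite_measure M" "finite_measure N" 
    and [measurable]: "y \<in> borel_measurable M" "z \<in> borel_measurable N"
    and y01: "\<And>x. y x \<in> {0..1::real}" and z01: "\<And>x. z x \<in> {0..1::real}"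
    and eq: "\<And>k. (\<integral>x. y x ^ k \<partial>M) = (\<integral>x. z x ^ k \<partial>N)"
    and h: "continuous_on {0..1} (h :: real \<Rightarrow> real)" and hm[measurable]: "h \<in> borel_measurable borel"
  shows "(\<integral>x. h (y x) \<partial>M) = (\<integral>x. h (z x) \<partial>N)"
proof -
  interpret M: finite_measure M by fact
  interpret N: finite_measure N by fact
  have pw: "integrable M (\<lambda>x. y x ^ k)" "integrable N (\<lambda>x. z x ^ k)" for k
    using y01 z01 
    by (auto intro!: M.integrable_const_bound[where B=1] N.integrable_const_bound[where B=1] simp: power_le_one)
  have "bounded (h ` {0..1})"
    using h by (intro compact_imp_bounded compact_continuous_image) auto
  then obtain B where B: "\<And>u. u \<in> {0..1} \<Longrightarrow> \<bar>h u\<bar> \<le> B" by (force simp: bounded_iff)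
  have hi: "integrable M (\<lambda>x. h (y x))" "integrable N (\<lambda>x. h (z x))"
    using B y01 z01 by (auto intro!: M.integrable_const_bound[where B=B] N.integrable_const_bound[where B=B])
  define S where "S = measure M (space M) + measure N (space N)"
  have bd: "\<bar>(\<integral>x. h (y x) \<partial>M) - (\<integral>x. h (z x) \<partial>N)\<bar> \<le> e * S" if "e > 0" for e
  proof -
    obtain g where g: "real_polynomial_function g" "\<And>u. u \<in> {0..1} \<Longrightarrow> \<bar>h u - g u\<bar> < e"
      using Stone_Weierstrass_real_polynomial_function[OF _ h \<open>e > 0\<close>] by auto
    obtain a n where a: "g = (\<lambda>u. \<Sum>i\<le>n. a i * u ^ i)"
      using g(1) real_polynomial_function_iff_sum by blast
    have gi: "integrable M (\<lambda>x. g (y x))" "integrable N (\<lambda>x. g (z x))" unfolding a using pw by auto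
    have geq: "(\<integral>x. g (y x) \<partial>M) = (\<integral>x. g (z x) \<partial>N)" unfolding a using pw eq by simp
    have "\<bar>(\<integral>x. h (y x) \<partial>M) - (\<integral>x. g (y x) \<partial>M)\<bar> \<le> e * measure M (space M)"
    proof -
      have "\<bar>(\<integral>x. h (y x) \<partial>M) - (\<integral>x. g (y x) \<partial>M)\<bar> = \<bar>\<integral>x. h (y x) - g (y x) \<partial>M\<bar>" using hi gi by simp
      also have "\<dots> \<le> (\<integral>x. \<bar>h (y x) - g (y x)\<bar> \<partial>M)" by (rule integral_abs_bound)
      also have "\<dots> \<le> (\<integral>x. e \<partial>M)" using g(2) y01 hi gi by (intro integral_mono) (auto intro: less_imp_le)
      finally show ?thesis by (simp add: mult.commute)
    qed
    moreover have "\<bar>(\<integral>x. h (z x) \<partial>N) - (\<integral>x. g (z x) \<partial>N)\<bar> \<le> e * measure N (space N)"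
    proof -
      have "\<bar>(\<integral>x. h (z x) \<partial>N) - (\<integral>x. g (z x) \<partial>N)\<bar> = \<bar>\<integral>x. h (z x) - g (z x) \<partial>N\<bar>" using hi gi by simp
      also have "\<dots> \<le> (\<integral>x. \<bar>h (z x) - g (z x)\<bar> \<partial>N)" by (rule integral_abs_bound)
      also have "\<dots> \<le> (\<integral>x. e \<partial>N)" using g(2) z01 hi gi by (intro integral_mono) (auto intro: less_imp_le)
      finally show ?thesis by (simp add: mult.commute)
    qed
    ultimately show ?thesis unfolding S_def using geq by (simp add: distrib_left)
  qed
  have "S \<ge> 0" by (simp add: S_def)
  have le: "\<bar>(\<integral>x. h (y x) \<partial>M) - (\<integral>x. h (z x) \<partial>N)\<bar> \<le> e" if "e > 0" for e
  proof -
    have "\<bar>(\<integral>x. h (y x) \<partial>M) - (\<integral>x. h (z x) \<partial>N)\<bar> \<le> e / (S + 1) * S"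
      using that \<open>S \<ge> 0\<close> by (intro bd) auto
    also have "\<dots> \<le> e" using that \<open>S \<ge> 0\<close> by (simp add: field_simps)
    finally show ?thesis .
  qed
  then have "\<bar>(\<integral>x. h (y x) \<partial>M) - (\<integral>x. h (z x) \<partial>N)\<bar> \<le> 0" by (rule dense_ge)
  then show ?thesis by simp
qed

lemma equal_moments_imp_equal_law:
  assumes M: "finite_measure M" and N: "finite_measure N" 
    and ym[measurable]: "y \<in> borel_measurable M" and zm[measurable]: "z \<in> borel_measurable N"
    and y01: "\<And>x. y x \<in> {0..1::real}" and z01: "\<And>x. z x \<in> {0..1::real}"
    and eq: "\<And>k. (\<integral>x. y x ^ k \<partial>M) = (\<integral>x. z x ^ k \<partial>N)"
  shows "distr M borel y = distr N borel z"
proof (rule measure_eqI_lessThan)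
  interpret M: finite_measure M by fact
  interpret N: finite_measure N by fact
  interpret DM: finite_measure "distr M borel y" by (rule M.finite_measure_distr) fact
  show "emeasure (distr M borel y) {a<..} < \<infinity>" for a by (simp add: DM.emeasure_finite less_top[symmetric])
  fix a
  define h where "h j u = min 1 (max 0 (real j * (u - a)))" for j u
  have h: "(\<lambda>j. h j u) \<longlonglongrightarrow> indicator {a<..} u" for u
  proof (cases "u > a")
    case True
    then obtain j0 where j0: "real j0 * (u - a) > 1" using reals_Archimedean3[of "u - a"] by auto
    have "h j u = 1" if "j \<ge> j0" for j
    proof -
      have "real j0 * (u - a) \<le> real j * (u - a)" using that True by (intro mult_right_mono) auto
      then show ?thesis using j0 by (auto simp: h_def)
    qed
    then have "eventually (\<lambda>j. h j u = 1) sequentially" by (auto simp: eventually_sequentially)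
    then show ?thesis using True by (simp add: tendsto_eventually)
  next
    case False
    then have "h j u = 0" for j by (auto simp: h_def mult_nonneg_nonpos)
    then show ?thesis using False by simp
  qed
  have hm[measurable]: "h j \<in> borel_measurable borel" for j unfolding h_def by measurable
  have "(\<lambda>j. \<integral>x. h j (y x) \<partial>M) \<longlonglongrightarrow> (\<integral>x. indicator {a<..} (y x) \<partial>M)"
    using h by (intro integral_dominated_convergence[where w="\<lambda>_. 1"]) (auto simp: h_def)
  moreover have "(\<lambda>j. \<integral>x. h j (z x) \<partial>N) \<longlonglongrightarrow> (\<integral>x. indicator {a<..} (z x) \<partial>N)"
    using h by (intro integral_dominated_convergence[where w="\<lambda>_. 1"]) (auto simp: h_def)
  moreover have "(\<integral>x. h j (y x) \<partial>M) = (\<integral>x. h j (z x) \<partial>N)" for j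
    by (rule equal_moments_imp_equal_integral[OF M N ym zm y01 z01 eq _ hm])
       (auto simp: h_def intro!: continuous_intros)
  ultimately have "(\<integral>x. indicator {a<..} (y x) \<partial>M) = (\<integral>x. indicator {a<..} (z x) \<partial>N :: real)"
    using LIMSEQ_unique by auto
  moreover have "(\<integral>x. indicator {a<..} (y x) \<partial>M) = measure (distr M borel y) {a<..}"
    by (subst integral_distr[OF ym, of "indicator {a<..}", symmetric]) auto
  moreover have "(\<integral>x. indicator {a<..} (z x) \<partial>N) = measure (distr N borel z) {a<..}"
    by (subst integral_distr[OF zm, of "indicator {a<..}", symmetric]) auto
  ultimately have "measure (distr M borel y) {a<..} = measure (distr N borel z) {a<..}" by simp
  then show "emeasure (distr M borel y) {a<..} = emeasure (distr N borel z) {a<..}"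
    using DM.emeasure_eq_measure finite_measure.emeasure_eq_measure[OF N.finite_measure_distr[OF zm]] by simp
qed auto

text \<open>Lists rather than finite sets of constraints: intersection of cylinders is concatenation, and statements
about cylinders are proved by adding one constraint at a time.\<close>
definition cylinder :: "(('a::topological_space \<Rightarrow> real) \<times> real set) list \<Rightarrow> 'a measure set" where
  "cylinder L = {\<eta> \<in> discrete_radon_measures. \<forall>(f, V)\<in>set L. (LINT x|\<eta>. f x) \<in> V}"

lemma sets_discrete_radon_space:
  assumes lc: "locally_compact_space (euclidean :: 'a topology)"
  shows "sets (discrete_radon_space :: 'a::polish_space measure measure)
    = sigma_sets discrete_radon_measures (cylinder ` lists (nonneg_test_functions \<times> sets borel))"
    (is "sets ?S = sigma_sets ?K ?G")
proof
  have sub: "?G \<subseteq> Pow ?K" by (auto simp: cylinder_def)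
  have [measurable]: "f \<in> nonneg_test_functions \<Longrightarrow> (\<lambda>\<eta>. LINT x|\<eta>. f x) \<in> borel_measurable ?S" for f
    by (rule test_integral_measurable) (simp add: nonneg_test_functions_def)
  have "(\<lambda>\<eta>. \<eta>) \<in> measurable (sigma ?K ?G) ?S"
  proof (rule measurable_into_discrete_radon_space[OF lc])
    show "\<eta> \<in> discrete_radon_measures" if "\<eta> \<in> space (sigma ?K ?G)" for \<eta>
      using that sub by (simp add: space_measure_of_conv)
    fix f :: "'a \<Rightarrow> real" assume f: "f \<in> nonneg_test_functions"
    show "(\<lambda>\<omega>. LINT x|\<omega>. f x) \<in> borel_measurable (sigma ?K ?G)"
    proof (rule measurableI)
      fix V :: "real set" assume "V \<in> sets borel"
      then have "cylinder [(f, V)] \<in> ?G" using f by (intro imageI) auto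
      moreover have "(\<lambda>\<omega>. LINT x|\<omega>. f x) -` V \<inter> space (sigma ?K ?G) = cylinder [(f, V)]"
        by (auto simp: cylinder_def space_measure_of_conv)
      ultimately show "(\<lambda>\<omega>. LINT x|\<omega>. f x) -` V \<inter> space (sigma ?K ?G) \<in> sets (sigma ?K ?G)"
        using sub by (simp add: sets_measure_of sigma_sets.Basic)
    qed simp
  qed
  then have "(\<lambda>\<eta>. \<eta>) -` A \<inter> space (sigma ?K ?G) \<in> sets (sigma ?K ?G)" if "A \<in> sets ?S" for A
    using that by (rule measurable_sets)
  then show "sets ?S \<subseteq> sigma_sets ?K ?G"
    using sub sets.sets_into_space[of _ ?S]
    by (auto simp: sets_measure_of space_measure_of_conv space_discrete_radon_space Int_absorb2)
  have "cylinder L \<in> sets ?S" if "L \<in> lists (nonneg_test_functions \<times> sets borel)" for L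
    using that
  proof induction
    case Nil
    have "cylinder [] = space ?S" by (simp add: cylinder_def space_discrete_radon_space)
    then show ?case by (metis sets.top)
  next
    case (Cons a L)
    obtain f V where a: "a = (f, V)" by (cases a)
    then have f: "f \<in> nonneg_test_functions" and [measurable]: "V \<in> sets borel" using Cons by auto
    have "(\<lambda>\<eta>. LINT x|\<eta>. f x) -` V \<inter> space ?S \<in> sets ?S"
      using f by measurable
    then have "((\<lambda>\<eta>. LINT x|\<eta>. f x) -` V \<inter> space ?S) \<inter> cylinder L \<in> sets ?S"
      using Cons.IH by (rule sets.Int)
    also have "((\<lambda>\<eta>. LINT x|\<eta>. f x) -` V \<inter> space ?S) \<inter> cylinder L = cylinder (a # L)"
      by (auto simp: cylinder_def space_discrete_radon_space a)
    finally show ?case .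
  qed
  then show "sigma_sets ?K ?G \<subseteq> sets ?S"
    unfolding space_discrete_radon_space[symmetric] by (intro sets.sigma_sets_subset) auto
qed

text \<open>The constraints are introduced one at a time. If the claim holds for \<open>L\<close> and all \<open>g\<close>, then in particular
for \<open>k f + g\<close> in place of \<open>g\<close>. These are the moments of \<open>y = exp (- \<langle>f, \<eta>\<rangle>)\<close>, which takes
values in the unit interval, under the measures with density \<open>1\<^sub>L exp (- \<langle>g, \<eta>\<rangle>)\<close>. Equal moments force equal laws
of \<open>y\<close>, so a constraint on \<open>\<langle>f, \<eta>\<rangle>\<close> can be added.\<close>
lemma cylinder_Laplace_eq:
  fixes P Q :: "'a::polish_space measure measure"
  assumes lc: "locally_compact_space (euclidean :: 'a topology)"
    and P: "finite_measure P" "sets P = sets discrete_radon_space"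
    and Q: "finite_measure Q" "sets Q = sets discrete_radon_space"
    and eq: "\<And>f. f \<in> nonneg_test_functions \<Longrightarrow>
      (\<integral>\<eta>. exp (- (LINT x|\<eta>. f x)) \<partial>P) = (\<integral>\<eta>. exp (- (LINT x|\<eta>. f x)) \<partial>Q)"
    and L: "L \<in> lists (nonneg_test_functions \<times> sets borel)"
    and g: "g \<in> nonneg_test_functions"
  shows "(\<integral>\<eta>. indicator (cylinder L) \<eta> * exp (- (LINT x|\<eta>. g x)) \<partial>P)
       = (\<integral>\<eta>. indicator (cylinder L) \<eta> * exp (- (LINT x|\<eta>. g x)) \<partial>Q)"
  using L g
proof (induction arbitrary: g)
  interpret P: finite_measure P by fact
  interpret Q: finite_measure Q by fact
  have spP: "space P = discrete_radon_measures" and spQ: "space Q = discrete_radon_measures"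
    using sets_eq_imp_space_eq[OF P(2)] sets_eq_imp_space_eq[OF Q(2)] by (simp_all add: space_discrete_radon_space)
  have mP[measurable]: "(\<lambda>\<eta>. LINT x|\<eta>. f x) \<in> borel_measurable P"
    and mQ[measurable]: "(\<lambda>\<eta>. LINT x|\<eta>. f x) \<in> borel_measurable Q" if "f \<in> nonneg_test_functions" for f
    using that unfolding measurable_cong_sets[OF P(2) refl] measurable_cong_sets[OF Q(2) refl]
    by (auto simp: nonneg_test_functions_def intro: test_integral_measurable)
  {
    case Nil
    have "(\<integral>\<eta>. indicator (cylinder []) \<eta> * exp (- (LINT x|\<eta>. g x)) \<partial>M) = (\<integral>\<eta>. exp (- (LINT x|\<eta>. g x)) \<partial>M)"
      if "space M = discrete_radon_measures" for M
      using that by (intro Bochner_Integration.integral_cong) (auto simp: cylinder_def)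
    then show ?case using eq[OF Nil] spP spQ by simp
  next
    case (Cons a L)
    obtain f V where a: "a = (f, V)" by (cases a)
    then have f: "f \<in> nonneg_test_functions" and V[measurable]: "V \<in> sets borel" using Cons by auto
    note [measurable] = mP[OF f] mQ[OF f] mP[OF Cons.prems] mQ[OF Cons.prems]
    have "cylinder L \<in> sets discrete_radon_space"
      unfolding sets_discrete_radon_space[OF lc] using Cons.hyps by (auto intro!: sigma_sets.Basic)
    then have [measurable]: "cylinder L \<in> sets P" "cylinder L \<in> sets Q" by (simp_all add: P Q)
    define r where "r \<eta> = indicator (cylinder L) \<eta> * exp (- (LINT x|\<eta>. g x))" for \<eta>
    have rm[measurable]: "r \<in> borel_measurable P" "r \<in> borel_measurable Q" unfolding r_def by measurable
    have r01: "0 \<le> r \<eta> \<and> r \<eta> \<le> 1" for \<eta>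
      using Cons.prems by (auto simp: r_def indicator_def nonneg_test_functions_def)
    define y where "y \<eta> = exp (- (LINT x|\<eta>. f x))" for \<eta> :: "'a measure"
    have ym[measurable]: "y \<in> borel_measurable P" "y \<in> borel_measurable Q" unfolding y_def by measurable
    have y01: "y \<eta> \<in> {0..1}" for \<eta> using f by (auto simp: y_def nonneg_test_functions_def)
    have fin: "finite_measure (density M (\<lambda>\<eta>. ennreal (r \<eta>)))"
      if "finite_measure M" "r \<in> borel_measurable M" for M
    proof (rule finite_measureI)
      interpret finite_measure M by fact
      have "(\<integral>\<^sup>+\<eta>. ennreal (r \<eta>) \<partial>M) \<le> (\<integral>\<^sup>+\<eta>. 1 \<partial>M)" using r01 by (intro nn_integral_mono) auto
      also have "\<dots> < \<infinity>" by (simp add: emeasure_finite less_top[symmetric])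
      finally show "emeasure (density M (\<lambda>\<eta>. ennreal (r \<eta>))) (space (density M (\<lambda>\<eta>. ennreal (r \<eta>)))) \<noteq> \<infinity>"
        using that(2) by (subst emeasure_density) (auto cong: nn_integral_cong)
    qed
    have "distr (density P (\<lambda>\<eta>. ennreal (r \<eta>))) borel y = distr (density Q (\<lambda>\<eta>. ennreal (r \<eta>))) borel y"
    proof (rule equal_moments_imp_equal_law[OF fin[OF P(1)] fin[OF Q(1)]])
      fix k :: nat
      define h where "h x = real k * f x + g x" for x
      have h: "h \<in> nonneg_test_functions"
        unfolding h_def using f Cons.prems by (intro nonneg_test_functions_simps(3,4)) auto
      have "(\<integral>\<eta>. y \<eta> ^ k \<partial>density M (\<lambda>\<eta>. ennreal (r \<eta>))) =
         (\<integral>\<eta>. indicator (cylinder L) \<eta> * exp (- (LINT x|\<eta>. h x)) \<partial>M)"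
        if [measurable]: "r \<in> borel_measurable M" "y \<in> borel_measurable M" and sp: "space M = discrete_radon_measures" for M
      proof (subst integral_density)
        have "r \<eta> * y \<eta> ^ k = indicator (cylinder L) \<eta> * exp (- (LINT x|\<eta>. h x))" if "\<eta> \<in> space M" for \<eta>
        proof -
          have "\<eta> \<in> radon_measures" using that by (auto simp: sp discrete_radon_measures_def)
          then have "integrable \<eta> f" "integrable \<eta> g"
            using f Cons.prems by (auto intro!: radon_test_integrable simp: nonneg_test_functions_def)
          then have "(LINT x|\<eta>. h x) = real k * (LINT x|\<eta>. f x) + (LINT x|\<eta>. g x)" by (simp add: h_def)
          moreover have "y \<eta> ^ k = exp (real k * - (LINT x|\<eta>. f x))"
            by (simp only: y_def exp_of_nat_mult)
          ultimately show ?thesis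
            by (simp add: r_def mult_exp_exp algebra_simps)
        qed
        then show "(\<integral>\<eta>. r \<eta> *\<^sub>R y \<eta> ^ k \<partial>M) = (\<integral>\<eta>. indicator (cylinder L) \<eta> * exp (- (LINT x|\<eta>. h x)) \<partial>M)"
          by (intro Bochner_Integration.integral_cong) auto
      qed (use r01 in auto)
      then show "(\<integral>\<eta>. y \<eta> ^ k \<partial>density P (\<lambda>\<eta>. ennreal (r \<eta>))) = (\<integral>\<eta>. y \<eta> ^ k \<partial>density Q (\<lambda>\<eta>. ennreal (r \<eta>)))"
        using rm ym spP spQ Cons.IH[OF h] by simp
    qed (use y01 in \<open>auto intro: ym\<close>)
    \<comment> \<open>the constraint on \<open>\<langle>f, \<eta>\<rangle>\<close> as a constraint on \<open>y\<close>\<close>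
    moreover define A where "A = {u. 0 < u \<and> - ln u \<in> V}"
    have [measurable]: "A \<in> sets borel" unfolding A_def by measurable
    have *: "(\<integral>\<eta>. indicator (cylinder (a # L)) \<eta> * exp (- (LINT x|\<eta>. g x)) \<partial>M)
       = measure (distr (density M (\<lambda>\<eta>. ennreal (r \<eta>))) borel y) A"
      if [measurable]: "r \<in> borel_measurable M" "y \<in> borel_measurable M" for M
    proof -
      have "measure (distr (density M (\<lambda>\<eta>. ennreal (r \<eta>))) borel y) A = (\<integral>u. indicator A u \<partial>distr (density M (\<lambda>\<eta>. ennreal (r \<eta>))) borel y)"
        by simp
      also have "\<dots> = (\<integral>\<eta>. indicator A (y \<eta>) \<partial>density M (\<lambda>\<eta>. ennreal (r \<eta>)))"
        by (rule integral_distr) auto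
      also have "\<dots> = (\<integral>\<eta>. r \<eta> *\<^sub>R indicator A (y \<eta>) \<partial>M)"
        using r01 by (intro integral_density) auto
      also have "\<dots> = (\<integral>\<eta>. indicator (cylinder (a # L)) \<eta> * exp (- (LINT x|\<eta>. g x)) \<partial>M)"
        by (intro Bochner_Integration.integral_cong) (auto simp: r_def y_def A_def a cylinder_def indicator_def)
      finally show ?thesis by simp
    qed
    ultimately show ?case using *[OF rm(1) ym(1)] *[OF rm(2) ym(2)] by simp
  }
qed

lemma Laplace_functional_determines_measure:
  fixes P Q :: "'a::polish_space measure measure"
  assumes lc: "locally_compact_space (euclidean :: 'a topology)"
    and P: "finite_measure P" "sets P = sets discrete_radon_space"
    and Q: "finite_measure Q" "sets Q = sets discrete_radon_space"
    and eq: "\<And>f. f \<in> nonneg_test_functions \<Longrightarrow>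
      (\<integral>\<eta>. exp (- (LINT x|\<eta>. f x)) \<partial>P) = (\<integral>\<eta>. exp (- (LINT x|\<eta>. f x)) \<partial>Q)"
  shows "P = Q"
proof (rule measure_eqI_generator_eq)
  interpret P: finite_measure P by fact
  interpret Q: finite_measure Q by fact
  let ?G = "cylinder ` lists (nonneg_test_functions \<times> sets borel) :: 'a measure set set"
  show "sets P = sigma_sets discrete_radon_measures ?G" "sets Q = sigma_sets discrete_radon_measures ?G"
    using P(2) Q(2) sets_discrete_radon_space[OF lc] by auto
  have "cylinder L1 \<inter> cylinder L2 = cylinder (L1 @ L2)" for L1 L2 :: "(('a \<Rightarrow> real) \<times> real set) list"
    by (auto simp: cylinder_def)
  then show "Int_stable ?G"
    unfolding Int_stable_def by (auto intro!: imageI simp del: lists_eq_set)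
  show "?G \<subseteq> Pow discrete_radon_measures" by (auto simp: cylinder_def)
  show "range (\<lambda>_. cylinder []) \<subseteq> ?G" by auto
  show "(\<Union>i::nat. cylinder []) = (discrete_radon_measures :: 'a measure set)" by (auto simp: cylinder_def)
  show "emeasure P (cylinder []) \<noteq> \<infinity>" by simp
  fix X assume "X \<in> ?G"
  then obtain L where L: "L \<in> lists (nonneg_test_functions \<times> sets borel)" "X = cylinder L" by blast
  have "X \<in> sets discrete_radon_space"
    unfolding sets_discrete_radon_space[OF lc] using L by (auto intro!: sigma_sets.Basic)
  then have "X \<in> sets P" "X \<in> sets Q" by (simp_all add: P Q)
  moreover have "(\<integral>\<eta>. indicator X \<eta> \<partial>P) = (\<integral>\<eta>. indicator X \<eta> \<partial>Q :: real)"
    using cylinder_Laplace_eq[OF lc P Q eq L(1) zero_nonneg_test] by (simp add: L(2))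
  ultimately have "measure P X = measure Q X" by simp
  then show "emeasure P X = emeasure Q X" by (simp add: P.emeasure_eq_measure Q.emeasure_eq_measure)
qed

section \<open>Masses, atoms and integrals as functions of the measure\<close>

lemma relatively_compact_mass_finite:
  assumes "\<eta> \<in> radon_measures" "compact (closure U)"
  shows "emeasure \<eta> U < \<infinity>"
proof -
  have "emeasure \<eta> U \<le> emeasure \<eta> (closure U)"
    using assms by (intro emeasure_mono closure_subset) (auto simp: radon_measures_def)
  also have "\<dots> < \<infinity>" using assms by (simp add: radon_measures_def)
  finally show ?thesis .
qed

lemma open_mass_measurable:
  fixes U :: "'a::polish_space set"
  assumes U: "open U" "compact (closure U)"
  shows "(\<lambda>\<eta>. emeasure \<eta> U) \<in> borel_measurable discrete_radon_space"
proof -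
  have fin: "emeasure \<eta> U < \<infinity>" if "\<eta> \<in> space discrete_radon_space" for \<eta>
    by (rule relatively_compact_mass_finite[OF space_discrete_radon_spaceD(1)[OF that] U(2)])
  have lim: "(\<lambda>k. LINT x|\<eta>. bump U k x) \<longlonglongrightarrow> measure \<eta> U" if "\<eta> \<in> space discrete_radon_space" for \<eta>
  proof -
    note D = space_discrete_radon_spaceD[OF that]
    have [measurable]: "bump U k \<in> borel_measurable \<eta>" "U \<in> sets \<eta>" for k
      using D(2) U(1) bump_continuous[of UNIV U k] measurable_cong_sets[OF D(2) refl]
      by (auto intro!: borel_measurable_continuous_onI)
    have "(\<lambda>k. LINT x|\<eta>. bump U k x) \<longlonglongrightarrow> (LINT x|\<eta>. indicator U x)"
    proof (rule integral_dominated_convergence[where w="indicator U"])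
      show "integrable \<eta> (indicator U :: _ \<Rightarrow> real)" using fin[OF that] by simp
      show "AE x in \<eta>. norm (bump U k x) \<le> indicator U x" for k
        using bump_nonneg[of U k] bump_le_1[of U k] bump_outside[of _ U k] by (auto simp: indicator_def)
    qed (use bump_tendsto[OF U(1)] in auto)
    then show ?thesis by simp
  qed
  have "(\<lambda>\<eta>. measure \<eta> U) \<in> borel_measurable discrete_radon_space"
    using bump_test[OF U(2)]
    by (intro borel_measurable_LIMSEQ_real[OF lim] test_integral_measurable) (auto simp: nonneg_test_functions_def)
  then have "(\<lambda>\<eta>. ennreal (measure \<eta> U)) \<in> borel_measurable discrete_radon_space" by measurable
  then show ?thesis
    using fin by (subst measurable_cong[where g="\<lambda>\<eta>. ennreal (measure \<eta> U)"]) (auto simp: emeasure_eq_ennreal_measure less_top[symmetric])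
qed

text \<open>On each relatively compact \<open>U n\<close> the measure \<open>\<eta>\<close> divided by \<open>1 + \<eta> (U n)\<close> is a subprobability measure, so
the measurability theory of subprobability kernels applies; the factor is put back afterwards and \<open>U n\<close>
exhausts the space.\<close>
lemma kernel_integral_measurable [measurable (raw)]:
  fixes h :: "'a::polish_space measure \<Rightarrow> 'a \<Rightarrow> ennreal"
  assumes lc: "locally_compact_space (euclidean :: 'a topology)"
    and h[measurable]: "(\<lambda>(\<eta>, x). h \<eta> x) \<in> borel_measurable (discrete_radon_space \<Otimes>\<^sub>M borel)"
  shows "(\<lambda>\<eta>. \<integral>\<^sup>+x. h \<eta> x \<partial>\<eta>) \<in> borel_measurable discrete_radon_space"
proof -
  obtain U :: "nat \<Rightarrow> 'a set" where U: "\<And>n. open (U n)" "\<And>n. compact (closure (U n))" "incseq U" "(\<Union>n. U n) = UNIV"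
    using compact_exhaustion[OF lc] by blast
  have [measurable]: "U n \<in> sets borel" for n using U(1) by simp
  have [measurable]: "(\<lambda>\<eta>. emeasure \<eta> (U n)) \<in> borel_measurable discrete_radon_space" for n
    using U by (intro open_mass_measurable)
  define \<kappa> where "\<kappa> n \<eta> = density \<eta> (\<lambda>x. indicator (U n) x / (1 + emeasure \<eta> (U n)))" for n \<eta>
  have pos: "1 + emeasure \<eta> (U n) \<noteq> 0" "\<eta> \<in> space discrete_radon_space \<Longrightarrow> 1 + emeasure \<eta> (U n) \<noteq> \<infinity>" for \<eta> n
    using relatively_compact_mass_finite[OF space_discrete_radon_spaceD(1) U(2)] by (auto simp: add_eq_0_iff_both_eq_0 less_top)
  have em: "emeasure (\<kappa> n \<eta>) A = emeasure \<eta> (A \<inter> U n) / (1 + emeasure \<eta> (U n))"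
    if "\<eta> \<in> space discrete_radon_space" "A \<in> sets borel" for n \<eta> A
  proof -
    have [measurable_cong]: "sets \<eta> = sets borel" using space_discrete_radon_spaceD that by blast
    have [measurable]: "A \<in> sets \<eta>" using that space_discrete_radon_spaceD by blast
    have "emeasure (\<kappa> n \<eta>) A = (\<integral>\<^sup>+x. indicator (A \<inter> U n) x / (1 + emeasure \<eta> (U n)) \<partial>\<eta>)"
      unfolding \<kappa>_def by (subst emeasure_density) (auto intro!: nn_integral_cong simp: indicator_def)
    also have "\<dots> = emeasure \<eta> (A \<inter> U n) / (1 + emeasure \<eta> (U n))"
      by (subst nn_integral_divide) (auto)
    finally show ?thesis .
  qed
  have \<kappa>: "\<kappa> n \<in> measurable discrete_radon_space (subprob_algebra borel)" for n
  proof (rule measurable_subprob_algebra_generated[where G="{S. open S}" and \<Omega>=UNIV])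
    show "sets borel = sigma_sets UNIV {S::'a set. open S}" by (simp add: borel_def)
    show "Int_stable {S::'a set. open S}" by (auto simp: Int_stable_def)
    fix \<eta> :: "'a measure" assume \<eta>: "\<eta> \<in> space discrete_radon_space"
    show s: "sets (\<kappa> n \<eta>) = sets borel" using space_discrete_radon_spaceD[OF \<eta>] by (simp add: \<kappa>_def)
    have "emeasure \<eta> (U n) / (1 + emeasure \<eta> (U n)) \<le> 1"
      using pos[of \<eta> n] \<eta> by (intro divide_le_posI_ennreal) (auto simp: zero_less_iff_neq_zero)
    then show "subprob_space (\<kappa> n \<eta>)"
      using em[OF \<eta>, of UNIV] sets_eq_imp_space_eq[OF s] by (intro subprob_spaceI) auto
  next
    have om: "(\<lambda>\<eta>. emeasure (\<kappa> n \<eta>) A) \<in> borel_measurable discrete_radon_space" if "open A" for A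
    proof -
      have "A \<inter> U n \<subseteq> closure (U n)" using closure_subset by blast
      then have "compact (closure (A \<inter> U n))" by (rule compact_closure_of_subset[OF U(2)])
      then have [measurable]: "(\<lambda>\<eta>. emeasure \<eta> (A \<inter> U n)) \<in> borel_measurable discrete_radon_space"
        using that U(1) by (intro open_mass_measurable) auto
      show ?thesis using that by (subst measurable_cong[OF em]) auto
    qed
    show "A \<in> {S. open S} \<Longrightarrow> (\<lambda>\<eta>. emeasure (\<kappa> n \<eta>) A) \<in> borel_measurable discrete_radon_space" for A
      using om by simp
    show "(\<lambda>\<eta>. emeasure (\<kappa> n \<eta>) UNIV) \<in> borel_measurable discrete_radon_space" using om by simp
  qed auto
  have "(\<integral>\<^sup>+x. h \<eta> x \<partial>\<eta>) = (SUP n. (1 + emeasure \<eta> (U n)) * (\<integral>\<^sup>+x. h \<eta> x \<partial>\<kappa> n \<eta>))"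
    if \<eta>: "\<eta> \<in> space discrete_radon_space" for \<eta>
  proof -
    have [measurable_cong]: "sets \<eta> = sets borel" using space_discrete_radon_spaceD \<eta> by blast
    have [measurable]: "h \<eta> \<in> borel_measurable borel" using \<eta> by measurable
    have "(1 + emeasure \<eta> (U n)) * (\<integral>\<^sup>+x. h \<eta> x \<partial>\<kappa> n \<eta>) = (\<integral>\<^sup>+x. h \<eta> x * indicator (U n) x \<partial>\<eta>)" for n
    proof -
      have "(1 + emeasure \<eta> (U n)) * (\<integral>\<^sup>+x. h \<eta> x \<partial>\<kappa> n \<eta>)
         = (\<integral>\<^sup>+x. (1 + emeasure \<eta> (U n)) * (indicator (U n) x / (1 + emeasure \<eta> (U n)) * h \<eta> x) \<partial>\<eta>)"
        unfolding \<kappa>_def by (subst nn_integral_density) (auto simp: nn_integral_cmult)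
      also have "\<dots> = (\<integral>\<^sup>+x. h \<eta> x * indicator (U n) x \<partial>\<eta>)"
      proof (intro nn_integral_cong)
        fix x
        have "(1 + emeasure \<eta> (U n)) / (1 + emeasure \<eta> (U n)) = 1"
          using pos[of \<eta> n] \<eta> by (intro ennreal_divide_self) (auto simp: less_top)
        then show "(1 + emeasure \<eta> (U n)) * (indicator (U n) x / (1 + emeasure \<eta> (U n)) * h \<eta> x) = h \<eta> x * indicator (U n) x"
          by (auto simp: indicator_def mult.assoc[symmetric] ennreal_times_divide)
      qed
      finally show ?thesis .
    qed
    moreover have "(\<integral>\<^sup>+x. h \<eta> x \<partial>\<eta>) = (SUP n. \<integral>\<^sup>+x. h \<eta> x * indicator (U n) x \<partial>\<eta>)"
    proof -
      have "h \<eta> x = (SUP n. h \<eta> x * indicator (U n) x)" for x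
      proof (rule antisym)
        obtain n where "x \<in> U n" using U(4) by auto
        then show "h \<eta> x \<le> (SUP n. h \<eta> x * indicator (U n) x)" by (intro SUP_upper2[of n]) auto
      qed (auto intro!: SUP_least simp: indicator_def)
      then have "(\<integral>\<^sup>+x. h \<eta> x \<partial>\<eta>) = (\<integral>\<^sup>+x. (SUP n. h \<eta> x * indicator (U n) x) \<partial>\<eta>)" by simp
      also have "\<dots> = (SUP n. \<integral>\<^sup>+x. h \<eta> x * indicator (U n) x \<partial>\<eta>)"
        using U(3) by (intro nn_integral_monotone_convergence_SUP)
           (auto simp: incseq_def le_fun_def indicator_def)
      finally show ?thesis .
    qed
    ultimately show ?thesis by simp
  qed
  moreover have "(\<lambda>\<eta>. SUP n. (1 + emeasure \<eta> (U n)) * (\<integral>\<^sup>+x. h \<eta> x \<partial>\<kappa> n \<eta>)) \<in> borel_measurable discrete_radon_space"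
    using nn_integral_measurable_subprob_algebra2[OF h \<kappa>] by measurable
  ultimately show ?thesis by (subst measurable_cong) auto
qed

lemma mass_measurable:
  fixes A :: "'a::polish_space set"
  assumes lc: "locally_compact_space (euclidean :: 'a topology)" and [measurable]: "A \<in> sets borel"
  shows "(\<lambda>\<eta>. emeasure \<eta> A) \<in> borel_measurable discrete_radon_space"
proof -
  have "(\<lambda>\<eta>. \<integral>\<^sup>+x. indicator A x \<partial>\<eta>) \<in> borel_measurable discrete_radon_space"
    by (intro kernel_integral_measurable[OF lc]) measurable
  then show ?thesis
    by (rule measurable_cong[THEN iffD1, rotated]) (auto simp: space_discrete_radon_spaceD)
qed

text \<open>This expresses the mass of a moving point through the masses of countably many fixed sets, and is what
makes \<open>(\<eta>, x) \<mapsto> \<eta> {x}\<close> jointly measurable.\<close>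
lemma atom_mass_eq_INF:
  fixes x :: "'a::polish_space"
  assumes B: "topological_basis \<B>" "\<And>U. U \<in> \<B> \<Longrightarrow> compact (closure U)" and \<eta>: "\<eta> \<in> radon_measures"
  shows "emeasure \<eta> {x} = (INF U\<in>\<B>. if x \<in> U then emeasure \<eta> U else \<infinity>)"
proof (rule antisym)
  have sets: "sets \<eta> = sets borel" using \<eta> by (simp add: radon_measures_def)
  have op: "U \<in> \<B> \<Longrightarrow> open U" for U using topological_basis_open[OF B(1)] by blast
  show "emeasure \<eta> {x} \<le> (INF U\<in>\<B>. if x \<in> U then emeasure \<eta> U else \<infinity>)"
    using op sets by (intro INF_greatest) (auto intro!: emeasure_mono)
  obtain U0 where U0: "U0 \<in> \<B>" "x \<in> U0" using topological_basisE[OF B(1) open_UNIV] by blast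
  define A where "A n = ball x (1 / real (Suc n)) \<inter> U0" for n
  have A: "open (A n)" "x \<in> A n" for n using op U0 by (auto simp: A_def)
  have fin: "emeasure \<eta> (A n) \<noteq> \<infinity>" for n
  proof -
    have "emeasure \<eta> (A n) \<le> emeasure \<eta> U0"
      using op[OF U0(1)] sets by (intro emeasure_mono) (auto simp: A_def)
    also have "\<dots> < \<infinity>" by (rule relatively_compact_mass_finite[OF \<eta> B(2)[OF U0(1)]])
    finally show ?thesis by simp
  qed
  have "decseq A"
    unfolding decseq_def A_def by (intro allI impI Int_mono subset_ball frac_le) auto
  moreover have "(\<Inter>n. A n) = {x}"
  proof -
    have "y = x" if "\<forall>n. dist x y < 1 / real (Suc n)" for y
    proof (rule ccontr)
      assume "y \<noteq> x"
      then obtain n where "1 / real (Suc n) < dist x y"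
        using nat_approx_posE[of "dist x y"] by auto
      with that show False by (meson less_asym)
    qed
    then show ?thesis using U0 by (auto simp: A_def)
  qed
  ultimately have infA: "(INF n. emeasure \<eta> (A n)) = emeasure \<eta> {x}"
    using INF_emeasure_decseq[of A \<eta>] A(1) fin sets by (simp add: image_subset_iff)
  have "(INF U\<in>\<B>. if x \<in> U then emeasure \<eta> U else \<infinity>) \<le> emeasure \<eta> (A n)" for n
  proof -
    obtain U where U: "U \<in> \<B>" "x \<in> U" "U \<subseteq> A n" using topological_basisE[OF B(1) A] by blast
    have "(INF U\<in>\<B>. if x \<in> U then emeasure \<eta> U else \<infinity>) \<le> emeasure \<eta> U"
      using U by (intro INF_lower2[of U]) auto
    also have "\<dots> \<le> emeasure \<eta> (A n)" using U A(1) sets by (intro emeasure_mono) auto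
    finally show ?thesis .
  qed
  then show "(INF U\<in>\<B>. if x \<in> U then emeasure \<eta> U else \<infinity>) \<le> emeasure \<eta> {x}"
    unfolding infA[symmetric] by (rule INF_greatest)
qed

lemma atom_mass_measurable:
  assumes lc: "locally_compact_space (euclidean :: 'a::polish_space topology)"
  shows "(\<lambda>(\<eta>, x). emeasure \<eta> {x}) \<in> borel_measurable (discrete_radon_space \<Otimes>\<^sub>M (borel :: 'a::polish_space measure))"
proof -
  obtain \<B> :: "'a set set" where B: "countable \<B>" "topological_basis \<B>" "\<And>U. U \<in> \<B> \<Longrightarrow> compact (closure U)"
    using locally_compact_countable_basis[OF lc] by blast
  have eq: "(\<lambda>(\<eta>, x). emeasure \<eta> {x}) p = (\<lambda>p. INF U\<in>\<B>. if snd p \<in> U then emeasure (fst p) U else \<infinity>) p"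
    if "p \<in> space (discrete_radon_space \<Otimes>\<^sub>M (borel :: 'a::polish_space measure))" for p
    using that atom_mass_eq_INF[OF B(2,3) space_discrete_radon_spaceD(1)] by (auto simp: space_pair_measure)
  show ?thesis
  proof (subst measurable_cong[OF eq])
    show "(\<lambda>p. INF U\<in>\<B>. if snd p \<in> U then emeasure (fst p) U else \<infinity>)
      \<in> borel_measurable (discrete_radon_space \<Otimes>\<^sub>M (borel :: 'a measure))"
    proof (intro borel_measurable_INF[OF B(1)])
      fix U assume U: "U \<in> \<B>"
      then have o: "open U" using topological_basis_open[OF B(2)] by blast
      then have [measurable]: "U \<in> sets borel" by simp
      have [measurable]: "(\<lambda>\<eta>. emeasure \<eta> U) \<in> borel_measurable discrete_radon_space"
        using open_mass_measurable[OF o B(3)[OF U]] .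
      show "(\<lambda>p. if snd p \<in> U then emeasure (fst p) U else \<infinity>) \<in> borel_measurable (discrete_radon_space \<Otimes>\<^sub>M (borel :: 'a measure))"
        by measurable
    qed
  qed auto
qed

lemma countable_in_borel: "countable A \<Longrightarrow> A \<in> sets (borel :: 'a::t1_space measure)"
  by (rule sets.countable) auto

text \<open>A description by a countable carrier is easier to transport than the series representation: it is
evidently preserved by densities and by adding an atom.\<close>
lemma discrete_radon_measures_iff:
  fixes \<eta> :: "'a::t1_space measure"
  shows "\<eta> \<in> discrete_radon_measures \<longleftrightarrow> \<eta> \<in> radon_measures \<and> (\<exists>T. countable T \<and> emeasure \<eta> (- T) = 0)"
    (is "_ \<longleftrightarrow> ?R")
proof
  assume \<eta>: "\<eta> \<in> discrete_radon_measures"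
  then obtain T s where T: "countable T" "\<forall>A\<in>sets borel. emeasure \<eta> A = (\<integral>\<^sup>+x. ennreal (s x) * emeasure (return borel x) A \<partial>count_space T)"
    unfolding discrete_radon_measures_def by blast
  have "T \<in> sets borel" by (rule countable_in_borel[OF T(1)])
  then have "emeasure \<eta> (- T) = (\<integral>\<^sup>+x. ennreal (s x) * emeasure (return borel x) (- T) \<partial>count_space T)"
    using T(2) by simp
  also have "\<dots> = (\<integral>\<^sup>+x. 0 \<partial>count_space T)"
    using \<open>T \<in> sets borel\<close> by (intro nn_integral_cong) auto
  finally show ?R using \<eta> T(1) by (auto simp: discrete_radon_measures_def)
next
  assume ?R
  then obtain T where \<eta>: "\<eta> \<in> radon_measures" and T: "countable T" "emeasure \<eta> (- T) = 0" by blast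
  have sets: "sets \<eta> = sets borel" using \<eta> by (simp add: radon_measures_def)
  have Tm: "A \<in> sets borel" if "A \<subseteq> T" for A :: "'a set" using countable_subset[OF that T(1)] by (rule countable_in_borel)
  define T' where "T' = {x \<in> T. emeasure \<eta> {x} > 0}"
  have fin: "emeasure \<eta> {x} < \<infinity>" for x using \<eta> by (simp add: radon_measures_def)
  have em: "emeasure \<eta> {x} = ennreal (measure \<eta> {x})" for x
    using fin[of x] by (intro emeasure_eq_ennreal_measure) auto
  have "\<forall>x\<in>T'. measure \<eta> {x} > 0"
    using fin by (auto simp: T'_def measure_def enn2real_positive_iff)
  moreover have "emeasure \<eta> A = (\<integral>\<^sup>+x. ennreal (measure \<eta> {x}) * emeasure (return borel x) A \<partial>count_space T')"
    if A: "A \<in> sets borel" for A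
  proof -
    have "emeasure \<eta> A = emeasure \<eta> (A \<inter> T)"
    proof (rule emeasure_eq_AE)
      have "- T \<in> null_sets \<eta>" using T Tm[of T] sets by (intro null_setsI) auto
      then have "AE x in \<eta>. x \<notin> - T" by (rule AE_not_in)
      then show "AE x in \<eta>. (x \<in> A) = (x \<in> A \<inter> T)" by eventually_elim auto
    qed (use A Tm[of T] sets in auto)
    also have "\<dots> = (\<integral>\<^sup>+x. emeasure \<eta> {x} \<partial>count_space (A \<inter> T))"
      using T(1) sets by (intro emeasure_countable_singleton) auto
    also have "\<dots> = (\<integral>\<^sup>+x. emeasure \<eta> {x} * indicator (A \<inter> T) x \<partial>count_space UNIV)"
      by (simp add: nn_integral_count_space_indicator)
    also have "\<dots> = (\<integral>\<^sup>+x. ennreal (measure \<eta> {x}) * emeasure (return borel x) A * indicator T' x \<partial>count_space UNIV)"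
      using A em by (intro nn_integral_cong)
        (auto simp: indicator_def T'_def em[symmetric] zero_less_iff_neq_zero)
    finally show ?thesis by (simp add: nn_integral_count_space_indicator)
  qed
  moreover have "countable T'" using T(1) by (auto simp: T'_def intro: countable_subset)
  ultimately show "\<eta> \<in> discrete_radon_measures"
    unfolding discrete_radon_measures_def using \<eta> by (intro CollectI conjI exI[of _ T'] exI[of _ "\<lambda>x. measure \<eta> {x}"]) auto
qed

lemma countable_atoms_discrete:
  fixes \<eta> :: "'a::t1_space measure"
  assumes "\<eta> \<in> discrete_radon_measures"
  shows "countable (atoms \<eta>)" "AE x in \<eta>. emeasure \<eta> {x} > 0" "AE x in \<eta>. x \<in> atoms \<eta>"
proof -
  obtain T where \<eta>: "\<eta> \<in> radon_measures" and T: "countable T" "emeasure \<eta> (- T) = 0"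
    using assms discrete_radon_measures_iff by blast
  have sets: "sets \<eta> = sets borel" using \<eta> by (simp add: radon_measures_def)
  have Tm: "A \<in> sets borel" if "A \<subseteq> T" for A :: "'a set" using countable_subset[OF that T(1)] by (rule countable_in_borel)
  have "x \<in> T" if "x \<in> atoms \<eta>" for x
  proof (rule ccontr)
    assume "x \<notin> T"
    then have "emeasure \<eta> {x} \<le> emeasure \<eta> (- T)" using Tm[of T] sets by (intro emeasure_mono) auto
    then show False using T that by (auto simp: atoms_def)
  qed
  then show "countable (atoms \<eta>)" using T(1) by (meson countable_subset subsetI)
  have n1: "- T \<in> null_sets \<eta>" using T Tm[of T] sets by (intro null_setsI) auto
  have n2: "(\<Union>x\<in>{x\<in>T. emeasure \<eta> {x} = 0}. {x}) \<in> null_sets \<eta>"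
    using T(1) sets by (intro null_sets_UN') (auto intro: countable_subset)
  show "AE x in \<eta>. emeasure \<eta> {x} > 0"
    using AE_not_in[OF n1] AE_not_in[OF n2] by eventually_elim (auto simp: zero_less_iff_neq_zero)
  then show "AE x in \<eta>. x \<in> atoms \<eta>" by (simp add: atoms_def)
qed

lemma multiplier_bounded:
  fixes \<theta> :: "'a::topological_space \<Rightarrow> real"
  assumes "\<theta> \<in> multiplier_group"
  obtains C where "C > 0" "\<And>x. 0 < \<theta> x \<and> \<theta> x \<le> C"
proof -
  obtain K where K: "compact K" "\<And>x. x \<notin> K \<Longrightarrow> \<theta> x = 1" and pos: "\<And>x. \<theta> x > 0" and c: "continuous_on UNIV \<theta>"
    using assms by (auto simp: multiplier_group_def)
  have "bounded (\<theta> ` K)"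
    using K(1) c by (intro compact_imp_bounded compact_continuous_image) (auto intro: continuous_on_subset)
  then obtain B where B: "\<And>x. x \<in> K \<Longrightarrow> \<bar>\<theta> x\<bar> \<le> B" by (force simp: bounded_iff)
  have "0 < \<theta> x \<and> \<theta> x \<le> max B 1" for x using B[of x] K(2)[of x] pos[of x] by (cases "x \<in> K") auto
  then show ?thesis by (intro that[of "max B 1"]) auto
qed

lemma multiplier_inverse:
  "\<theta> \<in> multiplier_group \<Longrightarrow> (\<lambda>x. inverse (\<theta> x)) \<in> multiplier_group"
  unfolding multiplier_group_def
  by (auto intro!: continuous_intros simp: less_imp_neq[symmetric])

lemma multiplier_measurable [measurable_dest]:
  "\<theta> \<in> multiplier_group \<Longrightarrow> \<theta> \<in> borel_measurable borel"
  unfolding multiplier_group_def by (auto intro: borel_measurable_continuous_onI)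

lemma multiply_discrete:
  fixes \<eta> :: "'a::t2_space measure"
  assumes \<theta>: "\<theta> \<in> multiplier_group" and \<eta>: "\<eta> \<in> discrete_radon_measures"
  shows "multiply \<theta> \<eta> \<in> discrete_radon_measures"
proof -
  obtain T where r: "\<eta> \<in> radon_measures" and T: "countable T" "emeasure \<eta> (- T) = 0"
    using \<eta> discrete_radon_measures_iff by blast
  have sets[measurable_cong]: "sets \<eta> = sets borel" using r by (simp add: radon_measures_def)
  note [measurable] = multiplier_measurable[OF \<theta>]
  obtain C where C: "C > 0" "\<And>x. 0 < \<theta> x \<and> \<theta> x \<le> C" using multiplier_bounded[OF \<theta>] by blast
  have le: "emeasure (multiply \<theta> \<eta>) A \<le> ennreal C * emeasure \<eta> A" if [measurable]: "A \<in> sets borel" for A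
  proof -
    have Am: "A \<in> sets \<eta>" using sets by simp
    have "emeasure (multiply \<theta> \<eta>) A = (\<integral>\<^sup>+x. ennreal (\<theta> x) * indicator A x \<partial>\<eta>)"
      using Am by (subst emeasure_density) auto
    also have "\<dots> \<le> (\<integral>\<^sup>+x. ennreal C * indicator A x \<partial>\<eta>)"
      using C by (intro nn_integral_mono mult_right_mono ennreal_leI) auto
    also have "\<dots> = ennreal C * emeasure \<eta> A" using Am by (simp add: nn_integral_cmult)
    finally show ?thesis .
  qed
  have "multiply \<theta> \<eta> \<in> radon_measures"
  proof -
    have "emeasure (multiply \<theta> \<eta>) K < \<infinity>" if "compact K" for K
    proof -
      have "emeasure (multiply \<theta> \<eta>) K \<le> ennreal C * emeasure \<eta> K"
        using that by (intro le borel_closed compact_imp_closed)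
      also have "\<dots> < \<infinity>" using that r by (simp add: radon_measures_def ennreal_mult_less_top)
      finally show ?thesis .
    qed
    then show ?thesis using sets by (simp add: radon_measures_def)
  qed
  moreover have "emeasure (multiply \<theta> \<eta>) (- T) = 0"
    using le[of "- T"] T countable_in_borel[OF T(1)] by simp
  ultimately show ?thesis using T(1) discrete_radon_measures_iff by blast
qed

text \<open>The measure \<open>\<eta> + s \<delta>\<^sub>x\<close>; a negative \<open>s\<close> counts as \<open>0\<close>.\<close>
definition add_atom :: "'a::topological_space measure \<Rightarrow> 'a \<Rightarrow> real \<Rightarrow> 'a measure" where
  "add_atom \<eta> x s = measure_of UNIV (sets borel) (\<lambda>A. emeasure \<eta> A + ennreal s * indicator A x)"

lemma sets_add_atom [simp]: "sets (add_atom \<eta> x s) = sets borel"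
  unfolding add_atom_def by (subst sets_measure_of) (auto simp: sigma_algebra.sigma_sets_eq[OF sets.sigma_algebra_axioms[of borel, simplified]])

lemma space_add_atom [simp]: "space (add_atom \<eta> x s) = UNIV"
  by (simp add: add_atom_def space_measure_of_conv)

lemma emeasure_add_atom:
  assumes sets: "sets \<eta> = sets borel" and A: "A \<in> sets borel"
  shows "emeasure (add_atom \<eta> x s) A = emeasure \<eta> A + ennreal s * indicator A x"
  using add_atom_def[of \<eta> x s]
proof (rule emeasure_measure_of)
  show "countably_additive (sets (add_atom \<eta> x s)) (\<lambda>A. emeasure \<eta> A + ennreal s * indicator A x)"
  proof (rule countably_additiveI)
    fix B :: "nat \<Rightarrow> 'a set" assume B: "range B \<subseteq> sets (add_atom \<eta> x s)" "disjoint_family B"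
    have "(\<Sum>i. indicator (B i) x) = (indicator (\<Union>i. B i) x :: ennreal)"
      using B(2) by (rule suminf_indicator)
    then show "(\<Sum>i. emeasure \<eta> (B i) + ennreal s * indicator (B i) x) = emeasure \<eta> (\<Union>i. B i) + ennreal s * indicator (\<Union>i. B i) x"
      using B sets by (simp add: suminf_add[symmetric] suminf_emeasure)
  qed
  show "sets borel \<subseteq> Pow (UNIV::'a set)" by simp
  show "A \<in> sets (add_atom \<eta> x s)" using A by simp
qed (simp add: positive_def)

lemma nn_integral_add_atom:
  assumes sets[measurable_cong]: "sets \<eta> = sets borel" and h: "h \<in> borel_measurable borel"
  shows "(\<integral>\<^sup>+y. h y \<partial>add_atom \<eta> x s) = (\<integral>\<^sup>+y. h y \<partial>\<eta>) + ennreal s * h x"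
  using h
proof (induction rule: borel_measurable_induct)
  case (cong f g)
  then show ?case by simp
next
  case (set A)
  then show ?case using emeasure_add_atom[OF sets, of A x s] sets by simp
next
  case (mult u c)
  then have "u \<in> borel_measurable (add_atom \<eta> x s)" by (simp add: measurable_cong_sets[OF sets_add_atom refl])
  with mult show ?case by (simp add: nn_integral_cmult distrib_left mult.left_commute)
next
  case (add u v)
  then have "u \<in> borel_measurable (add_atom \<eta> x s)" "v \<in> borel_measurable (add_atom \<eta> x s)"
    by (simp_all add: measurable_cong_sets[OF sets_add_atom refl])
  with add show ?case by (simp add: nn_integral_add distrib_left add_ac)
next
  case (seq U)
  have "U i \<in> borel_measurable (add_atom \<eta> x s)" for i
    using seq by (simp add: measurable_cong_sets[OF sets_add_atom refl])
  then have "(\<integral>\<^sup>+y. (SUP i. U i) y \<partial>add_atom \<eta> x s) = (SUP i. \<integral>\<^sup>+y. U i y \<partial>add_atom \<eta> x s)"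
    using seq by (simp add: image_comp nn_integral_monotone_convergence_SUP)
  also have "\<dots> = (SUP i. (\<integral>\<^sup>+y. U i y \<partial>\<eta>) + ennreal s * U i x)"
    using seq by simp
  also have "\<dots> = (SUP i. \<integral>\<^sup>+y. U i y \<partial>\<eta>) + (SUP i. ennreal s * U i x)"
    using seq(3) by (intro ennreal_SUP_add) (auto simp: incseq_def le_fun_def intro!: nn_integral_mono mult_left_mono)
  also have "\<dots> = (\<integral>\<^sup>+y. (SUP i. U i) y \<partial>\<eta>) + ennreal s * (SUP i. U i) x"
    using seq by (simp add: image_comp nn_integral_monotone_convergence_SUP SUP_mult_left_ennreal)
  finally show ?case .
qed

lemma add_atom_discrete:
  fixes \<eta> :: "'a::t2_space measure"
  assumes "\<eta> \<in> discrete_radon_measures"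
  shows "add_atom \<eta> x s \<in> discrete_radon_measures"
proof -
  obtain T where r: "\<eta> \<in> radon_measures" and T: "countable T" "emeasure \<eta> (- T) = 0"
    using assms discrete_radon_measures_iff by blast
  have sets: "sets \<eta> = sets borel" using r by (simp add: radon_measures_def)
  have "add_atom \<eta> x s \<in> radon_measures"
    unfolding radon_measures_def using r
    by (auto simp: emeasure_add_atom[OF sets] compact_imp_closed radon_measures_def ennreal_mult_less_top indicator_def)
  moreover have "emeasure (add_atom \<eta> x s) (- insert x T) = 0"
  proof -
    have "emeasure \<eta> (- insert x T) \<le> emeasure \<eta> (- T)"
      using countable_in_borel[OF T(1)] sets by (intro emeasure_mono) auto
    then show ?thesis using T countable_in_borel[of "insert x T"] by (subst emeasure_add_atom[OF sets]) auto
  qed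
  ultimately show ?thesis using T(1) discrete_radon_measures_iff by blast
qed

lemma test_integral_add_atom:
  assumes \<eta>: "\<eta> \<in> radon_measures" and f: "f \<in> nonneg_test_functions"
  shows "(LINT y|add_atom \<eta> x s. f y) = (LINT y|\<eta>. f y) + max 0 s * f x"
proof -
  have s: "max 0 s \<ge> 0" by simp
  have sets[measurable_cong]: "sets \<eta> = sets borel" using \<eta> by (simp add: radon_measures_def)
  have f0: "f y \<ge> 0" for y using f by (simp add: nonneg_test_functions_def)
  have [measurable]: "f \<in> borel_measurable borel"
    using f by (auto simp: nonneg_test_functions_def test_functions_def intro: borel_measurable_continuous_onI)
  have int: "integrable \<eta> f" using \<eta> f by (intro radon_test_integrable) (auto simp: nonneg_test_functions_def)
  have "(\<integral>\<^sup>+y. ennreal (f y) \<partial>add_atom \<eta> x s) = (\<integral>\<^sup>+y. ennreal (f y) \<partial>\<eta>) + ennreal s * ennreal (f x)"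
    by (rule nn_integral_add_atom[OF sets]) measurable
  also have "ennreal s = ennreal (max 0 s)" by (simp add: max_def ennreal_neg)
  also have "(\<integral>\<^sup>+y. ennreal (f y) \<partial>\<eta>) + ennreal (max 0 s) * ennreal (f x) = ennreal ((LINT y|\<eta>. f y) + max 0 s * f x)"
    using f0 s by (simp add: nn_integral_eq_integral[OF int] ennreal_mult ennreal_plus)
  finally have eq: "(\<integral>\<^sup>+y. ennreal (f y) \<partial>add_atom \<eta> x s) = ennreal ((LINT y|\<eta>. f y) + max 0 s * f x)" .
  have "f \<in> borel_measurable (add_atom \<eta> x s)" by (simp add: measurable_cong_sets[OF sets_add_atom refl])
  have "(LINT y|add_atom \<eta> x s. f y) = enn2real (\<integral>\<^sup>+y. ennreal (f y) \<partial>add_atom \<eta> x s)"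
    using f0 \<open>f \<in> borel_measurable (add_atom \<eta> x s)\<close> by (intro integral_eq_nn_integral) auto
  also have "\<dots> = (LINT y|\<eta>. f y) + max 0 s * f x"
    unfolding eq using f0 s by (intro enn2real_ennreal add_nonneg_nonneg Bochner_Integration.integral_nonneg mult_nonneg_nonneg)
  finally show ?thesis .
qed

lemma add_atom_measurable:
  assumes lc: "locally_compact_space (euclidean :: 'a::polish_space topology)"
  shows "(\<lambda>((x, s), \<eta>). add_atom \<eta> x s) \<in>
    measurable ((borel \<Otimes>\<^sub>M borel) \<Otimes>\<^sub>M discrete_radon_space) (discrete_radon_space :: 'a::polish_space measure measure)"
proof (rule measurable_into_discrete_radon_space[OF lc])
  show "(\<lambda>((x, s), \<eta>). add_atom \<eta> x s) p \<in> discrete_radon_measures"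
    if "p \<in> space ((borel \<Otimes>\<^sub>M borel) \<Otimes>\<^sub>M (discrete_radon_space :: 'a measure measure))" for p
    using that add_atom_discrete by (auto simp: space_pair_measure space_discrete_radon_space)
  fix f :: "'a \<Rightarrow> real" assume f: "f \<in> nonneg_test_functions"
  have [measurable]: "f \<in> borel_measurable borel"
    using f by (auto simp: nonneg_test_functions_def test_functions_def intro: borel_measurable_continuous_onI)
  have [measurable]: "(\<lambda>\<eta>. LINT x|\<eta>. f x) \<in> borel_measurable discrete_radon_space"
    using f by (intro test_integral_measurable) (simp add: nonneg_test_functions_def)
  have "(\<lambda>((x, s), \<eta>). (LINT y|\<eta>. f y) + max 0 s * f x)
      \<in> borel_measurable ((borel \<Otimes>\<^sub>M borel) \<Otimes>\<^sub>M discrete_radon_space)"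
    unfolding split_beta' by measurable
  then show "(\<lambda>p. LINT y|(\<lambda>((x, s), \<eta>). add_atom \<eta> x s) p. f y)
      \<in> borel_measurable ((borel \<Otimes>\<^sub>M borel) \<Otimes>\<^sub>M discrete_radon_space)"
    by (rule measurable_cong[THEN iffD1, rotated])
       (auto simp: space_pair_measure test_integral_add_atom[OF space_discrete_radon_spaceD(1) f])
qed

lemma multiply_measurable:
  fixes \<theta> :: "'a::polish_space \<Rightarrow> real"
  assumes lc: "locally_compact_space (euclidean :: 'a topology)" and \<theta>: "\<theta> \<in> multiplier_group"
  shows "multiply \<theta> \<in> measurable discrete_radon_space discrete_radon_space"
proof (rule measurable_into_discrete_radon_space[OF lc])
  show "multiply \<theta> \<eta> \<in> discrete_radon_measures" if "\<eta> \<in> space discrete_radon_space" for \<eta>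
    using multiply_discrete[OF \<theta>] that by (simp add: space_discrete_radon_space)
  fix f :: "'a \<Rightarrow> real" assume f: "f \<in> nonneg_test_functions"
  have "(\<lambda>x. \<theta> x * f x) \<in> test_functions"
    using f \<theta> by (intro test_functions_mult) (auto simp: nonneg_test_functions_def multiplier_group_def)
  then have "(\<lambda>\<eta>. LINT x|\<eta>. \<theta> x * f x) \<in> borel_measurable discrete_radon_space"
    by (rule test_integral_measurable)
  moreover have "(LINT x|multiply \<theta> \<eta>. f x) = (LINT x|\<eta>. \<theta> x * f x)" if "\<eta> \<in> space discrete_radon_space" for \<eta>
  proof -
    have [measurable_cong]: "sets \<eta> = sets borel" using space_discrete_radon_spaceD[OF that] by simp
    note [measurable] = multiplier_measurable[OF \<theta>]
    have [measurable]: "f \<in> borel_measurable borel"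
      using f by (auto simp: nonneg_test_functions_def test_functions_def intro: borel_measurable_continuous_onI)
    show ?thesis using \<theta> by (subst integral_density) (auto simp: multiplier_group_def intro: less_imp_le)
  qed
  ultimately show "(\<lambda>\<eta>. LINT x|multiply \<theta> \<eta>. f x) \<in> borel_measurable discrete_radon_space"
    by (subst measurable_cong) auto
qed

section \<open>From Fourier to Laplace transforms\<close>

abbreviation std_exponential :: "real measure" where
  "std_exponential \<equiv> density lborel (exponential_density 1)"

lemma std_exponential_real_distribution: "real_distribution std_exponential"
  using prob_space_exponential_density[of 1] by (simp add: real_distribution_def real_distribution_axioms_def)

lemma std_exponential_singleton: "measure std_exponential {x} = 0"
proof -
  have "emeasure std_exponential {x} = (\<integral>\<^sup>+y. ennreal (exponential_density 1 y) * indicator {x} y \<partial>lborel)"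
    by (intro emeasure_density) auto
  also have "\<dots> = 0" by (intro nn_integral_0_iff_AE[THEN iffD2]) (auto intro: AE_mp[OF AE_lborel_singleton[of x]])
  finally show ?thesis by (simp add: measure_def)
qed

lemma std_exponential_interval:
  assumes "0 \<le> z"
  shows "measure std_exponential {z<..z + 1} = exp (- z) * (1 - exp (- 1))"
proof -
  interpret real_distribution std_exponential by (rule std_exponential_real_distribution)
  have D: "distributed std_exponential lborel (\<lambda>x. x) (exponential_density 1)"
    unfolding distributed_def by (auto simp: distr_id2 sets_density)
  have "cdf std_exponential a = 1 - exp (- a)" if "0 \<le> a" for a
    using exponential_distributedD_le[OF D that] by (simp add: cdf_def atMost_def)
  then have "measure std_exponential {z<..z + 1} = (1 - exp (- (z + 1))) - (1 - exp (- z))"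
    using cdf_diff_eq[of z "z + 1"] assms by simp
  also have "\<dots> = exp (- z) * (1 - exp (- 1))"
    by (simp add: right_diff_distrib mult_exp_exp)
  finally show ?thesis .
qed

lemma char_std_exponential: "char std_exponential t = 1 / (1 - \<i> * t)"
proof -
  define a where "a = \<i> * complex_of_real t - 1"
  have a0: "a \<noteq> 0" by (auto simp: a_def complex_eq_iff)
  have nrm: "norm (exp (a * of_real x)) = exp (- x)" for x by (simp add: a_def norm_exp_eq_Re)
  have "char std_exponential t = (LINT x|lborel. exponential_density 1 x *\<^sub>R iexp (t * x))"
    unfolding char_def by (intro integral_density) (auto simp: exponential_density_nonneg)
  also have "\<dots> = (LINT x|lborel. indicator (einterval 0 \<infinity>) x *\<^sub>R exp (a * of_real x))"
  proof (intro integral_cong_AE)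
    show "AE x in lborel. exponential_density 1 x *\<^sub>R iexp (t * x) = indicator (einterval 0 \<infinity>) x *\<^sub>R exp (a * of_real x)"
      using AE_lborel_singleton[of 0]
    proof eventually_elim
      case (elim x)
      have "exp (- complex_of_real x) * iexp (t * x) = exp (a * of_real x)"
        by (simp add: a_def mult_exp_exp algebra_simps)
      moreover have "complex_of_real (exp (- x)) = exp (- complex_of_real x)" by (simp add: exp_of_real[symmetric])
      ultimately show ?case
        using elim by (auto simp: exponential_density_def indicator_def einterval_def zero_ereal_def scaleR_conv_of_real)
    qed
  qed auto
  also have "\<dots> = (LBINT x=0..\<infinity>. exp (a * of_real x))"
    by (simp add: interval_lebesgue_integral_def set_lebesgue_integral_def)
  also have "\<dots> = 0 - 1 / a"
  proof (rule interval_integral_FTC_integrable[where F="\<lambda>x. exp (a * of_real x) / a"])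
    show "((\<lambda>x. exp (a * of_real x) / a) has_vector_derivative exp (a * of_real x)) (at x)" for x
      using a0 by (auto intro!: derivative_eq_intros has_vector_derivative_real_field)
    show "isCont (\<lambda>x. exp (a * complex_of_real x)) x" for x by (intro continuous_intros)
    have "set_integrable lborel {0<..} (\<lambda>x::real. exp (- x))"
    proof -
      have "integrable lborel (exponential_density 1)"
        using prob_space.emeasure_space_1[OF prob_space_exponential_density[of 1]]
        by (intro integrableI_nonneg) (auto simp: emeasure_density exponential_density_nonneg)
      then have "integrable lborel (\<lambda>x. indicator {0<..} x *\<^sub>R exponential_density 1 x)"
        by (rule integrable_mult_indicator[rotated]) simp
      then show ?thesis unfolding set_integrable_def
        by (rule back_subst[of "integrable lborel"]) (auto simp: exponential_density_def indicator_def)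
    qed
    then show "set_integrable lborel (einterval 0 \<infinity>) (\<lambda>x. exp (a * complex_of_real x))"
      unfolding set_integrable_def
      by (rule Bochner_Integration.integrable_bound)
         (auto simp: nrm[simplified] norm_exp_eq_Re a_def indicator_def einterval_def zero_ereal_def)
    have "((\<lambda>x. exp (a * complex_of_real x) / a) \<longlongrightarrow> exp (a * complex_of_real 0) / a) (at_right 0)"
      using a0 by (intro tendsto_intros) auto
    then show "(((\<lambda>x. exp (a * complex_of_real x) / a) \<circ> real_of_ereal) \<longlongrightarrow> 1 / a) (at_right 0)"
      unfolding zero_ereal_def by (simp add: ereal_tendsto_simps1)
    have "((\<lambda>x. exp (a * complex_of_real x)) \<longlongrightarrow> 0) at_top"
    proof (rule tendsto_norm_zero_cancel)
      show "((\<lambda>x. norm (exp (a * complex_of_real x))) \<longlongrightarrow> 0) at_top"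
        unfolding nrm by (auto intro!: filterlim_compose[OF exp_at_bot] filterlim_uminus_at_bot_at_top)
    qed
    then have "((\<lambda>x. exp (a * complex_of_real x) / a) \<longlongrightarrow> 0 / a) at_top" using a0 by (intro tendsto_divide tendsto_const)
    then show "(((\<lambda>x. exp (a * complex_of_real x) / a) \<circ> real_of_ereal) \<longlongrightarrow> 0) (at_left \<infinity>)"
      by (simp add: ereal_tendsto_simps1)
  qed simp
  also have "\<dots> = 1 / (1 - \<i> * t)" using a0 by (simp add: a_def field_simps)
  finally show ?thesis .
qed

text \<open>This is \<open>(exp (- i t a) - exp (- i t b)) / (i t)\<close> with \<open>a = 0\<close> and \<open>b = 1\<close>, times the characteristic function
of the standard exponential law: the integrand of the Levy inversion formula for the mass of \<open>{0<..1}\<close>.\<close>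
definition exp_kernel :: "real \<Rightarrow> complex" where
  "exp_kernel t = (1 - iexp (- t)) / (\<i> * t) * (1 / (1 - \<i> * t))"

lemma exp_kernel_measurable [measurable]: "exp_kernel \<in> borel_measurable borel"
  unfolding exp_kernel_def by measurable

lemma exp_kernel_bound: "norm (exp_kernel t) \<le> 4 * inverse (1 + t\<^sup>2)"
proof (cases "t = 0")
  case False
  have n1: "norm (1 - \<i> * complex_of_real t) = sqrt (1 + t\<^sup>2)" by (simp add: cmod_def)
  have n2: "norm (1 - iexp (- t)) \<le> \<bar>t\<bar>"
    using iexp_approx1[of "-t" 0] by (simp add: norm_minus_commute)
  have n3: "norm (1 - iexp (- t)) \<le> 2" using norm_triangle_ineq4[of 1 "iexp (- t)"] by simp
  have s1: "1 \<le> sqrt (1 + t\<^sup>2)" and s2: "\<bar>t\<bar> \<le> sqrt (1 + t\<^sup>2)" by (auto intro: real_le_rsqrt)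
  have "norm (exp_kernel t) = norm (1 - iexp (- t)) / (\<bar>t\<bar> * sqrt (1 + t\<^sup>2))"
    by (simp add: exp_kernel_def norm_mult norm_divide n1)
  also have "\<dots> \<le> 4 * inverse (1 + t\<^sup>2)"
  proof (cases "\<bar>t\<bar> \<le> 1")
    case True
    have "norm (1 - iexp (- t)) / (\<bar>t\<bar> * sqrt (1 + t\<^sup>2)) \<le> \<bar>t\<bar> / (\<bar>t\<bar> * 1)"
      using n2 s1 False by (intro frac_le mult_left_mono) auto
    also have "\<dots> \<le> 4 * inverse (1 + t\<^sup>2)"
    proof -
      have "t\<^sup>2 \<le> 1" using True abs_square_le_1[of t] by simp
      then show ?thesis using False by (simp add: pos_le_divide_eq add_pos_nonneg inverse_eq_divide)
    qed
    finally show ?thesis .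
  next
    case False
    then have t: "1 \<le> t\<^sup>2" using abs_square_le_1[of t] by linarith
    have "norm (1 - iexp (- t)) / (\<bar>t\<bar> * sqrt (1 + t\<^sup>2)) \<le> 2 / (\<bar>t\<bar> * \<bar>t\<bar>)"
      using n3 s2 False by (intro frac_le mult_left_mono mult_pos_pos) auto
    also have "\<dots> = 2 / t\<^sup>2" by (simp add: power2_eq_square abs_mult_self_eq)
    also have "\<dots> \<le> 4 * inverse (1 + t\<^sup>2)"
      using t by (simp add: inverse_eq_divide divide_le_eq pos_le_divide_eq add_pos_nonneg)
    finally show ?thesis .
  qed
  finally show ?thesis .
qed (simp add: exp_kernel_def)

lemma exp_kernel_integrable: "integrable lborel exp_kernel"
proof (rule Bochner_Integration.integrable_bound)
  have "integrable lborel (\<lambda>x::real. inverse (1 + x\<^sup>2))"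
    using integrable_inverse_1_plus_square by (simp add: set_integrable_def einterval_def)
  then show "integrable lborel (\<lambda>x::real. 4 * inverse (1 + x\<^sup>2))" by simp
  show "AE t in lborel. norm (exp_kernel t) \<le> norm (4 * inverse (1 + t\<^sup>2))"
    using exp_kernel_bound by (auto intro: order_trans)
qed simp

text \<open>The factor \<open>iexp (- (t * z))\<close> shifts the interval of the inversion formula to \<open>{z<..z + 1}\<close>, whose mass under
the exponential law is proportional to \<open>exp (- z)\<close>. Hence integration against the kernel maps the
character \<open>t \<mapsto> iexp (- (t * z))\<close> to \<open>exp (- z)\<close> for all \<open>z \<ge> 0\<close> at once.\<close>
lemma exp_kernel_transform:
  assumes z: "0 \<le> z"
  shows "(LINT t|lborel. exp_kernel t * iexp (- (t * z))) = of_real (2 * pi * (1 - exp (- 1)) * exp (- z))"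
proof -
  interpret real_distribution std_exponential by (rule std_exponential_real_distribution)
  have F: "(iexp (-(t * z)) - iexp (-(t * (z + 1)))) / (\<i> * t) * char std_exponential t = exp_kernel t * iexp (- (t * z))" for t
  proof -
    have "iexp (-(t * (z + 1))) = iexp (-(t * z)) * iexp (- t)" by (simp add: mult_exp_exp algebra_simps)
    then show ?thesis unfolding char_std_exponential exp_kernel_def by (simp add: field_simps)
  qed
  have int: "integrable lborel (\<lambda>t. exp_kernel t * iexp (- (t * z)))"
    using exp_kernel_integrable by (rule Bochner_Integration.integrable_bound) (auto simp: norm_mult)
  have "(\<lambda>T::nat. LINT t|lborel. indicator {-real T<..<real T} t *\<^sub>R (exp_kernel t * iexp (- (t * z))))
     \<longlonglongrightarrow> (LINT t|lborel. exp_kernel t * iexp (- (t * z)))"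
  proof (rule integral_dominated_convergence[where w="\<lambda>t. norm (exp_kernel t * iexp (- (t * z)))"])
    show "AE t in lborel. (\<lambda>T. indicator {-real T<..<real T} t *\<^sub>R (exp_kernel t * iexp (- (t * z)))) \<longlonglongrightarrow> exp_kernel t * iexp (- (t * z))"
    proof (intro AE_I2)
      fix t :: real
      obtain T0 :: nat where T0: "\<bar>t\<bar> < real T0" using reals_Archimedean2 by blast
      have "eventually (\<lambda>T. indicator {-real T<..<real T} t *\<^sub>R (exp_kernel t * iexp (- (t * z))) = exp_kernel t * iexp (- (t * z))) sequentially"
        using eventually_ge_at_top[of T0]
      proof eventually_elim
        case (elim T)
        then have "real T0 \<le> real T" by simp
        then have "t \<in> {-real T<..<real T}" using T0 by auto
        then show ?case by simp
      qed
      then show "(\<lambda>T. indicator {-real T<..<real T} t *\<^sub>R (exp_kernel t * iexp (- (t * z)))) \<longlonglongrightarrow> exp_kernel t * iexp (- (t * z))"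
        by (rule tendsto_eventually)
    qed
  qed (use int in \<open>auto simp: indicator_def\<close>)
  moreover have "(CLBINT t=-real T..real T. exp_kernel t * iexp (- (t * z))) = (LINT t|lborel. indicator {-real T<..<real T} t *\<^sub>R (exp_kernel t * iexp (- (t * z))))" for T :: nat
    by (simp add: interval_lebesgue_integral_def set_lebesgue_integral_def einterval_def greaterThanLessThan_def
        greaterThan_def lessThan_def Int_def)
  ultimately have L1: "(\<lambda>T::nat. 1 / (2 * pi) * (CLBINT t=-real T..real T. exp_kernel t * iexp (- (t * z))))
     \<longlonglongrightarrow> 1 / (2 * pi) * (LINT t|lborel. exp_kernel t * iexp (- (t * z)))"
    by (intro tendsto_intros) simp
  have L2: "(\<lambda>T::nat. 1 / (2 * pi) * (CLBINT t=-real T..real T. exp_kernel t * iexp (- (t * z))))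
     \<longlonglongrightarrow> of_real (exp (- z) * (1 - exp (- 1)))"
    using Levy_Inversion[of z "z + 1", OF _ std_exponential_singleton std_exponential_singleton]
    unfolding F std_exponential_interval[OF z] by simp
  have "1 / (2 * pi) * (LINT t|lborel. exp_kernel t * iexp (- (t * z))) = complex_of_real (exp (- z) * (1 - exp (- 1)))"
    by (rule LIMSEQ_unique[OF L1 L2])
  then show ?thesis by (simp add: field_simps)
qed

abbreviation (input) "kernel_const \<equiv> 2 * pi * (1 - exp (- 1 :: real))"

lemma norm_iexp_diff_1: "norm (iexp x - 1) \<le> min 2 \<bar>x\<bar>"
  using iexp_approx1[of x 0] norm_triangle_ineq4[of "iexp x" 1] by simp

text \<open>Powers of a characteristic function are mixtures of characters, so the kernel maps them to the
corresponding powers of the Laplace transform. The character with parameter \<open>w\<close> carries the induction.\<close>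
lemma exp_kernel_power:
  assumes "finite_measure M" and [measurable]: "y \<in> borel_measurable M" and y0: "\<And>x. 0 \<le> y x" and "0 \<le> w"
  shows "(LINT t|lborel. exp_kernel t * (LINT x|M. iexp (- (t * y x))) ^ n * iexp (- (t * w)))
       = of_real (kernel_const * exp (- w) * (LINT x|M. exp (- y x)) ^ n)"
  using \<open>0 \<le> w\<close>
proof (induction n arbitrary: w)
  case 0
  then show ?case using exp_kernel_transform by simp
next
  case (Suc n)
  interpret M: finite_measure M by fact
  interpret pair_sigma_finite lborel M ..
  define C where "C = measure M (space M)"
  define F where "F t = (LINT x|M. iexp (- (t * y x)))" for t
  have [measurable]: "F \<in> borel_measurable borel" unfolding F_def by measurable
  have Fb: "norm (F t) \<le> C" for t
  proof -
    have "norm (F t) \<le> (LINT x|M. norm (iexp (- (t * y x))))" unfolding F_def by (rule integral_norm_bound)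
    then show ?thesis by (simp add: C_def)
  qed
  have C0: "C \<ge> 0" by (simp add: C_def)
  define G where "G t x = exp_kernel t * F t ^ n * iexp (- (t * (w + y x)))" for t x
  have Gm[measurable]: "case_prod G \<in> borel_measurable (lborel \<Otimes>\<^sub>M M)" unfolding G_def by measurable
  have Gb: "norm (G t x) \<le> norm (exp_kernel t) * C ^ n" for t x
    using Fb[of t] by (auto simp: G_def norm_mult norm_power intro!: mult_left_mono power_mono)
  have int: "integrable (lborel \<Otimes>\<^sub>M M) (case_prod G)"
  proof (rule Fubini_integrable[OF Gm])
    have i1: "integrable M (G t)" for t
      by (rule M.integrable_const_bound[where B="norm (exp_kernel t) * C ^ n"]) (use Gb in \<open>auto simp: G_def\<close>)
    then show "AE t in lborel. integrable M (\<lambda>x. case (t, x) of (x, xa) \<Rightarrow> G x xa)" by simp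
    show "integrable lborel (\<lambda>t. LINT x|M. norm (case (t, x) of (x, xa) \<Rightarrow> G x xa))"
    proof (rule Bochner_Integration.integrable_bound)
      show "integrable lborel (\<lambda>t. norm (exp_kernel t) * C ^ n * C)"
        using exp_kernel_integrable by auto
      have "(LINT x|M. norm (G t x)) \<le> (LINT x|M. norm (exp_kernel t) * C ^ n)" for t
        using i1 Gb by (intro integral_mono) auto
      then show "AE t in lborel. norm (LINT x|M. norm (case (t, x) of (x, xa) \<Rightarrow> G x xa)) \<le> norm (norm (exp_kernel t) * C ^ n * C)"
        using C0 by (auto simp: C_def mult_ac)
    qed measurable
  qed
  have "(LINT t|lborel. exp_kernel t * F t ^ Suc n * iexp (- (t * w))) = (LINT t|lborel. LINT x|M. G t x)"
  proof (intro Bochner_Integration.integral_cong refl)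
    fix t
    have "G t x = (exp_kernel t * F t ^ n * iexp (- (t * w))) * iexp (- (t * y x))" for x
      by (simp add: G_def mult_exp_exp algebra_simps)
    then have "(LINT x|M. G t x) = (exp_kernel t * F t ^ n * iexp (- (t * w))) * F t"
      by (simp add: F_def)
    then show "exp_kernel t * F t ^ Suc n * iexp (- (t * w)) = (LINT x|M. G t x)" by (simp add: mult_ac)
  qed
  also have "\<dots> = (LINT x|M. LINT t|lborel. G t x)"
    using Fubini_integral[OF int] by simp
  also have "\<dots> = (LINT x|M. of_real (kernel_const * exp (- w) * (LINT x|M. exp (- y x)) ^ n * exp (- y x)))"
    using Suc.IH[of "w + y x" for x] y0 Suc.prems
    by (intro Bochner_Integration.integral_cong refl)
       (simp add: G_def F_def exp_diff exp_minus field_simps)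
  also have "\<dots> = of_real (kernel_const * exp (- w) * (LINT x|M. exp (- y x)) ^ Suc n)"
    by (simp only: integral_complex_of_real) simp
  finally show ?case by (simp add: F_def)
qed

text \<open>Expand the exponential into its power series and apply \<open>exp_kernel_power\<close> term by term.\<close>
lemma exp_kernel_compound_Poisson:
  assumes M: "finite_measure M" and [measurable]: "y \<in> borel_measurable M" and y0: "\<And>x. 0 \<le> y x"
  shows "(LINT t|lborel. exp_kernel t * exp (LINT x|M. iexp (- (t * y x)) - 1))
       = of_real (kernel_const * exp (LINT x|M. exp (- y x) - 1))"
proof -
  interpret M: finite_measure M by fact
  define C where "C = measure M (space M)"
  define F where "F t = (LINT x|M. iexp (- (t * y x)))" for t
  define a where "a = (LINT x|M. exp (- y x))"
  have [measurable]: "F \<in> borel_measurable borel" unfolding F_def by measurable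
  have Fb: "norm (F t) \<le> C" for t
  proof -
    have "norm (F t) \<le> (LINT x|M. norm (iexp (- (t * y x))))" unfolding F_def by (rule integral_norm_bound)
    then show ?thesis by (simp add: C_def)
  qed
  have i1: "integrable M (\<lambda>x. iexp (- (t * y x)))" for t
    by (rule M.integrable_const_bound[where B=1]) auto
  have i2: "integrable M (\<lambda>x. exp (- y x))"
    by (rule M.integrable_const_bound[where B=1]) (use y0 in auto)
  have e1: "(LINT x|M. iexp (- (t * y x)) - 1) = F t - of_real C" for t
    using i1[of t] by (simp add: F_def C_def scaleR_conv_of_real)
  have e2: "(LINT x|M. exp (- y x) - 1) = a - C" using i2 by (simp add: a_def C_def)
  define S where "S n t = exp_kernel t * (\<Sum>k<n. F t ^ k /\<^sub>R fact k)" for n t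
  have pw: "integrable lborel (\<lambda>t. exp_kernel t * F t ^ k)" for k
  proof (rule Bochner_Integration.integrable_bound)
    show "integrable lborel (\<lambda>t. norm (exp_kernel t) * C ^ k)" using exp_kernel_integrable by auto
    show "AE t in lborel. norm (exp_kernel t * F t ^ k) \<le> norm (norm (exp_kernel t) * C ^ k)"
      using Fb by (auto simp: norm_mult norm_power intro!: AE_I2 mult_left_mono power_mono order_trans[OF _ abs_ge_self])
  qed simp
  have L1: "(\<lambda>n. LINT t|lborel. S n t) \<longlonglongrightarrow> (LINT t|lborel. exp_kernel t * exp (F t))"
  proof (rule integral_dominated_convergence[where w="\<lambda>t. norm (exp_kernel t) * exp C"])
    show "AE t in lborel. (\<lambda>n. S n t) \<longlonglongrightarrow> exp_kernel t * exp (F t)"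
      unfolding S_def using exp_converges[of "F t" for t] by (auto simp: sums_def intro!: tendsto_mult)
    show "AE t in lborel. norm (S n t) \<le> norm (exp_kernel t) * exp C" for n
    proof (intro AE_I2)
      fix t
      have "norm (\<Sum>k<n. F t ^ k /\<^sub>R fact k) \<le> (\<Sum>k<n. C ^ k /\<^sub>R fact k)"
        using Fb by (intro sum_norm_le) (auto simp: norm_power divide_inverse intro!: mult_left_mono power_mono)
      also have "\<dots> \<le> exp C"
        unfolding exp_def using C_def by (intro sum_le_suminf summable_exp_generic) auto
      finally show "norm (S n t) \<le> norm (exp_kernel t) * exp C" by (simp add: S_def norm_mult mult_left_mono)
    qed
  qed (use exp_kernel_integrable in \<open>auto simp: S_def\<close>)
  have L2: "(LINT t|lborel. S n t) = of_real (kernel_const * (\<Sum>k<n. a ^ k /\<^sub>R fact k))" for n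
  proof -
    have "(LINT t|lborel. S n t) = (LINT t|lborel. (\<Sum>k<n. (exp_kernel t * F t ^ k) /\<^sub>R fact k))"
      by (simp add: S_def sum_distrib_left)
    also have "\<dots> = (\<Sum>k<n. (LINT t|lborel. exp_kernel t * F t ^ k) /\<^sub>R fact k)"
      using pw by simp
    also have "\<dots> = (\<Sum>k<n. of_real (kernel_const * a ^ k) /\<^sub>R fact k)"
      using exp_kernel_power[OF M, of y 0] y0 by (simp add: F_def a_def)
    finally show ?thesis by (simp add: sum_distrib_left scaleR_conv_of_real mult_ac)
  qed
  have L3: "(\<lambda>n. complex_of_real (kernel_const * (\<Sum>k<n. a ^ k /\<^sub>R fact k))) \<longlonglongrightarrow> of_real (kernel_const * exp a)"
    using exp_converges[of a] unfolding sums_def by (intro tendsto_of_real tendsto_mult tendsto_const)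
  have key: "(LINT t|lborel. exp_kernel t * exp (F t)) = of_real (kernel_const * exp a)"
    by (rule LIMSEQ_unique[OF L1[unfolded L2] L3])
  have "(LINT t|lborel. exp_kernel t * exp (LINT x|M. iexp (- (t * y x)) - 1)) = (LINT t|lborel. exp (- of_real C) * (exp_kernel t * exp (F t)))"
    unfolding e1 by (simp add: exp_diff exp_minus field_simps)
  also have "\<dots> = exp (- of_real C) * of_real (kernel_const * exp a)"
    by (simp only: integral_mult_right_zero key)
  also have "\<dots> = of_real (kernel_const * exp (a - C))"
    by (simp add: exp_diff exp_minus exp_of_real[symmetric] field_simps)
  finally show ?thesis by (simp only: e2)
qed

text \<open>Restricting \<open>m\<close> to the marks above \<open>1 / (n + 1)\<close> gives finite measures. The characteristic functions
involved are bounded by \<open>1\<close>, so dominated convergence in \<open>t\<close> applies.\<close>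
lemma exp_kernel_infinitely_divisible:
  assumes y[measurable]: "y \<in> borel_measurable m" and y0: "\<And>x. 0 \<le> y x" and int: "integrable m (\<lambda>x. min 1 (y x))"
  shows "(LINT t|lborel. exp_kernel t * exp (LINT x|m. iexp (- (t * y x)) - 1))
       = of_real (kernel_const * exp (LINT x|m. exp (- y x) - 1))"
proof -
  define D where "D n = {x \<in> space m. 1 / real (Suc n) < y x}" for n
  have [measurable]: "D n \<in> sets m" for n unfolding D_def by measurable
  define M where "M n = density m (indicator (D n))" for n
  have fin: "finite_measure (M n)" for n
  proof (rule finite_measureI)
    have "(\<integral>\<^sup>+x. indicator (D n) x \<partial>m) \<le> (\<integral>\<^sup>+x. ennreal (real (Suc n)) * ennreal (min 1 (y x)) \<partial>m)"
    proof (intro nn_integral_mono)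
      fix x
      have "1 \<le> real (Suc n) * min 1 (y x)" if "x \<in> D n"
        using that by (auto simp: D_def min_def field_simps)
      then show "indicator (D n) x \<le> ennreal (real (Suc n)) * ennreal (min 1 (y x))"
        using y0 by (auto simp: indicator_def ennreal_mult[symmetric] simp del: of_nat_Suc)
    qed
    also have "\<dots> < \<infinity>"
      using int y0 by (simp add: nn_integral_cmult nn_integral_eq_integral ennreal_mult_less_top)
    finally show "emeasure (M n) (space (M n)) \<noteq> \<infinity>"
      by (simp add: M_def emeasure_density cong: nn_integral_cong)
  qed
  have ym[measurable]: "y \<in> borel_measurable (M n)" for n by (simp add: M_def)
  have restr: "(LINT x|M n. h x) = (LINT x|m. indicator (D n) x *\<^sub>R h x)" if [measurable]: "h \<in> borel_measurable m"
    for n and h :: "_ \<Rightarrow> 'b::{banach, second_countable_topology}"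
  proof -
    have "M n = density m (\<lambda>x. ennreal (indicator (D n) x))" by (simp add: M_def ennreal_indicator)
    then show ?thesis by (simp add: integral_density)
  qed
  have cont: "(\<lambda>n. LINT x|M n. h x) \<longlonglongrightarrow> (LINT x|m. h x)"
    if [measurable]: "h \<in> borel_measurable m" and hb: "\<And>x. norm (h x) \<le> c * min 1 (y x)"
    for c and h :: "_ \<Rightarrow> 'b::{banach, second_countable_topology}"
    unfolding restr[OF that(1)]
  proof (rule integral_dominated_convergence[where w="\<lambda>x. c * min 1 (y x)"])
    show "AE x in m. (\<lambda>n. indicator (D n) x *\<^sub>R h x) \<longlonglongrightarrow> h x"
    proof (intro AE_I2)
      fix x assume x: "x \<in> space m"
      show "(\<lambda>n. indicator (D n) x *\<^sub>R h x) \<longlonglongrightarrow> h x"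
      proof (cases "y x = 0")
        case True
        then have "h x = 0" using hb[of x] by simp
        then show ?thesis by simp
      next
        case False
        then obtain n0 where n0: "1 / real (Suc n0) < y x" using y0[of x] nat_approx_posE[of "y x"] by (auto simp: less_le)
        have "eventually (\<lambda>n. indicator (D n) x *\<^sub>R h x = h x) sequentially"
          using eventually_ge_at_top[of n0]
        proof eventually_elim
          case (elim n)
          have "1 / real (Suc n) \<le> 1 / real (Suc n0)" using elim by (intro frac_le) auto
          then show ?case using n0 x by (simp add: D_def)
        qed
        then show ?thesis by (rule tendsto_eventually)
      qed
    qed
    show "AE x in m. norm (indicator (D n) x *\<^sub>R h x) \<le> c * min 1 (y x)" for n
      using hb order_trans[OF norm_ge_zero hb] by (auto simp: indicator_def)
  qed (use int in auto)
  have b1: "norm (iexp (- (t * y x)) - 1) \<le> max 2 \<bar>t\<bar> * min 1 (y x)" for t x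
  proof -
    have "norm (iexp (- (t * y x)) - 1) \<le> min 2 (\<bar>t\<bar> * y x)"
      using norm_iexp_diff_1[of "- (t * y x)"] y0[of x] by (simp add: abs_mult)
    also have "\<dots> \<le> max 2 \<bar>t\<bar> * min 1 (y x)"
      using y0[of x] mult_right_mono[of "\<bar>t\<bar>" "max 2 \<bar>t\<bar>" "y x"] by (auto simp: min_def)
    finally show ?thesis .
  qed
  have b2: "norm (exp (- y x) - 1) \<le> 1 * min 1 (y x)" for x
    using y0[of x] exp_ge_add_one_self[of "- y x"] by (auto simp: min_def)
  have re: "Re (LINT x|M n. iexp (- (t * y x)) - 1) \<le> 0" for n t
  proof -
    interpret finite_measure "M n" by (rule fin)
    have "norm (iexp (- (t * y x)) - 1) \<le> 2" for x
      using norm_iexp_diff_1[of "- (t * y x)"] by simp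
    then have "integrable (M n) (\<lambda>x. iexp (- (t * y x)) - 1)"
      by (intro integrable_const_bound[where B=2] AE_I2) auto
    then have "Re (LINT x|M n. iexp (- (t * y x)) - 1) = (LINT x|M n. Re (iexp (- (t * y x)) - 1))"
      by (rule integral_Re[symmetric])
    also have "\<dots> = - (LINT x|M n. 1 - Re (iexp (- (t * y x))))"
      by (simp add: Bochner_Integration.integral_minus[symmetric] del: Bochner_Integration.integral_minus)
    also have "\<dots> \<le> 0" by (simp add: Re_exp)
    finally show ?thesis .
  qed
  have L1: "(\<lambda>n. LINT t|lborel. exp_kernel t * exp (LINT x|M n. iexp (- (t * y x)) - 1))
     \<longlonglongrightarrow> (LINT t|lborel. exp_kernel t * exp (LINT x|m. iexp (- (t * y x)) - 1))"
  proof (rule integral_dominated_convergence[where w="\<lambda>t. norm (exp_kernel t)"])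
    show "AE t in lborel. (\<lambda>n. exp_kernel t * exp (LINT x|M n. iexp (- (t * y x)) - 1))
      \<longlonglongrightarrow> exp_kernel t * exp (LINT x|m. iexp (- (t * y x)) - 1)"
      by (intro AE_I2 tendsto_intros cont[OF _ b1]) measurable
    show "AE t in lborel. norm (exp_kernel t * exp (LINT x|M n. iexp (- (t * y x)) - 1)) \<le> norm (exp_kernel t)" for n
      using re[of n] by (auto simp: norm_mult norm_exp_eq_Re intro!: mult_left_le)
    have meas: "(\<lambda>t. LINT x|M n. iexp (- (t * y x)) - 1) \<in> borel_measurable borel" for n
    proof -
      interpret finite_measure "M n" by (rule fin)
      show ?thesis by measurable
    qed
    show "(\<lambda>t. exp_kernel t * exp (LINT x|M n. iexp (- (t * y x)) - 1)) \<in> borel_measurable lborel" for n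
      using meas by measurable
    have "(\<lambda>t. LINT x|m. iexp (- (t * y x)) - 1) \<in> borel_measurable borel"
      by (rule borel_measurable_LIMSEQ_metric[OF meas]) (rule cont[OF _ b1], measurable)
    then show "(\<lambda>t. exp_kernel t * exp (LINT x|m. iexp (- (t * y x)) - 1)) \<in> borel_measurable lborel"
      by measurable
  qed (use exp_kernel_integrable in auto)
  have L2: "(\<lambda>n. complex_of_real (kernel_const * exp (LINT x|M n. exp (- y x) - 1)))
     \<longlonglongrightarrow> of_real (kernel_const * exp (LINT x|m. exp (- y x) - 1))"
    by (intro tendsto_of_real tendsto_mult tendsto_const tendsto_exp cont[OF _ b2]) measurable
  show ?thesis
    by (rule LIMSEQ_unique[OF L1[unfolded exp_kernel_compound_Poisson[OF fin ym y0]] L2])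
qed

lemma Laplace_from_Fourier:
  assumes y[measurable]: "y \<in> borel_measurable m" and y0: "\<And>x. 0 \<le> y x" and int: "integrable m (\<lambda>x. min 1 (y x))"
    and \<mu>: "prob_space \<mu>" and Z[measurable]: "Z \<in> borel_measurable \<mu>" and Z0: "\<And>\<omega>. 0 \<le> Z \<omega>"
    and Fourier: "\<And>t. (LINT \<omega>|\<mu>. iexp (- (t * Z \<omega>))) = exp (LINT x|m. iexp (- (t * y x)) - 1)"
  shows "(LINT \<omega>|\<mu>. exp (- Z \<omega>)) = exp (LINT x|m. exp (- y x) - 1)"
proof -
  interpret prob_space \<mu> by fact
  have "of_real (kernel_const * (LINT \<omega>|\<mu>. exp (- Z \<omega>))) = (LINT t|lborel. exp_kernel t * (LINT \<omega>|\<mu>. iexp (- (t * Z \<omega>))))"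
    using exp_kernel_power[OF finite_measure_axioms Z Z0, of 0 1] by simp
  also have "\<dots> = of_real (kernel_const * exp (LINT x|m. exp (- y x) - 1))"
    unfolding Fourier by (rule exp_kernel_infinitely_divisible[OF y y0 int])
  finally show ?thesis by (simp only: of_real_eq_iff mult_cancel_left) simp
qed

section \<open>The Mecke formula\<close>

text \<open>The difference quotient at \<open>0\<close> of \<open>t \<mapsto> 1 - exp (- t r)\<close> along \<open>t = 1 / 2 ^ n\<close>, for a convergent family of \<open>r\<close>.
It serves to differentiate Laplace functionals.\<close>
lemma dyadic_exp_quotient_tendsto:
  fixes r :: "nat \<Rightarrow> real"
  assumes r: "r \<longlonglongrightarrow> r'" and r0: "\<And>n. 0 \<le> r n"
  shows "(\<lambda>n. 2 ^ n * (1 - exp (- (r n / 2 ^ n)))) \<longlonglongrightarrow> r'"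
proof (rule tendsto_sandwich[OF _ _ _ r])
  have "(\<lambda>n. r n * (1 / 2) ^ n) \<longlonglongrightarrow> r' * 0"
    by (intro tendsto_mult r LIMSEQ_power_zero) auto
  then have "(\<lambda>n. r n / (1 + r n * (1 / 2) ^ n)) \<longlonglongrightarrow> r' / (1 + r' * 0)"
    by (intro tendsto_divide tendsto_add r tendsto_const) auto
  then show "(\<lambda>n. r n / (1 + r n / 2 ^ n)) \<longlonglongrightarrow> r'" by (simp add: power_divide)
  have "r n / (1 + r n / 2 ^ n) \<le> 2 ^ n * (1 - exp (- (r n / 2 ^ n)))" for n
  proof -
    define v where "v = r n / 2 ^ n"
    have v: "v \<ge> 0" using r0 by (simp add: v_def)
    have "exp (- v) \<le> 1 / (1 + v)"
      using exp_ge_add_one_self[of v] v by (simp add: exp_minus inverse_eq_divide frac_le)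
    then have "v / (1 + v) \<le> 1 - exp (- v)" using v by (simp add: field_simps)
    then have "2 ^ n * (v / (1 + v)) \<le> 2 ^ n * (1 - exp (- v))" by (intro mult_left_mono) auto
    then show ?thesis by (simp add: v_def)
  qed
  then show "\<forall>\<^sub>F n in sequentially. r n / (1 + r n / 2 ^ n) \<le> 2 ^ n * (1 - exp (- (r n / 2 ^ n)))" by simp
  have "2 ^ n * (1 - exp (- (r n / 2 ^ n))) \<le> r n" for n
  proof -
    have "1 - exp (- (r n / 2 ^ n)) \<le> r n / 2 ^ n" using exp_ge_add_one_self[of "- (r n / 2 ^ n)"] by linarith
    then have "2 ^ n * (1 - exp (- (r n / 2 ^ n))) \<le> 2 ^ n * (r n / 2 ^ n)" by (intro mult_left_mono) auto
    then show ?thesis by simp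
  qed
  then show "\<forall>\<^sub>F n in sequentially. 2 ^ n * (1 - exp (- (r n / 2 ^ n))) \<le> r n" by simp
qed

lemma dyadic_exp_quotient_le:
  fixes z :: real shows "2 ^ n * (1 - exp (- (z / 2 ^ n))) \<le> z"
proof -
  have "1 - exp (- (z / 2 ^ n)) \<le> z / 2 ^ n" using exp_ge_add_one_self[of "- (z / 2 ^ n)"] by linarith
  then have "2 ^ n * (1 - exp (- (z / 2 ^ n))) \<le> 2 ^ n * (z / 2 ^ n)" by (intro mult_left_mono) auto
  then show ?thesis by simp
qed

lemma mult_exp_minus_le_1: "z * exp (- z) \<le> (1::real)"
proof -
  have "z \<le> exp z" using exp_ge_add_one_self[of z] by linarith
  then show ?thesis by (simp add: exp_minus field_simps)
qed

text \<open>The Levy measure lives on \<open>X \<times> \<real>\<close> and charges only positive marks, so that functions of a point and a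
mark are measurable with respect to an ordinary product of Borel \<open>\<sigma>\<close>-algebras. As countable sets of points are not
charged, an atom placed according to \<open>m\<close> avoids the atoms already present.\<close>
locale completely_random_measure =
  fixes m :: "('a::polish_space \<times> real) measure" and \<mu> :: "'a measure measure"
  assumes lc: "locally_compact_space (euclidean :: 'a topology)"
    and sets_m [measurable_cong]: "sets m = sets (borel \<Otimes>\<^sub>M borel)"
    and sigma_finite_m: "sigma_finite_measure m"
    and positive_marks: "AE z in m. 0 < snd z"
    and diffuse: "\<And>T. countable T \<Longrightarrow> emeasure m (T \<times> UNIV) = 0"
    and small_marks: "\<And>K. compact K \<Longrightarrow> integrable m (\<lambda>z. indicator K (fst z) * min 1 \<bar>snd z\<bar>)"
    and prob: "prob_space \<mu>"
    and sets_\<mu> [measurable_cong]: "sets \<mu> = sets discrete_radon_space"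
    and Fourier: "\<And>f. f \<in> test_functions \<Longrightarrow>
      (LINT \<eta>|\<mu>. iexp (LINT x|\<eta>. f x)) = exp (LINT z|m. iexp (snd z * f (fst z)) - 1)"
begin

sublocale m: sigma_finite_measure m by (rule sigma_finite_m)
sublocale \<mu>: prob_space \<mu> by (rule prob)
sublocale pair_sigma_finite m \<mu> ..

lemma space_m: "space m = UNIV"
  using sets_eq_imp_space_eq[OF sets_m] by (simp add: space_pair_measure)

lemma space_\<mu>: "space \<mu> = space discrete_radon_space"
  using sets_eq_imp_space_eq[OF sets_\<mu>] .

lemma test_measurable:
  fixes f :: "'a \<Rightarrow> real"
  assumes "f \<in> nonneg_test_functions"
  shows "f \<in> borel_measurable borel" "(\<lambda>\<eta>. LINT x|\<eta>. f x) \<in> borel_measurable discrete_radon_space"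
    "(\<lambda>\<eta>. LINT x|\<eta>. f x) \<in> borel_measurable \<mu>"
  using assms test_integral_measurable[of f]
  by (auto simp: nonneg_test_functions_def test_functions_def measurable_cong_sets[OF sets_\<mu> refl] intro: borel_measurable_continuous_onI)

lemma test_integral_nonneg: "f \<in> nonneg_test_functions \<Longrightarrow> 0 \<le> (LINT x|\<eta>. f x)" for f :: "'a \<Rightarrow> real"
  by (auto simp: nonneg_test_functions_def)

lemma integrable_test_dominated:
  fixes h :: "'a \<times> real \<Rightarrow> 'b::{banach, second_countable_topology}"
  assumes f: "f \<in> nonneg_test_functions" and h[measurable]: "h \<in> borel_measurable m"
    and le: "\<And>x s. 0 < s \<Longrightarrow> norm (h (x, s)) \<le> c * min 1 (s * f x)"
  shows "integrable m h"
proof -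
  define K where "K = closure {x. f x \<noteq> 0}"
  have K: "compact K" unfolding K_def
    using f by (auto simp: nonneg_test_functions_def intro: test_functions_support)
  obtain C where C: "C > 0" "\<And>x. \<bar>f x\<bar> \<le> C"
    using f test_functions_bounded[of f] by (auto simp: nonneg_test_functions_def)
  have f0: "0 \<le> f x" for x using f by (simp add: nonneg_test_functions_def)
  show ?thesis
  proof (rule Bochner_Integration.integrable_bound)
    show "integrable m (\<lambda>z. \<bar>c\<bar> * max 1 C * (indicator K (fst z) * min 1 \<bar>snd z\<bar>))"
      using small_marks[OF K] by auto
    show "AE z in m. norm (h z) \<le> norm (\<bar>c\<bar> * max 1 C * (indicator K (fst z) * min 1 \<bar>snd z\<bar>))"
      using positive_marks
    proof eventually_elim
      case (elim z)
      obtain x s where z: "z = (x, s)" by (cases z)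
      have s: "s > 0" using elim z by simp
      have "min 1 (s * f x) \<le> max 1 C * (indicator K x * min 1 s)"
      proof (cases "x \<in> K")
        case True
        have sf: "s * f x \<le> max 1 C * s" using C(2)[of x] f0[of x] s
          by (subst mult.commute) (intro mult_right_mono, auto)
        have "min 1 (s * f x) \<le> max 1 C * min 1 s"
        proof (cases "s \<le> 1")
          case True
          then have "min 1 s = s" by simp
          then show ?thesis using sf by (metis min.cobounded2 order_trans)
        qed simp
        then show ?thesis using True by simp
      next
        case False
        then have "f x = 0" using f test_functions_support(2)[of f x] by (auto simp: K_def nonneg_test_functions_def)
        then show ?thesis using False by simp
      qed
      then have "\<bar>c\<bar> * min 1 (s * f x) \<le> \<bar>c\<bar> * (max 1 C * (indicator K x * min 1 s))" by (intro mult_left_mono) auto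
      moreover have "c * min 1 (s * f x) \<le> \<bar>c\<bar> * min 1 (s * f x)" using s f0[of x] by (intro mult_right_mono) auto
      ultimately have "norm (h z) \<le> \<bar>c\<bar> * (max 1 C * (indicator K x * min 1 s))" using le[OF s, of x] unfolding z by linarith
      then show ?case using s C z by (simp add: abs_mult mult.assoc)
    qed
  qed auto
qed

lemma exponent_integrable:
  fixes f :: "'a \<Rightarrow> real"
  assumes f: "f \<in> nonneg_test_functions"
  shows "integrable m (\<lambda>z. exp (- (snd z * f (fst z))) - 1)"
proof (rule integrable_test_dominated[OF f, where c=1])
  note [measurable] = test_measurable[OF f]
  show "(\<lambda>z. exp (- (snd z * f (fst z))) - 1) \<in> borel_measurable m" by measurable
  fix x and s :: real assume "0 < s"
  then have "0 \<le> s * f x" using f by (simp add: nonneg_test_functions_def)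
  then show "norm (exp (- (snd (x, s) * f (fst (x, s)))) - 1) \<le> 1 * min 1 (s * f x)"
    using exp_ge_add_one_self[of "- (s * f x)"] by (auto simp: min_def)
qed

lemma Laplace_functional:
  fixes f :: "'a \<Rightarrow> real"
  assumes f: "f \<in> nonneg_test_functions"
  shows "(LINT \<eta>|\<mu>. exp (- (LINT x|\<eta>. f x))) = exp (LINT z|m. exp (- (snd z * f (fst z))) - 1)"
proof -
  note [measurable] = test_measurable[OF f]
  define y where "y z = max 0 (snd z * f (fst z))" for z
  have ym[measurable]: "y \<in> borel_measurable m" unfolding y_def by measurable
  have f0: "0 \<le> f x" for x using f by (simp add: nonneg_test_functions_def)
  have yAE: "AE z in m. y z = snd z * f (fst z)"
    using positive_marks by eventually_elim (auto simp: y_def f0 less_imp_le)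
  have "(LINT \<eta>|\<mu>. exp (- (LINT x|\<eta>. f x))) = exp (LINT z|m. exp (- y z) - 1)"
  proof (rule Laplace_from_Fourier[OF ym _ _ prob])
    show "integrable m (\<lambda>z. min 1 (y z))"
      by (rule integrable_test_dominated[OF f, where c=1]) (auto simp: y_def f0 less_imp_le)
    fix t
    have "(\<lambda>x. - t * f x) \<in> test_functions"
      using f by (intro test_functions_cmult) (simp add: nonneg_test_functions_def)
    from Fourier[OF this]
    have "(LINT \<eta>|\<mu>. iexp (- (t * (LINT x|\<eta>. f x)))) = exp (LINT z|m. iexp (snd z * (- t * f (fst z))) - 1)" by simp
    also have "(LINT z|m. iexp (snd z * (- t * f (fst z))) - 1) = (LINT z|m. iexp (- (t * y z)) - 1)"
    proof (rule integral_cong_AE)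
      show "AE z in m. iexp (snd z * (- t * f (fst z))) - 1 = iexp (- (t * y z)) - 1"
        using yAE
      proof eventually_elim
        case (elim z)
        show ?case unfolding elim by (simp add: mult_ac)
      qed
    qed measurable
    finally show "(LINT \<eta>|\<mu>. iexp (- (t * (LINT x|\<eta>. f x)))) = exp (LINT z|m. iexp (- (t * y z)) - 1)" .
  qed (auto simp: y_def test_integral_nonneg[OF f])
  also have "(LINT z|m. exp (- y z) - 1) = (LINT z|m. exp (- (snd z * f (fst z))) - 1)"
    using yAE by (intro integral_cong_AE) auto
  finally show ?thesis .
qed

text \<open>Differentiate \<open>E exp (- \<langle>h + t f, \<eta>\<rangle>)\<close> at \<open>t = 0\<close>. First moments need not exist, but \<open>h\<close> dominates \<open>f\<close>,
and \<open>z exp (- z) \<le> 1\<close> then provides the majorants on both sides.\<close>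
lemma Laplace_derivative:
  fixes f g :: "'a \<Rightarrow> real"
  assumes f: "f \<in> nonneg_test_functions" and g: "g \<in> nonneg_test_functions"
  defines "h \<equiv> \<lambda>x. f x + g x"
  shows "(LINT \<eta>|\<mu>. (LINT x|\<eta>. f x) * exp (- (LINT x|\<eta>. h x)))
       = (LINT z|m. snd z * f (fst z) * exp (- (snd z * h (fst z)))) * (LINT \<eta>|\<mu>. exp (- (LINT x|\<eta>. h x)))"
    and "integrable m (\<lambda>z. snd z * f (fst z) * exp (- (snd z * h (fst z))))"
proof -
  have h: "h \<in> nonneg_test_functions" unfolding h_def using f g by (intro nonneg_test_functions_simps(3))
  note [measurable] = test_measurable[OF f] test_measurable[OF g] test_measurable[OF h]
  have f0: "0 \<le> f x" and g0: "0 \<le> g x" for x using f g by (auto simp: nonneg_test_functions_def)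
  define k where "k n x = h x + (1 / 2 ^ n) * f x" for n :: nat and x
  have k: "k n \<in> nonneg_test_functions" for n
    unfolding k_def using f h by (intro nonneg_test_functions_simps(3,4)) auto
  have kh: "exp (- (LINT x|\<eta>. k n x)) = exp (- (LINT x|\<eta>. h x)) * exp (- ((LINT x|\<eta>. f x) / 2 ^ n))"
    "(LINT x|\<eta>. f x) \<le> (LINT x|\<eta>. h x)"
    if "\<eta> \<in> space \<mu>" for \<eta> n
  proof -
    have "\<eta> \<in> radon_measures" using that space_discrete_radon_spaceD(1) by (simp add: space_\<mu>)
    then have i: "integrable \<eta> f" "integrable \<eta> h" "integrable \<eta> g"
      using f h g by (auto intro!: radon_test_integrable simp: nonneg_test_functions_def)
    then show "exp (- (LINT x|\<eta>. k n x)) = exp (- (LINT x|\<eta>. h x)) * exp (- ((LINT x|\<eta>. f x) / 2 ^ n))"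
      by (simp add: k_def exp_add[symmetric])
    show "(LINT x|\<eta>. f x) \<le> (LINT x|\<eta>. h x)" using i g0 by (intro integral_mono) (auto simp: h_def)
  qed
  define u where "u n v = 2 ^ n * (1 - exp (- (v / 2 ^ n)))" for n and v :: real
  have u0: "0 \<le> u n v" if "0 \<le> v" for n v using that by (simp add: u_def)
  have u_le: "u n v \<le> v" for n v unfolding u_def by (rule dyadic_exp_quotient_le)
  have u_lim: "(\<lambda>n. u n v) \<longlonglongrightarrow> v" if "0 \<le> v" for v
    unfolding u_def using that by (intro dyadic_exp_quotient_tendsto) auto
  have [measurable]: "u n \<in> borel_measurable borel" for n unfolding u_def by measurable
  define X where "X n \<eta> = u n (LINT x|\<eta>. f x) * exp (- (LINT x|\<eta>. h x))" for n and \<eta> :: "'a measure"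
  have lim1: "(\<lambda>n. LINT \<eta>|\<mu>. X n \<eta>) \<longlonglongrightarrow> (LINT \<eta>|\<mu>. (LINT x|\<eta>. f x) * exp (- (LINT x|\<eta>. h x)))"
  proof (rule integral_dominated_convergence[where w="\<lambda>_. 1"])
    show "AE \<eta> in \<mu>. (\<lambda>n. X n \<eta>) \<longlonglongrightarrow> (LINT x|\<eta>. f x) * exp (- (LINT x|\<eta>. h x))"
      unfolding X_def using test_integral_nonneg[OF f] by (intro AE_I2 tendsto_mult u_lim tendsto_const)
    show "AE \<eta> in \<mu>. norm (X n \<eta>) \<le> 1" for n
    proof (intro AE_I2)
      fix \<eta> assume \<eta>: "\<eta> \<in> space \<mu>"
      have "\<bar>X n \<eta>\<bar> = X n \<eta>" using u0[OF test_integral_nonneg[OF f]] by (simp add: X_def)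
      also have "\<dots> \<le> (LINT x|\<eta>. f x) * exp (- (LINT x|\<eta>. f x))"
        unfolding X_def using kh(2)[OF \<eta>] u_le u0[OF test_integral_nonneg[OF f]] test_integral_nonneg[OF f] by (intro mult_mono) auto
      also have "\<dots> \<le> 1" by (rule mult_exp_minus_le_1)
      finally show "norm (X n \<eta>) \<le> 1" by simp
    qed
  qed (auto simp: X_def)
  define A where "A q = (LINT z|m. exp (- (snd z * q (fst z))) - 1)" for q :: "'a \<Rightarrow> real"
  define r where "r n = (LINT z|m. u n (snd z * f (fst z)) * exp (- (snd z * h (fst z))))" for n
  have le1: "norm (v * exp (- w)) \<le> 1 * min 1 v" if "0 \<le> v" "v \<le> w" for v w :: real
  proof -
    have "v * exp (- w) \<le> v * exp (- v)" using that by (intro mult_left_mono) auto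
    then have "v * exp (- w) \<le> 1" using mult_exp_minus_le_1[of v] by linarith
    moreover have "v * exp (- w) \<le> v" using that by (intro mult_left_le) auto
    ultimately show ?thesis using that by simp
  qed
  have sf: "0 \<le> s * f x" "s * f x \<le> s * h x" if "s > 0" for x s
    using that f0[of x] g0[of x] by (auto simp: h_def)
  show I: "integrable m (\<lambda>z. snd z * f (fst z) * exp (- (snd z * h (fst z))))"
    by (rule integrable_test_dominated[OF f, where c=1]) (use le1 sf in auto)
  have un: "norm (u n v * exp (- w)) \<le> norm (v * exp (- w))" if "0 \<le> v" for n v w
    using u0[OF that] u_le[of n v] that by (auto simp: abs_mult)
  have I2: "integrable m (\<lambda>z. u n (snd z * f (fst z)) * exp (- (snd z * h (fst z))))" for n
    by (rule integrable_test_dominated[OF f, where c=1])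
       (use le1 sf order_trans[OF un le1] in auto)
  have lim2: "r \<longlonglongrightarrow> (LINT z|m. snd z * f (fst z) * exp (- (snd z * h (fst z))))"
    unfolding r_def
  proof (rule integral_dominated_convergence[where w="\<lambda>z. norm (snd z * f (fst z) * exp (- (snd z * h (fst z))))"])
    show "AE z in m. (\<lambda>n. u n (snd z * f (fst z)) * exp (- (snd z * h (fst z)))) \<longlonglongrightarrow> snd z * f (fst z) * exp (- (snd z * h (fst z)))"
      using positive_marks by eventually_elim (intro tendsto_mult u_lim tendsto_const, use f0 in auto)
    show "AE z in m. norm (u n (snd z * f (fst z)) * exp (- (snd z * h (fst z)))) \<le> norm (snd z * f (fst z) * exp (- (snd z * h (fst z))))" for n
      using positive_marks by eventually_elim (intro un, use f0 in auto)
  qed (use I in auto)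
  have r0: "0 \<le> r n" for n
    unfolding r_def using positive_marks u0 f0 by (intro integral_nonneg_AE) (auto elim!: eventually_mono)
  have Ak: "A (k n) = A h - r n / 2 ^ n" for n
  proof -
    have "A h - A (k n) = (LINT z|m. (exp (- (snd z * h (fst z))) - 1) - (exp (- (snd z * k n (fst z))) - 1))"
      unfolding A_def by (rule Bochner_Integration.integral_diff[symmetric]) (intro exponent_integrable h k)+
    also have "\<dots> = (LINT z|m. (u n (snd z * f (fst z)) * exp (- (snd z * h (fst z)))) / 2 ^ n)"
    proof (intro Bochner_Integration.integral_cong refl)
      fix z
      have dist: "a - a * b = (2 ^ n * (1 - b) * a) / 2 ^ n" for a b :: real
        by (simp add: mult.assoc) (simp add: algebra_simps)
      have "exp (- (snd z * k n (fst z))) = exp (- (snd z * h (fst z))) * exp (- (snd z * f (fst z) / 2 ^ n))"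
        by (simp add: k_def mult_exp_exp algebra_simps)
      then show "(exp (- (snd z * h (fst z))) - 1) - (exp (- (snd z * k n (fst z))) - 1) = (u n (snd z * f (fst z)) * exp (- (snd z * h (fst z)))) / 2 ^ n"
        using dist[of "exp (- (snd z * h (fst z)))" "exp (- (snd z * f (fst z) / 2 ^ n))"]
        by (simp add: u_def)
    qed
    also have "\<dots> = r n / 2 ^ n" by (simp add: r_def)
    finally show ?thesis by simp
  qed
  have X: "(LINT \<eta>|\<mu>. X n \<eta>) = exp (A h) * u n (r n)" for n
  proof -
    have ie: "integrable \<mu> (\<lambda>\<eta>. exp (- (LINT x|\<eta>. q x)))" if "q \<in> nonneg_test_functions" for q :: "'a \<Rightarrow> real"
      using test_integral_nonneg[OF that] test_measurable[OF that] by (intro \<mu>.integrable_const_bound[where B=1]) auto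
    have "(LINT \<eta>|\<mu>. X n \<eta>) = (LINT \<eta>|\<mu>. 2 ^ n * (exp (- (LINT x|\<eta>. h x)) - exp (- (LINT x|\<eta>. k n x))))"
      by (intro Bochner_Integration.integral_cong refl) (simp add: X_def u_def kh(1) algebra_simps)
    also have "\<dots> = 2 ^ n * (exp (A h) - exp (A (k n)))"
      using ie[OF h] ie[OF k, of n] Laplace_functional[OF h] Laplace_functional[OF k, of n] by (simp add: A_def)
    also have "\<dots> = exp (A h) * u n (r n)"
    proof -
      have "exp (A (k n)) = exp (A h) * exp (- (r n / 2 ^ n))" unfolding Ak by (simp add: mult_exp_exp)
      then show ?thesis by (simp add: u_def right_diff_distrib)
    qed
    finally show ?thesis .
  qed
  have "(\<lambda>n. exp (A h) * u n (r n)) \<longlonglongrightarrow> exp (A h) * (LINT z|m. snd z * f (fst z) * exp (- (snd z * h (fst z))))"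
    unfolding u_def by (intro tendsto_mult tendsto_const dyadic_exp_quotient_tendsto lim2 r0)
  from LIMSEQ_unique[OF lim1[unfolded X] this]
  show "(LINT \<eta>|\<mu>. (LINT x|\<eta>. f x) * exp (- (LINT x|\<eta>. h x)))
       = (LINT z|m. snd z * f (fst z) * exp (- (snd z * h (fst z)))) * (LINT \<eta>|\<mu>. exp (- (LINT x|\<eta>. h x)))"
    by (simp add: Laplace_functional[OF h] A_def mult.commute)
qed

lemma add_atom_measurable_m [measurable]:
  "(\<lambda>(z, \<eta>). add_atom \<eta> (fst z) (snd z)) \<in> measurable (m \<Otimes>\<^sub>M \<mu>) discrete_radon_space"
proof -
  have "sets (m \<Otimes>\<^sub>M \<mu>) = sets ((borel \<Otimes>\<^sub>M borel) \<Otimes>\<^sub>M discrete_radon_space)"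
    by (intro sets_pair_measure_cong sets_m sets_\<mu>)
  then have "(\<lambda>((x, s), \<eta>). add_atom \<eta> x s) \<in> measurable (m \<Otimes>\<^sub>M \<mu>) discrete_radon_space"
    using add_atom_measurable[OF lc] measurable_cong_sets[of "m \<Otimes>\<^sub>M \<mu>" _ discrete_radon_space discrete_radon_space] by blast
  then show ?thesis by (simp add: split_beta')
qed

text \<open>After damping by \<open>exp (- \<langle>f, \<eta>\<rangle>)\<close>, both sides are finite measures in \<open>G\<close>. By
\<open>Laplace_derivative\<close> they have the same Laplace functional, hence they coincide; then \<open>G\<close> can absorb the inverse
of the damping factor.\<close>
lemma Mecke_test_function:
  fixes f :: "'a \<Rightarrow> real"
  assumes f: "f \<in> nonneg_test_functions" and G: "G \<in> borel_measurable discrete_radon_space"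
  shows "(\<integral>\<^sup>+\<eta>. ennreal (LINT x|\<eta>. f x) * G \<eta> \<partial>\<mu>)
       = (\<integral>\<^sup>+z. \<integral>\<^sup>+\<eta>. ennreal (snd z * f (fst z)) * G (add_atom \<eta> (fst z) (snd z)) \<partial>\<mu> \<partial>m)"
proof -
  note [measurable] = test_measurable[OF f]
  have f0: "0 \<le> f x" for x using f by (auto simp: nonneg_test_functions_def)
  define I where "I \<eta> = (LINT x|\<eta>. f x)" for \<eta> :: "'a measure"
  have Im[measurable]: "I \<in> borel_measurable \<mu>" "I \<in> borel_measurable discrete_radon_space" unfolding I_def by measurable
  have I0: "0 \<le> I \<eta>" for \<eta> unfolding I_def by (rule test_integral_nonneg[OF f])
  define a where "a z = snd z * f (fst z) * exp (- (snd z * f (fst z)))" for z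
  have am[measurable]: "a \<in> borel_measurable m" unfolding a_def by measurable
  have addm[measurable]: "(\<lambda>p. add_atom (snd p) (fst (fst p)) (snd (fst p))) \<in> measurable (m \<Otimes>\<^sub>M \<mu>) discrete_radon_space"
    using add_atom_measurable_m by (simp add: split_beta')
  define P where "P = density \<mu> (\<lambda>\<eta>. ennreal (I \<eta> * exp (- I \<eta>)))"
  define Q where "Q = distr (density (m \<Otimes>\<^sub>M \<mu>) (\<lambda>p. ennreal (a (fst p)) * ennreal (exp (- I (snd p)))))
     discrete_radon_space (\<lambda>p. add_atom (snd p) (fst (fst p)) (snd (fst p)))"
  have nnP: "(\<integral>\<^sup>+\<eta>. F \<eta> \<partial>P) = (\<integral>\<^sup>+\<eta>. ennreal (I \<eta> * exp (- I \<eta>)) * F \<eta> \<partial>\<mu>)"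
    if [measurable]: "F \<in> borel_measurable discrete_radon_space" for F
    unfolding P_def by (subst nn_integral_density) auto
  have nnQ: "(\<integral>\<^sup>+\<eta>. F \<eta> \<partial>Q) = (\<integral>\<^sup>+z. \<integral>\<^sup>+\<eta>. ennreal (a z) * ennreal (exp (- I \<eta>)) * F (add_atom \<eta> (fst z) (snd z)) \<partial>\<mu> \<partial>m)"
    if [measurable]: "F \<in> borel_measurable discrete_radon_space" for F
  proof -
    have "(\<integral>\<^sup>+\<eta>. F \<eta> \<partial>Q) = (\<integral>\<^sup>+p. (ennreal (a (fst p)) * ennreal (exp (- I (snd p)))) * F (add_atom (snd p) (fst (fst p)) (snd (fst p))) \<partial>(m \<Otimes>\<^sub>M \<mu>))"
      unfolding Q_def by (subst nn_integral_distr) (auto simp: nn_integral_density)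
    also have "\<dots> = (\<integral>\<^sup>+z. \<integral>\<^sup>+\<eta>. (ennreal (a z) * ennreal (exp (- I \<eta>))) * F (add_atom \<eta> (fst z) (snd z)) \<partial>\<mu> \<partial>m)"
      by (subst \<mu>.nn_integral_fst[symmetric]) auto
    finally show ?thesis .
  qed
  have Lap: "(\<integral>\<^sup>+\<eta>. ennreal (exp (- (LINT x|\<eta>. g x))) \<partial>P) = (\<integral>\<^sup>+\<eta>. ennreal (exp (- (LINT x|\<eta>. g x))) \<partial>Q)"
    "(\<integral>\<^sup>+\<eta>. ennreal (exp (- (LINT x|\<eta>. g x))) \<partial>P) < \<infinity>"
    if g: "g \<in> nonneg_test_functions" for g :: "'a \<Rightarrow> real"
  proof -
    note [measurable] = test_measurable[OF g]
    define h where "h x = f x + g x" for x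
    have h: "h \<in> nonneg_test_functions" unfolding h_def using f g by (intro nonneg_test_functions_simps(3))
    note [measurable] = test_measurable[OF h]
    have g0: "0 \<le> g x" for x using g by (auto simp: nonneg_test_functions_def)
    have sum: "(LINT x|\<eta>. h x) = I \<eta> + (LINT x|\<eta>. g x)" if "\<eta> \<in> space \<mu>" for \<eta>
    proof -
      have "\<eta> \<in> radon_measures" using that space_discrete_radon_spaceD(1) by (simp add: space_\<mu>)
      then have i: "integrable \<eta> f" "integrable \<eta> g"
        using f g by (auto intro!: radon_test_integrable simp: nonneg_test_functions_def)
      then show ?thesis by (simp add: I_def h_def)
    qed
    have "(\<integral>\<^sup>+\<eta>. ennreal (exp (- (LINT x|\<eta>. g x))) \<partial>P) = (\<integral>\<^sup>+\<eta>. ennreal (I \<eta> * exp (- (LINT x|\<eta>. h x))) \<partial>\<mu>)"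
      by (subst nnP) (auto intro!: nn_integral_cong simp: sum ennreal_mult[symmetric] I0 exp_add[symmetric] mult.assoc mult_exp_exp)
    also have "\<dots> = ennreal (LINT \<eta>|\<mu>. I \<eta> * exp (- (LINT x|\<eta>. h x)))"
    proof (rule nn_integral_eq_integral)
      show "integrable \<mu> (\<lambda>\<eta>. I \<eta> * exp (- (LINT x|\<eta>. h x)))"
      proof (rule \<mu>.integrable_const_bound[where B=1])
        show "AE \<eta> in \<mu>. norm (I \<eta> * exp (- (LINT x|\<eta>. h x))) \<le> 1"
        proof (rule AE_I2)
          fix \<eta> assume \<eta>: "\<eta> \<in> space \<mu>"
          have "I \<eta> * exp (- (LINT x|\<eta>. h x)) \<le> I \<eta> * exp (- I \<eta>)"
            using sum[OF \<eta>] test_integral_nonneg[OF g, of \<eta>] I0 by (intro mult_left_mono) auto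
          also have "\<dots> \<le> 1" by (rule mult_exp_minus_le_1)
          finally show "norm (I \<eta> * exp (- (LINT x|\<eta>. h x))) \<le> 1" using I0[of \<eta>] by simp
        qed
      qed measurable
    qed (use I0 in auto)
    finally have 1: "(\<integral>\<^sup>+\<eta>. ennreal (exp (- (LINT x|\<eta>. g x))) \<partial>P) = ennreal (LINT \<eta>|\<mu>. I \<eta> * exp (- (LINT x|\<eta>. h x)))" .
    then show "(\<integral>\<^sup>+\<eta>. ennreal (exp (- (LINT x|\<eta>. g x))) \<partial>P) < \<infinity>" by simp
    have "(\<integral>\<^sup>+\<eta>. ennreal (exp (- (LINT x|\<eta>. g x))) \<partial>Q)
       = (\<integral>\<^sup>+z. \<integral>\<^sup>+\<eta>. ennreal (a z) * ennreal (exp (- I \<eta>)) * ennreal (exp (- (LINT x|add_atom \<eta> (fst z) (snd z). g x))) \<partial>\<mu> \<partial>m)"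
      by (rule nnQ) measurable
    also have "\<dots> = (\<integral>\<^sup>+z. \<integral>\<^sup>+\<eta>. ennreal (snd z * f (fst z) * exp (- (snd z * h (fst z)))) * ennreal (exp (- (LINT x|\<eta>. h x))) \<partial>\<mu> \<partial>m)"
    proof (rule nn_integral_cong_AE, use positive_marks in eventually_elim, rule nn_integral_cong)
      fix z :: "'a \<times> real" and \<eta> assume z: "0 < snd z" and \<eta>: "\<eta> \<in> space \<mu>"
      have \<eta>r: "\<eta> \<in> radon_measures" using \<eta> space_discrete_radon_spaceD(1) by (simp add: space_\<mu>)
      show "ennreal (a z) * ennreal (exp (- I \<eta>)) * ennreal (exp (- (LINT x|add_atom \<eta> (fst z) (snd z). g x)))
         = ennreal (snd z * f (fst z) * exp (- (snd z * h (fst z)))) * ennreal (exp (- (LINT x|\<eta>. h x)))"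
        unfolding sum[OF \<eta>] test_integral_add_atom[OF \<eta>r g] a_def
        using z f0[of "fst z"]
        by (simp add: h_def ennreal_mult[symmetric] mult_exp_exp algebra_simps less_imp_le)
    qed
    also have "\<dots> = (\<integral>\<^sup>+z. ennreal (snd z * f (fst z) * exp (- (snd z * h (fst z)))) \<partial>m) * (\<integral>\<^sup>+\<eta>. ennreal (exp (- (LINT x|\<eta>. h x))) \<partial>\<mu>)"
      by (simp add: nn_integral_cmult nn_integral_multc)
    also have "(\<integral>\<^sup>+\<eta>. ennreal (exp (- (LINT x|\<eta>. h x))) \<partial>\<mu>) = ennreal (LINT \<eta>|\<mu>. exp (- (LINT x|\<eta>. h x)))"
      using test_integral_nonneg[OF h] by (intro nn_integral_eq_integral \<mu>.integrable_const_bound[where B=1]) auto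
    also have "(\<integral>\<^sup>+z. ennreal (snd z * f (fst z) * exp (- (snd z * h (fst z)))) \<partial>m) = ennreal (LINT z|m. snd z * f (fst z) * exp (- (snd z * h (fst z))))"
      using Laplace_derivative(2)[OF f g] positive_marks f0
      by (intro nn_integral_eq_integral) (auto simp: h_def elim!: eventually_mono)
    also have "ennreal (LINT z|m. snd z * f (fst z) * exp (- (snd z * h (fst z)))) * ennreal (LINT \<eta>|\<mu>. exp (- (LINT x|\<eta>. h x)))
      = ennreal (LINT \<eta>|\<mu>. I \<eta> * exp (- (LINT x|\<eta>. h x)))"
      using Laplace_derivative(1)[OF f g] by (simp add: ennreal_mult''[symmetric] I_def h_def)
    finally show "(\<integral>\<^sup>+\<eta>. ennreal (exp (- (LINT x|\<eta>. g x))) \<partial>P) = (\<integral>\<^sup>+\<eta>. ennreal (exp (- (LINT x|\<eta>. g x))) \<partial>Q)"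
      using 1 by simp
  qed
  have PQ: "P = Q"
  proof (rule Laplace_functional_determines_measure[OF lc])
    show sP: "sets P = sets discrete_radon_space" by (simp add: P_def sets_\<mu>)
    show sQ: "sets Q = sets discrete_radon_space" by (simp add: Q_def)
    show "finite_measure P" "finite_measure Q"
      using Lap[OF zero_nonneg_test] by (auto intro!: finite_measureI)
    fix g :: "'a \<Rightarrow> real" assume g: "g \<in> nonneg_test_functions"
    have "(\<lambda>\<eta>. exp (- (LINT x|\<eta>. g x))) \<in> borel_measurable P" "(\<lambda>\<eta>. exp (- (LINT x|\<eta>. g x))) \<in> borel_measurable Q"
      using test_measurable(2)[OF g] by (simp_all add: measurable_cong_sets[OF sP refl] measurable_cong_sets[OF sQ refl])
    then show "(LINT \<eta>|P. exp (- (LINT x|\<eta>. g x))) = (LINT \<eta>|Q. exp (- (LINT x|\<eta>. g x)))"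
      using Lap(1)[OF g] by (simp add: integral_eq_nn_integral)
  qed
  define G' where "G' \<eta> = G \<eta> * ennreal (exp (I \<eta>))" for \<eta>
  have [measurable]: "G \<in> borel_measurable discrete_radon_space" by fact
  have G'm: "G' \<in> borel_measurable discrete_radon_space" unfolding G'_def by measurable
  have "(\<integral>\<^sup>+\<eta>. ennreal (I \<eta>) * G \<eta> \<partial>\<mu>) = (\<integral>\<^sup>+\<eta>. G' \<eta> \<partial>P)"
  proof (subst nnP[OF G'm], intro nn_integral_cong)
    fix \<eta>
    have "ennreal (I \<eta> * exp (- I \<eta>)) * G' \<eta> = (ennreal (I \<eta> * exp (- I \<eta>)) * ennreal (exp (I \<eta>))) * G \<eta>"
      by (simp add: G'_def mult_ac)
    also have "ennreal (I \<eta> * exp (- I \<eta>)) * ennreal (exp (I \<eta>)) = ennreal (I \<eta>)"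
      using I0 by (simp add: ennreal_mult[symmetric] mult.assoc mult_exp_exp)
    finally show "ennreal (I \<eta>) * G \<eta> = ennreal (I \<eta> * exp (- I \<eta>)) * G' \<eta>" by simp
  qed
  also have "\<dots> = (\<integral>\<^sup>+\<eta>. G' \<eta> \<partial>Q)" by (simp add: PQ)
  also have "\<dots> = (\<integral>\<^sup>+z. \<integral>\<^sup>+\<eta>. ennreal (a z) * ennreal (exp (- I \<eta>)) * G' (add_atom \<eta> (fst z) (snd z)) \<partial>\<mu> \<partial>m)"
    by (rule nnQ[OF G'm])
  also have "\<dots> = (\<integral>\<^sup>+z. \<integral>\<^sup>+\<eta>. ennreal (snd z * f (fst z)) * G (add_atom \<eta> (fst z) (snd z)) \<partial>\<mu> \<partial>m)"
  proof (rule nn_integral_cong_AE, use positive_marks in eventually_elim, rule nn_integral_cong)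
    fix z :: "'a \<times> real" and \<eta> assume z: "0 < snd z" and \<eta>: "\<eta> \<in> space \<mu>"
    have \<eta>r: "\<eta> \<in> radon_measures" using \<eta> space_discrete_radon_spaceD(1) by (simp add: space_\<mu>)
    have "I (add_atom \<eta> (fst z) (snd z)) = I \<eta> + snd z * f (fst z)"
      unfolding I_def test_integral_add_atom[OF \<eta>r f] using z by simp
    then have "ennreal (a z) * ennreal (exp (- I \<eta>)) * ennreal (exp (I (add_atom \<eta> (fst z) (snd z)))) = ennreal (snd z * f (fst z))"
      using z f0[of "fst z"] by (simp add: a_def ennreal_mult[symmetric] mult_exp_exp mult.assoc less_imp_le)
    then show "ennreal (a z) * ennreal (exp (- I \<eta>)) * G' (add_atom \<eta> (fst z) (snd z)) = ennreal (snd z * f (fst z)) * G (add_atom \<eta> (fst z) (snd z))"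
      by (simp add: G'_def mult_ac)
  qed
  finally show ?thesis by (simp add: I_def)
qed

end

lemma SUP_bump:
  assumes "open U"
  shows "(SUP k. ennreal (bump U k x)) = indicator U x"
proof (rule antisym)
  show "(SUP k. ennreal (bump U k x)) \<le> indicator U x"
    by (intro SUP_least) (auto simp: indicator_def bump_outside bump_le_1)
  show "indicator U x \<le> (SUP k. ennreal (bump U k x))"
  proof (cases "x \<in> U")
    case True
    then obtain k where "bump U k x = 1" using bump_eventually_1[OF assms] by blast
    then show ?thesis using True by (intro SUP_upper2[of k]) auto
  qed simp
qed

lemma incseq_bump: "incseq (\<lambda>k. ennreal (bump U k x))"
  by (auto simp: incseq_def intro!: ennreal_leI bump_mono)

lemma sets_borel_relatively_compact:
  assumes lc: "locally_compact_space (euclidean :: 'a::polish_space topology)"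
  shows "sets borel = sigma_sets UNIV {U :: 'a::polish_space set. open U \<and> compact (closure U)}"
proof -
  obtain \<B> :: "'a set set" where B: "countable \<B>" "topological_basis \<B>" "\<And>U. U \<in> \<B> \<Longrightarrow> compact (closure U)"
    using locally_compact_countable_basis[OF lc] by blast
  have "sets (borel :: 'a measure) = sets (sigma UNIV \<B>)"
    by (rule arg_cong[OF borel_eq_countable_basis[OF B(1,2)]])
  also have "\<dots> = sigma_sets UNIV \<B>" by (rule sets_measure_of) simp
  also have "\<dots> \<subseteq> sigma_sets UNIV {U. open U \<and> compact (closure U)}"
    using B(3) topological_basis_open[OF B(2)] by (intro sigma_sets_mono') auto
  finally show ?thesis
    by (intro antisym) (auto intro!: sets.sigma_sets_subset[of _ borel, simplified])
qed

context completely_random_measure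
begin

lemma kernel_emeasure_measurable:
  assumes [measurable]: "E \<in> sets (discrete_radon_space \<Otimes>\<^sub>M (borel :: 'a measure))"
  shows "(\<lambda>\<eta>. emeasure \<eta> (Pair \<eta> -` E)) \<in> borel_measurable discrete_radon_space"
proof -
  have "(\<lambda>\<eta>. \<integral>\<^sup>+x. indicator E (\<eta>, x) \<partial>\<eta>) \<in> borel_measurable discrete_radon_space"
    by (intro kernel_integral_measurable[OF lc]) measurable
  moreover have "(\<integral>\<^sup>+x. indicator E (\<eta>, x) \<partial>\<eta>) = emeasure \<eta> (Pair \<eta> -` E)" if "\<eta> \<in> space discrete_radon_space" for \<eta>
  proof -
    have "Pair \<eta> -` E \<in> sets \<eta>"
      using sets_Pair1[OF assms] space_discrete_radon_spaceD[OF that] by simp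
    then have "emeasure \<eta> (Pair \<eta> -` E) = (\<integral>\<^sup>+x. indicator (Pair \<eta> -` E) x \<partial>\<eta>)" by simp
    then show ?thesis by (simp add: indicator_def)
  qed
  ultimately show ?thesis by (subst (asm) measurable_cong) auto
qed

text \<open>The measure \<open>\<mu>(d\<eta>) \<eta>(dx)\<close>. It need not be finite, nor is \<open>\<eta>\<close> a subprobability kernel, hence the definition
through its values on sets.\<close>
definition atom_joint_law :: "('a measure \<times> 'a) measure" where
  "atom_joint_law = measure_of (space (discrete_radon_space \<Otimes>\<^sub>M borel)) (sets (discrete_radon_space \<Otimes>\<^sub>M borel))
     (\<lambda>E. \<integral>\<^sup>+\<eta>. emeasure \<eta> (Pair \<eta> -` E) \<partial>\<mu>)"

lemma sets_atom_joint_law [measurable_cong]: "sets atom_joint_law = sets (discrete_radon_space \<Otimes>\<^sub>M borel)"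
  unfolding atom_joint_law_def by (rule sets.sets_measure_of_eq)

lemma space_atom_joint_law: "space atom_joint_law = space (discrete_radon_space \<Otimes>\<^sub>M borel)"
  using sets_eq_imp_space_eq[OF sets_atom_joint_law] .

lemma emeasure_atom_joint_law:
  assumes E: "E \<in> sets (discrete_radon_space \<Otimes>\<^sub>M borel)"
  shows "emeasure atom_joint_law E = (\<integral>\<^sup>+\<eta>. emeasure \<eta> (Pair \<eta> -` E) \<partial>\<mu>)"
  using atom_joint_law_def
proof (rule emeasure_measure_of)
  show "sets (discrete_radon_space \<Otimes>\<^sub>M borel) \<subseteq> Pow (space (discrete_radon_space \<Otimes>\<^sub>M (borel :: 'a measure)))"
    by (rule sets.space_closed)
  show "countably_additive (sets atom_joint_law) (\<lambda>E. \<integral>\<^sup>+\<eta>. emeasure \<eta> (Pair \<eta> -` E) \<partial>\<mu>)"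
  proof (rule countably_additiveI)
    fix A :: "nat \<Rightarrow> ('a measure \<times> 'a) set"
    assume A: "range A \<subseteq> sets atom_joint_law" "disjoint_family A"
    have Am: "A i \<in> sets (discrete_radon_space \<Otimes>\<^sub>M borel)" for i using A(1) by (auto simp: sets_atom_joint_law)
    have "(\<Sum>i. \<integral>\<^sup>+\<eta>. emeasure \<eta> (Pair \<eta> -` A i) \<partial>\<mu>) = (\<integral>\<^sup>+\<eta>. (\<Sum>i. emeasure \<eta> (Pair \<eta> -` A i)) \<partial>\<mu>)"
      using kernel_emeasure_measurable[OF Am] by (intro nn_integral_suminf[symmetric]) (simp add: measurable_cong_sets[OF sets_\<mu> refl])
    also have "\<dots> = (\<integral>\<^sup>+\<eta>. emeasure \<eta> (Pair \<eta> -` (\<Union>i. A i)) \<partial>\<mu>)"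
    proof (rule nn_integral_cong)
      fix \<eta> assume "\<eta> \<in> space \<mu>"
      then have "sets \<eta> = sets borel" using space_discrete_radon_spaceD by (simp add: space_\<mu>)
      then have "range (\<lambda>i. Pair \<eta> -` A i) \<subseteq> sets \<eta>" using sets_Pair1[OF Am] by auto
      moreover have "disjoint_family (\<lambda>i. Pair \<eta> -` A i)" using A(2) by (auto simp: disjoint_family_on_def)
      ultimately show "(\<Sum>i. emeasure \<eta> (Pair \<eta> -` A i)) = emeasure \<eta> (Pair \<eta> -` (\<Union>i. A i))"
        by (simp add: suminf_emeasure vimage_UN)
    qed
    finally show "(\<Sum>i. \<integral>\<^sup>+\<eta>. emeasure \<eta> (Pair \<eta> -` A i) \<partial>\<mu>) = (\<integral>\<^sup>+\<eta>. emeasure \<eta> (Pair \<eta> -` (\<Union>i. A i)) \<partial>\<mu>)" .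
  qed
  show "E \<in> sets atom_joint_law" using E by (simp add: sets_atom_joint_law)
qed (simp add: positive_def)

lemma nn_integral_atom_joint_law:
  assumes H: "H \<in> borel_measurable (discrete_radon_space \<Otimes>\<^sub>M borel)"
  shows "(\<integral>\<^sup>+p. H p \<partial>atom_joint_law) = (\<integral>\<^sup>+\<eta>. \<integral>\<^sup>+x. H (\<eta>, x) \<partial>\<eta> \<partial>\<mu>)"
proof -
  have Hx: "(\<lambda>x. F (\<eta>, x)) \<in> borel_measurable \<eta>"
    if "F \<in> borel_measurable (discrete_radon_space \<Otimes>\<^sub>M borel)" "\<eta> \<in> space \<mu>" for F :: "'a measure \<times> 'a \<Rightarrow> ennreal" and \<eta>
  proof -
    have "sets \<eta> = sets borel" "\<eta> \<in> space discrete_radon_space" using that(2) space_discrete_radon_spaceD by (auto simp: space_\<mu>)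
    then show ?thesis using measurable_Pair2[OF that(1)] measurable_cong_sets by blast
  qed
  have K: "(\<lambda>\<eta>. \<integral>\<^sup>+x. F (\<eta>, x) \<partial>\<eta>) \<in> borel_measurable \<mu>"
    if "F \<in> borel_measurable (discrete_radon_space \<Otimes>\<^sub>M borel)" for F :: "'a measure \<times> 'a \<Rightarrow> ennreal"
    unfolding measurable_cong_sets[OF sets_\<mu> refl]
    by (rule kernel_integral_measurable[OF lc]) (use that in \<open>simp add: split_beta'\<close>)
  have M: "F \<in> borel_measurable atom_joint_law"
    if "F \<in> borel_measurable (discrete_radon_space \<Otimes>\<^sub>M borel)" for F :: "'a measure \<times> 'a \<Rightarrow> ennreal"
    using that by (simp add: measurable_cong_sets[OF sets_atom_joint_law refl])
  show ?thesis using H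
  proof (induction rule: borel_measurable_induct)
    case (cong f g)
    have "(\<integral>\<^sup>+p. f p \<partial>atom_joint_law) = (\<integral>\<^sup>+p. g p \<partial>atom_joint_law)"
      using cong(3) by (intro nn_integral_cong) (simp add: space_atom_joint_law)
    moreover have "(\<integral>\<^sup>+\<eta>. \<integral>\<^sup>+x. f (\<eta>, x) \<partial>\<eta> \<partial>\<mu>) = (\<integral>\<^sup>+\<eta>. \<integral>\<^sup>+x. g (\<eta>, x) \<partial>\<eta> \<partial>\<mu>)"
      using cong(3) by (intro nn_integral_cong) (simp add: space_pair_measure space_\<mu>)
    ultimately show ?case using cong by simp
  next
    case (set A)
    have "emeasure \<eta> (Pair \<eta> -` A) = (\<integral>\<^sup>+x. indicator A (\<eta>, x) \<partial>\<eta>)" if "\<eta> \<in> space \<mu>" for \<eta>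
    proof -
      have "Pair \<eta> -` A \<in> sets \<eta>"
        using sets_Pair1[OF set] space_discrete_radon_spaceD that by (auto simp: space_\<mu>)
      then have "emeasure \<eta> (Pair \<eta> -` A) = (\<integral>\<^sup>+x. indicator (Pair \<eta> -` A) x \<partial>\<eta>)" by simp
      then show ?thesis by (simp add: indicator_def)
    qed
    then show ?case using set by (simp add: sets_atom_joint_law emeasure_atom_joint_law cong: nn_integral_cong)
  next
    case (mult u c)
    have "(\<integral>\<^sup>+\<eta>. \<integral>\<^sup>+x. c * u (\<eta>, x) \<partial>\<eta> \<partial>\<mu>) = (\<integral>\<^sup>+\<eta>. c * \<integral>\<^sup>+x. u (\<eta>, x) \<partial>\<eta> \<partial>\<mu>)"
      using mult by (intro nn_integral_cong nn_integral_cmult Hx)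
    also have "\<dots> = c * (\<integral>\<^sup>+\<eta>. \<integral>\<^sup>+x. u (\<eta>, x) \<partial>\<eta> \<partial>\<mu>)"
      by (rule nn_integral_cmult[OF K]) (rule mult)
    also have "\<dots> = (\<integral>\<^sup>+p. c * u p \<partial>atom_joint_law)"
      unfolding mult.IH[symmetric] by (rule nn_integral_cmult[OF M, symmetric]) (rule mult)
    finally show ?case by simp
  next
    case (add u v)
    have "(\<integral>\<^sup>+\<eta>. \<integral>\<^sup>+x. v (\<eta>, x) + u (\<eta>, x) \<partial>\<eta> \<partial>\<mu>) = (\<integral>\<^sup>+\<eta>. (\<integral>\<^sup>+x. v (\<eta>, x) \<partial>\<eta>) + (\<integral>\<^sup>+x. u (\<eta>, x) \<partial>\<eta>) \<partial>\<mu>)"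
      using add by (intro nn_integral_cong nn_integral_add Hx)
    also have "\<dots> = (\<integral>\<^sup>+\<eta>. \<integral>\<^sup>+x. v (\<eta>, x) \<partial>\<eta> \<partial>\<mu>) + (\<integral>\<^sup>+\<eta>. \<integral>\<^sup>+x. u (\<eta>, x) \<partial>\<eta> \<partial>\<mu>)"
      by (rule nn_integral_add[OF K K]) (rule add)+
    also have "\<dots> = (\<integral>\<^sup>+p. v p + u p \<partial>atom_joint_law)"
      unfolding add.IH[symmetric] by (rule nn_integral_add[OF M M, symmetric]) (rule add)+
    finally show ?case by simp
  next
    case (seq U)
    have inc: "incseq (\<lambda>i x. U i (\<eta>, x))" for \<eta> using seq(3) by (auto simp: incseq_def le_fun_def)
    have "(\<integral>\<^sup>+\<eta>. \<integral>\<^sup>+x. (SUP i. U i) (\<eta>, x) \<partial>\<eta> \<partial>\<mu>) = (\<integral>\<^sup>+\<eta>. (SUP i. \<integral>\<^sup>+x. U i (\<eta>, x) \<partial>\<eta>) \<partial>\<mu>)"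
      using seq inc by (intro nn_integral_cong) (simp add: image_comp nn_integral_monotone_convergence_SUP Hx)
    also have "\<dots> = (SUP i. \<integral>\<^sup>+\<eta>. \<integral>\<^sup>+x. U i (\<eta>, x) \<partial>\<eta> \<partial>\<mu>)"
      using inc seq by (intro nn_integral_monotone_convergence_SUP K)
         (auto simp: incseq_def le_fun_def intro!: nn_integral_mono)
    also have "\<dots> = (SUP i. \<integral>\<^sup>+p. U i p \<partial>atom_joint_law)" using seq by simp
    also have "\<dots> = (\<integral>\<^sup>+p. (SUP i. U i p) \<partial>atom_joint_law)"
      by (rule nn_integral_monotone_convergence_SUP[symmetric, OF seq(3) M[OF seq(1)]])
    also have "\<dots> = (\<integral>\<^sup>+p. (SUP i. U i) p \<partial>atom_joint_law)" by (simp only: SUP_apply)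
    finally show ?case by simp
  qed
qed

lemma Mecke_open_set:
  assumes U: "open U" "compact (closure U)" and G: "G \<in> borel_measurable discrete_radon_space"
  shows "(\<integral>\<^sup>+\<eta>. emeasure \<eta> U * G \<eta> \<partial>\<mu>)
       = (\<integral>\<^sup>+z. \<integral>\<^sup>+\<eta>. ennreal (snd z) * indicator U (fst z) * G (add_atom \<eta> (fst z) (snd z)) \<partial>\<mu> \<partial>m)"
proof -
  have [measurable]: "G \<in> borel_measurable discrete_radon_space" by fact
  have addm[measurable]: "(\<lambda>p. add_atom (snd p) (fst (fst p)) (snd (fst p))) \<in> measurable (m \<Otimes>\<^sub>M \<mu>) discrete_radon_space"
    using add_atom_measurable_m by (simp add: split_beta')
  have [measurable]: "U \<in> sets borel" using U(1) by simp
  have b: "bump U k \<in> nonneg_test_functions" for k by (rule bump_test[OF U(2)])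
  note [measurable] = test_measurable[OF b]
  have lim: "(SUP k. ennreal (LINT x|\<eta>. bump U k x)) = emeasure \<eta> U" if "\<eta> \<in> space \<mu>" for \<eta>
  proof -
    have [measurable_cong]: "sets \<eta> = sets borel" and r: "\<eta> \<in> radon_measures"
      using that space_discrete_radon_spaceD by (auto simp: space_\<mu>)
    have "ennreal (LINT x|\<eta>. bump U k x) = (\<integral>\<^sup>+x. ennreal (bump U k x) \<partial>\<eta>)" for k
      using radon_test_integrable[OF r, of "bump U k"] b[of k] bump_nonneg
      by (intro nn_integral_eq_integral[symmetric]) (auto simp: nonneg_test_functions_def)
    then have "(SUP k. ennreal (LINT x|\<eta>. bump U k x)) = (SUP k. \<integral>\<^sup>+x. ennreal (bump U k x) \<partial>\<eta>)" by simp
    also have "\<dots> = (\<integral>\<^sup>+x. (SUP k. ennreal (bump U k x)) \<partial>\<eta>)"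
      using incseq_bump[of U] by (intro nn_integral_monotone_convergence_SUP[symmetric]) (auto simp: incseq_def le_fun_def)
    also have "\<dots> = emeasure \<eta> U"
      using U(1) by (simp add: SUP_bump)
    finally show ?thesis .
  qed
  have mono: "incseq (\<lambda>k. ennreal (LINT x|\<eta>. bump U k x))" if "\<eta> \<in> space \<mu>" for \<eta>
  proof -
    have r: "\<eta> \<in> radon_measures" using that space_discrete_radon_spaceD by (auto simp: space_\<mu>)
    have "integrable \<eta> (bump U k)" for k
      using radon_test_integrable[OF r] b[of k] by (auto simp: nonneg_test_functions_def)
    then show ?thesis
      by (auto simp: incseq_def intro!: ennreal_leI integral_mono bump_mono)
  qed
  have "(\<integral>\<^sup>+\<eta>. emeasure \<eta> U * G \<eta> \<partial>\<mu>) = (\<integral>\<^sup>+\<eta>. (SUP k. ennreal (LINT x|\<eta>. bump U k x) * G \<eta>) \<partial>\<mu>)"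
    by (intro nn_integral_cong) (simp add: lim[symmetric] SUP_mult_right_ennreal)
  also have "\<dots> = (SUP k. \<integral>\<^sup>+\<eta>. ennreal (LINT x|\<eta>. bump U k x) * G \<eta> \<partial>\<mu>)"
    using mono by (intro nn_integral_monotone_convergence_SUP_AE) (auto simp: incseq_def intro!: AE_I2 mult_right_mono)
  also have "\<dots> = (SUP k. \<integral>\<^sup>+p. ennreal (snd (fst p)) * ennreal (bump U k (fst (fst p))) * G (add_atom (snd p) (fst (fst p)) (snd (fst p))) \<partial>(m \<Otimes>\<^sub>M \<mu>))"
    unfolding Mecke_test_function[OF b G]
    by (subst \<mu>.nn_integral_fst[symmetric]) (auto simp: ennreal_mult'' bump_nonneg)
  also have "\<dots> = (\<integral>\<^sup>+p. (SUP k. ennreal (snd (fst p)) * ennreal (bump U k (fst (fst p))) * G (add_atom (snd p) (fst (fst p)) (snd (fst p)))) \<partial>(m \<Otimes>\<^sub>M \<mu>))"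
    by (intro nn_integral_monotone_convergence_SUP[symmetric])
       (auto simp: incseq_def le_fun_def intro!: mult_right_mono mult_left_mono ennreal_leI bump_mono)
  also have "\<dots> = (\<integral>\<^sup>+p. ennreal (snd (fst p)) * indicator U (fst (fst p)) * G (add_atom (snd p) (fst (fst p)) (snd (fst p))) \<partial>(m \<Otimes>\<^sub>M \<mu>))"
    by (simp only: SUP_bump[OF U(1), symmetric] SUP_mult_right_ennreal SUP_mult_left_ennreal)
  also have "\<dots> = (\<integral>\<^sup>+z. \<integral>\<^sup>+\<eta>. ennreal (snd z) * indicator U (fst z) * G (add_atom \<eta> (fst z) (snd z)) \<partial>\<mu> \<partial>m)"
    by (subst \<mu>.nn_integral_fst[symmetric]) auto
  finally show ?thesis .
qed

text \<open>Both sides are integrals of \<open>H\<close> against measures on pairs \<open>(\<eta>, x)\<close> that agree on rectangles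
\<open>B \<times> V\<close> with \<open>V\<close> open and relatively compact. The rectangles with \<open>B = {\<eta>. \<eta> V \<le> j}\<close> have
finite measure and cover the space.\<close>
theorem Mecke:
  assumes H: "H \<in> borel_measurable (discrete_radon_space \<Otimes>\<^sub>M borel)"
  shows "(\<integral>\<^sup>+\<eta>. \<integral>\<^sup>+x. H (\<eta>, x) \<partial>\<eta> \<partial>\<mu>)
       = (\<integral>\<^sup>+z. \<integral>\<^sup>+\<eta>. ennreal (snd z) * H (add_atom \<eta> (fst z) (snd z), fst z) \<partial>\<mu> \<partial>m)"
proof -
  let ?S = "discrete_radon_space \<Otimes>\<^sub>M (borel :: 'a measure)"
  have addm[measurable]: "(\<lambda>p. add_atom (snd p) (fst (fst p)) (snd (fst p))) \<in> measurable (m \<Otimes>\<^sub>M \<mu>) discrete_radon_space"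
    using add_atom_measurable_m by (simp add: split_beta')
  define M2 where "M2 = distr (density (m \<Otimes>\<^sub>M \<mu>) (\<lambda>p. ennreal (snd (fst p)))) ?S
     (\<lambda>p. (add_atom (snd p) (fst (fst p)) (snd (fst p)), fst (fst p)))"
  have nn2: "(\<integral>\<^sup>+p. F p \<partial>M2) = (\<integral>\<^sup>+z. \<integral>\<^sup>+\<eta>. ennreal (snd z) * F (add_atom \<eta> (fst z) (snd z), fst z) \<partial>\<mu> \<partial>m)"
    if [measurable]: "F \<in> borel_measurable ?S" for F
  proof -
    have "(\<integral>\<^sup>+p. F p \<partial>M2) = (\<integral>\<^sup>+p. ennreal (snd (fst p)) * F (add_atom (snd p) (fst (fst p)) (snd (fst p)), fst (fst p)) \<partial>(m \<Otimes>\<^sub>M \<mu>))"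
      unfolding M2_def by (subst nn_integral_distr) (auto simp: nn_integral_density)
    also have "\<dots> = (\<integral>\<^sup>+z. \<integral>\<^sup>+\<eta>. ennreal (snd z) * F (add_atom \<eta> (fst z) (snd z), fst z) \<partial>\<mu> \<partial>m)"
      by (subst \<mu>.nn_integral_fst[symmetric]) auto
    finally show ?thesis .
  qed
  define \<U> where "\<U> = {U :: 'a set. open U \<and> compact (closure U)}"
  obtain U :: "nat \<Rightarrow> 'a set" where U: "\<And>n. open (U n)" "\<And>n. compact (closure (U n))" "incseq U" "(\<Union>n. U n) = UNIV"
    using compact_exhaustion[OF lc] by blast
  define E where "E = {B \<times> V | B V. B \<in> sets (discrete_radon_space :: 'a measure measure) \<and> V \<in> \<U>}"
  have E: "sets ?S = sigma_sets (space ?S) E"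
  proof -
    have "sets ?S = sets (sigma (space discrete_radon_space \<times> space borel) E)"
      unfolding E_def
    proof (rule sets_pair_eq)
      show "sets discrete_radon_space \<subseteq> Pow (space (discrete_radon_space :: 'a measure measure))" by (rule sets.space_closed)
      show "sets discrete_radon_space = sigma_sets (space (discrete_radon_space :: 'a measure measure)) (sets discrete_radon_space)"
        by (simp add: sets.sigma_sets_eq)
      show "sets borel = sigma_sets (space borel) \<U>"
        unfolding \<U>_def using sets_borel_relatively_compact[OF lc] by simp
      show "countable {space (discrete_radon_space :: 'a measure measure)}" "{space discrete_radon_space} \<subseteq> sets (discrete_radon_space :: 'a measure measure)"
        "\<Union>{space (discrete_radon_space :: 'a measure measure)} = space discrete_radon_space" by auto
      show "countable (range U)" "range U \<subseteq> \<U>" "\<Union>(range U) = space borel" using U by (auto simp: \<U>_def)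
    qed (auto simp: \<U>_def)
    also have "\<dots> = sigma_sets (space ?S) E"
      by (subst sets_measure_of) (auto simp: E_def space_pair_measure dest: sets.sets_into_space)
    finally show ?thesis .
  qed
  have "atom_joint_law = M2"
  proof (rule measure_eqI_generator_eq_countable)
    have "V \<inter> V' \<in> \<U>" if "V \<in> \<U>" "V' \<in> \<U>" for V V'
    proof -
      have "V \<inter> V' \<subseteq> closure V" using closure_subset by blast
      then have "compact (closure (V \<inter> V'))" using that by (intro compact_closure_of_subset) (auto simp: \<U>_def)
      then show ?thesis using that by (auto simp: \<U>_def)
    qed
    then show "Int_stable E"
      unfolding E_def by (intro Int_stableI) (clarsimp simp: Times_Int_Times, metis sets.Int)
    show "E \<subseteq> Pow (space ?S)" by (auto simp: E_def space_pair_measure dest: sets.sets_into_space)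
    show "sets atom_joint_law = sigma_sets (space ?S) E" "sets M2 = sigma_sets (space ?S) E"
      by (simp_all add: sets_atom_joint_law E[symmetric] M2_def)
    have BV: "emeasure atom_joint_law (B \<times> V) = (\<integral>\<^sup>+\<eta>. emeasure \<eta> V * indicator B \<eta> \<partial>\<mu>)"
      if [measurable]: "B \<in> sets discrete_radon_space" and V: "V \<in> \<U>" for B V
    proof -
      have [measurable]: "V \<in> sets borel" using V by (simp add: \<U>_def)
      have "emeasure atom_joint_law (B \<times> V) = (\<integral>\<^sup>+\<eta>. emeasure \<eta> (Pair \<eta> -` (B \<times> V)) \<partial>\<mu>)"
        by (rule emeasure_atom_joint_law) measurable
      also have "\<dots> = (\<integral>\<^sup>+\<eta>. emeasure \<eta> V * indicator B \<eta> \<partial>\<mu>)"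
        by (intro nn_integral_cong) (auto simp: indicator_def vimage_def)
      finally show ?thesis .
    qed
    show "emeasure atom_joint_law X = emeasure M2 X" if XE: "X \<in> E" for X
    proof -
      obtain B V where X: "X = B \<times> V" and [measurable]: "B \<in> sets discrete_radon_space" and V: "V \<in> \<U>"
        using XE by (auto simp: E_def)
      have [measurable]: "V \<in> sets borel" using V by (simp add: \<U>_def)
      have "emeasure M2 X = (\<integral>\<^sup>+p. indicator (B \<times> V) p \<partial>M2)" by (simp add: X M2_def)
      also have "\<dots> = (\<integral>\<^sup>+z. \<integral>\<^sup>+\<eta>. ennreal (snd z) * indicator (B \<times> V) (add_atom \<eta> (fst z) (snd z), fst z) \<partial>\<mu> \<partial>m)"
        by (rule nn2) measurable
      also have "\<dots> = (\<integral>\<^sup>+z. \<integral>\<^sup>+\<eta>. ennreal (snd z) * indicator V (fst z) * indicator B (add_atom \<eta> (fst z) (snd z)) \<partial>\<mu> \<partial>m)"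
        by (intro nn_integral_cong) (auto simp: indicator_def)
      also have "\<dots> = (\<integral>\<^sup>+\<eta>. emeasure \<eta> V * indicator B \<eta> \<partial>\<mu>)"
        using V by (intro Mecke_open_set[symmetric]) (auto simp: \<U>_def)
      finally show ?thesis using BV[OF _ V] X by simp
    qed
    define B where "B n j = {\<eta> \<in> space discrete_radon_space. emeasure \<eta> (U n) \<le> of_nat j}" for n j
    have Bm[measurable]: "B n j \<in> sets discrete_radon_space" for n j
      unfolding B_def using mass_measurable[OF lc, of "U n"] U(1) by measurable
    define C where "C = (\<lambda>(n, j). B n j \<times> U n) ` UNIV"
    have "B n j \<times> U n \<in> E" for n j using Bm[of n j] U(1,2)[of n] unfolding E_def \<U>_def by blast
    then show "C \<subseteq> E" by (auto simp: C_def)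
    show "countable C" unfolding C_def by (intro countable_image) auto
    show "\<Union>C = space ?S"
    proof (intro antisym subsetI)
      fix p :: "'a measure \<times> 'a" assume p: "p \<in> space ?S"
      then have \<eta>: "fst p \<in> space discrete_radon_space" by (auto simp: space_pair_measure)
      obtain n where n: "snd p \<in> U n" using U(4) by blast
      have "emeasure (fst p) (U n) < \<infinity>"
        by (rule relatively_compact_mass_finite[OF space_discrete_radon_spaceD(1)[OF \<eta>] U(2)])
      then obtain j :: nat where "emeasure (fst p) (U n) \<le> of_nat j"
        using ennreal_Ex_less_of_nat[of "emeasure (fst p) (U n)"] by (auto intro: less_imp_le)
      then have "fst p \<in> B n j" using \<eta> by (simp add: B_def)
      then have "p \<in> B n j \<times> U n" using n by (simp add: mem_Times_iff)
      then show "p \<in> \<Union>C" unfolding C_def by blast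
    qed (auto simp: C_def B_def space_pair_measure)
    show "emeasure atom_joint_law a \<noteq> \<infinity>" if "a \<in> C" for a
    proof -
      obtain n j where a: "a = B n j \<times> U n" using \<open>a \<in> C\<close> by (auto simp: C_def)
      have "U n \<in> \<U>" using U by (simp add: \<U>_def)
      then have "emeasure atom_joint_law a = (\<integral>\<^sup>+\<eta>. emeasure \<eta> (U n) * indicator (B n j) \<eta> \<partial>\<mu>)"
        unfolding a by (rule BV[OF Bm])
      also have "\<dots> \<le> (\<integral>\<^sup>+\<eta>. of_nat j \<partial>\<mu>)"
        by (intro nn_integral_mono) (auto simp: B_def split: split_indicator)
      finally have "emeasure atom_joint_law a \<le> (\<integral>\<^sup>+\<eta>. of_nat j \<partial>\<mu>)" .
      then show ?thesis by (auto simp: \<mu>.emeasure_space_1 top_unique)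
    qed
  qed
  then show ?thesis using nn_integral_atom_joint_law[OF H] nn2[OF H] by simp
qed

end

section \<open>Functionals of the marks\<close>

text \<open>The sum of \<open>h(x, s\<^sub>x)\<close> over the atoms of a discrete \<open>\<eta>\<close>. Written as an integral against \<open>\<eta>\<close> it is
measurable in \<open>\<eta>\<close>, and the Mecke formula applies to it.\<close>
definition marks_sum :: "('a \<Rightarrow> real \<Rightarrow> ennreal) \<Rightarrow> 'a measure \<Rightarrow> ennreal" where
  "marks_sum h \<eta> = (\<integral>\<^sup>+x. h x (measure \<eta> {x}) / emeasure \<eta> {x} \<partial>\<eta>)"

text \<open>The signed counterpart of \<open>marks_sum\<close>: the sum of \<open>g(x, s\<^sub>x)\<close> over the atoms when it converges absolutely,
and \<open>0\<close> otherwise.\<close>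
definition mark_integral :: "('a \<Rightarrow> real \<Rightarrow> real) \<Rightarrow> 'a measure \<Rightarrow> real" where
  "mark_integral g \<eta> = (LINT x|\<eta>. g x (measure \<eta> {x}) / measure \<eta> {x})"

definition mark_integrable :: "('a \<Rightarrow> real \<Rightarrow> real) \<Rightarrow> 'a measure \<Rightarrow> bool" where
  "mark_integrable g \<eta> \<longleftrightarrow> integrable \<eta> (\<lambda>x. g x (measure \<eta> {x}) / measure \<eta> {x})"

lemma atom_mass_finite:
  fixes x :: "'a::t1_space"
  assumes "\<eta> \<in> radon_measures"
  shows "emeasure \<eta> {x} = ennreal (measure \<eta> {x})" "emeasure \<eta> {x} < \<infinity>"
proof -
  show "emeasure \<eta> {x} < \<infinity>" using assms by (simp add: radon_measures_def)
  then show "emeasure \<eta> {x} = ennreal (measure \<eta> {x})" by (intro emeasure_eq_ennreal_measure) auto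
qed

lemma discrete_AE_atoms:
  fixes \<eta> :: "'a::t1_space measure"
  assumes "\<eta> \<in> discrete_radon_measures"
  shows "AE x in \<eta>. 0 < measure \<eta> {x} \<and> emeasure \<eta> {x} = ennreal (measure \<eta> {x})"
proof -
  have r: "\<eta> \<in> radon_measures" using assms by (simp add: discrete_radon_measures_def)
  show ?thesis using countable_atoms_discrete(2)[OF assms]
    by eventually_elim (simp add: atom_mass_finite[OF r])
qed

context
  assumes lc: "locally_compact_space (euclidean :: 'a::polish_space topology)"
begin

lemma measure_atom_measurable [measurable]:
  "(\<lambda>p. measure (fst p) {snd p}) \<in> borel_measurable (discrete_radon_space \<Otimes>\<^sub>M (borel :: 'a measure))"
  "(\<lambda>p. emeasure (fst p) {snd p}) \<in> borel_measurable (discrete_radon_space \<Otimes>\<^sub>M (borel :: 'a measure))"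
  using atom_mass_measurable[OF lc] unfolding measure_def by (simp_all add: split_beta')

lemma measure_atom_measurable1:
  fixes \<eta> :: "'a measure"
  assumes "\<eta> \<in> space discrete_radon_space"
  shows "(\<lambda>x. measure \<eta> {x}) \<in> borel_measurable borel" "(\<lambda>x. emeasure \<eta> {x}) \<in> borel_measurable borel"
  using measurable_Pair2[OF measure_atom_measurable(1) assms] measurable_Pair2[OF measure_atom_measurable(2) assms] by simp_all

lemma mark_term_measurable:
  fixes g :: "'a \<Rightarrow> real \<Rightarrow> real" and h :: "'a \<Rightarrow> real \<Rightarrow> ennreal"
  assumes \<eta>: "\<eta> \<in> space discrete_radon_space"
  shows "case_prod g \<in> borel_measurable (borel \<Otimes>\<^sub>M borel) \<Longrightarrow> (\<lambda>x. g x (measure \<eta> {x}) / measure \<eta> {x}) \<in> borel_measurable borel"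
    "case_prod h \<in> borel_measurable (borel \<Otimes>\<^sub>M borel) \<Longrightarrow> (\<lambda>x. h x (measure \<eta> {x}) / emeasure \<eta> {x}) \<in> borel_measurable borel"
proof -
  note [measurable] = measure_atom_measurable1[OF \<eta>]
  show "(\<lambda>x. g x (measure \<eta> {x}) / measure \<eta> {x}) \<in> borel_measurable borel"
    if [measurable]: "case_prod g \<in> borel_measurable (borel \<Otimes>\<^sub>M borel)" by measurable
  show "(\<lambda>x. h x (measure \<eta> {x}) / emeasure \<eta> {x}) \<in> borel_measurable borel"
    if [measurable]: "case_prod h \<in> borel_measurable (borel \<Otimes>\<^sub>M borel)" by measurable
qed

lemma marks_sum_measurable:
  fixes h :: "'a \<Rightarrow> real \<Rightarrow> ennreal"
  assumes [measurable]: "case_prod h \<in> borel_measurable (borel \<Otimes>\<^sub>M borel)"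
  shows "marks_sum h \<in> borel_measurable discrete_radon_space"
proof -
  have "(\<lambda>p. h (snd p) (measure (fst p) {snd p}) / emeasure (fst p) {snd p}) \<in> borel_measurable (discrete_radon_space \<Otimes>\<^sub>M borel)"
    by measurable
  then show ?thesis
    unfolding marks_sum_def[abs_def] by (intro kernel_integral_measurable[OF lc]) (simp add: split_beta')
qed

lemma nn_mark_integral_eq_marks_sum:
  fixes g :: "'a \<Rightarrow> real \<Rightarrow> real"
  assumes \<eta>: "\<eta> \<in> space discrete_radon_space"
  shows "(\<integral>\<^sup>+x. ennreal (g x (measure \<eta> {x}) / measure \<eta> {x}) \<partial>\<eta>) = marks_sum (\<lambda>x s. ennreal (g x s)) \<eta>"
  unfolding marks_sum_def
proof (rule nn_integral_cong_AE)
  show "AE x in \<eta>. ennreal (g x (measure \<eta> {x}) / measure \<eta> {x}) = ennreal (g x (measure \<eta> {x})) / emeasure \<eta> {x}"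
    using discrete_AE_atoms[OF space_discrete_radon_spaceD(4)[OF \<eta>]]
  proof eventually_elim
    case (elim x)
    show ?case
    proof (cases "0 \<le> g x (measure \<eta> {x})")
      case True
      then show ?thesis using elim by (simp add: divide_ennreal)
    next
      case False
      then have "g x (measure \<eta> {x}) / measure \<eta> {x} \<le> 0" using elim by (simp add: divide_le_0_iff)
      then show ?thesis using False by (simp add: ennreal_neg)
    qed
  qed
qed

lemma mark_integrable_iff:
  fixes g :: "'a \<Rightarrow> real \<Rightarrow> real"
  assumes \<eta>: "\<eta> \<in> space discrete_radon_space" and g: "case_prod g \<in> borel_measurable (borel \<Otimes>\<^sub>M borel)"
  shows "mark_integrable g \<eta> \<longleftrightarrow> marks_sum (\<lambda>x s. ennreal \<bar>g x s\<bar>) \<eta> < \<infinity>"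
proof -
  have "(\<lambda>x. g x (measure \<eta> {x}) / measure \<eta> {x}) \<in> borel_measurable \<eta>"
    using mark_term_measurable(1)[OF \<eta> g] measurable_cong_sets[OF space_discrete_radon_spaceD(2)[OF \<eta>] refl] by blast
  moreover have "(\<integral>\<^sup>+x. ennreal (norm (g x (measure \<eta> {x}) / measure \<eta> {x})) \<partial>\<eta>) = marks_sum (\<lambda>x s. ennreal \<bar>g x s\<bar>) \<eta>"
    unfolding nn_mark_integral_eq_marks_sum[OF \<eta>, symmetric] by (simp add: abs_divide)
  ultimately show ?thesis by (simp add: mark_integrable_def integrable_iff_bounded)
qed

lemma mark_integral_measurable:
  fixes g :: "'a \<Rightarrow> real \<Rightarrow> real"
  assumes g[measurable]: "case_prod g \<in> borel_measurable (borel \<Otimes>\<^sub>M borel)"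
  shows "mark_integral g \<in> borel_measurable discrete_radon_space"
proof -
  have [measurable]: "marks_sum (\<lambda>x s. ennreal \<bar>g x s\<bar>) \<in> borel_measurable discrete_radon_space"
    "marks_sum (\<lambda>x s. ennreal (g x s)) \<in> borel_measurable discrete_radon_space"
    "marks_sum (\<lambda>x s. ennreal (- g x s)) \<in> borel_measurable discrete_radon_space"
    by (intro marks_sum_measurable; measurable)+
  have "(\<lambda>\<eta>. if marks_sum (\<lambda>x s. ennreal \<bar>g x s\<bar>) \<eta> < \<infinity> then enn2real (marks_sum (\<lambda>x s. ennreal (g x s)) \<eta>)
     - enn2real (marks_sum (\<lambda>x s. ennreal (- g x s)) \<eta>) else 0) \<in> borel_measurable discrete_radon_space"
    by measurable
  moreover have "mark_integral g \<eta> = (if marks_sum (\<lambda>x s. ennreal \<bar>g x s\<bar>) \<eta> < \<infinity> then enn2real (marks_sum (\<lambda>x s. ennreal (g x s)) \<eta>)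
     - enn2real (marks_sum (\<lambda>x s. ennreal (- g x s)) \<eta>) else 0)" if \<eta>: "\<eta> \<in> space discrete_radon_space" for \<eta>
  proof (cases "mark_integrable g \<eta>")
    case True
    then have "mark_integral g \<eta> = enn2real (\<integral>\<^sup>+x. ennreal (g x (measure \<eta> {x}) / measure \<eta> {x}) \<partial>\<eta>)
       - enn2real (\<integral>\<^sup>+x. ennreal ((- g x (measure \<eta> {x})) / measure \<eta> {x}) \<partial>\<eta>)"
      unfolding mark_integral_def mark_integrable_def by (subst real_lebesgue_integral_def) auto
    then show ?thesis
      using True mark_integrable_iff[OF \<eta> g]
      by (simp only: nn_mark_integral_eq_marks_sum[OF \<eta>, of "\<lambda>x s. - g x s"] nn_mark_integral_eq_marks_sum[OF \<eta>, of g]) simp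
  next
    case False
    then show ?thesis
      using mark_integrable_iff[OF \<eta> g] by (simp add: mark_integral_def mark_integrable_def not_integrable_integral_eq)
  qed
  ultimately show ?thesis by (subst measurable_cong) auto
qed

lemma emeasure_add_atom_singleton:
  assumes \<eta>: "\<eta> \<in> space discrete_radon_space" and fresh: "emeasure \<eta> {x} = 0"
  shows "emeasure (add_atom \<eta> x s) {y :: 'a} = (if y = x then ennreal s else emeasure \<eta> {y})"
  using fresh by (subst emeasure_add_atom[OF space_discrete_radon_spaceD(2)[OF \<eta>]]) auto

lemma fresh_AE:
  assumes \<eta>: "\<eta> \<in> space discrete_radon_space" and fresh: "emeasure \<eta> {x :: 'a} = 0"
  shows "AE y in \<eta>. y \<noteq> x"
proof -
  have "{x} \<in> null_sets \<eta>" using fresh space_discrete_radon_spaceD(2)[OF \<eta>] by (intro null_setsI) auto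
  then have "AE y in \<eta>. y \<notin> {x}" by (rule AE_not_in)
  then show ?thesis by simp
qed

lemma add_atom_in_space:
  "\<eta> \<in> space discrete_radon_space \<Longrightarrow> add_atom \<eta> (x :: 'a) s \<in> space discrete_radon_space"
  by (simp add: space_discrete_radon_space add_atom_discrete)

text \<open>An atom added at a point without mass leaves the marks of all other atoms alone, and \<open>\<eta>\<close> does not see the
new point.\<close>
lemma marks_sum_add_atom:
  fixes h :: "'a \<Rightarrow> real \<Rightarrow> ennreal"
  assumes \<eta>: "\<eta> \<in> space discrete_radon_space" and fresh: "emeasure \<eta> {x} = 0" and s: "0 < s"
    and h: "case_prod h \<in> borel_measurable (borel \<Otimes>\<^sub>M borel)"
  shows "marks_sum h (add_atom \<eta> x s) = marks_sum h \<eta> + h x s"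
proof -
  let ?a = "add_atom \<eta> x s"
  note e = emeasure_add_atom_singleton[OF \<eta> fresh]
  have "marks_sum h ?a = (\<integral>\<^sup>+y. h y (measure ?a {y}) / emeasure ?a {y} \<partial>\<eta>) + ennreal s * (h x (measure ?a {x}) / emeasure ?a {x})"
    unfolding marks_sum_def
    by (rule nn_integral_add_atom[OF space_discrete_radon_spaceD(2)[OF \<eta>] mark_term_measurable(2)[OF add_atom_in_space[OF \<eta>] h]])
  also have "(\<integral>\<^sup>+y. h y (measure ?a {y}) / emeasure ?a {y} \<partial>\<eta>) = marks_sum h \<eta>"
    unfolding marks_sum_def
  proof (rule nn_integral_cong_AE)
    show "AE y in \<eta>. h y (measure ?a {y}) / emeasure ?a {y} = h y (measure \<eta> {y}) / emeasure \<eta> {y}"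
      using fresh_AE[OF \<eta> fresh] by eventually_elim (simp add: e measure_def)
  qed
  also have "ennreal s * (h x (measure ?a {x}) / emeasure ?a {x}) = h x s"
  proof -
    have "measure ?a {x} = s" using s by (simp add: measure_def e)
    moreover have "ennreal s * (h x s / ennreal s) = h x s"
      using s mult_divide_eq_ennreal[of "ennreal s" "h x s"] by (simp add: ennreal_times_divide mult.commute)
    ultimately show ?thesis by (simp add: e)
  qed
  finally show ?thesis .
qed

lemma integral_add_atom:
  fixes u :: "'a \<Rightarrow> real"
  assumes \<eta>: "\<eta> \<in> space discrete_radon_space" and u[measurable]: "u \<in> borel_measurable borel" and int: "integrable \<eta> u" and s: "0 \<le> s"
  shows "integrable (add_atom \<eta> x s) u" "(LINT y|add_atom \<eta> x s. u y) = (LINT y|\<eta>. u y) + s * u x"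
proof -
  note sets = space_discrete_radon_spaceD(2)[OF \<eta>]
  have um: "u \<in> borel_measurable (add_atom \<eta> x s)" by (simp add: measurable_cong_sets[OF sets_add_atom refl])
  have nn: "(\<integral>\<^sup>+y. ennreal (v (u y)) \<partial>add_atom \<eta> x s) = (\<integral>\<^sup>+y. ennreal (v (u y)) \<partial>\<eta>) + ennreal s * ennreal (v (u x))"
    if [measurable]: "v \<in> borel_measurable borel" for v :: "real \<Rightarrow> real"
    by (rule nn_integral_add_atom[OF sets]) measurable
  have fin: "(\<integral>\<^sup>+y. ennreal \<bar>u y\<bar> \<partial>\<eta>) < \<infinity>" using int by (simp add: integrable_iff_bounded)
  show int': "integrable (add_atom \<eta> x s) u"
    using um fin nn[of abs] by (simp add: integrable_iff_bounded ennreal_mult_less_top)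
  have finp: "(\<integral>\<^sup>+y. ennreal (u y) \<partial>\<eta>) < \<infinity>" "(\<integral>\<^sup>+y. ennreal (- u y) \<partial>\<eta>) < \<infinity>"
    by (rule le_less_trans[OF nn_integral_mono fin]; intro ennreal_leI abs_ge_self abs_ge_minus_self)+
  have pos: "enn2real (ennreal s * ennreal v) = s * max 0 v" for v
    using s by (simp add: enn2real_mult max_def ennreal_neg)
  show "(LINT y|add_atom \<eta> x s. u y) = (LINT y|\<eta>. u y) + s * u x"
    unfolding real_lebesgue_integral_def[OF int'] real_lebesgue_integral_def[OF int] nn[of "\<lambda>v. v", simplified] nn[of uminus, simplified]
    using finp by (subst (1 2) enn2real_plus) (auto simp: pos ennreal_mult_less_top max_def algebra_simps)
qed

lemma mark_integral_add_atom:
  fixes g :: "'a \<Rightarrow> real \<Rightarrow> real"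
  assumes \<eta>: "\<eta> \<in> space discrete_radon_space" and fresh: "emeasure \<eta> {x} = 0" and s: "0 < s"
    and g: "case_prod g \<in> borel_measurable (borel \<Otimes>\<^sub>M borel)" and int: "mark_integrable g \<eta>"
  shows "mark_integral g (add_atom \<eta> x s) = mark_integral g \<eta> + g x s"
proof -
  let ?a = "add_atom \<eta> x s"
  define u where "u y = g y (measure ?a {y}) / measure ?a {y}" for y
  note e = emeasure_add_atom_singleton[OF \<eta> fresh]
  have um: "u \<in> borel_measurable borel" unfolding u_def by (rule mark_term_measurable(1)[OF add_atom_in_space[OF \<eta>] g])
  have um': "u \<in> borel_measurable \<eta>" using um measurable_cong_sets[OF space_discrete_radon_spaceD(2)[OF \<eta>] refl] by blast
  have gm': "(\<lambda>x. g x (measure \<eta> {x}) / measure \<eta> {x}) \<in> borel_measurable \<eta>"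
    using mark_term_measurable(1)[OF \<eta> g] measurable_cong_sets[OF space_discrete_radon_spaceD(2)[OF \<eta>] refl] by blast
  have AE: "AE y in \<eta>. u y = g y (measure \<eta> {y}) / measure \<eta> {y}"
    using fresh_AE[OF \<eta> fresh] by eventually_elim (simp add: u_def e measure_def)
  have iu: "integrable \<eta> u"
    using int unfolding mark_integrable_def by (subst integrable_cong_AE[OF um' gm' AE])
  have "mark_integral g ?a = (LINT y|\<eta>. u y) + s * u x"
    unfolding mark_integral_def u_def[symmetric] using s by (intro integral_add_atom[OF \<eta> um iu]) simp
  also have "(LINT y|\<eta>. u y) = mark_integral g \<eta>"
    unfolding mark_integral_def by (rule integral_cong_AE[OF um' gm' AE])
  also have "s * u x = g x s" using s by (simp add: u_def measure_def e)
  finally show ?thesis .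
qed

lemma marks_sum_finite_set:
  fixes h :: "'a \<Rightarrow> real \<Rightarrow> ennreal"
  assumes \<eta>: "\<eta> \<in> space discrete_radon_space" and fin: "finite F" "F \<subseteq> atoms \<eta>"
  shows "(\<integral>\<^sup>+x. h x (measure \<eta> {x}) / emeasure \<eta> {x} * indicator F x \<partial>\<eta>) = (\<Sum>x\<in>F. h x (measure \<eta> {x}))"
proof -
  have "(\<integral>\<^sup>+x. h x (measure \<eta> {x}) / emeasure \<eta> {x} * indicator F x \<partial>\<eta>) = (\<Sum>x\<in>F. h x (measure \<eta> {x}) / emeasure \<eta> {x} * emeasure \<eta> {x})"
    using space_discrete_radon_spaceD(2)[OF \<eta>] by (intro nn_integral_indicator_finite[OF fin(1)]) auto
  also have "\<dots> = (\<Sum>x\<in>F. h x (measure \<eta> {x}))"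
  proof (intro sum.cong refl)
    fix x assume "x \<in> F"
    then have "0 < emeasure \<eta> {x}" "emeasure \<eta> {x} < \<infinity>"
      using fin(2) atom_mass_finite(2)[OF space_discrete_radon_spaceD(1)[OF \<eta>]] by (auto simp: atoms_def)
    then show "h x (measure \<eta> {x}) / emeasure \<eta> {x} * emeasure \<eta> {x} = h x (measure \<eta> {x})"
      using mult_divide_eq_ennreal[of "emeasure \<eta> {x}" "h x (measure \<eta> {x})"]
      by (simp add: ennreal_times_divide mult.commute less_top[symmetric])
  qed
  finally show ?thesis .
qed

text \<open>Together with \<open>mark_count_integer\<close> this says that \<open>marks_sum\<close> of an indicator is a counting variable, with values
in the natural numbers or infinite.\<close>
lemma finitely_many_marks:
  fixes D :: "('a \<times> real) set"
  assumes \<eta>: "\<eta> \<in> space discrete_radon_space"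
    and D[measurable]: "D \<in> sets (borel \<Otimes>\<^sub>M borel)" and N: "marks_sum (\<lambda>x s. indicator D (x, s)) \<eta> < \<infinity>"
  shows "finite {x \<in> atoms \<eta>. (x, measure \<eta> {x}) \<in> D}"
proof (rule ccontr)
  let ?E = "{x \<in> atoms \<eta>. (x, measure \<eta> {x}) \<in> D}"
  assume inf: "infinite ?E"
  have "of_nat n \<le> marks_sum (\<lambda>x s. indicator D (x, s)) \<eta>" for n
  proof -
    obtain F where F: "F \<subseteq> ?E" "finite F" "card F = n"
      using infinite_arbitrarily_large[OF inf] by blast
    have "of_nat n = (\<Sum>x\<in>F. (indicator D (x, measure \<eta> {x}) :: ennreal))"
    proof -
      have "(\<Sum>x\<in>F. (indicator D (x, measure \<eta> {x}) :: ennreal)) = (\<Sum>x\<in>F. 1)" using F(1) by (intro sum.cong) auto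
      then show ?thesis using F(3) by simp
    qed
    also have "\<dots> = (\<integral>\<^sup>+x. indicator D (x, measure \<eta> {x}) / emeasure \<eta> {x} * indicator F x \<partial>\<eta>)"
      using F by (intro marks_sum_finite_set[OF \<eta>, symmetric]) auto
    also have "\<dots> \<le> marks_sum (\<lambda>x s. indicator D (x, s)) \<eta>"
      unfolding marks_sum_def by (intro nn_integral_mono) (auto simp: indicator_def)
    finally show ?thesis .
  qed
  moreover obtain n :: nat where "marks_sum (\<lambda>x s. indicator D (x, s)) \<eta> < of_nat n"
    using N ennreal_Ex_less_of_nat by auto
  ultimately show False by (meson leD)
qed

lemma marks_sum_eq_sum:
  fixes D :: "('a \<times> real) set" and h :: "'a \<Rightarrow> real \<Rightarrow> ennreal"
  assumes \<eta>: "\<eta> \<in> space discrete_radon_space"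
    and D: "D \<in> sets (borel \<Otimes>\<^sub>M borel)" and N: "marks_sum (\<lambda>x s. indicator D (x, s)) \<eta> < \<infinity>"
    and h: "\<And>x s. (x, s) \<notin> D \<Longrightarrow> h x s = 0"
  shows "marks_sum h \<eta> = (\<Sum>x\<in>{x \<in> atoms \<eta>. (x, measure \<eta> {x}) \<in> D}. h x (measure \<eta> {x}))"
proof -
  let ?E = "{x \<in> atoms \<eta>. (x, measure \<eta> {x}) \<in> D}"
  have "marks_sum h \<eta> = (\<integral>\<^sup>+x. h x (measure \<eta> {x}) / emeasure \<eta> {x} * indicator ?E x \<partial>\<eta>)"
    unfolding marks_sum_def
  proof (rule nn_integral_cong_AE)
    show "AE x in \<eta>. h x (measure \<eta> {x}) / emeasure \<eta> {x} = h x (measure \<eta> {x}) / emeasure \<eta> {x} * indicator ?E x"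
      using countable_atoms_discrete(3)[OF space_discrete_radon_spaceD(4)[OF \<eta>]]
      by eventually_elim (auto simp: indicator_def h)
  qed
  also have "\<dots> = (\<Sum>x\<in>?E. h x (measure \<eta> {x}))"
    by (rule marks_sum_finite_set[OF \<eta> finitely_many_marks[OF \<eta> D N]]) auto
  finally show ?thesis .
qed

lemma mark_count_integer:
  fixes D :: "('a \<times> real) set"
  assumes \<eta>: "\<eta> \<in> space discrete_radon_space"
    and D: "D \<in> sets (borel \<Otimes>\<^sub>M borel)" and N: "marks_sum (\<lambda>x s. indicator D (x, s)) \<eta> < \<infinity>"
  shows "marks_sum (\<lambda>x s. indicator D (x, s)) \<eta> = of_nat (card {x \<in> atoms \<eta>. (x, measure \<eta> {x}) \<in> D})"
  by (subst marks_sum_eq_sum[OF \<eta> D N]) auto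

lemma mark_integrable_finite_count:
  fixes D :: "('a \<times> real) set" and g :: "'a \<Rightarrow> real \<Rightarrow> real"
  assumes \<eta>: "\<eta> \<in> space discrete_radon_space"
    and D: "D \<in> sets (borel \<Otimes>\<^sub>M borel)" and N: "marks_sum (\<lambda>x s. indicator D (x, s)) \<eta> < \<infinity>"
    and g: "\<And>x s. (x, s) \<notin> D \<Longrightarrow> g x s = 0" and gm: "case_prod g \<in> borel_measurable (borel \<Otimes>\<^sub>M borel)"
  shows "mark_integrable g \<eta>"
  unfolding mark_integrable_iff[OF \<eta> gm]
  using finitely_many_marks[OF \<eta> D N] by (subst marks_sum_eq_sum[OF \<eta> D N]) (auto simp: g less_top[symmetric] sum_Pinfty)

end

context completely_random_measure
begin

text \<open>For fixed \<open>\<eta>\<close> the exceptional points are the countably many atoms of \<open>\<eta>\<close>, which \<open>m\<close> does not charge.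
Exchange the order of integration.\<close>
lemma fresh_atom: "AE z in m. AE \<eta> in \<mu>. emeasure \<eta> {fst z} = 0"
proof -
  have am: "(\<lambda>p. emeasure (snd p) {fst (fst p)}) \<in> borel_measurable (m \<Otimes>\<^sub>M \<mu>)"
  proof -
    have "(\<lambda>p. (snd p, fst (fst p))) \<in> measurable (m \<Otimes>\<^sub>M \<mu>) (discrete_radon_space \<Otimes>\<^sub>M borel)" by measurable
    from measurable_compose[OF this measure_atom_measurable(2)[OF lc]] show ?thesis by simp
  qed
  define f where "f z \<eta> = (if emeasure \<eta> {fst z} = 0 then 0 else 1 :: ennreal)" for z :: "'a \<times> real" and \<eta> :: "'a measure"
  have fm[measurable]: "case_prod f \<in> borel_measurable (m \<Otimes>\<^sub>M \<mu>)"
    unfolding f_def split_beta' using am by measurable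
  have "(\<integral>\<^sup>+z. \<integral>\<^sup>+\<eta>. f z \<eta> \<partial>\<mu> \<partial>m) = (\<integral>\<^sup>+\<eta>. \<integral>\<^sup>+z. f z \<eta> \<partial>m \<partial>\<mu>)"
    by (rule Fubini'[OF fm, symmetric])
  also have "\<dots> = (\<integral>\<^sup>+\<eta>. 0 \<partial>\<mu>)"
  proof (rule nn_integral_cong)
    fix \<eta> assume "\<eta> \<in> space \<mu>"
    then have c: "countable (atoms \<eta>)"
      using countable_atoms_discrete(1) space_discrete_radon_spaceD(4) by (auto simp: space_\<mu>)
    have "atoms \<eta> \<times> UNIV \<in> sets m" using countable_in_borel[OF c] by measurable
    then have "atoms \<eta> \<times> UNIV \<in> null_sets m" using diffuse[OF c] by (intro null_setsI)
    from AE_not_in[OF this] have "AE z in m. f z \<eta> = 0"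
      by eventually_elim (auto simp: f_def atoms_def zero_less_iff_neq_zero)
    then have "(\<integral>\<^sup>+z. f z \<eta> \<partial>m) = (\<integral>\<^sup>+z. 0 \<partial>m)" by (rule nn_integral_cong_AE)
    then show "(\<integral>\<^sup>+z. f z \<eta> \<partial>m) = 0" by simp
  qed
  finally have "(\<integral>\<^sup>+z. \<integral>\<^sup>+\<eta>. f z \<eta> \<partial>\<mu> \<partial>m) = 0" by simp
  then have zero: "AE z in m. (\<integral>\<^sup>+\<eta>. f z \<eta> \<partial>\<mu>) = 0"
    by (subst (asm) nn_integral_0_iff_AE) measurable
  have "AE \<eta> in \<mu>. emeasure \<eta> {fst z} = 0" if "(\<integral>\<^sup>+\<eta>. f z \<eta> \<partial>\<mu>) = 0" for z
  proof -
    have "f z \<in> borel_measurable \<mu>" using measurable_Pair2[OF fm, of z] by (simp add: space_m)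
    then have "AE \<eta> in \<mu>. f z \<eta> = 0" using that by (simp add: nn_integral_0_iff_AE)
    then show ?thesis by eventually_elim (auto simp: f_def split: if_splits)
  qed
  with zero show ?thesis by (rule eventually_mono)
qed

text \<open>At a fresh point the new atom of \<open>\<eta> + s \<delta>\<^sub>x\<close> has mass exactly \<open>s\<close>, so the factor \<open>s\<close> of the Mecke
formula cancels the division by the atom mass in \<open>marks_sum\<close>.\<close>
lemma marked_Mecke:
  assumes h[measurable]: "case_prod h \<in> borel_measurable (borel \<Otimes>\<^sub>M borel)"
    and W[measurable]: "W \<in> borel_measurable discrete_radon_space"
  shows "(\<integral>\<^sup>+\<eta>. marks_sum h \<eta> * W \<eta> \<partial>\<mu>)
       = (\<integral>\<^sup>+z. \<integral>\<^sup>+\<eta>. h (fst z) (snd z) * W (add_atom \<eta> (fst z) (snd z)) \<partial>\<mu> \<partial>m)"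
proof -
  note [measurable] = measure_atom_measurable[OF lc]
  define H where "H p = h (snd p) (measure (fst p) {snd p}) / emeasure (fst p) {snd p} * W (fst p)" for p
  have Hm: "H \<in> borel_measurable (discrete_radon_space \<Otimes>\<^sub>M borel)" unfolding H_def by measurable
  have "(\<integral>\<^sup>+\<eta>. marks_sum h \<eta> * W \<eta> \<partial>\<mu>) = (\<integral>\<^sup>+\<eta>. \<integral>\<^sup>+x. H (\<eta>, x) \<partial>\<eta> \<partial>\<mu>)"
  proof (rule nn_integral_cong)
    fix \<eta> assume "\<eta> \<in> space \<mu>"
    then have \<eta>: "\<eta> \<in> space discrete_radon_space" by (simp add: space_\<mu>)
    have "(\<lambda>x. h x (measure \<eta> {x}) / emeasure \<eta> {x}) \<in> borel_measurable \<eta>"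
      using mark_term_measurable(2)[OF lc \<eta> h] measurable_cong_sets[OF space_discrete_radon_spaceD(2)[OF \<eta>] refl] by blast
    then show "marks_sum h \<eta> * W \<eta> = (\<integral>\<^sup>+x. H (\<eta>, x) \<partial>\<eta>)"
      by (simp add: marks_sum_def H_def nn_integral_multc)
  qed
  also have "\<dots> = (\<integral>\<^sup>+z. \<integral>\<^sup>+\<eta>. ennreal (snd z) * H (add_atom \<eta> (fst z) (snd z), fst z) \<partial>\<mu> \<partial>m)"
    by (rule Mecke[OF Hm])
  also have "\<dots> = (\<integral>\<^sup>+z. \<integral>\<^sup>+\<eta>. h (fst z) (snd z) * W (add_atom \<eta> (fst z) (snd z)) \<partial>\<mu> \<partial>m)"
  proof (rule nn_integral_cong_AE, use fresh_atom positive_marks in eventually_elim, rule nn_integral_cong_AE)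
    fix z :: "'a \<times> real"
    assume fr: "AE \<eta> in \<mu>. emeasure \<eta> {fst z} = 0" and s: "0 < snd z"
    show "AE \<eta> in \<mu>. ennreal (snd z) * H (add_atom \<eta> (fst z) (snd z), fst z) = h (fst z) (snd z) * W (add_atom \<eta> (fst z) (snd z))"
      using fr AE_space
    proof eventually_elim
      case (elim \<eta>)
      have e: "emeasure (add_atom \<eta> (fst z) (snd z)) {fst z} = ennreal (snd z)"
        using elim by (subst emeasure_add_atom_singleton[OF lc]) (auto simp: space_\<mu>)
      moreover have "measure (add_atom \<eta> (fst z) (snd z)) {fst z} = snd z" using s by (simp add: measure_def e)
      moreover have "ennreal (snd z) * (h (fst z) (snd z) / ennreal (snd z)) = h (fst z) (snd z)"
        using s mult_divide_eq_ennreal[of "ennreal (snd z)" "h (fst z) (snd z)"] by (simp add: ennreal_times_divide mult.commute)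
      ultimately show ?case by (simp add: H_def mult.assoc[symmetric])
    qed
  qed
  finally show ?thesis .
qed

lemma expected_marks_sum:
  assumes h[measurable]: "case_prod h \<in> borel_measurable (borel \<Otimes>\<^sub>M borel)"
  shows "(\<integral>\<^sup>+\<eta>. marks_sum h \<eta> \<partial>\<mu>) = (\<integral>\<^sup>+z. h (fst z) (snd z) \<partial>m)"
  using marked_Mecke[OF h, of "\<lambda>_. 1"] by (simp add: \<mu>.emeasure_space_1)

lemma AE_marks_sum_finite:
  assumes h: "case_prod h \<in> borel_measurable (borel \<Otimes>\<^sub>M borel)" and fin: "(\<integral>\<^sup>+z. h (fst z) (snd z) \<partial>m) < \<infinity>"
  shows "AE \<eta> in \<mu>. marks_sum h \<eta> < \<infinity>"
proof -
  have "marks_sum h \<in> borel_measurable \<mu>"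
    using marks_sum_measurable[OF lc h] by (simp add: measurable_cong_sets[OF sets_\<mu> refl])
  then have "AE \<eta> in \<mu>. marks_sum h \<eta> \<noteq> \<infinity>"
    using fin expected_marks_sum[OF h] by (intro nn_integral_PInf_AE) auto
  then show ?thesis by (simp add: less_top)
qed

end

section \<open>The exponential formula\<close>

context completely_random_measure
begin

text \<open>Where \<open>\<bar>e\<^sup>g - 1\<bar> \<le> 1/2\<close>, the function \<open>\<bar>g\<bar>\<close> is at most \<open>2 \<bar>e\<^sup>g - 1\<bar>\<close> and the sum has finite
expectation. The complement has finite measure, hence almost surely contributes only finitely many terms.\<close>
lemma AE_mark_integrable:
  fixes g :: "'a \<Rightarrow> real \<Rightarrow> real"
  assumes g[measurable]: "case_prod g \<in> borel_measurable (borel \<Otimes>\<^sub>M borel)"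
    and fin: "(\<integral>\<^sup>+z. ennreal \<bar>exp (g (fst z) (snd z)) - 1\<bar> \<partial>m) < \<infinity>"
  shows "AE \<eta> in \<mu>. mark_integrable g \<eta>"
proof -
  define D where "D = {z. 1 / 2 < \<bar>exp (g (fst z) (snd z)) - 1\<bar>}"
  have Dm[measurable]: "D \<in> sets (borel \<Otimes>\<^sub>M borel)"
  proof -
    have "{z \<in> space (borel \<Otimes>\<^sub>M borel). 1 / 2 < \<bar>exp (g (fst z) (snd z)) - 1\<bar>} \<in> sets (borel \<Otimes>\<^sub>M borel)" by measurable
    then show ?thesis by (simp add: D_def space_pair_measure)
  qed
  define g1 g2 where "g1 x s = g x s * indicator D (x, s)" and "g2 x s = g x s * indicator (- D) (x, s)" for x s
  have gm[measurable]: "case_prod g1 \<in> borel_measurable (borel \<Otimes>\<^sub>M borel)" "case_prod g2 \<in> borel_measurable (borel \<Otimes>\<^sub>M borel)"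
    unfolding g1_def g2_def by measurable
  have "(\<integral>\<^sup>+z. indicator D z \<partial>m) \<le> (\<integral>\<^sup>+z. 2 * ennreal \<bar>exp (g (fst z) (snd z)) - 1\<bar> \<partial>m)"
  proof (rule nn_integral_mono)
    fix z
    have "indicator D z \<le> ennreal (2 * \<bar>exp (g (fst z) (snd z)) - 1\<bar>)" by (auto simp: D_def indicator_def)
    then show "indicator D z \<le> 2 * ennreal \<bar>exp (g (fst z) (snd z)) - 1\<bar>" by (simp add: ennreal_mult')
  qed
  also have "\<dots> < \<infinity>" using fin by (simp add: nn_integral_cmult ennreal_mult_less_top)
  finally have D: "(\<integral>\<^sup>+z. indicator D (fst z, snd z) \<partial>m) < \<infinity>" by simp
  have AE1: "AE \<eta> in \<mu>. marks_sum (\<lambda>x s. indicator D (x, s)) \<eta> < \<infinity>"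
    using D by (intro AE_marks_sum_finite) auto
  have small: "\<bar>g2 x s\<bar> \<le> 2 * \<bar>exp (g x s) - 1\<bar>" for x s
  proof (cases "(x, s) \<in> D")
    case False
    define v where "v = exp (g x s)"
    have v: "1 / 2 \<le> v" "\<bar>v - 1\<bar> \<le> 1 / 2" proof -
      show "\<bar>v - 1\<bar> \<le> 1 / 2" using False by (simp add: D_def v_def)
      then show "1 / 2 \<le> v" by linarith
    qed
    \<comment> \<open>for \<open>v < 1\<close> the bound comes from \<open>ln (1/v) \<le> 1/v - 1\<close>, and \<open>v \<ge> 1/2\<close> gives the factor \<open>2\<close>\<close>
    have "\<bar>ln v\<bar> \<le> 2 * \<bar>v - 1\<bar>"
    proof (cases "1 \<le> v")
      case True
      then show ?thesis using ln_le_minus_one[of v] by (auto simp: abs_if)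
    next
      case False
      have "- ln v = ln (1 / v)" using v by (simp add: ln_div)
      also have "\<dots> \<le> 1 / v - 1" using v by (intro ln_le_minus_one) auto
      also have "\<dots> = (1 - v) / v" using v by (simp add: field_simps)
      also have "\<dots> \<le> (1 - v) / (1 / 2)" using v False by (intro divide_left_mono) auto
      finally show ?thesis using False v by (simp add: abs_if)
    qed
    then show ?thesis using False by (simp add: v_def g2_def)
  qed (simp add: g2_def)
  have "(\<integral>\<^sup>+z. ennreal \<bar>g2 (fst z) (snd z)\<bar> \<partial>m) \<le> (\<integral>\<^sup>+z. 2 * ennreal \<bar>exp (g (fst z) (snd z)) - 1\<bar> \<partial>m)"
    using small by (intro nn_integral_mono) (simp add: ennreal_mult'[symmetric] ennreal_leI del: ennreal_mult' flip: ennreal_numeral)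
  also have "\<dots> < \<infinity>" using fin by (simp add: nn_integral_cmult ennreal_mult_less_top)
  finally have AE2: "AE \<eta> in \<mu>. marks_sum (\<lambda>x s. ennreal \<bar>g2 x s\<bar>) \<eta> < \<infinity>"
    by (intro AE_marks_sum_finite) auto
  show ?thesis
    using AE1 AE2 AE_space
  proof eventually_elim
    case (elim \<eta>)
    then have \<eta>: "\<eta> \<in> space discrete_radon_space" by (simp add: space_\<mu>)
    have "mark_integrable g1 \<eta>"
      by (rule mark_integrable_finite_count[OF lc \<eta> Dm elim(1) _ gm(1)]) (simp add: g1_def)
    moreover have "mark_integrable g2 \<eta>" using elim(2) mark_integrable_iff[OF lc \<eta> gm(2)] by simp
    ultimately have "mark_integrable (\<lambda>x s. g1 x s + g2 x s) \<eta>"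
      by (simp add: mark_integrable_def add_divide_distrib)
    moreover have "g1 x s + g2 x s = g x s" for x s by (simp add: g1_def g2_def indicator_def)
    ultimately show ?case by simp
  qed
qed

text \<open>Since \<open>N = k + 1\<close> on the event, the left side is \<open>E [N W; N = k + 1]\<close>; the marked Mecke formula replaces the sum
\<open>N\<close> by one added atom, which changes the condition to \<open>N = k\<close> and contributes the factor \<open>w\<close>.\<close>
lemma count_recursion:
  fixes w :: "'a \<times> real \<Rightarrow> ennreal" and D :: "('a \<times> real) set"
  defines "N \<equiv> marks_sum (\<lambda>x s. indicator D (x, s))"
  assumes D[measurable]: "D \<in> sets (borel \<Otimes>\<^sub>M borel)"
    and W[measurable]: "W \<in> borel_measurable discrete_radon_space" and w[measurable]: "w \<in> borel_measurable (borel \<Otimes>\<^sub>M borel)"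
    and add: "AE \<eta> in \<mu>. \<forall>x s. 0 < s \<longrightarrow> emeasure \<eta> {x} = 0 \<longrightarrow> (x, s) \<in> D \<longrightarrow> W (add_atom \<eta> x s) = w (x, s) * W \<eta>"
  shows "of_nat (Suc k) * (\<integral>\<^sup>+\<eta>. W \<eta> * indicator {\<eta>. N \<eta> = of_nat (Suc k)} \<eta> \<partial>\<mu>)
       = (\<integral>\<^sup>+z. w z * indicator D z \<partial>m) * (\<integral>\<^sup>+\<eta>. W \<eta> * indicator {\<eta>. N \<eta> = of_nat k} \<eta> \<partial>\<mu>)"
proof -
  have hD: "case_prod (\<lambda>x s. indicator D (x, s) :: ennreal) \<in> borel_measurable (borel \<Otimes>\<^sub>M borel)" by measurable
  have Nm[measurable]: "N \<in> borel_measurable discrete_radon_space"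
    unfolding N_def by (rule marks_sum_measurable[OF lc hD])
  define V where "V j \<eta> = W \<eta> * (if N \<eta> = of_nat j then 1 else 0)" for j :: nat and \<eta>
  have Vm[measurable]: "V j \<in> borel_measurable discrete_radon_space" for j unfolding V_def by measurable
  have V: "W \<eta> * indicator {\<eta>. N \<eta> = of_nat j} \<eta> = V j \<eta>" for j \<eta> by (simp add: V_def)
  have "of_nat (Suc k) * (\<integral>\<^sup>+\<eta>. V (Suc k) \<eta> \<partial>\<mu>) = (\<integral>\<^sup>+\<eta>. N \<eta> * V (Suc k) \<eta> \<partial>\<mu>)"
    by (subst nn_integral_cmult[symmetric]) (auto intro!: nn_integral_cong simp: V_def)
  also have "\<dots> = (\<integral>\<^sup>+z. \<integral>\<^sup>+\<eta>. indicator D (fst z, snd z) * V (Suc k) (add_atom \<eta> (fst z) (snd z)) \<partial>\<mu> \<partial>m)"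
    unfolding N_def by (rule marked_Mecke[OF hD Vm])
  also have "\<dots> = (\<integral>\<^sup>+z. \<integral>\<^sup>+\<eta>. (w z * indicator D z) * V k \<eta> \<partial>\<mu> \<partial>m)"
  proof (rule nn_integral_cong_AE, use fresh_atom positive_marks in eventually_elim, rule nn_integral_cong_AE)
    fix z :: "'a \<times> real"
    assume fr: "AE \<eta> in \<mu>. emeasure \<eta> {fst z} = 0" and s: "0 < snd z"
    show "AE \<eta> in \<mu>. indicator D (fst z, snd z) * V (Suc k) (add_atom \<eta> (fst z) (snd z)) = (w z * indicator D z) * V k \<eta>"
      using fr add AE_space
    proof eventually_elim
      case (elim \<eta>)
      then have \<eta>: "\<eta> \<in> space discrete_radon_space" by (simp add: space_\<mu>)
      show ?case
      proof (cases "z \<in> D")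
        case True
        have "W (add_atom \<eta> (fst z) (snd z)) = w z * W \<eta>" using elim(1,2) s True by simp
        moreover have "N (add_atom \<eta> (fst z) (snd z)) = N \<eta> + 1"
          unfolding N_def using True by (subst marks_sum_add_atom[OF lc \<eta> elim(1) s hD]) simp
        moreover have "N \<eta> + 1 = of_nat (Suc k) \<longleftrightarrow> N \<eta> = of_nat k"
          by (cases "N \<eta>") (auto simp: ennreal_of_nat_eq_real_of_nat ennreal_plus[symmetric] simp flip: ennreal_1 simp del: ennreal_plus ennreal_1)
        ultimately show ?thesis using True by (simp add: V_def mult.assoc del: of_nat_Suc)
      qed simp
    qed
  qed
  also have "\<dots> = (\<integral>\<^sup>+z. (w z * indicator D z) * (\<integral>\<^sup>+\<eta>. V k \<eta> \<partial>\<mu>) \<partial>m)"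
    by (simp add: nn_integral_cmult)
  also have "\<dots> = (\<integral>\<^sup>+z. w z * indicator D z \<partial>m) * (\<integral>\<^sup>+\<eta>. V k \<eta> \<partial>\<mu>)"
    by (rule nn_integral_multc) measurable
  finally show ?thesis unfolding V .
qed

text \<open>Solving the recursion, \<open>E [W; N = k] = L ^ k / k! E [W; N = 0]\<close>.\<close>
lemma Poisson_expansion:
  fixes w :: "'a \<times> real \<Rightarrow> ennreal" and D :: "('a \<times> real) set"
  defines "N \<equiv> marks_sum (\<lambda>x s. indicator D (x, s))"
  assumes D[measurable]: "D \<in> sets (borel \<Otimes>\<^sub>M borel)" and Dfin: "emeasure m D < \<infinity>"
    and W[measurable]: "W \<in> borel_measurable discrete_radon_space" and w: "w \<in> borel_measurable (borel \<Otimes>\<^sub>M borel)"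
    and add: "AE \<eta> in \<mu>. \<forall>x s. 0 < s \<longrightarrow> emeasure \<eta> {x} = 0 \<longrightarrow> (x, s) \<in> D \<longrightarrow> W (add_atom \<eta> x s) = w (x, s) * W \<eta>"
    and L: "(\<integral>\<^sup>+z. w z * indicator D z \<partial>m) = ennreal L" "0 \<le> L"
  shows "(\<integral>\<^sup>+\<eta>. W \<eta> \<partial>\<mu>) = ennreal (exp L) * (\<integral>\<^sup>+\<eta>. W \<eta> * indicator {\<eta>. N \<eta> = 0} \<eta> \<partial>\<mu>)"
proof -
  have hD: "case_prod (\<lambda>x s. indicator D (x, s) :: ennreal) \<in> borel_measurable (borel \<Otimes>\<^sub>M borel)" by measurable
  have Nm[measurable]: "N \<in> borel_measurable discrete_radon_space"
    unfolding N_def by (rule marks_sum_measurable[OF lc hD])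
  define a where "a k = (\<integral>\<^sup>+\<eta>. W \<eta> * indicator {\<eta>. N \<eta> = of_nat k} \<eta> \<partial>\<mu>)" for k
  have rec: "of_nat (Suc k) * a (Suc k) = ennreal L * a k" for k
    unfolding a_def N_def L(1)[symmetric] by (rule count_recursion[OF D W w add])
  have a: "a k = ennreal (L ^ k / fact k) * a 0" for k
  proof (induction k)
    case (Suc k)
    have "a (Suc k) = ennreal (1 / real (Suc k)) * (of_nat (Suc k) * a (Suc k))"
      by (simp add: mult.assoc[symmetric] ennreal_of_nat_eq_real_of_nat ennreal_mult'[symmetric] del: of_nat_Suc)
    also have "\<dots> = ennreal (1 / real (Suc k)) * ennreal L * ennreal (L ^ k / fact k) * a 0"
      unfolding rec Suc by (simp add: mult.assoc)
    also have "ennreal (1 / real (Suc k)) * ennreal L * ennreal (L ^ k / fact k) = ennreal (L ^ Suc k / fact (Suc k))"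
      using L(2) by (simp add: ennreal_mult[symmetric] field_simps)
    finally show ?case .
  qed simp
  have "AE \<eta> in \<mu>. N \<eta> < \<infinity>"
    unfolding N_def using Dfin D by (intro AE_marks_sum_finite[OF hD]) (simp add: sets_m)
  then have "AE \<eta> in \<mu>. W \<eta> = (\<Sum>k. W \<eta> * indicator {\<eta>. N \<eta> = of_nat k} \<eta>)"
    using AE_space
  proof eventually_elim
    case (elim \<eta>)
    then have "\<eta> \<in> space discrete_radon_space" by (simp add: space_\<mu>)
    then obtain j :: nat where j: "N \<eta> = of_nat j"
      using mark_count_integer[OF lc _ D] elim(1) unfolding N_def by blast
    have "(\<Sum>k. W \<eta> * indicator {\<eta>. N \<eta> = of_nat k} \<eta>) = (\<Sum>k. if k = j then W \<eta> else 0)"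
      by (intro arg_cong[where f=suminf] ext) (auto simp: j indicator_def)
    also have "\<dots> = W \<eta>" by (subst suminf_finite[of "{j}"]) auto
    finally show ?case by simp
  qed
  then have "(\<integral>\<^sup>+\<eta>. W \<eta> \<partial>\<mu>) = (\<integral>\<^sup>+\<eta>. (\<Sum>k. W \<eta> * indicator {\<eta>. N \<eta> = of_nat k} \<eta>) \<partial>\<mu>)"
    by (rule nn_integral_cong_AE)
  also have "\<dots> = (\<Sum>k. a k)"
    unfolding a_def
  proof (rule nn_integral_suminf)
    fix k
    have "(\<lambda>\<eta>. W \<eta> * (if N \<eta> = of_nat k then 1 else 0)) \<in> borel_measurable \<mu>" by measurable
    then show "(\<lambda>\<eta>. W \<eta> * indicator {\<eta>. N \<eta> = of_nat k} \<eta>) \<in> borel_measurable \<mu>" by (simp add: indicator_def of_bool_def)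
  qed
  also have "\<dots> = (\<Sum>k. ennreal (L ^ k / fact k) * a 0)" by (subst a) simp
  also have "\<dots> = (\<Sum>k. ennreal (L ^ k / fact k)) * a 0" by (rule ennreal_suminf_multc)
  also have "(\<Sum>k. ennreal (L ^ k / fact k)) = ennreal (exp L)"
    using L(2) exp_converges[of L] by (intro suminf_ennreal_eq) (auto simp: divide_inverse mult.commute)
  finally show ?thesis by (simp add: a_def)
qed

text \<open>On \<open>{N = 0}\<close> no mark lies in \<open>D\<close> and the exponential is \<open>1\<close>. So \<open>Poisson_expansion\<close> leaves the probability of that event,
which the same lemma with \<open>W = 1\<close> evaluates to \<open>exp (- m D)\<close>.\<close>
lemma exponential_formula_finite:
  fixes g :: "'a \<Rightarrow> real \<Rightarrow> real" and D :: "('a \<times> real) set"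
  assumes D[measurable]: "D \<in> sets (borel \<Otimes>\<^sub>M borel)" and Dfin: "emeasure m D < \<infinity>"
    and g[measurable]: "case_prod g \<in> borel_measurable (borel \<Otimes>\<^sub>M borel)" and off: "\<And>x s. (x, s) \<notin> D \<Longrightarrow> g x s = 0"
    and int: "integrable m (\<lambda>z. exp (g (fst z) (snd z)) - 1)"
  shows "(\<integral>\<^sup>+\<eta>. ennreal (exp (mark_integral g \<eta>)) \<partial>\<mu>) = ennreal (exp (LINT z|m. exp (g (fst z) (snd z)) - 1))"
proof -
  define N where "N = marks_sum (\<lambda>x s. indicator D (x :: 'a, s))"
  have hD: "case_prod (\<lambda>x s. indicator D (x, s) :: ennreal) \<in> borel_measurable (borel \<Otimes>\<^sub>M borel)" by measurable
  have Nm[measurable]: "N \<in> borel_measurable discrete_radon_space"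
    unfolding N_def by (rule marks_sum_measurable[OF lc hD])
  have AEN: "AE \<eta> in \<mu>. N \<eta> < \<infinity>"
    unfolding N_def using Dfin D by (intro AE_marks_sum_finite[OF hD]) (simp add: sets_m)
  have Dm: "D \<in> sets m" using D by (simp add: sets_m)
  have iD: "integrable m (indicator D :: _ \<Rightarrow> real)" using Dm Dfin by simp
  define Lg where "Lg = (LINT z|m. exp (g (fst z) (snd z)) * indicator D z)"
  have split: "exp (g (fst z) (snd z)) * indicator D z = (exp (g (fst z) (snd z)) - 1) + indicator D z" for z
    using off[of "fst z" "snd z"] by (auto simp: indicator_def)
  have ig: "integrable m (\<lambda>z. exp (g (fst z) (snd z)) * indicator D z)"
    unfolding split using int iD by auto
  have Lg: "Lg = (LINT z|m. exp (g (fst z) (snd z)) - 1) + measure m D"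
    unfolding Lg_def split using int iD Dm by simp
  have ex: "(\<integral>\<^sup>+\<eta>. ennreal (exp (mark_integral g \<eta>)) \<partial>\<mu>)
      = ennreal (exp Lg) * (\<integral>\<^sup>+\<eta>. ennreal (exp (mark_integral g \<eta>)) * indicator {\<eta>. N \<eta> = 0} \<eta> \<partial>\<mu>)"
    unfolding N_def
  proof (rule Poisson_expansion[OF D Dfin, where w="\<lambda>z. ennreal (exp (g (fst z) (snd z)))"])
    have [measurable]: "mark_integral g \<in> borel_measurable discrete_radon_space" by (rule mark_integral_measurable[OF lc g])
    show "(\<lambda>\<eta>. ennreal (exp (mark_integral g \<eta>))) \<in> borel_measurable discrete_radon_space" by measurable
    show "(\<integral>\<^sup>+z. ennreal (exp (g (fst z) (snd z))) * indicator D z \<partial>m) = ennreal Lg"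
      unfolding Lg_def using ig
      by (subst nn_integral_eq_integral[symmetric]) (auto intro!: nn_integral_cong simp: indicator_def)
    show "0 \<le> Lg" unfolding Lg_def by (intro Bochner_Integration.integral_nonneg) auto
    show "AE \<eta> in \<mu>. \<forall>x s. 0 < s \<longrightarrow> emeasure \<eta> {x} = 0 \<longrightarrow> (x, s) \<in> D \<longrightarrow>
      ennreal (exp (mark_integral g (add_atom \<eta> x s))) = ennreal (exp (g (fst (x, s)) (snd (x, s)))) * ennreal (exp (mark_integral g \<eta>))"
      using AEN AE_space
    proof eventually_elim
      case (elim \<eta>)
      then have \<eta>: "\<eta> \<in> space discrete_radon_space" by (simp add: space_\<mu>)
      have "mark_integrable g \<eta>"
        by (rule mark_integrable_finite_count[OF lc \<eta> D elim(1)[unfolded N_def] off g])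
      then show ?case
        by (auto simp: mark_integral_add_atom[OF lc \<eta> _ _ g] exp_add ennreal_mult mult.commute)
    qed
  qed measurable
  have one: "1 = ennreal (exp (measure m D)) * (\<integral>\<^sup>+\<eta>. indicator {\<eta>. N \<eta> = 0} \<eta> \<partial>\<mu>)"
  proof -
    have "(\<integral>\<^sup>+\<eta>. 1 \<partial>\<mu>) = ennreal (exp (measure m D)) * (\<integral>\<^sup>+\<eta>. 1 * indicator {\<eta>. N \<eta> = 0} \<eta> \<partial>\<mu>)"
      unfolding N_def
      by (rule Poisson_expansion[OF D Dfin, where w="\<lambda>_. 1"])
         (use Dm Dfin in \<open>auto simp: emeasure_eq_ennreal_measure less_top[symmetric]\<close>)
    then show ?thesis by (simp add: \<mu>.emeasure_space_1)
  qed
  have "(\<integral>\<^sup>+\<eta>. ennreal (exp (mark_integral g \<eta>)) * indicator {\<eta>. N \<eta> = 0} \<eta> \<partial>\<mu>) = (\<integral>\<^sup>+\<eta>. indicator {\<eta>. N \<eta> = 0} \<eta> \<partial>\<mu>)"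
  proof (rule nn_integral_cong)
    fix \<eta> assume "\<eta> \<in> space \<mu>"
    then have \<eta>: "\<eta> \<in> space discrete_radon_space" by (simp add: space_\<mu>)
    have "mark_integral g \<eta> = 0" if N0: "N \<eta> = 0"
    proof -
      have fin: "finite {x \<in> atoms \<eta>. (x, measure \<eta> {x}) \<in> D}"
        using finitely_many_marks[OF lc \<eta> D] N0 by (simp add: N_def)
      have "(of_nat (card {x \<in> atoms \<eta>. (x, measure \<eta> {x}) \<in> D}) :: ennreal) = 0"
        using mark_count_integer[OF lc \<eta> D] N0 by (simp add: N_def)
      then have empty: "{x \<in> atoms \<eta>. (x, measure \<eta> {x}) \<in> D} = {}" using fin by simp
      have "AE x in \<eta>. g x (measure \<eta> {x}) / measure \<eta> {x} = 0"
        using countable_atoms_discrete(3)[OF space_discrete_radon_spaceD(4)[OF \<eta>]]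
      proof eventually_elim
        case (elim x)
        then have "(x, measure \<eta> {x}) \<notin> D" using empty by blast
        then show ?case by (simp add: off)
      qed
      then show ?thesis unfolding mark_integral_def by (rule integral_eq_zero_AE)
    qed
    then show "ennreal (exp (mark_integral g \<eta>)) * indicator {\<eta>. N \<eta> = 0} \<eta> = indicator {\<eta>. N \<eta> = 0} \<eta>"
      by (auto simp: indicator_def)
  qed
  then have "(\<integral>\<^sup>+\<eta>. ennreal (exp (mark_integral g \<eta>)) \<partial>\<mu>) = ennreal (exp Lg) * (\<integral>\<^sup>+\<eta>. indicator {\<eta>. N \<eta> = 0} \<eta> \<partial>\<mu>)"
    using ex by simp
  also have "ennreal (exp Lg) = ennreal (exp (LINT z|m. exp (g (fst z) (snd z)) - 1)) * ennreal (exp (measure m D))"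
    by (simp add: Lg exp_add ennreal_mult)
  also have "\<dots> * (\<integral>\<^sup>+\<eta>. indicator {\<eta>. N \<eta> = 0} \<eta> \<partial>\<mu>) = ennreal (exp (LINT z|m. exp (g (fst z) (snd z)) - 1))"
    using one by (simp add: mult.assoc)
  finally show ?thesis .
qed

text \<open>The sets \<open>D n\<close> where \<open>\<bar>e\<^sup>g - 1\<bar> > 1 / (n + 1)\<close> have finite measure and exhaust \<open>{g \<noteq> 0}\<close>. The restrictions
of \<open>g\<close> to \<open>D n\<close> are dominated by the positive part of \<open>g\<close>, whose exponential is integrable by Fatou's lemma.\<close>
theorem exponential_formula:
  fixes g :: "'a \<Rightarrow> real \<Rightarrow> real"
  assumes g[measurable]: "case_prod g \<in> borel_measurable (borel \<Otimes>\<^sub>M borel)"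
    and int: "integrable m (\<lambda>z. exp (g (fst z) (snd z)) - 1)"
  shows "(\<integral>\<^sup>+\<eta>. ennreal (exp (mark_integral g \<eta>)) \<partial>\<mu>) = ennreal (exp (LINT z|m. exp (g (fst z) (snd z)) - 1))"
proof -
  define e where "e z = exp (g (fst z) (snd z)) - 1" for z
  have [measurable]: "e \<in> borel_measurable (borel \<Otimes>\<^sub>M borel)" unfolding e_def by measurable
  define D where "D n = {z. 1 / real (Suc n) < \<bar>e z\<bar>}" for n
  have Dm[measurable]: "D n \<in> sets (borel \<Otimes>\<^sub>M borel)" for n
  proof -
    have "{z \<in> space (borel \<Otimes>\<^sub>M borel). 1 / real (Suc n) < \<bar>e z\<bar>} \<in> sets (borel \<Otimes>\<^sub>M borel)" by measurable
    then show ?thesis by (simp add: D_def space_pair_measure)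
  qed
  have nnfin: "(\<integral>\<^sup>+z. ennreal \<bar>e z\<bar> \<partial>m) < \<infinity>" using int by (simp add: integrable_iff_bounded e_def)
  have Dfin: "emeasure m (D n) < \<infinity>" for n
  proof -
    have "emeasure m (D n) = (\<integral>\<^sup>+z. indicator (D n) z \<partial>m)" by (simp add: sets_m)
    also have "\<dots> \<le> (\<integral>\<^sup>+z. ennreal (real (Suc n)) * ennreal \<bar>e z\<bar> \<partial>m)"
    proof (rule nn_integral_mono)
      fix z
      have "1 \<le> real (Suc n) * \<bar>e z\<bar>" if "z \<in> D n"
        using that by (simp add: D_def field_simps)
      then show "indicator (D n) z \<le> ennreal (real (Suc n)) * ennreal \<bar>e z\<bar>"
        by (auto simp: indicator_def ennreal_mult[symmetric] simp del: of_nat_Suc)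
    qed
    also have "\<dots> < \<infinity>" using nnfin by (simp add: nn_integral_cmult ennreal_mult_less_top)
    finally show ?thesis .
  qed
  have D_lim: "\<exists>n0. \<forall>n\<ge>n0. (x, s) \<in> D n" if "g x s \<noteq> 0" for x s
  proof -
    have "\<bar>e (x, s)\<bar> > 0" using that by (simp add: e_def)
    then obtain n0 where n0: "1 / real (Suc n0) < \<bar>e (x, s)\<bar>" using nat_approx_posE by blast
    have "(x, s) \<in> D n" if "n \<ge> n0" for n
    proof -
      have "1 / real (Suc n) \<le> 1 / real (Suc n0)" using that by (intro frac_le) auto
      then show ?thesis using n0 by (simp add: D_def)
    qed
    then show ?thesis by blast
  qed
  have approx: "(\<integral>\<^sup>+\<eta>. ennreal (exp (mark_integral (\<lambda>x s. f x s * indicator (D n) (x, s)) \<eta>)) \<partial>\<mu>) =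
      ennreal (exp (LINT z|m. exp (f (fst z) (snd z) * indicator (D n) z) - 1))"
    and approx_lim: "(\<lambda>n. LINT z|m. exp (f (fst z) (snd z) * indicator (D n) z) - 1) \<longlonglongrightarrow> (LINT z|m. exp (f (fst z) (snd z)) - 1)"
    if f[measurable]: "case_prod f \<in> borel_measurable (borel \<Otimes>\<^sub>M borel)"
      and fe: "\<And>x s. \<bar>exp (f x s) - 1\<bar> \<le> \<bar>e (x, s)\<bar>" for f n
  proof -
    have fi: "integrable m (\<lambda>z. exp (f (fst z) (snd z) * indicator (D n) z) - 1)" for n
      by (rule Bochner_Integration.integrable_bound[OF int]) (use fe in \<open>auto simp: indicator_def e_def\<close>)
    show "(\<integral>\<^sup>+\<eta>. ennreal (exp (mark_integral (\<lambda>x s. f x s * indicator (D n) (x, s)) \<eta>)) \<partial>\<mu>) =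
      ennreal (exp (LINT z|m. exp (f (fst z) (snd z) * indicator (D n) z) - 1))"
      by (subst exponential_formula_finite[OF Dm Dfin, of _ n]) (use fi[of n] in auto)
    have f0: "f x s = 0" if "g x s = 0" for x s using fe[of x s] that by (simp add: e_def)
    show "(\<lambda>n. LINT z|m. exp (f (fst z) (snd z) * indicator (D n) z) - 1) \<longlonglongrightarrow> (LINT z|m. exp (f (fst z) (snd z)) - 1)"
    proof (rule integral_dominated_convergence[where w="\<lambda>z. \<bar>e z\<bar>"])
      show "AE z in m. (\<lambda>n. exp (f (fst z) (snd z) * indicator (D n) z) - 1) \<longlonglongrightarrow> exp (f (fst z) (snd z)) - 1"
      proof (rule AE_I2)
        fix z
        show "(\<lambda>n. exp (f (fst z) (snd z) * indicator (D n) z) - 1) \<longlonglongrightarrow> exp (f (fst z) (snd z)) - 1"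
        proof (cases "g (fst z) (snd z) = 0")
          case False
          then obtain n0 where "\<forall>n\<ge>n0. z \<in> D n" using D_lim[OF False] by auto
          then have "eventually (\<lambda>n. z \<in> D n) sequentially" by (auto simp: eventually_sequentially)
          then have "eventually (\<lambda>n. exp (f (fst z) (snd z) * indicator (D n) z) - 1 = exp (f (fst z) (snd z)) - 1) sequentially"
            by eventually_elim simp
          then show ?thesis by (rule tendsto_eventually)
        qed (simp add: f0)
      qed
      show "integrable m (\<lambda>z. \<bar>e z\<bar>)" using int by (simp add: e_def)
    qed (use fe in \<open>auto simp: indicator_def\<close>)
  qed
  define gp where "gp x s = max 0 (g x s)" for x s
  have gpm[measurable]: "case_prod gp \<in> borel_measurable (borel \<Otimes>\<^sub>M borel)" unfolding gp_def by measurable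
  have gpe: "\<bar>exp (gp x s) - 1\<bar> \<le> \<bar>e (x, s)\<bar>" for x s by (auto simp: gp_def e_def max_def)
  have ge: "\<bar>exp (g x s) - 1\<bar> \<le> \<bar>e (x, s)\<bar>" for x s by (simp add: e_def)
  have AEg: "AE \<eta> in \<mu>. mark_integrable g \<eta>"
    using nnfin by (intro AE_mark_integrable[OF g]) (simp add: e_def)
  have lim: "(\<lambda>n. mark_integral (\<lambda>x s. f x s * indicator (D n) (x, s)) \<eta>) \<longlonglongrightarrow> mark_integral f \<eta>"
    if \<eta>: "\<eta> \<in> space discrete_radon_space" and gi: "mark_integrable g \<eta>"
      and f[measurable]: "case_prod f \<in> borel_measurable (borel \<Otimes>\<^sub>M borel)" and fg: "\<And>x s. \<bar>f x s\<bar> \<le> \<bar>g x s\<bar>" for f \<eta>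
    unfolding mark_integral_def
  proof (rule integral_dominated_convergence[where w="\<lambda>x. \<bar>g x (measure \<eta> {x}) / measure \<eta> {x}\<bar>"])
    have mb: "(\<lambda>x. q x (measure \<eta> {x}) / measure \<eta> {x}) \<in> borel_measurable \<eta>"
      if "case_prod q \<in> borel_measurable (borel \<Otimes>\<^sub>M borel)" for q :: "'a \<Rightarrow> real \<Rightarrow> real"
      using mark_term_measurable(1)[OF lc \<eta> that] measurable_cong_sets[OF space_discrete_radon_spaceD(2)[OF \<eta>] refl] by blast
    show "(\<lambda>x. f x (measure \<eta> {x}) / measure \<eta> {x}) \<in> borel_measurable \<eta>" by (rule mb[OF f])
    show "(\<lambda>x. f x (measure \<eta> {x}) * indicator (D n) (x, measure \<eta> {x}) / measure \<eta> {x}) \<in> borel_measurable \<eta>" for n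
      by (rule mb) measurable
    show "integrable \<eta> (\<lambda>x. \<bar>g x (measure \<eta> {x}) / measure \<eta> {x}\<bar>)"
      by (rule integrable_abs[OF gi[unfolded mark_integrable_def]])
    show "AE x in \<eta>. norm (f x (measure \<eta> {x}) * indicator (D n) (x, measure \<eta> {x}) / measure \<eta> {x}) \<le> \<bar>g x (measure \<eta> {x}) / measure \<eta> {x}\<bar>" for n
      using fg by (auto simp: abs_divide abs_mult indicator_def intro!: divide_right_mono)
    show "AE x in \<eta>. (\<lambda>n. f x (measure \<eta> {x}) * indicator (D n) (x, measure \<eta> {x}) / measure \<eta> {x}) \<longlonglongrightarrow> f x (measure \<eta> {x}) / measure \<eta> {x}"
    proof (rule AE_I2)
      fix x
      show "(\<lambda>n. f x (measure \<eta> {x}) * indicator (D n) (x, measure \<eta> {x}) / measure \<eta> {x}) \<longlonglongrightarrow> f x (measure \<eta> {x}) / measure \<eta> {x}"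
      proof (cases "g x (measure \<eta> {x}) = 0")
        case True
        then show ?thesis using fg[of x "measure \<eta> {x}"] by simp
      next
        case False
        then obtain n0 where "\<forall>n\<ge>n0. (x, measure \<eta> {x}) \<in> D n" using D_lim[OF False] by blast
        then have "eventually (\<lambda>n. (x, measure \<eta> {x}) \<in> D n) sequentially" by (auto simp: eventually_sequentially)
        then have "eventually (\<lambda>n. f x (measure \<eta> {x}) * indicator (D n) (x, measure \<eta> {x}) / measure \<eta> {x} = f x (measure \<eta> {x}) / measure \<eta> {x}) sequentially"
          by eventually_elim simp
        then show ?thesis by (rule tendsto_eventually)
      qed
    qed
  qed
  have meas[measurable]: "mark_integral f \<in> borel_measurable \<mu>"
    if "case_prod f \<in> borel_measurable (borel \<Otimes>\<^sub>M borel)" for f :: "'a \<Rightarrow> real \<Rightarrow> real"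
    using mark_integral_measurable[OF lc that] by (simp add: measurable_cong_sets[OF sets_\<mu> refl])
  have measD[measurable]: "mark_integral (\<lambda>x s. f x s * indicator (D n) (x, s)) \<in> borel_measurable \<mu>"
    if [measurable]: "case_prod f \<in> borel_measurable (borel \<Otimes>\<^sub>M borel)" for f :: "'a \<Rightarrow> real \<Rightarrow> real" and n
    by (rule meas) measurable
  have gpg: "\<bar>gp x s\<bar> \<le> \<bar>g x s\<bar>" for x s by (simp add: gp_def)
  have dom: "(\<integral>\<^sup>+\<eta>. ennreal (exp (mark_integral gp \<eta>)) \<partial>\<mu>) < \<infinity>"
  proof -
    have "(\<integral>\<^sup>+\<eta>. ennreal (exp (mark_integral gp \<eta>)) \<partial>\<mu>) = (\<integral>\<^sup>+\<eta>. liminf (\<lambda>n. ennreal (exp (mark_integral (\<lambda>x s. gp x s * indicator (D n) (x, s)) \<eta>))) \<partial>\<mu>)"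
    proof (rule nn_integral_cong_AE)
      show "AE \<eta> in \<mu>. ennreal (exp (mark_integral gp \<eta>)) = liminf (\<lambda>n. ennreal (exp (mark_integral (\<lambda>x s. gp x s * indicator (D n) (x, s)) \<eta>)))"
        using AEg AE_space
      proof eventually_elim
        case (elim \<eta>)
        then have "\<eta> \<in> space discrete_radon_space" by (simp add: space_\<mu>)
        from lim[OF this elim(1) gpm gpg]
        have "(\<lambda>n. ennreal (exp (mark_integral (\<lambda>x s. gp x s * indicator (D n) (x, s)) \<eta>))) \<longlonglongrightarrow> ennreal (exp (mark_integral gp \<eta>))"
          by (intro tendsto_ennrealI tendsto_exp)
        then show ?case by (intro lim_imp_Liminf[symmetric]) auto
      qed
    qed
    also have "\<dots> \<le> liminf (\<lambda>n. \<integral>\<^sup>+\<eta>. ennreal (exp (mark_integral (\<lambda>x s. gp x s * indicator (D n) (x, s)) \<eta>)) \<partial>\<mu>)"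
      by (rule nn_integral_liminf) (use measD[OF gpm] in measurable)
    also have "\<dots> = liminf (\<lambda>n. ennreal (exp (LINT z|m. exp (gp (fst z) (snd z) * indicator (D n) z) - 1)))"
      unfolding approx[OF gpm gpe] ..
    also have "\<dots> = ennreal (exp (LINT z|m. exp (gp (fst z) (snd z)) - 1))"
      by (intro lim_imp_Liminf tendsto_ennrealI tendsto_exp approx_lim[OF gpm gpe]) auto
    finally show ?thesis by (auto intro: le_less_trans)
  qed
  have "(\<lambda>n. \<integral>\<^sup>+\<eta>. ennreal (exp (mark_integral (\<lambda>x s. g x s * indicator (D n) (x, s)) \<eta>)) \<partial>\<mu>)
     \<longlonglongrightarrow> (\<integral>\<^sup>+\<eta>. ennreal (exp (mark_integral g \<eta>)) \<partial>\<mu>)"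
  proof (rule nn_integral_dominated_convergence[where w="\<lambda>\<eta>. ennreal (exp (mark_integral gp \<eta>))"])
    show "AE \<eta> in \<mu>. ennreal (exp (mark_integral (\<lambda>x s. g x s * indicator (D n) (x, s)) \<eta>)) \<le> ennreal (exp (mark_integral gp \<eta>))" for n
      using AEg AE_space
    proof eventually_elim
      case (elim \<eta>)
      then have \<eta>: "\<eta> \<in> space discrete_radon_space" by (simp add: space_\<mu>)
      have mb: "(\<lambda>x. q x (measure \<eta> {x}) / measure \<eta> {x}) \<in> borel_measurable \<eta>"
        if "case_prod q \<in> borel_measurable (borel \<Otimes>\<^sub>M borel)" for q :: "'a \<Rightarrow> real \<Rightarrow> real"
        using mark_term_measurable(1)[OF lc \<eta> that] measurable_cong_sets[OF space_discrete_radon_spaceD(2)[OF \<eta>] refl] by blast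
      have "mark_integral (\<lambda>x s. g x s * indicator (D n) (x, s)) \<eta> \<le> mark_integral gp \<eta>"
        unfolding mark_integral_def
      proof (rule integral_mono)
        have gi: "integrable \<eta> (\<lambda>x. g x (measure \<eta> {x}) / measure \<eta> {x})" using elim(1) by (simp add: mark_integrable_def)
        show "integrable \<eta> (\<lambda>x. g x (measure \<eta> {x}) * indicator (D n) (x, measure \<eta> {x}) / measure \<eta> {x})"
          by (rule Bochner_Integration.integrable_bound[OF gi mb]) (auto simp: indicator_def)
        show "integrable \<eta> (\<lambda>x. gp x (measure \<eta> {x}) / measure \<eta> {x})"
          by (rule Bochner_Integration.integrable_bound[OF gi mb[OF gpm]]) (use gpg in \<open>auto intro!: divide_right_mono\<close>)
        show "g x (measure \<eta> {x}) * indicator (D n) (x, measure \<eta> {x}) / measure \<eta> {x} \<le> gp x (measure \<eta> {x}) / measure \<eta> {x}" for x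
          by (intro divide_right_mono) (auto simp: gp_def indicator_def)
      qed
      then show ?case by (intro ennreal_leI) simp
    qed
    show "AE \<eta> in \<mu>. (\<lambda>n. ennreal (exp (mark_integral (\<lambda>x s. g x s * indicator (D n) (x, s)) \<eta>))) \<longlonglongrightarrow> ennreal (exp (mark_integral g \<eta>))"
      using AEg AE_space
    proof eventually_elim
      case (elim \<eta>)
      then have "\<eta> \<in> space discrete_radon_space" by (simp add: space_\<mu>)
      from lim[OF this elim(1) g order_refl] show ?case by (intro tendsto_ennrealI tendsto_exp)
    qed
    show "(\<lambda>\<eta>. ennreal (exp (mark_integral g \<eta>))) \<in> borel_measurable \<mu>"
      "(\<lambda>\<eta>. ennreal (exp (mark_integral gp \<eta>))) \<in> borel_measurable \<mu>"
      "(\<lambda>\<eta>. ennreal (exp (mark_integral (\<lambda>x s. g x s * indicator (D n) (x, s)) \<eta>))) \<in> borel_measurable \<mu>" for n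
      using meas[OF g] meas[OF gpm] measD[OF g] by measurable
  qed (rule dom)
  moreover have "(\<lambda>n. ennreal (exp (LINT z|m. exp (g (fst z) (snd z) * indicator (D n) z) - 1))) \<longlonglongrightarrow> ennreal (exp (LINT z|m. exp (g (fst z) (snd z)) - 1))"
    by (intro tendsto_ennrealI tendsto_exp approx_lim[OF g ge])
  ultimately show ?thesis unfolding approx[OF g ge] by (rule LIMSEQ_unique)
qed

end

section \<open>Dilations of a function with integrable oscillation\<close>

text \<open>For a nonmeasurable \<open>f\<close> the integral is a lower integral, and lower integrals are subadditive once one
of the summands is measurable. This is needed because suprema over uncountable sets of dilations are not
measurable a priori.\<close>
lemma nn_integral_add_le:
  assumes g[measurable]: "g \<in> borel_measurable M"
  shows "(\<integral>\<^sup>+x. f x + g x \<partial>M) \<le> (\<integral>\<^sup>+x. f x \<partial>M) + (\<integral>\<^sup>+x. g x \<partial>M)"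
proof (cases "(\<integral>\<^sup>+x. g x \<partial>M) = \<infinity>")
  case False
  then have fin: "AE x in M. g x \<noteq> \<infinity>" by (intro nn_integral_PInf_AE) auto
  have "(\<integral>\<^sup>+x. u x \<partial>M) \<le> (\<integral>\<^sup>+x. f x \<partial>M) + (\<integral>\<^sup>+x. g x \<partial>M)"
    if u: "u \<in> borel_measurable M" "u \<le> (\<lambda>x. f x + g x)" for u
  proof -
    note [measurable] = u(1)
    define v where "v x = (if g x = \<infinity> then 0 else u x - g x)" for x
    have [measurable]: "v \<in> borel_measurable M" unfolding v_def by measurable
    have vf: "v x \<le> f x" for x
      using u(2) by (auto simp: v_def le_fun_def ennreal_minus_le_iff add.commute)
    have "(\<integral>\<^sup>+x. u x \<partial>M) \<le> (\<integral>\<^sup>+x. v x + g x \<partial>M)"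
    proof (rule nn_integral_mono_AE, use fin in eventually_elim)
      fix x assume "g x \<noteq> \<infinity>"
      then show "u x \<le> v x + g x" using linear[of "g x" "u x"] by (auto simp: v_def diff_add_self_ennreal)
    qed
    also have "\<dots> = (\<integral>\<^sup>+x. v x \<partial>M) + (\<integral>\<^sup>+x. g x \<partial>M)" by (rule nn_integral_add) auto
    also have "\<dots> \<le> (\<integral>\<^sup>+x. f x \<partial>M) + (\<integral>\<^sup>+x. g x \<partial>M)"
      using vf by (intro add_right_mono nn_integral_mono)
    finally show ?thesis .
  qed
  then show ?thesis
    unfolding nn_integral_def[of M "\<lambda>x. f x + g x"]
    by (intro SUP_least) (auto simp: nn_integral_eq_simple_integral[symmetric] borel_measurable_simple_function)
qed simp

lemma nn_integral_cmult_le: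
  assumes c: "0 < c"
  shows "(\<integral>\<^sup>+x. ennreal c * f x \<partial>M) \<le> ennreal c * (\<integral>\<^sup>+x. f x \<partial>M)"
proof -
  have "(\<integral>\<^sup>+x. u x \<partial>M) \<le> ennreal c * (\<integral>\<^sup>+x. f x \<partial>M)"
    if u: "u \<in> borel_measurable M" "u \<le> (\<lambda>x. ennreal c * f x)" for u
  proof -
    note [measurable] = u(1)
    have one: "ennreal c * ennreal (1 / c) = 1" using c by (simp add: ennreal_mult[symmetric])
    have "ennreal (1 / c) * u x \<le> f x" for x
    proof -
      have "ennreal (1 / c) * u x \<le> ennreal (1 / c) * (ennreal c * f x)"
        using u(2) by (intro mult_left_mono) (auto simp: le_fun_def)
      then show ?thesis using one by (simp add: mult.assoc[symmetric] mult.commute)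
    qed
    then have "ennreal c * (\<integral>\<^sup>+x. ennreal (1 / c) * u x \<partial>M) \<le> ennreal c * (\<integral>\<^sup>+x. f x \<partial>M)"
      by (intro mult_left_mono nn_integral_mono) auto
    moreover have "ennreal c * (\<integral>\<^sup>+x. ennreal (1 / c) * u x \<partial>M) = (\<integral>\<^sup>+x. u x \<partial>M)"
      using one by (simp add: nn_integral_cmult mult.assoc[symmetric])
    ultimately show ?thesis by simp
  qed
  then show ?thesis
    unfolding nn_integral_def[of M "\<lambda>x. ennreal c * f x"]
    by (intro SUP_least) (auto simp: nn_integral_eq_simple_integral[symmetric] borel_measurable_simple_function)
qed

lemma dilation_difference_differentiable:
  fixes l1 :: "real \<Rightarrow> real"
  assumes d: "\<And>s. s \<in> {0<..<\<epsilon>} \<Longrightarrow> l1 differentiable (at s)"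
    and n: "1 \<le> (n::nat)" and r: "r \<in> {1 / real n..real n}" and s: "0 < s" "s < \<epsilon> / real n"
  shows "ennreal (\<bar>l1 (r * s) - l1 s\<bar> / s) \<le> ennreal (real n) * (SUP u\<in>{s / real n..s * real n}. ennreal \<bar>deriv l1 u\<bar>)"
proof -
  have n0: "real n > 0" "real n \<ge> 1" using n by auto
  have rs: "s / real n \<le> r * s" "r * s \<le> s * real n"
    using r s mult_right_mono[of "1 / real n" r s] mult_right_mono[of r "real n" s] by (auto simp: mult.commute)
  have sn: "s / real n \<le> s" "s \<le> s * real n" using n0 s by (auto simp: field_simps)
  have top: "s * real n < \<epsilon>" using s n0 by (simp add: field_simps)
  have bot: "0 < s / real n" using s n0 by simp
  have D: "DERIV l1 u :> deriv l1 u" if "s / real n \<le> u" "u \<le> s * real n" for u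
    using d[of u] that top bot by (auto simp: DERIV_deriv_iff_real_differentiable)
  have "\<exists>u\<in>{s / real n..s * real n}. \<bar>l1 (r * s) - l1 s\<bar> = \<bar>r * s - s\<bar> * \<bar>deriv l1 u\<bar>"
  proof (cases "r * s" s rule: linorder_cases)
    case less
    obtain z where z: "r * s < z" "z < s" "l1 s - l1 (r * s) = (s - r * s) * deriv l1 z"
      using MVT2[OF less, of l1 "deriv l1"] D rs sn by force
    have "\<bar>l1 (r * s) - l1 s\<bar> = \<bar>s - r * s\<bar> * \<bar>deriv l1 z\<bar>" by (simp add: abs_minus_commute[of "l1 (r * s)"] z(3) abs_mult)
    then show ?thesis using z rs sn by (intro bexI[of _ z]) (auto simp: abs_minus_commute)
  next
    case equal
    then show ?thesis using sn by (intro bexI[of _ s]) auto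
  next
    case greater
    obtain z where z: "s < z" "z < r * s" "l1 (r * s) - l1 s = (r * s - s) * deriv l1 z"
      using MVT2[OF greater, of l1 "deriv l1"] D rs sn by force
    then show ?thesis using rs sn by (intro bexI[of _ z]) (auto simp: abs_mult)
  qed
  then obtain u where u: "u \<in> {s / real n..s * real n}" "\<bar>l1 (r * s) - l1 s\<bar> = \<bar>r * s - s\<bar> * \<bar>deriv l1 u\<bar>" by blast
  have "\<bar>r * s - s\<bar> \<le> real n * s"
  proof -
    have "0 \<le> r * s" using rs bot by linarith
    then have "r * s - s \<le> s * real n" "s - r * s \<le> s * real n" using rs sn s by linarith+
    then show ?thesis by (simp add: mult.commute abs_le_iff)
  qed
  then have "\<bar>l1 (r * s) - l1 s\<bar> / s \<le> (real n * s) * \<bar>deriv l1 u\<bar> / s"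
    unfolding u(2) using s by (intro divide_right_mono mult_right_mono) auto
  also have "\<dots> = real n * \<bar>deriv l1 u\<bar>" using s by simp
  finally have "ennreal (\<bar>l1 (r * s) - l1 s\<bar> / s) \<le> ennreal (real n) * ennreal \<bar>deriv l1 u\<bar>"
    using n0 by (simp add: ennreal_mult[symmetric] ennreal_leI)
  also have "\<dots> \<le> ennreal (real n) * (SUP u\<in>{s / real n..s * real n}. ennreal \<bar>deriv l1 u\<bar>)"
    using u(1) by (intro mult_left_mono SUP_upper) auto
  finally show ?thesis .
qed

text \<open>The contribution of \<open>l2\<close> is bounded through \<open>\<integral> \<bar>l2 (r s)\<bar> ds/s = \<integral> \<bar>l2 s\<bar> ds/s\<close>, by the
substitution \<open>s \<mapsto> r s\<close>; the bound does not depend on \<open>r\<close>.\<close>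
lemma dilation_difference_integral:
  fixes l l1 l2 :: "real \<Rightarrow> real"
  assumes dec: "\<And>s. s \<in> {0<..<\<epsilon>} \<Longrightarrow> l s = l1 s + l2 s"
    and d: "\<And>s. s \<in> {0<..<\<epsilon>} \<Longrightarrow> l1 differentiable (at s)"
    and m2: "(\<lambda>s. indicator {0<..<\<epsilon>} s * l2 s) \<in> borel_measurable borel"
    and n: "1 \<le> (n::nat)" and r: "r \<in> {1 / real n..real n}"
  shows "(\<integral>\<^sup>+s\<in>{0<..<\<epsilon> / real n}. ennreal (\<bar>l (r * s) - l s\<bar> / s) \<partial>lborel)
    \<le> ennreal (real n) * (\<integral>\<^sup>+s\<in>{0<..<\<epsilon> / real n}. (SUP u\<in>{s / real n..s * real n}. ennreal \<bar>deriv l1 u\<bar>) \<partial>lborel)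
      + 2 * (\<integral>\<^sup>+s\<in>{0<..<\<epsilon>}. ennreal (\<bar>l2 s\<bar> / s) \<partial>lborel)"
proof -
  have n0: "real n > 0" "real n \<ge> 1" using n by auto
  have r0: "r > 0" using r n0 by (auto intro: less_le_trans[of 0 "1 / real n"])
  define h where "h v = ennreal (\<bar>indicator {0<..<\<epsilon>} v * l2 v\<bar> / v)" for v
  have hm[measurable]: "h \<in> borel_measurable borel" unfolding h_def using m2 by measurable
  have h: "(\<integral>\<^sup>+s\<in>{0<..<\<epsilon>}. ennreal (\<bar>l2 s\<bar> / s) \<partial>lborel) = (\<integral>\<^sup>+s. h s \<partial>lborel)"
    by (intro nn_integral_cong) (auto simp: h_def indicator_def)
  have "ennreal (\<bar>l (r * s) - l s\<bar> / s) * indicator {0<..<\<epsilon> / real n} s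
     \<le> ennreal (real n) * ((SUP u\<in>{s / real n..s * real n}. ennreal \<bar>deriv l1 u\<bar>) * indicator {0<..<\<epsilon> / real n} s)
       + (ennreal r * h (r * s) + h s)" for s
  proof (cases "s \<in> {0<..<\<epsilon> / real n}")
    case True
    then have s: "0 < s" "s < \<epsilon> / real n" by auto
    have rs: "0 < r * s" "r * s < \<epsilon>"
    proof -
      show "0 < r * s" using r0 s by simp
      have "r * s \<le> real n * s" using r s by (intro mult_right_mono) auto
      also have "\<dots> < \<epsilon>" using s n0 by (simp add: field_simps)
      finally show "r * s < \<epsilon>" .
    qed
    have s2: "s < \<epsilon>"
    proof -
      have "1 * s \<le> real n * s" using n0 s by (intro mult_right_mono) auto
      also have "\<dots> < \<epsilon>" using s n0 by (simp add: field_simps)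
      finally show ?thesis by simp
    qed
    have "\<bar>l (r * s) - l s\<bar> \<le> \<bar>l1 (r * s) - l1 s\<bar> + (\<bar>l2 (r * s)\<bar> + \<bar>l2 s\<bar>)"
      using dec[of s] dec[of "r * s"] rs s s2 by auto
    then have "\<bar>l (r * s) - l s\<bar> / s \<le> (\<bar>l1 (r * s) - l1 s\<bar> + (\<bar>l2 (r * s)\<bar> + \<bar>l2 s\<bar>)) / s"
      using s by (intro divide_right_mono) auto
    also have "\<dots> = \<bar>l1 (r * s) - l1 s\<bar> / s + (r * (\<bar>l2 (r * s)\<bar> / (r * s)) + \<bar>l2 s\<bar> / s)"
      using r0 s by (simp add: add_divide_distrib)
    finally have "ennreal (\<bar>l (r * s) - l s\<bar> / s) \<le> ennreal (\<bar>l1 (r * s) - l1 s\<bar> / s) + (ennreal r * ennreal (\<bar>l2 (r * s)\<bar> / (r * s)) + ennreal (\<bar>l2 s\<bar> / s))"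
      using r0 s rs by (simp add: ennreal_plus[symmetric] ennreal_mult[symmetric] ennreal_leI del: ennreal_plus)
    also have "\<dots> \<le> ennreal (real n) * (SUP u\<in>{s / real n..s * real n}. ennreal \<bar>deriv l1 u\<bar>) + (ennreal r * h (r * s) + h s)"
    proof (intro add_mono)
      show "ennreal (\<bar>l1 (r * s) - l1 s\<bar> / s) \<le> ennreal (real n) * (SUP u\<in>{s / real n..s * real n}. ennreal \<bar>deriv l1 u\<bar>)"
        by (rule dilation_difference_differentiable[OF d n r s])
    qed (use rs s s2 in \<open>auto simp: h_def\<close>)
    finally show ?thesis using True by simp
  qed simp
  then have "(\<integral>\<^sup>+s\<in>{0<..<\<epsilon> / real n}. ennreal (\<bar>l (r * s) - l s\<bar> / s) \<partial>lborel)
    \<le> (\<integral>\<^sup>+s. ennreal (real n) * ((SUP u\<in>{s / real n..s * real n}. ennreal \<bar>deriv l1 u\<bar>) * indicator {0<..<\<epsilon> / real n} s)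
       + (ennreal r * h (r * s) + h s) \<partial>lborel)"
    by (rule nn_integral_mono)
  also have "\<dots> \<le> (\<integral>\<^sup>+s. ennreal (real n) * ((SUP u\<in>{s / real n..s * real n}. ennreal \<bar>deriv l1 u\<bar>) * indicator {0<..<\<epsilon> / real n} s) \<partial>lborel)
     + (\<integral>\<^sup>+s. ennreal r * h (r * s) + h s \<partial>lborel)"
    by (rule nn_integral_add_le) measurable
  also have "(\<integral>\<^sup>+s. ennreal r * h (r * s) + h s \<partial>lborel) = ennreal r * (\<integral>\<^sup>+s. h (r * s) \<partial>lborel) + (\<integral>\<^sup>+s. h s \<partial>lborel)"
    by (subst nn_integral_add) (auto simp: nn_integral_cmult)
  also have "ennreal r * (\<integral>\<^sup>+s. h (r * s) \<partial>lborel) = (\<integral>\<^sup>+s. h s \<partial>lborel)"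
    using nn_integral_real_affine[OF hm, of r 0] r0 by simp
  also have "(\<integral>\<^sup>+s. h s \<partial>lborel) + (\<integral>\<^sup>+s. h s \<partial>lborel) = 2 * (\<integral>\<^sup>+s. h s \<partial>lborel)" by (simp add: mult_2)
  also have "(\<integral>\<^sup>+s. ennreal (real n) * ((SUP u\<in>{s / real n..s * real n}. ennreal \<bar>deriv l1 u\<bar>) * indicator {0<..<\<epsilon> / real n} s) \<partial>lborel)
     \<le> ennreal (real n) * (\<integral>\<^sup>+s\<in>{0<..<\<epsilon> / real n}. (SUP u\<in>{s / real n..s * real n}. ennreal \<bar>deriv l1 u\<bar>) \<partial>lborel)"
    using n0 by (intro nn_integral_cmult_le) auto
  finally show ?thesis unfolding h by (simp add: add_right_mono)
qed

lemma sup_dilation_integral_finite: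
  fixes \<sigma> :: "'a::topological_space measure" and l l1 l2 :: "'a \<Rightarrow> real \<Rightarrow> real"
  assumes \<sigma>[measurable_cong]: "sets \<sigma> = sets borel" and n: "1 \<le> (n::nat)"
    and A: "A \<in> sets borel" "A \<subseteq> Y" and Y: "Y \<in> sets borel"
    and m2: "(\<lambda>(x, s). l2 x s) \<in> borel_measurable (restrict_space borel Y \<Otimes>\<^sub>M restrict_space borel {0<..<\<epsilon>})"
    and dec: "\<And>x s. x \<in> Y \<Longrightarrow> s \<in> {0<..<\<epsilon>} \<Longrightarrow> l x s = l1 x s + l2 x s"
    and d: "\<And>x s. x \<in> Y \<Longrightarrow> s \<in> {0<..<\<epsilon>} \<Longrightarrow> l1 x differentiable (at s)"
    and eps: "0 < \<epsilon>"
    and fin1: "(\<integral>\<^sup>+x\<in>A. (\<integral>\<^sup>+s\<in>{0<..<\<epsilon> / real n}.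
         (SUP u\<in>{s / real n..s * real n}. ennreal \<bar>deriv (l1 x) u\<bar>) \<partial>lborel) \<partial>\<sigma>) < \<infinity>"
    and fin2: "(\<integral>\<^sup>+x\<in>A. (\<integral>\<^sup>+s\<in>{0<..<\<epsilon>}. ennreal (\<bar>l2 x s\<bar> / s) \<partial>lborel) \<partial>\<sigma>) < \<infinity>"
  shows "(\<integral>\<^sup>+x\<in>A. (SUP r\<in>{1 / real n..real n}.
      \<integral>\<^sup>+s\<in>{0<..<\<epsilon> / real n}. ennreal (\<bar>l x (r * s) - l x s\<bar> / s) \<partial>lborel) \<partial>\<sigma>) < \<infinity>"
proof -
  note [measurable] = A(1) Y
  have n0: "real n > 0" using n by auto
  define G where "G x = (\<integral>\<^sup>+s\<in>{0<..<\<epsilon> / real n}. (SUP u\<in>{s / real n..s * real n}. ennreal \<bar>deriv (l1 x) u\<bar>) \<partial>lborel)" for x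
  define H where "H x = (\<integral>\<^sup>+s\<in>{0<..<\<epsilon>}. ennreal (\<bar>l2 x s\<bar> / s) \<partial>lborel)" for x
  define t where "t s = (if s \<in> {0<..<\<epsilon>} then s else \<epsilon> / 2)" for s :: real
  have tm: "t \<in> measurable borel (restrict_space borel {0<..<\<epsilon>})"
    unfolding t_def[abs_def] by (rule measurable_restrict_space2) (use eps in auto)
  have l2m: "(\<lambda>(x, s). indicator {0<..<\<epsilon>} s * l2 x s) \<in> borel_measurable (restrict_space borel Y \<Otimes>\<^sub>M borel)"
  proof -
    have "(\<lambda>p. (fst p, t (snd p))) \<in> measurable (restrict_space borel Y \<Otimes>\<^sub>M borel) (restrict_space borel Y \<Otimes>\<^sub>M restrict_space borel {0<..<\<epsilon>})"
      using tm by measurable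
    from measurable_compose[OF this m2]
    have [measurable]: "(\<lambda>p. l2 (fst p) (t (snd p))) \<in> borel_measurable (restrict_space borel Y \<Otimes>\<^sub>M borel)" by simp
    have "(\<lambda>p. indicator {0<..<\<epsilon>} (snd p) * l2 (fst p) (t (snd p))) \<in> borel_measurable (restrict_space borel Y \<Otimes>\<^sub>M borel)" by measurable
    also have "(\<lambda>p. indicator {0<..<\<epsilon>} (snd p) * l2 (fst p) (t (snd p))) = (\<lambda>(x, s). indicator {0<..<\<epsilon>} s * l2 x s)"
      by (auto simp: t_def fun_eq_iff indicator_def)
    finally show ?thesis .
  qed
  have Hm: "H \<in> borel_measurable (restrict_space borel Y)"
  proof -
    have "(\<lambda>x. \<integral>\<^sup>+s. ennreal (\<bar>(\<lambda>(x, s). indicator {0<..<\<epsilon>} s * l2 x s) (x, s)\<bar> / s) \<partial>lborel) \<in> borel_measurable (restrict_space borel Y)"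
      using l2m by measurable
    also have "(\<lambda>x. \<integral>\<^sup>+s. ennreal (\<bar>(\<lambda>(x, s). indicator {0<..<\<epsilon>} s * l2 x s) (x, s)\<bar> / s) \<partial>lborel) = H"
      unfolding H_def by (intro ext nn_integral_cong) (auto simp: indicator_def)
    finally show ?thesis .
  qed
  have "(\<lambda>x. H x * indicator Y x) \<in> borel_measurable borel"
    using Hm by (subst (asm) borel_measurable_restrict_space_iff_ennreal) auto
  then have "(\<lambda>x. (H x * indicator Y x) * indicator A x) \<in> borel_measurable borel" by measurable
  also have "(\<lambda>x. (H x * indicator Y x) * indicator A x) = (\<lambda>x. H x * indicator A x)"
    using A(2) by (auto simp: indicator_def fun_eq_iff)
  finally have HA: "(\<lambda>x. 2 * (H x * indicator A x)) \<in> borel_measurable \<sigma>" by measurable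
  have pt: "(SUP r\<in>{1 / real n..real n}. \<integral>\<^sup>+s\<in>{0<..<\<epsilon> / real n}. ennreal (\<bar>l x (r * s) - l x s\<bar> / s) \<partial>lborel) * indicator A x
     \<le> ennreal (real n) * (G x * indicator A x) + 2 * (H x * indicator A x)" for x
  proof (cases "x \<in> A")
    case True
    then have x: "x \<in> Y" using A(2) by auto
    have sm: "(\<lambda>s. indicator {0<..<\<epsilon>} s * l2 x s) \<in> borel_measurable borel"
      using measurable_Pair2[OF l2m, of x] x by (simp add: space_restrict_space)
    have "(SUP r\<in>{1 / real n..real n}. \<integral>\<^sup>+s\<in>{0<..<\<epsilon> / real n}. ennreal (\<bar>l x (r * s) - l x s\<bar> / s) \<partial>lborel)
      \<le> ennreal (real n) * G x + 2 * H x"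
      unfolding G_def H_def
      by (intro SUP_least dilation_difference_integral[OF dec[OF x] d[OF x] sm n])
    then show ?thesis using True by simp
  qed simp
  have "(\<integral>\<^sup>+x\<in>A. (SUP r\<in>{1 / real n..real n}. \<integral>\<^sup>+s\<in>{0<..<\<epsilon> / real n}. ennreal (\<bar>l x (r * s) - l x s\<bar> / s) \<partial>lborel) \<partial>\<sigma>)
     \<le> (\<integral>\<^sup>+x. ennreal (real n) * (G x * indicator A x) + 2 * (H x * indicator A x) \<partial>\<sigma>)"
    using pt by (rule nn_integral_mono)
  also have "\<dots> \<le> (\<integral>\<^sup>+x. ennreal (real n) * (G x * indicator A x) \<partial>\<sigma>) + (\<integral>\<^sup>+x. 2 * (H x * indicator A x) \<partial>\<sigma>)"
    by (rule nn_integral_add_le[OF HA])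
  also have "\<dots> \<le> ennreal (real n) * (\<integral>\<^sup>+x\<in>A. G x \<partial>\<sigma>) + ennreal 2 * (\<integral>\<^sup>+x\<in>A. H x \<partial>\<sigma>)"
    using n0 nn_integral_cmult_le[where c=2 and f="\<lambda>x. H x * indicator A x" and M=\<sigma>] by (intro add_mono nn_integral_cmult_le) auto
  also have "\<dots> < \<infinity>" using fin1 fin2 by (simp add: G_def H_def ennreal_mult_less_top)
  finally show ?thesis .
qed

section \<open>The Levy measure of the theorem\<close>

locale levy_density =
  fixes \<sigma> :: "'a::polish_space measure" and l :: "'a \<Rightarrow> real \<Rightarrow> real" and Y :: "'a set"
  assumes lc: "locally_compact_space (euclidean :: 'a topology)"
    and radon: "\<sigma> \<in> radon_measures" and nonatomic: "atoms \<sigma> = {}"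
    and l_measurable: "(\<lambda>(x, s). l x s) \<in> borel_measurable (borel \<Otimes>\<^sub>M restrict_space borel {0<..})"
    and l_nonneg: "\<And>x s. s > 0 \<Longrightarrow> l x s \<ge> 0"
    and dichotomy: "\<And>x. (\<forall>s>0. l x s > 0) \<or> (\<forall>s>0. l x s = 0)"
    and Y: "Y = {x. \<forall>s>0. l x s > 0}"
    and l_integrable: "\<And>A. A \<in> relatively_compact_borel Y \<Longrightarrow>
      (\<integral>\<^sup>+z\<in>A \<times> {0<..}. (case z of (x, s) \<Rightarrow> ennreal (l x s * min (1 / s) 1))
         \<partial>(\<sigma> \<Otimes>\<^sub>M restrict_space lborel {0<..})) < \<infinity>"
begin

lemma sets_\<sigma> [measurable_cong]: "sets \<sigma> = sets borel"
  using radon by (simp add: radon_measures_def)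

lemma space_\<sigma>: "space \<sigma> = UNIV"
  using sets_eq_imp_space_eq[OF sets_\<sigma>] by simp

lemma sigma_finite_\<sigma>: "sigma_finite_measure \<sigma>"
proof
  obtain U :: "nat \<Rightarrow> 'a set" where U: "\<And>n. open (U n)" "\<And>n. compact (closure (U n))" "incseq U" "(\<Union>n. U n) = UNIV"
    using compact_exhaustion[OF lc] by blast
  have "emeasure \<sigma> (U n) \<noteq> \<infinity>" for n using relatively_compact_mass_finite[OF radon U(2)] by (simp add: less_top)
  then show "\<exists>A. countable A \<and> A \<subseteq> sets \<sigma> \<and> \<Union>A = space \<sigma> \<and> (\<forall>a\<in>A. emeasure \<sigma> a \<noteq> \<infinity>)"
    using U by (intro exI[of _ "range U"]) (auto simp: sets_\<sigma> space_\<sigma>)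
qed

sublocale \<sigma>: sigma_finite_measure \<sigma> by (rule sigma_finite_\<sigma>)
sublocale pair: pair_sigma_finite \<sigma> lborel ..

text \<open>The function \<open>l\<close> extended by \<open>0\<close> to nonpositive marks, where nothing is known about \<open>l\<close>.\<close>
definition rate :: "'a \<Rightarrow> real \<Rightarrow> real" where
  "rate x s = (if 0 < s then l x s else 0)"

lemma rate_measurable [measurable]: "case_prod rate \<in> borel_measurable (borel \<Otimes>\<^sub>M borel)"
proof -
  define t where "t s = (if 0 < s then s else 1)" for s :: real
  have tm: "t \<in> measurable borel (restrict_space borel {0<..})"
    unfolding t_def[abs_def] by (rule measurable_restrict_space2) auto
  have "(\<lambda>p. (fst p, t (snd p))) \<in> measurable (borel \<Otimes>\<^sub>M borel) ((borel :: 'a measure) \<Otimes>\<^sub>M restrict_space borel {0<..})"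
    using tm by measurable
  from measurable_compose[OF this l_measurable]
  have [measurable]: "(\<lambda>p. l (fst p) (t (snd p))) \<in> borel_measurable (borel \<Otimes>\<^sub>M borel)" by simp
  have "(\<lambda>p. if 0 < snd p then l (fst p) (t (snd p)) else 0) \<in> borel_measurable (borel \<Otimes>\<^sub>M borel)" by measurable
  also have "(\<lambda>p. if 0 < snd p then l (fst p) (t (snd p)) else 0) = case_prod rate"
    by (auto simp: t_def rate_def fun_eq_iff)
  finally show ?thesis .
qed

lemma rate_nonneg: "0 \<le> rate x s"
  by (simp add: rate_def l_nonneg)

lemma rate_outside: "x \<notin> Y \<Longrightarrow> rate x s = 0"
  using dichotomy[of x] Y by (auto simp: rate_def)

lemma rate_pos: "x \<in> Y \<Longrightarrow> 0 < s \<Longrightarrow> 0 < rate x s"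
  using Y by (simp add: rate_def)

lemma Y_measurable [measurable]: "Y \<in> sets borel"
proof -
  have "Y = {x \<in> space borel. 0 < rate x 1}"
    using rate_pos[of _ 1] rate_outside[of _ 1] by fastforce
  also have "\<dots> \<in> sets borel" by measurable
  finally show ?thesis .
qed

definition levy :: "('a \<times> real) measure" where
  "levy = density (\<sigma> \<Otimes>\<^sub>M lborel) (\<lambda>z. ennreal (rate (fst z) (snd z) / snd z))"

lemma sets_levy [measurable_cong]: "sets levy = sets (borel \<Otimes>\<^sub>M borel)"
  unfolding levy_def sets_density by (rule sets_pair_measure_cong[OF sets_\<sigma> sets_lborel])

lemma rate_measurable_pair [measurable]: "(\<lambda>z. rate (fst z) (snd z)) \<in> borel_measurable (\<sigma> \<Otimes>\<^sub>M lborel)"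
  by measurable

lemma nn_integral_levy:
  assumes h: "h \<in> borel_measurable (borel \<Otimes>\<^sub>M borel)"
  shows "(\<integral>\<^sup>+z. h z \<partial>levy) = (\<integral>\<^sup>+x. \<integral>\<^sup>+s. ennreal (rate x s / s) * h (x, s) \<partial>lborel \<partial>\<sigma>)"
proof -
  have [measurable]: "h \<in> borel_measurable (borel \<Otimes>\<^sub>M borel)" by fact
  have "(\<integral>\<^sup>+z. h z \<partial>levy) = (\<integral>\<^sup>+z. ennreal (rate (fst z) (snd z) / snd z) * h z \<partial>(\<sigma> \<Otimes>\<^sub>M lborel))"
    unfolding levy_def by (rule nn_integral_density) measurable
  also have "\<dots> = (\<integral>\<^sup>+x. \<integral>\<^sup>+s. ennreal (rate x s / s) * h (x, s) \<partial>lborel \<partial>\<sigma>)"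
    by (subst lborel.nn_integral_fst[symmetric]) auto
  finally show ?thesis .
qed

lemma sets_positive_pair: "sets (\<sigma> \<Otimes>\<^sub>M restrict_space lborel {0<..}) = sets (borel \<Otimes>\<^sub>M restrict_space borel {0<..})"
  by (intro sets_pair_measure_cong sets_\<sigma> sets_restrict_space_cong) simp

lemma nn_integral_positive_pair:
  assumes h: "h \<in> borel_measurable (borel \<Otimes>\<^sub>M restrict_space borel {0::real<..})"
  shows "(\<integral>\<^sup>+z. h z \<partial>(\<sigma> \<Otimes>\<^sub>M restrict_space lborel {0<..})) = (\<integral>\<^sup>+x. (\<integral>\<^sup>+s\<in>{0<..}. h (x, s) \<partial>lborel) \<partial>\<sigma>)"
proof -
  interpret R: sigma_finite_measure "restrict_space lborel {0::real<..}"
    by (rule sigma_finite_measure_restrict_space) (auto intro: lborel.sigma_finite_measure_axioms)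
  have "h \<in> borel_measurable (\<sigma> \<Otimes>\<^sub>M restrict_space lborel {0<..})"
    using h measurable_cong_sets[OF sets_positive_pair refl] by blast
  from R.nn_integral_fst[OF this, symmetric] show ?thesis
    by (simp add: nn_integral_restrict_space)
qed

lemma mark_space_inclusion:
  "(\<lambda>z. z) \<in> measurable (borel \<Otimes>\<^sub>M restrict_space borel {0::real<..}) ((borel :: 'a measure) \<Otimes>\<^sub>M borel)"
proof -
  have "(\<lambda>z. (fst z, snd z)) \<in> measurable (borel \<Otimes>\<^sub>M restrict_space borel {0::real<..}) ((borel :: 'a measure) \<Otimes>\<^sub>M borel)"
    by (intro measurable_Pair measurable_fst) (rule measurable_compose[OF measurable_snd], simp add: measurable_restrict_space1)
  then show ?thesis by simp
qed

lemma sets_levy_measure: "sets (levy_measure \<sigma> l) = sets (borel \<Otimes>\<^sub>M restrict_space borel {0<..})"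
  by (simp add: levy_measure_def sets_positive_pair)

text \<open>The Levy measure on \<open>X \<times> {0<..}\<close>, regarded as a measure on \<open>X \<times> \<real>\<close>.\<close>
lemma levy_measure_distr: "distr (levy_measure \<sigma> l) (borel \<Otimes>\<^sub>M borel) (\<lambda>z. z) = levy"
proof (rule measure_eqI)
  have inc: "(\<lambda>z. z) \<in> measurable (levy_measure \<sigma> l) (borel \<Otimes>\<^sub>M borel)"
    using mark_space_inclusion measurable_cong_sets[OF sets_levy_measure refl] by blast
  fix A assume "A \<in> sets (distr (levy_measure \<sigma> l) (borel \<Otimes>\<^sub>M borel) (\<lambda>z. z))"
  then have A[measurable]: "A \<in> sets (borel \<Otimes>\<^sub>M borel)" by simp
  have lm: "(\<lambda>(x, s). ennreal (l x s / s)) \<in> borel_measurable (borel \<Otimes>\<^sub>M restrict_space borel {0<..})"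
  proof -
    have "(\<lambda>p. snd p) \<in> borel_measurable ((borel :: 'a measure) \<Otimes>\<^sub>M restrict_space borel {0::real<..})"
      by (rule measurable_compose[OF measurable_snd]) (simp add: measurable_restrict_space1)
    then show ?thesis using l_measurable by (simp add: split_beta')
  qed
  have iA: "indicator A \<in> borel_measurable ((borel :: 'a measure) \<Otimes>\<^sub>M restrict_space borel {0::real<..})"
    by (rule measurable_compose[OF mark_space_inclusion borel_measurable_indicator[OF A]])
  have "emeasure (distr (levy_measure \<sigma> l) (borel \<Otimes>\<^sub>M borel) (\<lambda>z. z)) A = (\<integral>\<^sup>+z. indicator A z \<partial>distr (levy_measure \<sigma> l) (borel \<Otimes>\<^sub>M borel) (\<lambda>z. z))"
    by simp
  also have "\<dots> = (\<integral>\<^sup>+z. indicator A z \<partial>levy_measure \<sigma> l)"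
    by (rule nn_integral_distr[OF inc]) simp
  also have "\<dots> = (\<integral>\<^sup>+z. (\<lambda>(x, s). ennreal (l x s / s)) z * indicator A z \<partial>(\<sigma> \<Otimes>\<^sub>M restrict_space lborel {0<..}))"
    unfolding levy_measure_def using lm iA
    by (intro nn_integral_density) (simp_all add: measurable_cong_sets[OF sets_positive_pair refl])
  also have "\<dots> = (\<integral>\<^sup>+x. (\<integral>\<^sup>+s\<in>{0<..}. ennreal (l x s / s) * indicator A (x, s) \<partial>lborel) \<partial>\<sigma>)"
    using borel_measurable_times_ennreal[OF lm iA] by (subst nn_integral_positive_pair) (auto simp: split_beta')
  also have "\<dots> = (\<integral>\<^sup>+x. \<integral>\<^sup>+s. ennreal (rate x s / s) * indicator A (x, s) \<partial>lborel \<partial>\<sigma>)"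
    by (intro nn_integral_cong) (auto simp: rate_def indicator_def)
  also have "\<dots> = (\<integral>\<^sup>+z. indicator A z \<partial>levy)" by (rule nn_integral_levy[symmetric]) simp
  also have "\<dots> = emeasure levy A" by (simp add: sets_levy)
  finally show "emeasure (distr (levy_measure \<sigma> l) (borel \<Otimes>\<^sub>M borel) (\<lambda>z. z)) A = emeasure levy A" .
qed (simp add: sets_levy)

lemma truncated_rate_integrable:
  assumes A: "A \<in> relatively_compact_borel Y"
  shows "(\<integral>\<^sup>+x. \<integral>\<^sup>+s. ennreal (rate x s * min (1 / s) 1) * indicator A x \<partial>lborel \<partial>\<sigma>) < \<infinity>"
proof -
  have Am[measurable]: "A \<in> sets borel" using A by (simp add: relatively_compact_borel_def)
  have sm[measurable]: "snd \<in> borel_measurable ((borel :: 'a measure) \<Otimes>\<^sub>M restrict_space borel {0::real<..})"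
    by (rule measurable_compose[OF measurable_snd]) (simp add: measurable_restrict_space1)
  have lm[measurable]: "(\<lambda>p. l (fst p) (snd p)) \<in> borel_measurable (borel \<Otimes>\<^sub>M restrict_space borel {0<..})"
    using l_measurable by (simp add: split_beta')
  have meas: "(\<lambda>z. ennreal (l (fst z) (snd z) * min (1 / snd z) 1) * indicator A (fst z))
      \<in> borel_measurable (borel \<Otimes>\<^sub>M restrict_space borel {0<..})"
    by measurable
  have "(\<integral>\<^sup>+z\<in>A \<times> {0<..}. (case z of (x, s) \<Rightarrow> ennreal (l x s * min (1 / s) 1)) \<partial>(\<sigma> \<Otimes>\<^sub>M restrict_space lborel {0<..}))
     = (\<integral>\<^sup>+z. ennreal (l (fst z) (snd z) * min (1 / snd z) 1) * indicator A (fst z) \<partial>(\<sigma> \<Otimes>\<^sub>M restrict_space lborel {0<..}))"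
    by (intro nn_integral_cong) (auto simp: indicator_def space_pair_measure space_restrict_space)
  also have "\<dots> = (\<integral>\<^sup>+x. (\<integral>\<^sup>+s\<in>{0<..}. ennreal (l x s * min (1 / s) 1) * indicator A x \<partial>lborel) \<partial>\<sigma>)"
    using meas by (subst nn_integral_positive_pair) simp_all
  also have "\<dots> = (\<integral>\<^sup>+x. \<integral>\<^sup>+s. ennreal (rate x s * min (1 / s) 1) * indicator A x \<partial>lborel \<partial>\<sigma>)"
    by (intro nn_integral_cong) (auto simp: rate_def indicator_def)
  finally show ?thesis using l_integrable[OF A] by simp
qed

lemma compact_Int_Y: "compact K \<Longrightarrow> K \<inter> Y \<in> relatively_compact_borel Y"
proof -
  assume K: "compact K"
  have "compact (closure (K \<inter> Y))" using K by (rule compact_closure_of_subset) simp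
  then show ?thesis using K by (auto simp: relatively_compact_borel_def compact_imp_closed)
qed

lemma levy_completely_random:
  assumes \<mu>: "completely_random_law (levy_measure \<sigma> l) \<mu>"
  shows "completely_random_measure levy \<mu>"
proof (rule completely_random_measure.intro)
  show "locally_compact_space (euclidean :: 'a topology)" by (rule lc)
  show "sets levy = sets (borel \<Otimes>\<^sub>M borel)" by (rule sets_levy)
  show "sigma_finite_measure levy"
    unfolding levy_def 
    by (subst sigma_finite_measure.sigma_finite_iff_density_finite[OF pair.sigma_finite_measure_axioms]) auto
  show "AE z in levy. 0 < snd z"
  proof -
    have "(\<lambda>z. ennreal (rate (fst z) (snd z) / snd z)) \<in> borel_measurable (\<sigma> \<Otimes>\<^sub>M lborel)" by measurable
    then show ?thesis unfolding levy_def by (subst AE_density) (auto simp: rate_def)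
  qed
  show "emeasure levy (T \<times> UNIV) = 0" if "countable T" for T
  proof -
    have Tm[measurable]: "T \<in> sets borel" using that by (rule countable_in_borel)
    have "emeasure \<sigma> T = (\<integral>\<^sup>+x. emeasure \<sigma> {x} \<partial>count_space T)"
      using that by (intro emeasure_countable_singleton) (auto simp: sets_\<sigma>)
    also have "\<dots> = 0" using nonatomic by (simp add: atoms_def zero_less_iff_neq_zero)
    finally have T0: "T \<in> null_sets \<sigma>" using Tm by (intro null_setsI) (simp_all add: sets_\<sigma>)
    have "emeasure levy (T \<times> UNIV) = (\<integral>\<^sup>+z. indicator (T \<times> UNIV) z \<partial>levy)"
      using Tm by (subst nn_integral_indicator) (auto simp: sets_levy)
    also have "\<dots> = (\<integral>\<^sup>+x. \<integral>\<^sup>+s. ennreal (rate x s / s) * indicator (T \<times> UNIV) (x, s) \<partial>lborel \<partial>\<sigma>)"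
      by (rule nn_integral_levy) measurable
    also have "\<dots> = (\<integral>\<^sup>+x. 0 \<partial>\<sigma>)"
      using AE_not_in[OF T0] by (intro nn_integral_cong_AE) (auto elim!: eventually_mono)
    finally show ?thesis by simp
  qed
  show "integrable levy (\<lambda>z. indicator K (fst z) * min 1 \<bar>snd z\<bar>)" if K: "compact K" for K :: "'a set"
  proof (rule integrableI_nonneg)
    have [measurable]: "K \<in> sets borel" using K by (simp add: compact_imp_closed)
    show m1: "(\<lambda>z. indicator K (fst z) * min 1 \<bar>snd z\<bar>) \<in> borel_measurable levy" by measurable
    have "(\<integral>\<^sup>+z. ennreal (indicator K (fst z) * min 1 \<bar>snd z\<bar>) \<partial>levy)
      = (\<integral>\<^sup>+x. \<integral>\<^sup>+s. ennreal (rate x s / s) * ennreal (indicator K (fst (x, s)) * min 1 \<bar>snd (x, s)\<bar>) \<partial>lborel \<partial>\<sigma>)"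
      by (rule nn_integral_levy) measurable
    also have "\<dots> = (\<integral>\<^sup>+x. \<integral>\<^sup>+s. ennreal (rate x s * min (1 / s) 1) * indicator (K \<inter> Y) x \<partial>lborel \<partial>\<sigma>)"
    proof (intro nn_integral_cong)
      fix x s
      have "rate x s / s * min 1 \<bar>s\<bar> = rate x s * min (1 / s) 1"
        by (cases "0 < s") (auto simp: rate_def min_def field_simps)
      moreover have "0 \<le> rate x s / s" by (auto simp: rate_def l_nonneg)
      ultimately show "ennreal (rate x s / s) * ennreal (indicator K (fst (x, s)) * min 1 \<bar>snd (x, s)\<bar>)
         = ennreal (rate x s * min (1 / s) 1) * indicator (K \<inter> Y) x"
        by (cases "x \<in> Y") (auto simp: indicator_def ennreal_mult[symmetric] rate_outside)
    qed
    also have "\<dots> < \<infinity>" by (rule truncated_rate_integrable[OF compact_Int_Y[OF K]])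
    finally show "(\<integral>\<^sup>+z. ennreal (indicator K (fst z) * min 1 \<bar>snd z\<bar>) \<partial>levy) < \<infinity>" .
  qed simp
  show "prob_space \<mu>" using \<mu> by (simp add: completely_random_law_def)
  show "sets \<mu> = sets discrete_radon_space" using \<mu> by (simp add: completely_random_law_def)
  fix f :: "'a \<Rightarrow> real" assume f: "f \<in> test_functions"
  have fm[measurable]: "f \<in> borel_measurable borel"
    using f by (auto simp: test_functions_def intro: borel_measurable_continuous_onI)
  have inc: "(\<lambda>z. z) \<in> measurable (levy_measure \<sigma> l) (borel \<Otimes>\<^sub>M borel)"
    using mark_space_inclusion measurable_cong_sets[OF sets_levy_measure refl] by blast
  have "(LINT z|levy. iexp (snd z * f (fst z)) - 1) = (LINT z|levy_measure \<sigma> l. iexp (snd z * f (fst z)) - 1)"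
    unfolding levy_measure_distr[symmetric] by (rule integral_distr[OF inc]) measurable
  then show "(LINT \<eta>|\<mu>. iexp (LINT x|\<eta>. f x)) = exp (LINT z|levy. iexp (snd z * f (fst z)) - 1)"
    using \<mu> f by (simp add: completely_random_law_def split_beta')
qed

end

section \<open>Quasi-invariance under multiplication\<close>

context levy_density
begin

lemma dilated_rate_measurable [measurable]:
  assumes [measurable]: "\<iota> \<in> borel_measurable borel"
  shows "(\<lambda>z. rate (fst z) (\<iota> (fst z) * snd z)) \<in> borel_measurable (borel \<Otimes>\<^sub>M borel)"
proof -
  have "(\<lambda>z. (fst z, \<iota> (fst z) * snd z)) \<in> measurable (borel \<Otimes>\<^sub>M borel) (borel \<Otimes>\<^sub>M borel)" by measurable
  from measurable_compose[OF this rate_measurable] show ?thesis by simp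
qed

lemma rate_section_measurable [measurable]: "rate x \<in> borel_measurable borel"
  using measurable_Pair2[OF rate_measurable, of x] by simp

text \<open>With \<open>n\<close> so large that \<open>1 / \<theta>\<close> takes values between \<open>1/n\<close> and \<open>n\<close>, small marks are covered by the assumed bound for
dilations. For marks above \<open>\<epsilon>'\<close> the two terms of the difference are integrated separately: the
dilated one only involves marks above \<open>\<epsilon>' / n\<close>, where \<open>1/s\<close> is comparable with \<open>min {1/s, 1}\<close>. Off
a compact set \<open>\<theta> = 1\<close>, and the two terms cancel.\<close>
lemma dilation_total_variation_finite:
  assumes \<theta>: "\<theta> \<in> multiplier_group"
    and sup_fin: "\<And>n::nat. n \<ge> 1 \<Longrightarrow> \<exists>\<epsilon>'>0. \<forall>A\<in>relatively_compact_borel Y.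
            (\<integral>\<^sup>+x\<in>A. (SUP r\<in>{1 / real n..real n}.
               \<integral>\<^sup>+s\<in>{0<..<\<epsilon>'}. ennreal (\<bar>l x (r * s) - l x s\<bar> / s) \<partial>lborel) \<partial>\<sigma>) < \<infinity>"
  shows "(\<integral>\<^sup>+x. \<integral>\<^sup>+s. ennreal (\<bar>rate x (inverse (\<theta> x) * s) - rate x s\<bar> / s) \<partial>lborel \<partial>\<sigma>) < \<infinity>"
proof -
  define \<iota> where "\<iota> x = inverse (\<theta> x)" for x
  have \<iota>: "\<iota> \<in> multiplier_group" unfolding \<iota>_def[abs_def] by (rule multiplier_inverse[OF \<theta>])
  note [measurable] = multiplier_measurable[OF \<iota>]
  obtain C1 where C1: "C1 > 0" "\<And>x. 0 < \<theta> x \<and> \<theta> x \<le> C1" using multiplier_bounded[OF \<theta>] by blast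
  obtain C2 where C2: "C2 > 0" "\<And>x. 0 < \<iota> x \<and> \<iota> x \<le> C2" using multiplier_bounded[OF \<iota>] by blast
  obtain n :: nat where n: "max 1 (max C1 C2) \<le> real n" using real_arch_simple by blast
  then have n1: "1 \<le> n" "0 < real n" by auto
  have range: "\<iota> x \<in> {1 / real n..real n}" for x
  proof -
    have "1 / real n \<le> 1 / \<theta> x" using C1(2)[of x] n by (intro frac_le) auto
    then show ?thesis using C2(2)[of x] n by (auto simp: \<iota>_def inverse_eq_divide)
  qed
  obtain \<epsilon>' where e: "\<epsilon>' > 0" and fin: "\<And>A. A \<in> relatively_compact_borel Y \<Longrightarrow>
            (\<integral>\<^sup>+x\<in>A. (SUP r\<in>{1 / real n..real n}.
               \<integral>\<^sup>+s\<in>{0<..<\<epsilon>'}. ennreal (\<bar>l x (r * s) - l x s\<bar> / s) \<partial>lborel) \<partial>\<sigma>) < \<infinity>"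
    using sup_fin[OF n1(1)] by blast
  obtain K where K: "compact K" "\<And>x. x \<notin> K \<Longrightarrow> \<theta> x = 1" using \<theta> by (auto simp: multiplier_group_def)
  define A where "A = K \<inter> Y"
  have A: "A \<in> relatively_compact_borel Y" unfolding A_def by (rule compact_Int_Y[OF K(1)])
  then have Am[measurable]: "A \<in> sets borel" by (simp add: relatively_compact_borel_def)
  define \<delta> where "\<delta> = \<epsilon>' / real n"
  have \<delta>: "0 < \<delta>" "\<delta> \<le> \<epsilon>'" using e n by (auto simp: \<delta>_def field_simps)
  define h where "h x v = ennreal (rate x v / v) * indicator {\<delta>..} v" for x v
  have hm[measurable]: "h x \<in> borel_measurable borel" for x unfolding h_def by measurable
  have hm2: "(\<lambda>z. h (fst z) (snd z)) \<in> borel_measurable (\<sigma> \<Otimes>\<^sub>M lborel)" unfolding h_def by measurable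
  define S where "S x = (SUP r\<in>{1 / real n..real n}. \<integral>\<^sup>+s\<in>{0<..<\<epsilon>'}. ennreal (\<bar>l x (r * s) - l x s\<bar> / s) \<partial>lborel)" for x
  define R where "R x = (\<integral>\<^sup>+s. h x s \<partial>lborel)" for x
  have Rm[measurable]: "R \<in> borel_measurable \<sigma>" unfolding R_def using hm2 by measurable
  define F where "F x s = ennreal (\<bar>rate x (\<iota> x * s) - rate x s\<bar> / s)" for x s
  have rm[measurable]: "(\<lambda>s. rate x (c * s)) \<in> borel_measurable borel" for x c
    by (rule measurable_compose[OF _ rate_section_measurable]) simp
  have Fm[measurable]: "F x \<in> borel_measurable borel" for x unfolding F_def by measurable
  have inner: "(\<integral>\<^sup>+s. F x s \<partial>lborel) \<le> S x * indicator A x + 2 * (R x * indicator A x)" for x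
  proof (cases "x \<in> A")
    case False
    have "F x s = 0" for s
    proof (cases "x \<in> K")
      case True
      then have "x \<notin> Y" using False by (simp add: A_def)
      then show ?thesis by (simp add: F_def rate_outside)
    next
      case False
      then show ?thesis using K(2) by (simp add: F_def \<iota>_def)
    qed
    then show ?thesis by simp
  next
    case True
    have i0: "0 < \<iota> x" using C2(2) by blast
    have pt: "F x s \<le> F x s * indicator {0<..<\<epsilon>'} s + (ennreal (\<iota> x) * h x (\<iota> x * s) + h x s)" for s
    proof -
      consider "s \<le> 0" | "0 < s" "s < \<epsilon>'" | "0 < s" "\<epsilon>' \<le> s" by linarith
      then show ?thesis
      proof cases
        case 1
        then have "\<not> 0 < \<iota> x * s" using i0 by (simp add: mult_le_0_iff not_less)
        then show ?thesis using 1 by (simp add: F_def rate_def)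
      next
        case 3
        have "1 / real n * \<epsilon>' \<le> \<iota> x * s" using 3 range[of x] e i0 by (intro mult_mono) auto
        then have low: "\<delta> \<le> \<iota> x * s" by (simp add: \<delta>_def)
        have "\<bar>rate x (\<iota> x * s) - rate x s\<bar> \<le> rate x (\<iota> x * s) + rate x s"
          using rate_nonneg[of x "\<iota> x * s"] rate_nonneg[of x s] by linarith
        then have "\<bar>rate x (\<iota> x * s) - rate x s\<bar> / s \<le> (rate x (\<iota> x * s) + rate x s) / s"
          using 3 by (intro divide_right_mono) auto
        also have "\<dots> = \<iota> x * (rate x (\<iota> x * s) / (\<iota> x * s)) + rate x s / s"
          using i0 by (simp add: add_divide_distrib)
        finally have "F x s \<le> ennreal (\<iota> x * (rate x (\<iota> x * s) / (\<iota> x * s)) + rate x s / s)"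
          unfolding F_def by (rule ennreal_leI)
        also have "\<dots> = ennreal (\<iota> x * (rate x (\<iota> x * s) / (\<iota> x * s))) + ennreal (rate x s / s)"
          using 3 i0 by (intro ennreal_plus) (auto intro!: mult_nonneg_nonneg divide_nonneg_nonneg rate_nonneg)
        also have "ennreal (\<iota> x * (rate x (\<iota> x * s) / (\<iota> x * s))) = ennreal (\<iota> x) * ennreal (rate x (\<iota> x * s) / (\<iota> x * s))"
          using i0 by (intro ennreal_mult') simp
        also have "\<dots> = ennreal (\<iota> x) * h x (\<iota> x * s)" using low by (simp add: h_def)
        also have "ennreal (rate x s / s) = h x s" using 3 \<delta> by (simp add: h_def)
        finally show ?thesis by (rule order_trans) simp
      qed simp
    qed
    have "(\<integral>\<^sup>+s. F x s \<partial>lborel) \<le> (\<integral>\<^sup>+s. F x s * indicator {0<..<\<epsilon>'} s + (ennreal (\<iota> x) * h x (\<iota> x * s) + h x s) \<partial>lborel)"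
      using pt by (rule nn_integral_mono)
    also have "\<dots> = (\<integral>\<^sup>+s\<in>{0<..<\<epsilon>'}. F x s \<partial>lborel) + (ennreal (\<iota> x) * (\<integral>\<^sup>+s. h x (\<iota> x * s) \<partial>lborel) + R x)"
      by (simp add: nn_integral_add nn_integral_cmult R_def)
    also have "ennreal (\<iota> x) * (\<integral>\<^sup>+s. h x (\<iota> x * s) \<partial>lborel) = R x"
      using nn_integral_real_affine[OF hm, of "\<iota> x" x 0] i0 by (simp add: R_def)
    also have "(\<integral>\<^sup>+s\<in>{0<..<\<epsilon>'}. F x s \<partial>lborel) = (\<integral>\<^sup>+s\<in>{0<..<\<epsilon>'}. ennreal (\<bar>l x (\<iota> x * s) - l x s\<bar> / s) \<partial>lborel)"
      using i0 by (intro nn_integral_cong) (auto simp: F_def rate_def indicator_def)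
    also have "\<dots> \<le> S x" unfolding S_def using range by (intro SUP_upper)
    finally show ?thesis using True by (simp add: mult_2 add_right_mono)
  qed
  have Rfin: "(\<integral>\<^sup>+x. R x * indicator A x \<partial>\<sigma>) < \<infinity>"
  proof -
    have "(\<integral>\<^sup>+x. R x * indicator A x \<partial>\<sigma>) \<le> (\<integral>\<^sup>+x. ennreal (max 1 (1 / \<delta>)) * (\<integral>\<^sup>+s. ennreal (rate x s * min (1 / s) 1) * indicator A x \<partial>lborel) \<partial>\<sigma>)"
    proof (rule nn_integral_mono)
      fix x
      have "rate x s / s * indicator {\<delta>..} s \<le> max 1 (1 / \<delta>) * (rate x s * min (1 / s) 1)" for s
      proof (cases "\<delta> \<le> s")
        case True
        then have s: "0 < s" using \<delta> by linarith
        have "1 / s \<le> max 1 (1 / \<delta>) * min (1 / s) 1"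
        proof (cases "1 \<le> s")
          case True
          then have "min (1 / s) 1 = 1 / s" using s by (simp add: min_def)
          moreover have "1 * (1 / s) \<le> max 1 (1 / \<delta>) * (1 / s)" using s by (intro mult_right_mono) auto
          ultimately show ?thesis by simp
        next
          case False
          then have "min (1 / s) 1 = 1" using s by (simp add: min_def)
          moreover have "1 / s \<le> 1 / \<delta>" using True \<delta> by (intro frac_le) auto
          ultimately show ?thesis by simp
        qed
        then have "rate x s * (1 / s) \<le> rate x s * (max 1 (1 / \<delta>) * min (1 / s) 1)"
          by (intro mult_left_mono rate_nonneg)
        then show ?thesis using True by (simp add: mult_ac)
      next
        case False
        then show ?thesis using \<delta> by (auto simp: rate_def min_def l_nonneg intro!: mult_nonneg_nonneg)
      qed
      then have "h x s \<le> ennreal (max 1 (1 / \<delta>)) * ennreal (rate x s * min (1 / s) 1)" for s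
        unfolding h_def
        by (simp add: ennreal_mult'[symmetric] ennreal_indicator[symmetric] ennreal_mult''[symmetric] ennreal_leI del: ennreal_indicator)
      then have "R x \<le> (\<integral>\<^sup>+s. ennreal (max 1 (1 / \<delta>)) * ennreal (rate x s * min (1 / s) 1) \<partial>lborel)"
        unfolding R_def by (rule nn_integral_mono)
      also have "\<dots> = ennreal (max 1 (1 / \<delta>)) * (\<integral>\<^sup>+s. ennreal (rate x s * min (1 / s) 1) \<partial>lborel)"
        by (rule nn_integral_cmult) measurable
      finally show "R x * indicator A x \<le> ennreal (max 1 (1 / \<delta>)) * (\<integral>\<^sup>+s. ennreal (rate x s * min (1 / s) 1) * indicator A x \<partial>lborel)"
        by (auto simp: indicator_def)
    qed
    also have "\<dots> = ennreal (max 1 (1 / \<delta>)) * (\<integral>\<^sup>+x. \<integral>\<^sup>+s. ennreal (rate x s * min (1 / s) 1) * indicator A x \<partial>lborel \<partial>\<sigma>)"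
      by (rule nn_integral_cmult) measurable
    also have "\<dots> < \<infinity>" using truncated_rate_integrable[OF A] by (simp add: ennreal_mult_less_top)
    finally show ?thesis .
  qed
  have "(\<integral>\<^sup>+x. \<integral>\<^sup>+s. F x s \<partial>lborel \<partial>\<sigma>) \<le> (\<integral>\<^sup>+x. S x * indicator A x + 2 * (R x * indicator A x) \<partial>\<sigma>)"
    using inner by (rule nn_integral_mono)
  also have "\<dots> \<le> (\<integral>\<^sup>+x\<in>A. S x \<partial>\<sigma>) + (\<integral>\<^sup>+x. 2 * (R x * indicator A x) \<partial>\<sigma>)"
    by (rule nn_integral_add_le) measurable
  also have "(\<integral>\<^sup>+x. 2 * (R x * indicator A x) \<partial>\<sigma>) = 2 * (\<integral>\<^sup>+x. R x * indicator A x \<partial>\<sigma>)"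
    by (rule nn_integral_cmult) measurable
  also have "(\<integral>\<^sup>+x\<in>A. S x \<partial>\<sigma>) + 2 * (\<integral>\<^sup>+x. R x * indicator A x \<partial>\<sigma>) < \<infinity>"
    using fin[OF A] Rfin by (simp add: S_def ennreal_mult_less_top)
  finally show ?thesis by (simp add: F_def \<iota>_def)
qed

text \<open>The density of the dilated Levy measure with respect to the original one. It is set to \<open>1\<close> where both
vanish, so that its logarithm makes sense everywhere.\<close>
definition tilt :: "('a \<Rightarrow> real) \<Rightarrow> 'a \<Rightarrow> real \<Rightarrow> real" where
  "tilt \<theta> x s = (if x \<in> Y \<and> 0 < s then rate x (inverse (\<theta> x) * s) / rate x s else 1)"

context
  fixes \<theta> :: "'a \<Rightarrow> real"
  assumes \<theta>: "\<theta> \<in> multiplier_group"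
begin

lemma \<theta>_pos: "0 < \<theta> x"
  using \<theta> by (simp add: multiplier_group_def)

lemma inverse_\<theta>_measurable [measurable]: "(\<lambda>x. inverse (\<theta> x)) \<in> borel_measurable borel"
  using multiplier_measurable[OF multiplier_inverse[OF \<theta>]] by simp

lemma \<theta>_measurable [measurable]: "\<theta> \<in> borel_measurable borel"
  by (rule multiplier_measurable[OF \<theta>])

lemma rate_dilated_measurable [measurable]:
  "(\<lambda>z. rate (fst z) (inverse (\<theta> (fst z)) * snd z)) \<in> borel_measurable (borel \<Otimes>\<^sub>M borel)"
  by (rule dilated_rate_measurable) measurable

lemma tilt_pos: "0 < tilt \<theta> x s"
  using \<theta>_pos rate_pos by (auto simp: tilt_def)

lemma tilt_measurable [measurable]: "case_prod (tilt \<theta>) \<in> borel_measurable (borel \<Otimes>\<^sub>M borel)"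
proof -
  have "(\<lambda>z. if fst z \<in> Y \<and> 0 < snd z then rate (fst z) (inverse (\<theta> (fst z)) * snd z) / rate (fst z) (snd z) else 1)
     \<in> borel_measurable (borel \<Otimes>\<^sub>M borel)" by measurable
  then show ?thesis by (simp add: tilt_def split_beta')
qed

lemma rate_mult_tilt: "rate x s * tilt \<theta> x s = rate x (inverse (\<theta> x) * s)"
proof (cases "0 < s")
  case True
  then show ?thesis using rate_pos[of x s] by (cases "x \<in> Y") (auto simp: tilt_def rate_outside)
next
  case False
  then have "\<not> 0 < inverse (\<theta> x) * s" using \<theta>_pos[of x] by (simp add: zero_less_mult_iff)
  then show ?thesis using False by (simp add: rate_def)
qed

lemma rate_weighted_tilt: "rate x s / s * (1 - tilt \<theta> x s) = (rate x s - rate x (inverse (\<theta> x) * s)) / s"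
  by (simp add: right_diff_distrib rate_mult_tilt diff_divide_distrib)

lemma density_nonneg: "0 \<le> rate x s / s"
  by (auto simp: rate_def l_nonneg)

lemma levy_integrable_iff:
  fixes h :: "'a \<times> real \<Rightarrow> real"
  assumes [measurable]: "h \<in> borel_measurable (borel \<Otimes>\<^sub>M borel)"
  shows "integrable levy h \<longleftrightarrow> integrable (\<sigma> \<Otimes>\<^sub>M lborel) (\<lambda>z. rate (fst z) (snd z) / snd z * h z)"
    "integral\<^sup>L levy h = (LINT z|(\<sigma> \<Otimes>\<^sub>M lborel). rate (fst z) (snd z) / snd z * h z)"
  unfolding levy_def using density_nonneg
  by (subst integrable_density integral_density; auto)+

lemma one_minus_tilt_measurable: "(\<lambda>z. 1 - tilt \<theta> (fst z) (snd z)) \<in> borel_measurable (borel \<Otimes>\<^sub>M borel)"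
  by measurable

lemma difference_pointwise:
  "indicator (Y \<times> {0<..}) (x, s) *\<^sub>R ((l x s - l x (inverse (\<theta> x) * s)) / s) = (rate x s - rate x (inverse (\<theta> x) * s)) / s"
proof (cases "0 < s")
  case True
  then show ?thesis
    using \<theta>_pos[of x] by (cases "x \<in> Y") (auto simp: rate_outside, auto simp: rate_def)
next
  case False
  then have "\<not> 0 < inverse (\<theta> x) * s" using \<theta>_pos[of x] by (simp add: zero_less_mult_iff)
  then show ?thesis using False by (simp add: rate_def)
qed

text \<open>The substitution \<open>s \<mapsto> \<theta>(x) s\<close>: \<open>tilt \<theta>\<close> is the density of the image of the Levy measure under it.\<close>
lemma dilation_substitution:
  fixes f :: "'a \<Rightarrow> real"
  assumes [measurable]: "f \<in> borel_measurable borel" and f0: "\<And>x. 0 \<le> f x"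
  shows "(\<integral>\<^sup>+z. ennreal (1 - exp (- (snd z * (\<theta> (fst z) * f (fst z))))) \<partial>levy)
       = (\<integral>\<^sup>+z. ennreal (tilt \<theta> (fst z) (snd z) * (1 - exp (- (snd z * f (fst z))))) \<partial>levy)"
proof -
  define q where "q x v = ennreal (rate x (inverse (\<theta> x) * v) / v * (1 - exp (- (v * f x))))" for x v
  have [measurable]: "(\<lambda>v. rate x (c * v)) \<in> borel_measurable borel" for x c
    by (rule measurable_compose[OF _ rate_section_measurable]) simp
  have qm: "q x \<in> borel_measurable borel" for x unfolding q_def by measurable
  have "(\<integral>\<^sup>+z. ennreal (1 - exp (- (snd z * (\<theta> (fst z) * f (fst z))))) \<partial>levy)
     = (\<integral>\<^sup>+x. \<integral>\<^sup>+s. ennreal (rate x s / s) * ennreal (1 - exp (- (s * (\<theta> x * f x)))) \<partial>lborel \<partial>\<sigma>)"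
    using nn_integral_levy[of "\<lambda>z. ennreal (1 - exp (- (snd z * (\<theta> (fst z) * f (fst z)))))"] by simp
  also have "\<dots> = (\<integral>\<^sup>+x. \<integral>\<^sup>+s. ennreal (\<theta> x) * q x (\<theta> x * s) \<partial>lborel \<partial>\<sigma>)"
  proof (intro nn_integral_cong)
    fix x s
    have t: "0 < \<theta> x" by (rule \<theta>_pos)
    have "inverse (\<theta> x) * (\<theta> x * s) = s" using t by simp
    moreover have "\<theta> x * (rate x s / (\<theta> x * s)) = rate x s / s" using t by simp
    ultimately have "ennreal (\<theta> x) * q x (\<theta> x * s) = ennreal (rate x s / s * (1 - exp (- (s * (\<theta> x * f x)))))"
      using t by (simp only: q_def ennreal_mult'[symmetric, OF less_imp_le[OF t]] mult.assoc[symmetric]) (simp add: mult_ac)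
    also have "\<dots> = ennreal (rate x s / s) * ennreal (1 - exp (- (s * (\<theta> x * f x))))"
      by (rule ennreal_mult'[OF density_nonneg])
    finally show "ennreal (rate x s / s) * ennreal (1 - exp (- (s * (\<theta> x * f x)))) = ennreal (\<theta> x) * q x (\<theta> x * s)" by simp
  qed
  also have "\<dots> = (\<integral>\<^sup>+x. \<integral>\<^sup>+v. q x v \<partial>lborel \<partial>\<sigma>)"
  proof (rule nn_integral_cong)
    fix x
    have [measurable]: "q x \<in> borel_measurable borel" by (rule qm)
    have "(\<integral>\<^sup>+s. ennreal (\<theta> x) * q x (\<theta> x * s) \<partial>lborel) = ennreal (\<theta> x) * (\<integral>\<^sup>+s. q x (\<theta> x * s) \<partial>lborel)"
      by (rule nn_integral_cmult) measurable
    also have "\<dots> = (\<integral>\<^sup>+v. q x v \<partial>lborel)"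
      using nn_integral_real_affine[OF qm, of "\<theta> x" x 0] \<theta>_pos[of x] by simp
    finally show "(\<integral>\<^sup>+s. ennreal (\<theta> x) * q x (\<theta> x * s) \<partial>lborel) = (\<integral>\<^sup>+v. q x v \<partial>lborel)" .
  qed
  also have "\<dots> = (\<integral>\<^sup>+x. \<integral>\<^sup>+s. ennreal (rate x s / s) * ennreal (tilt \<theta> x s * (1 - exp (- (s * f x)))) \<partial>lborel \<partial>\<sigma>)"
    by (intro nn_integral_cong)
       (simp add: q_def ennreal_mult'[symmetric, OF density_nonneg] rate_mult_tilt[symmetric] mult.assoc)
  also have "\<dots> = (\<integral>\<^sup>+z. ennreal (tilt \<theta> (fst z) (snd z) * (1 - exp (- (snd z * f (fst z))))) \<partial>levy)"
  proof -
    have "(\<lambda>z. ennreal (tilt \<theta> (fst z) (snd z) * (1 - exp (- (snd z * f (fst z)))))) \<in> borel_measurable (borel \<Otimes>\<^sub>M borel)"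
      by measurable
    from nn_integral_levy[OF this] show ?thesis by simp
  qed
  finally show ?thesis .
qed

context
  assumes tv: "(\<integral>\<^sup>+x. \<integral>\<^sup>+s. ennreal (\<bar>rate x (inverse (\<theta> x) * s) - rate x s\<bar> / s) \<partial>lborel \<partial>\<sigma>) < \<infinity>"
begin

lemma difference_integrable:
  "integrable (\<sigma> \<Otimes>\<^sub>M lborel) (\<lambda>z. (rate (fst z) (snd z) - rate (fst z) (inverse (\<theta> (fst z)) * snd z)) / snd z)"
proof (rule integrableI_bounded)
  have "(\<integral>\<^sup>+z. ennreal (norm ((rate (fst z) (snd z) - rate (fst z) (inverse (\<theta> (fst z)) * snd z)) / snd z)) \<partial>(\<sigma> \<Otimes>\<^sub>M lborel))
     = (\<integral>\<^sup>+x. \<integral>\<^sup>+s. ennreal (norm ((rate x s - rate x (inverse (\<theta> x) * s)) / s)) \<partial>lborel \<partial>\<sigma>)"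
    by (subst lborel.nn_integral_fst[symmetric]) auto
  also have "\<dots> = (\<integral>\<^sup>+x. \<integral>\<^sup>+s. ennreal (\<bar>rate x (inverse (\<theta> x) * s) - rate x s\<bar> / s) \<partial>lborel \<partial>\<sigma>)"
  proof (intro nn_integral_cong arg_cong[where f=ennreal])
    fix x s
    show "norm ((rate x s - rate x (inverse (\<theta> x) * s)) / s) = \<bar>rate x (inverse (\<theta> x) * s) - rate x s\<bar> / s"
    proof (cases "0 < s")
      case False
      then have "\<not> 0 < inverse (\<theta> x) * s" using \<theta>_pos[of x] by (simp add: zero_less_mult_iff)
      then show ?thesis using False by (simp add: rate_def)
    qed (simp add: abs_minus_commute)
  qed
  finally show "(\<integral>\<^sup>+z. ennreal (norm ((rate (fst z) (snd z) - rate (fst z) (inverse (\<theta> (fst z)) * snd z)) / snd z)) \<partial>(\<sigma> \<Otimes>\<^sub>M lborel)) < \<infinity>"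
    using tv by simp
qed measurable

lemma tilt_integrable: "integrable levy (\<lambda>z. tilt \<theta> (fst z) (snd z) - 1)"
proof -
  have "integrable levy (\<lambda>z. 1 - tilt \<theta> (fst z) (snd z))"
    unfolding levy_integrable_iff(1)[OF one_minus_tilt_measurable] rate_weighted_tilt
    by (rule difference_integrable)
  then have "integrable levy (\<lambda>z. - (1 - tilt \<theta> (fst z) (snd z)))" by (rule Bochner_Integration.integrable_minus)
  then show ?thesis by simp
qed

lemma difference_set_integrable:
  "set_integrable (\<sigma> \<Otimes>\<^sub>M lborel) (Y \<times> {0<..}) (\<lambda>(x, s). (l x s - l x (inverse (\<theta> x) * s)) / s)"
  unfolding set_integrable_def using difference_integrable
  by (rule back_subst[where P="integrable (\<sigma> \<Otimes>\<^sub>M lborel)"])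
     (auto simp: fun_eq_iff difference_pointwise[symmetric])

lemma difference_integral:
  "(LINT x:Y|\<sigma>. LINT s:{0<..}|lborel. (l x s - l x (inverse (\<theta> x) * s)) / s) = (LINT z|levy. 1 - tilt \<theta> (fst z) (snd z))"
proof -
  have "(LINT x:Y|\<sigma>. LINT s:{0<..}|lborel. (l x s - l x (inverse (\<theta> x) * s)) / s)
    = (LINT x|\<sigma>. LINT s|lborel. (rate x s - rate x (inverse (\<theta> x) * s)) / s)"
    unfolding set_lebesgue_integral_def
  proof (intro Bochner_Integration.integral_cong refl)
    fix x
    have "indicator Y x *\<^sub>R (LINT s|lborel. indicator {0<..} s *\<^sub>R ((l x s - l x (inverse (\<theta> x) * s)) / s))
      = (LINT s|lborel. indicator Y x *\<^sub>R (indicator {0<..} s *\<^sub>R ((l x s - l x (inverse (\<theta> x) * s)) / s)))"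
      by (cases "x \<in> Y") simp_all
    also have "\<dots> = (LINT s|lborel. (rate x s - rate x (inverse (\<theta> x) * s)) / s)"
      by (intro Bochner_Integration.integral_cong refl)
         (auto simp: difference_pointwise[symmetric] indicator_def)
    finally show "indicator Y x *\<^sub>R (LINT s|lborel. indicator {0<..} s *\<^sub>R ((l x s - l x (inverse (\<theta> x) * s)) / s))
      = (LINT s|lborel. (rate x s - rate x (inverse (\<theta> x) * s)) / s)" .
  qed
  also have "\<dots> = (LINT z|(\<sigma> \<Otimes>\<^sub>M lborel). (rate (fst z) (snd z) - rate (fst z) (inverse (\<theta> (fst z)) * snd z)) / snd z)"
    using pair.integral_fst'[OF difference_integrable] by simp
  also have "\<dots> = (LINT z|levy. 1 - tilt \<theta> (fst z) (snd z))"
    unfolding levy_integrable_iff(2)[OF one_minus_tilt_measurable] rate_weighted_tilt ..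
  finally show ?thesis .
qed

end

end


text \<open>Both sides have Laplace functional \<open>f \<mapsto> exp (\<integral> (exp (- s \<theta>(x) f(x)) - 1) dm)\<close>. On the right it is
obtained from the exponential formula for \<open>g(x, s) - s f(x)\<close>; the constant \<open>c\<close> turns the
exponent \<open>\<integral> (\<phi> exp (- s f) - 1) dm\<close>, where \<open>\<phi>\<close> is the tilt, into \<open>\<integral> \<phi> (exp (- s f) - 1) dm\<close>, to which
\<open>dilation_substitution\<close> applies.\<close>
lemma quasi_invariant_density:
  assumes \<theta>: "\<theta> \<in> multiplier_group"
    and tv: "(\<integral>\<^sup>+x. \<integral>\<^sup>+s. ennreal (\<bar>rate x (inverse (\<theta> x) * s) - rate x s\<bar> / s) \<partial>lborel \<partial>\<sigma>) < \<infinity>"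
    and \<mu>: "completely_random_law (levy_measure \<sigma> l) \<mu>"
  defines "g \<equiv> \<lambda>x s. ln (tilt \<theta> x s)" and "c \<equiv> LINT z|levy. 1 - tilt \<theta> (fst z) (snd z)"
  shows "distr \<mu> discrete_radon_space (multiply \<theta>) = density \<mu> (\<lambda>\<eta>. ennreal (exp (mark_integral g \<eta> + c)))"
    and "AE \<eta> in \<mu>. mark_integrable g \<eta>" and "mark_integral g \<in> borel_measurable \<mu>"
proof -
  interpret C: completely_random_measure levy \<mu> by (rule levy_completely_random[OF \<mu>])
  note [measurable] = tilt_measurable[OF \<theta>] \<theta>_measurable[OF \<theta>]
  have tp: "0 < tilt \<theta> x s" for x s by (rule tilt_pos[OF \<theta>])
  have gm[measurable]: "case_prod g \<in> borel_measurable (borel \<Otimes>\<^sub>M borel)" unfolding g_def by measurable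
  have ti: "integrable levy (\<lambda>z. tilt \<theta> (fst z) (snd z) - 1)" by (rule tilt_integrable[OF \<theta> tv])
  have "(\<integral>\<^sup>+z. ennreal \<bar>exp (g (fst z) (snd z)) - 1\<bar> \<partial>levy) < \<infinity>"
    using ti tp by (simp add: g_def integrable_iff_bounded)
  then show AEg: "AE \<eta> in \<mu>. mark_integrable g \<eta>" by (rule C.AE_mark_integrable[OF gm])
  have mS: "mark_integral g \<in> borel_measurable discrete_radon_space" by (rule mark_integral_measurable[OF lc gm])
  then show mg[measurable]: "mark_integral g \<in> borel_measurable \<mu>"
    by (simp add: measurable_cong_sets[OF C.sets_\<mu> refl])
  have mult_m: "multiply \<theta> \<in> measurable \<mu> discrete_radon_space"
    using multiply_measurable[OF lc \<theta>] by (simp add: measurable_cong_sets[OF C.sets_\<mu> refl])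
  let ?P = "distr \<mu> discrete_radon_space (multiply \<theta>)"
  let ?Q = "density \<mu> (\<lambda>\<eta>. ennreal (exp (mark_integral g \<eta> + c)))"
  have lap: "(\<integral>\<^sup>+\<eta>. ennreal (exp (- (LINT x|\<eta>. f x))) \<partial>?P) = (\<integral>\<^sup>+\<eta>. ennreal (exp (- (LINT x|\<eta>. f x))) \<partial>?Q)"
    if f: "f \<in> nonneg_test_functions" for f :: "'a \<Rightarrow> real"
  proof -
    note fm[measurable] = C.test_measurable[OF f]
    have f0: "0 \<le> f x" for x using f by (simp add: nonneg_test_functions_def)
    define f' where "f' x = \<theta> x * f x" for x
    have f': "f' \<in> nonneg_test_functions"
    proof -
      have "f' \<in> test_functions"
        unfolding f'_def using f \<theta> by (intro test_functions_mult) (auto simp: nonneg_test_functions_def multiplier_group_def)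
      moreover have "0 \<le> f' x" for x using f0[of x] \<theta>_pos[OF \<theta>, of x] by (simp add: f'_def)
      ultimately show ?thesis by (simp add: nonneg_test_functions_def)
    qed
    define u where "u z = exp (- (snd z * f (fst z)))" for z :: "'a \<times> real"
    have um[measurable]: "u \<in> borel_measurable (borel \<Otimes>\<^sub>M borel)" unfolding u_def by measurable
    have u1: "AE z in levy. u z \<le> 1 \<and> 0 < u z"
      using C.positive_marks by eventually_elim (simp add: u_def f0 less_imp_le)
    have ui: "integrable levy (\<lambda>z. u z - 1)" unfolding u_def by (rule C.exponent_integrable[OF f])
    have f'i: "integrable levy (\<lambda>z. exp (- (snd z * f' (fst z))) - 1)" by (rule C.exponent_integrable[OF f'])
    have tui: "integrable levy (\<lambda>z. (tilt \<theta> (fst z) (snd z) - 1) * u z)"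
    proof (rule Bochner_Integration.integrable_bound[OF ti])
      show "(\<lambda>z. (tilt \<theta> (fst z) (snd z) - 1) * u z) \<in> borel_measurable levy" by measurable
      show "AE z in levy. norm ((tilt \<theta> (fst z) (snd z) - 1) * u z) \<le> norm (tilt \<theta> (fst z) (snd z) - 1)"
        using u1 by eventually_elim (simp add: abs_mult mult_left_le)
    qed
    have prod_i: "integrable levy (\<lambda>z. tilt \<theta> (fst z) (snd z) * u z - 1)"
    proof -
      have "integrable levy (\<lambda>z. (tilt \<theta> (fst z) (snd z) - 1) * u z + (u z - 1))" using tui ui by auto
      then show ?thesis by (simp add: algebra_simps)
    qed
    have diff_i: "integrable levy (\<lambda>z. tilt \<theta> (fst z) (snd z) * (1 - u z))"
    proof -
      have "integrable levy (\<lambda>z. (tilt \<theta> (fst z) (snd z) - 1) - (tilt \<theta> (fst z) (snd z) * u z - 1))"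
        using ti prod_i by (rule Bochner_Integration.integrable_diff)
      then show ?thesis by (simp add: algebra_simps)
    qed
    have sub: "(LINT z|levy. 1 - exp (- (snd z * f' (fst z)))) = (LINT z|levy. tilt \<theta> (fst z) (snd z) * (1 - u z))"
    proof -
      have "(LINT z|levy. 1 - exp (- (snd z * f' (fst z)))) = enn2real (\<integral>\<^sup>+z. ennreal (1 - exp (- (snd z * f' (fst z)))) \<partial>levy)"
        using C.positive_marks C.test_measurable[OF f'] f'
        by (intro integral_eq_nn_integral) (auto simp: nonneg_test_functions_def elim!: eventually_mono)
      also have "(\<integral>\<^sup>+z. ennreal (1 - exp (- (snd z * f' (fst z)))) \<partial>levy) = (\<integral>\<^sup>+z. ennreal (tilt \<theta> (fst z) (snd z) * (1 - u z)) \<partial>levy)"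
        unfolding f'_def u_def by (rule dilation_substitution[OF \<theta> fm(1) f0])
      also have "enn2real \<dots> = (LINT z|levy. tilt \<theta> (fst z) (snd z) * (1 - u z))"
        using u1 tp by (intro integral_eq_nn_integral[symmetric]) (auto elim!: eventually_mono simp: less_imp_le)
      finally show ?thesis .
    qed
    have exponent: "(LINT z|levy. tilt \<theta> (fst z) (snd z) * u z - 1) + c = (LINT z|levy. exp (- (snd z * f' (fst z))) - 1)"
    proof -
      have "(LINT z|levy. tilt \<theta> (fst z) (snd z) * u z - 1) = (LINT z|levy. (tilt \<theta> (fst z) (snd z) - 1) - tilt \<theta> (fst z) (snd z) * (1 - u z))"
        by (intro Bochner_Integration.integral_cong refl) (simp add: algebra_simps)
      also have "\<dots> = (LINT z|levy. tilt \<theta> (fst z) (snd z) - 1) - (LINT z|levy. tilt \<theta> (fst z) (snd z) * (1 - u z))"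
        by (rule Bochner_Integration.integral_diff[OF ti diff_i])
      also have "(LINT z|levy. tilt \<theta> (fst z) (snd z) - 1) = - c"
        unfolding c_def by (simp flip: Bochner_Integration.integral_minus)
      also have "(LINT z|levy. tilt \<theta> (fst z) (snd z) * (1 - u z)) = - (LINT z|levy. exp (- (snd z * f' (fst z))) - 1)"
        unfolding sub[symmetric] by (simp flip: Bochner_Integration.integral_minus)
      finally show ?thesis by simp
    qed
    have "(\<integral>\<^sup>+\<eta>. ennreal (exp (- (LINT x|\<eta>. f x))) \<partial>?P) = (\<integral>\<^sup>+\<eta>. ennreal (exp (- (LINT x|multiply \<theta> \<eta>. f x))) \<partial>\<mu>)"
      using fm(2) by (intro nn_integral_distr[OF mult_m]) simp
    also have "\<dots> = (\<integral>\<^sup>+\<eta>. ennreal (exp (- (LINT x|\<eta>. f' x))) \<partial>\<mu>)"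
    proof (intro nn_integral_cong)
      fix \<eta> assume "\<eta> \<in> space \<mu>"
      then have [measurable_cong]: "sets \<eta> = sets borel" using space_discrete_radon_spaceD(2) by (simp add: C.space_\<mu>)
      have "(LINT x|multiply \<theta> \<eta>. f x) = (LINT x|\<eta>. \<theta> x *\<^sub>R f x)"
        using \<theta>_pos[OF \<theta>] fm(1) by (intro integral_density) (auto intro: less_imp_le)
      then show "ennreal (exp (- (LINT x|multiply \<theta> \<eta>. f x))) = ennreal (exp (- (LINT x|\<eta>. f' x)))" by (simp add: f'_def)
    qed
    also have "\<dots> = ennreal (LINT \<eta>|\<mu>. exp (- (LINT x|\<eta>. f' x)))"
      using C.test_integral_nonneg[OF f'] C.test_measurable[OF f']
      by (intro nn_integral_eq_integral C.\<mu>.integrable_const_bound[where B=1]) auto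
    also have "\<dots> = ennreal (exp (LINT z|levy. exp (- (snd z * f' (fst z))) - 1))" by (simp add: C.Laplace_functional[OF f'])
    finally have P: "(\<integral>\<^sup>+\<eta>. ennreal (exp (- (LINT x|\<eta>. f x))) \<partial>?P) = ennreal (exp (LINT z|levy. exp (- (snd z * f' (fst z))) - 1))" .
    define g' where "g' x s = g x s - s * f x" for x s
    have g'm[measurable]: "case_prod g' \<in> borel_measurable (borel \<Otimes>\<^sub>M borel)" unfolding g'_def by measurable
    have eg': "exp (g' (fst z) (snd z)) = tilt \<theta> (fst z) (snd z) * u z" for z
      using tp by (simp add: g'_def g_def u_def exp_diff exp_minus divide_inverse)
    have "(\<integral>\<^sup>+\<eta>. ennreal (exp (- (LINT x|\<eta>. f x))) \<partial>?Q) = (\<integral>\<^sup>+\<eta>. ennreal (exp (mark_integral g \<eta> + c)) * ennreal (exp (- (LINT x|\<eta>. f x))) \<partial>\<mu>)"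
      using fm(3) mg by (intro nn_integral_density) measurable
    also have "\<dots> = (\<integral>\<^sup>+\<eta>. ennreal (exp c) * ennreal (exp (mark_integral g' \<eta>)) \<partial>\<mu>)"
    proof (rule nn_integral_cong_AE, use AEg AE_space in eventually_elim)
      fix \<eta> assume gi: "mark_integrable g \<eta>" and "\<eta> \<in> space \<mu>"
      then have \<eta>: "\<eta> \<in> space discrete_radon_space" by (simp add: C.space_\<mu>)
      have fi: "integrable \<eta> f"
        using radon_test_integrable[OF space_discrete_radon_spaceD(1)[OF \<eta>]] f by (auto simp: nonneg_test_functions_def)
      have "mark_integral g' \<eta> = (LINT x|\<eta>. g x (measure \<eta> {x}) / measure \<eta> {x} - f x)"
        unfolding mark_integral_def
      proof (rule integral_cong_AE)
        show "(\<lambda>x. g' x (measure \<eta> {x}) / measure \<eta> {x}) \<in> borel_measurable \<eta>"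
          using mark_term_measurable(1)[OF lc \<eta> g'm] measurable_cong_sets[OF space_discrete_radon_spaceD(2)[OF \<eta>] refl] by blast
        show "(\<lambda>x. g x (measure \<eta> {x}) / measure \<eta> {x} - f x) \<in> borel_measurable \<eta>"
          using gi fi by (auto simp: mark_integrable_def)
        show "AE x in \<eta>. g' x (measure \<eta> {x}) / measure \<eta> {x} = g x (measure \<eta> {x}) / measure \<eta> {x} - f x"
          using discrete_AE_atoms[OF space_discrete_radon_spaceD(4)[OF \<eta>]]
          by eventually_elim (simp add: g'_def diff_divide_distrib)
      qed
      also have "\<dots> = mark_integral g \<eta> - (LINT x|\<eta>. f x)"
        unfolding mark_integral_def by (rule Bochner_Integration.integral_diff[OF gi[unfolded mark_integrable_def] fi])
      finally show "ennreal (exp (mark_integral g \<eta> + c)) * ennreal (exp (- (LINT x|\<eta>. f x))) = ennreal (exp c) * ennreal (exp (mark_integral g' \<eta>))"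
        by (simp add: ennreal_mult[symmetric] mult_exp_exp algebra_simps)
    qed
    also have "\<dots> = ennreal (exp c) * (\<integral>\<^sup>+\<eta>. ennreal (exp (mark_integral g' \<eta>)) \<partial>\<mu>)"
      using mark_integral_measurable[OF lc g'm]
      by (intro nn_integral_cmult) (simp add: measurable_cong_sets[OF C.sets_\<mu> refl])
    also have "(\<integral>\<^sup>+\<eta>. ennreal (exp (mark_integral g' \<eta>)) \<partial>\<mu>) = ennreal (exp (LINT z|levy. exp (g' (fst z) (snd z)) - 1))"
      by (rule C.exponential_formula[OF g'm]) (simp only: eg' prod_i)
    also have "ennreal (exp c) * \<dots> = ennreal (exp (LINT z|levy. exp (- (snd z * f' (fst z))) - 1))"
      unfolding eg' exponent[symmetric] by (simp add: ennreal_mult[symmetric] mult_exp_exp add.commute)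
    finally show ?thesis using P by simp
  qed
  show "?P = ?Q"
  proof (rule Laplace_functional_determines_measure[OF lc])
    show "finite_measure ?P"
      using C.\<mu>.prob_space_distr[OF mult_m] by (rule prob_space.finite_measure)
    have one: "emeasure M (space M) = (\<integral>\<^sup>+\<eta>. ennreal (exp (- (LINT x|\<eta>. (0::real)))) \<partial>M)" for M :: "'a measure measure" by simp
    show "finite_measure ?Q"
    proof (rule finite_measureI)
      have "emeasure ?Q (space ?Q) = emeasure ?P (space ?P)"
        using lap[OF zero_nonneg_test] unfolding one[symmetric] by simp
      then show "emeasure ?Q (space ?Q) \<noteq> \<infinity>"
        using C.\<mu>.prob_space_distr[OF mult_m, THEN prob_space.emeasure_space_1] by simp
    qed
    show sP: "sets ?P = sets discrete_radon_space" by simp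
    show sQ: "sets ?Q = sets discrete_radon_space" by (simp add: C.sets_\<mu>)
    fix f :: "'a \<Rightarrow> real" assume f: "f \<in> nonneg_test_functions"
    have "(\<lambda>\<eta>. exp (- (LINT x|\<eta>. f x))) \<in> borel_measurable ?P" "(\<lambda>\<eta>. exp (- (LINT x|\<eta>. f x))) \<in> borel_measurable ?Q"
      using C.test_measurable(2)[OF f] by (simp_all add: measurable_cong_sets[OF sP refl] measurable_cong_sets[OF sQ refl])
    then show "(LINT \<eta>|?P. exp (- (LINT x|\<eta>. f x))) = (LINT \<eta>|?Q. exp (- (LINT x|\<eta>. f x)))"
      using lap[OF f] by (simp add: integral_eq_nn_integral)
  qed
qed

text \<open>At a point without mass both sides are \<open>0\<close>, by the convention for division by \<open>0\<close>.\<close>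
lemma log_ratio_eq_mark_term:
  assumes \<theta>: "\<theta> \<in> multiplier_group"
  shows "indicator Y x *\<^sub>R log_ratio l \<theta> \<eta> x = ln (tilt \<theta> x (measure \<eta> {x})) / measure \<eta> {x}"
proof (cases "measure \<eta> {x} = 0")
  case False
  then have s: "0 < measure \<eta> {x}" by (simp add: less_le)
  have "0 < \<theta> x" using \<theta> by (simp add: multiplier_group_def)
  then show ?thesis using s by (auto simp: log_ratio_def Let_def tilt_def rate_def)
qed (simp add: log_ratio_def)

lemma quasi_invariance:
  assumes \<theta>: "\<theta> \<in> multiplier_group"
    and tv: "(\<integral>\<^sup>+x. \<integral>\<^sup>+s. ennreal (\<bar>rate x (inverse (\<theta> x) * s) - rate x s\<bar> / s) \<partial>lborel \<partial>\<sigma>) < \<infinity>"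
    and \<mu>: "completely_random_law (levy_measure \<sigma> l) \<mu>"
  defines "\<mu>\<theta> \<equiv> distr \<mu> discrete_radon_space (multiply \<theta>)"
  shows "equivalent_measures \<mu> \<mu>\<theta>"
    and "AE \<eta> in \<mu>. set_integrable \<eta> Y (log_ratio l \<theta> \<eta>)"
    and "AE \<eta> in \<mu>. RN_deriv \<mu> \<mu>\<theta> \<eta> = ennreal (exp
                  ((LINT x:Y|\<eta>. log_ratio l \<theta> \<eta> x) +
                   (LINT x:Y|\<sigma>. LINT s:{0<..}|lborel. (l x s - l x (inverse (\<theta> x) * s)) / s)))"
proof -
  interpret C: completely_random_measure levy \<mu> by (rule levy_completely_random[OF \<mu>])
  define g where "g x s = ln (tilt \<theta> x s)" for x s
  define c where "c = (LINT x:Y|\<sigma>. LINT s:{0<..}|lborel. (l x s - l x (inverse (\<theta> x) * s)) / s)"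
  note Q = quasi_invariant_density[OF \<theta> tv \<mu>, folded g_def[abs_def], folded difference_integral[OF \<theta> tv], folded c_def, folded \<mu>\<theta>_def]
  note [measurable] = Q(3)
  have "AE \<eta> in \<mu>. set_integrable \<eta> Y (log_ratio l \<theta> \<eta>) \<longleftrightarrow> mark_integrable g \<eta>"
    by (simp add: set_integrable_def mark_integrable_def log_ratio_eq_mark_term[OF \<theta>] g_def del: real_scaleR_def)
  then show "AE \<eta> in \<mu>. set_integrable \<eta> Y (log_ratio l \<theta> \<eta>)" using Q(2) by eventually_elim simp
  have li: "(LINT x:Y|\<eta>. log_ratio l \<theta> \<eta> x) = mark_integral g \<eta>" for \<eta>
    by (simp add: set_lebesgue_integral_def mark_integral_def log_ratio_eq_mark_term[OF \<theta>] g_def del: real_scaleR_def)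
  define \<rho> where "\<rho> \<eta> = ennreal (exp (mark_integral g \<eta> + c))" for \<eta>
  have [measurable]: "\<rho> \<in> borel_measurable \<mu>" unfolding \<rho>_def by measurable
  have dens: "\<mu>\<theta> = density \<mu> \<rho>" unfolding \<rho>_def by (rule Q(1))
  have "AE \<eta> in \<mu>. \<rho> \<eta> = RN_deriv \<mu> \<mu>\<theta> \<eta>"
    by (rule C.\<mu>.RN_deriv_unique) (simp_all add: dens)
  then show "AE \<eta> in \<mu>. RN_deriv \<mu> \<mu>\<theta> \<eta> = ennreal (exp ((LINT x:Y|\<eta>. log_ratio l \<theta> \<eta> x) +
      (LINT x:Y|\<sigma>. LINT s:{0<..}|lborel. (l x s - l x (inverse (\<theta> x) * s)) / s)))"
    by eventually_elim (simp add: li c_def[symmetric] \<rho>_def)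
  show "equivalent_measures \<mu> \<mu>\<theta>"
    unfolding equivalent_measures_def
  proof (intro conjI)
    show "sets \<mu> = sets \<mu>\<theta>" by (simp add: dens)
    show "absolutely_continuous \<mu> \<mu>\<theta>" unfolding dens by (rule absolutely_continuousI_density) simp
    show "absolutely_continuous \<mu>\<theta> \<mu>"
      unfolding absolutely_continuous_def dens
    proof
      fix N assume "N \<in> null_sets (density \<mu> \<rho>)"
      then have N: "N \<in> sets \<mu>" "AE \<eta> in \<mu>. \<eta> \<in> N \<longrightarrow> \<rho> \<eta> = 0" by (simp_all add: null_sets_density_iff)
      from N(2) have "AE \<eta> in \<mu>. \<eta> \<notin> N" by eventually_elim (auto simp: \<rho>_def)
      then show "N \<in> null_sets \<mu>" using N(1) by (simp add: AE_iff_null_sets)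
    qed
  qed
qed

end

theorem corollary15:
  fixes \<sigma> :: "'a::polish_space measure"
    and l l\<^sub>1 l\<^sub>2 :: "'a \<Rightarrow> real \<Rightarrow> real"
    and Y :: "'a set"
    and \<epsilon> :: real
  assumes "locally_compact_space (euclidean :: 'a topology)"
    and "\<sigma> \<in> radon_measures" and "atoms \<sigma> = {}"
    and "(\<lambda>(x, s). l x s) \<in> borel_measurable (borel \<Otimes>\<^sub>M restrict_space borel {0<..})"
    and "\<And>x s. s > 0 \<Longrightarrow> l x s \<ge> 0"
    and "\<And>x. (\<forall>s>0. l x s > 0) \<or> (\<forall>s>0. l x s = 0)"
    and Y: "Y = {x. \<forall>s>0. l x s > 0}"
    and "\<And>A. A \<in> relatively_compact_borel Y \<Longrightarrow>
      (\<integral>\<^sup>+z\<in>A \<times> {0<..}. (case z of (x, s) \<Rightarrow> ennreal (l x s * min (1 / s) 1))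
         \<partial>(\<sigma> \<Otimes>\<^sub>M restrict_space lborel {0<..})) < \<infinity>"
    and "\<epsilon> > 0"
    and "(\<lambda>(x, s). l\<^sub>1 x s) \<in>
      borel_measurable (restrict_space borel Y \<Otimes>\<^sub>M restrict_space borel {0<..<\<epsilon>})"
    and "(\<lambda>(x, s). l\<^sub>2 x s) \<in>
      borel_measurable (restrict_space borel Y \<Otimes>\<^sub>M restrict_space borel {0<..<\<epsilon>})"
    and "\<And>x s. x \<in> Y \<Longrightarrow> s \<in> {0<..<\<epsilon>} \<Longrightarrow> l x s = l\<^sub>1 x s + l\<^sub>2 x s"
    and "\<And>x s. x \<in> Y \<Longrightarrow> s \<in> {0<..<\<epsilon>} \<Longrightarrow> l\<^sub>1 x differentiable (at s)"
    and "\<And>(n::nat) A. n \<ge> (1::nat) \<Longrightarrow> A \<in> relatively_compact_borel Y \<Longrightarrow>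
      (\<integral>\<^sup>+x\<in>A. (\<integral>\<^sup>+s\<in>{0<..<\<epsilon> / real n}.
         (SUP u\<in>{s / real n..s * real n}. ennreal \<bar>deriv (l\<^sub>1 x) u\<bar>) \<partial>lborel) \<partial>\<sigma>) < \<infinity>"
    and "\<And>A. A \<in> relatively_compact_borel Y \<Longrightarrow>
      (\<integral>\<^sup>+x\<in>A. (\<integral>\<^sup>+s\<in>{0<..<\<epsilon>}. ennreal (\<bar>l\<^sub>2 x s\<bar> / s) \<partial>lborel) \<partial>\<sigma>) < \<infinity>"
  shows "(\<forall>n::nat. n \<ge> 1 \<longrightarrow> (\<exists>\<epsilon>'>0. \<forall>A\<in>relatively_compact_borel Y.
            (\<integral>\<^sup>+x\<in>A. (SUP r\<in>{1 / real n..real n}.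
               \<integral>\<^sup>+s\<in>{0<..<\<epsilon>'}. ennreal (\<bar>l x (r * s) - l x s\<bar> / s) \<partial>lborel) \<partial>\<sigma>) < \<infinity>)) \<and>
         (\<forall>\<theta>\<in>multiplier_group.
            (\<forall>\<eta>\<in>discrete_radon_measures. multiply \<theta> \<eta> \<in> discrete_radon_measures) \<and>
            (\<forall>\<mu>. completely_random_law (levy_measure \<sigma> l) \<mu> \<longrightarrow>
             (let \<mu>\<theta> = distr \<mu> discrete_radon_space (multiply \<theta>) in
               equivalent_measures \<mu> \<mu>\<theta> \<and>
               (AE \<eta> in \<mu>. set_integrable \<eta> Y (log_ratio l \<theta> \<eta>)) \<and>
               set_integrable (\<sigma> \<Otimes>\<^sub>M lborel) (Y \<times> {0<..})
                 (\<lambda>(x, s). (l x s - l x (inverse (\<theta> x) * s)) / s) \<and>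
               (AE \<eta> in \<mu>. RN_deriv \<mu> \<mu>\<theta> \<eta> = ennreal (exp
                  ((LINT x:Y|\<eta>. log_ratio l \<theta> \<eta> x) +
                   (LINT x:Y|\<sigma>. LINT s:{0<..}|lborel.
                      (l x s - l x (inverse (\<theta> x) * s)) / s)))))))"
proof -
  interpret levy_density \<sigma> l Y
    by (rule levy_density.intro) (fact assms(1-6) Y assms(8))+
  have dilation_bound: "\<exists>\<epsilon>'>0. \<forall>A\<in>relatively_compact_borel Y.
            (\<integral>\<^sup>+x\<in>A. (SUP r\<in>{1 / real n..real n}.
               \<integral>\<^sup>+s\<in>{0<..<\<epsilon>'}. ennreal (\<bar>l x (r * s) - l x s\<bar> / s) \<partial>lborel) \<partial>\<sigma>) < \<infinity>"
    if n: "1 \<le> n" for n :: nat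
  proof (intro exI[of _ "\<epsilon> / real n"] conjI ballI)
    show "0 < \<epsilon> / real n" using n assms(9) by simp
    fix A assume A: "A \<in> relatively_compact_borel Y"
    then have "A \<in> sets borel" "A \<subseteq> Y" by (auto simp: relatively_compact_borel_def)
    then show "(\<integral>\<^sup>+x\<in>A. (SUP r\<in>{1 / real n..real n}.
               \<integral>\<^sup>+s\<in>{0<..<\<epsilon> / real n}. ennreal (\<bar>l x (r * s) - l x s\<bar> / s) \<partial>lborel) \<partial>\<sigma>) < \<infinity>"
      by (rule sup_dilation_integral_finite[OF sets_\<sigma> n _ _ Y_measurable assms(11,12,13,9) assms(14)[OF n A] assms(15)[OF A]])
  qed
  have tv: "(\<integral>\<^sup>+x. \<integral>\<^sup>+s. ennreal (\<bar>rate x (inverse (\<theta> x) * s) - rate x s\<bar> / s) \<partial>lborel \<partial>\<sigma>) < \<infinity>"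
    if "\<theta> \<in> multiplier_group" for \<theta>
    by (rule dilation_total_variation_finite[OF that dilation_bound])
  show ?thesis
    unfolding Let_def
    using dilation_bound multiply_discrete quasi_invariance[OF _ tv] difference_set_integrable[OF _ tv] by blast
qed

end
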